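(* Let $\mathbf I$ and $\mathbf C$ be $2$-categories, and let $F\colon\mathbf I\to\mathbf C$ be a normal pseudo-functor. The following statements are equivalent. (i) There is a bi-limit $(X,\lambda)$ of $F$. (ii) There is an object $X\in \mathbf C$ together with a pseudo-natural transformation $\lambda\colon \Delta X\Rightarrow F$ in $\mathbf{Ps}(\mathbf I,\mathbf C)$ such that $(X,\lambda)$ is double bi-terminal in the pseudo-slice double category $\mathbb H\Delta\downarrow\downarrow F$. (iii) There is an object $X\in \mathbf C$ together with a pseudo-natural transformation $\lambda\colon \Delta X\Rightarrow F$ in $\mathbf{Ps}(\mathbf I,\mathbf C)$ such that $(X,\lambda)$ is bi-terminal in the pseudo-slice $2$-category $\Delta\downarrow F$ and $(X,\mathrm{id}_\lambda)$ is bi-terminal in the pseudo-slice $2$-category $\mathrm{Ar}_*\Delta\downarrow F$. (iv) There is an object $X\in \mathbf C$ together with a pseudo-natural transformation $\lambda\colon \Delta X\Rightarrow F$ in $\mathbf{Ps}(\mathbf I,\mathbf C)$ such that $(X,\mathrm{id}_\lambda)$ is bi-terminal in $\mathrm{Ar}_*\Delta\downarrow F$.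
   Context: **$2$-categories.** $\mathbf{Cat}$ is the $2$-category of categories, functors and natural transformations; $\mathbf C^{\mathrm{op}}$ reverses morphisms but not $2$-morphisms. A normal pseudo-functor $F\colon\mathbf A\to\mathbf B$ between (strict) $2$-categories consists of an assignment on objects, functors $\mathbf A(A,A')\to\mathbf B(FA,FA')$, and invertible compositors $\phi_{a,a'}\colon (Fa')(Fa)\Rightarrow F(a'a)$ satisfying the usual naturality, associativity and unit axioms, with all unitors identities (so $F\mathrm{id}_A=\mathrm{id}_{FA}$). $\mathbf{Ps}(\mathbf A,\mathbf B)$ is the $2$-category of normal pseudo-functors, pseudo-natural transformations (with invertible $2$-morphism components) and modifications. $\Delta\colon\mathbf C\to\mathbf{Ps}(\mathbf I,\mathbf C)$ is the diagonal (constant-diagram) $2$-functor. **Bi-limit.** A (conical) bi-limit of $F$ is a weighted bi-limit of $F$ by the constant weight $\Delta\mathbb 1\colon\mathbf I\to\mathbf{Cat}$ at the terminal category: a pair $(X,\lambda)$ of an object $X\in\mathbf C$ and a pseudo-natural transformation $\lambda\colon\Delta\mathbb 1\Rightarrow\mathbf C(X,F-)$ (equivalently, a pseudo-natural transformation $\Delta X\Rightarrow F$) such that for every $C\in\mathbf C$ the functor $\mathbf C(C,X)\to\mathbf{Ps}(\mathbf I,\mathbf{Cat})(\Delta\mathbb 1,\mathbf C(C,F-))$, $f\mapsto\mathbf C(f,F-)\circ\lambda$, is an adjoint equivalence of categories. **Pseudo-slice $2$-categories.** For a normal pseudo-functor $L\colon\mathbf B\to\mathbf A$ and $D\in\mathbf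 A$, $L\downarrow D$ has objects $(C,f\colon LC\to D)$; morphisms $(C,f)\to(C',f')$ pairs $(c,\psi)$ of $c\colon C\to C'$ and an invertible $\psi\colon f'(Lc)\Rightarrow f$ (composed using the compositors of $L$); $2$-morphisms $(c,\psi)\Rightarrow(d,\varphi)$ the $\beta\colon c\Rightarrow d$ with $\varphi\circ(f'\,L\beta)=\psi$. $\Delta\downarrow F$ is the case $L=\Delta\colon\mathbf C\to\mathbf{Ps}(\mathbf I,\mathbf C)$, $D=F$. **$\mathrm{Ar}_*$.** For a $2$-category $\mathbf A$, $\mathrm{Ar}_*\mathbf A$ is the $2$-category with the same objects and hom-categories the arrow categories $\mathrm{Ar}_*\mathbf A(A,A')=\mathbf A(A,A')^{\mathbb 2}$, $\mathbb 2=\{0\to1\}$: morphisms are $2$-morphisms of $\mathbf A$ (composed horizontally), and $2$-morphisms are commutative squares of vertical composites of $2$-morphisms. $\mathrm{Ar}_*L$ acts as $L$ on objects and as $L^{\mathbb 2}$ on hom-categories. $\mathrm{Ar}_*\Delta\downarrow F$ is the pseudo-slice for $\mathrm{Ar}_*\Delta\colon\mathrm{Ar}_*\mathbf C\to\mathrm{Ar}_*\mathbf{Ps}(\mathbf I,\mathbf C)$ and the object $F$; its objects are pairs of $C\in\mathbf C$ and a modification between pseudo-natural transformations $\Delta C\Rightarrow F$. **Double categories** are strict. They have objects, horizontal morphisms, vertical morphisms and squares; a square has a top and a bottom horizontal morphism and a left and a right vertical morphism. $\mathrm e_A$ denotes the vertical identity at $A$. A square whose left and right boundaries are vertical identities is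 vertically invertible if it has an inverse for vertical composition. $\mathbb A^{\mathrm{op}}$ denotes the horizontal opposite. **Pseudo-slice double category $\mathbb H\Delta\downarrow\downarrow F$.** ($\mathbb H$ views a $2$-category as a double category with only identity vertical morphisms.) Its objects and horizontal morphisms are the objects and morphisms of $\Delta\downarrow F$; its vertical morphisms from $(C,\kappa)$ to $(C,\mu)$ are the modifications $\Theta$ from $\kappa$ to $\mu$ (there are none between objects with different first components); its squares with top $(c,\Psi)\colon(C,\kappa)\to(C',\kappa')$, bottom $(d,\Phi)\colon(C,\mu)\to(C',\mu')$, left $\Theta$, right $\Theta'$ are the $2$-morphisms $\gamma\colon c\Rightarrow d$ of $\mathbf C$ with $\Theta\circ\Psi=\Phi\circ(\Theta' * \Delta\gamma)$, where $*$ is horizontal composition. **Bi-initial and bi-terminal objects.** For an object $I$ of a $2$-category $\mathbf A$, the pseudo-slice $I\downarrow\mathbf A$ has objects $(A,f\colon I\to A)$; morphisms $(A,f)\to(A',f')$ pairs $(a,\psi)$ of $a\colon A\to A'$ and an invertible $\psi\colon f'\Rightarrow af$; $2$-morphisms $(a,\psi)\Rightarrow(b,\varphi)$ the $\beta\colon a\Rightarrow b$ with $(\beta f)\circ\psi=\varphi$. A $2$-functor is a trivial fibration if it is surjective on objects, full on morphisms (every morphism $GA\to GA'$ is the image of some morphism $A\to A'$) and fully faithful on $2$-morphisms. $I$ is bi-initial if the projection $I\downarrow\mathbf A\to\mathbf A$ is a trivial fibration, and bi-terminal in $\mathbf A$ if it is bi-initial in $\mathbf A^{\mathrm{op}}$.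 **Double bi-initial and bi-terminal objects.** For an object $I$ of a double category $\mathbb A$, the pseudo-slice double category $I\downarrow\downarrow\mathbb A$ has: objects $(A,f)$ with $f\colon I\to A$ horizontal; horizontal morphisms $(A,f)\to(A',f')$: pairs $(a,\psi)$ of a horizontal $a\colon A\to A'$ and a vertically invertible square $\psi$ with top $f'$, bottom $af$, left $\mathrm e_I$, right $\mathrm e_{A'}$; vertical morphisms from $(A,f)$ to $(B,g)$: pairs $(u,\gamma)$ of a vertical morphism $u$ from $A$ to $B$ and a square $\gamma$ with top $f$, bottom $g$, left $\mathrm e_I$, right $u$; squares with top $(a,\psi)$, bottom $(b,\varphi)$, left $(u,\gamma)$, right $(u',\gamma')$: squares $\alpha$ of $\mathbb A$ with top $a$, bottom $b$, left $u$, right $u'$ such that $\psi$ pasted vertically above the horizontal composite of $\gamma$ and $\alpha$ equals $\gamma'$ pasted vertically above $\varphi$. A double functor is a double trivial fibration if it is surjective on objects, full on horizontal morphisms, surjective on vertical morphisms, and fully faithful on squares (every square whose boundary is the image of a given boundary is the image of a unique square with that given boundary). $I$ is double bi-initial if the projection $I\downarrow\downarrow\mathbb A\to\mathbb A$ is a double trivial fibration, and double bi-terminal in $\mathbb A$ if it is double bi-initial in $\mathbb A^{\mathrm{op}}$. *)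

theory Defs
  imports "HOL-Library.FuncSet"
begin

section \<open>Categories and 2-categories\<close>

text \<open>
  Categories, 2-categories and double categories are given by explicit carriers; the
  operations are only meaningful on the carriers. Data that are functions on a carrier
  (functors, transformations, modifications, ...) are required to be extensional, so that
  equality of such data is equality on the carrier.
\<close>

datatype ('x, 'd) arrow = Arrow (source: 'x) (target: 'x) (label: 'd)

record ('a, 'b) cat =
  cOb :: "'a set"
  cAr :: "'b set"
  cdom :: "'b \<Rightarrow> 'a"
  ccod :: "'b \<Rightarrow> 'a"
  cid :: "'a \<Rightarrow> 'b"
  ccomp :: "'b \<Rightarrow> 'b \<Rightarrow> 'b" (infixr "\<odot>\<index>" 70)

definition chom :: "('a, 'b) cat \<Rightarrow> 'a \<Rightarrow> 'a \<Rightarrow> 'b set" where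
  "chom A x y = {u \<in> cAr A. cdom A u = x \<and> ccod A u = y}"

locale category =
  fixes A :: "('a, 'b) cat" (structure)
  assumes dom_cod: "u \<in> cAr A \<Longrightarrow> cdom A u \<in> cOb A \<and> ccod A u \<in> cOb A"
    and id_hom: "x \<in> cOb A \<Longrightarrow> cid A x \<in> chom A x x"
    and comp_hom: "u \<in> chom A x y \<Longrightarrow> v \<in> chom A y z \<Longrightarrow> v \<odot> u \<in> chom A x z"
    and id_left: "u \<in> chom A x y \<Longrightarrow> cid A y \<odot> u = u"
    and id_right: "u \<in> chom A x y \<Longrightarrow> u \<odot> cid A x = u"
    and assoc: "u \<in> chom A x y \<Longrightarrow> v \<in> chom A y z \<Longrightarrow> w \<in> chom A z t \<Longrightarrow>
      (w \<odot> v) \<odot> u = w \<odot> (v \<odot> u)"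

text \<open>
  Composition of 1-morphisms, vertical composition and horizontal composition of 2-morphisms
  are all written in the order of function composition.
\<close>

record ('o, 'm, 't) two_cat =
  Obj :: "'o set"
  Mor :: "'m set"
  Cell :: "'t set"
  src :: "'m \<Rightarrow> 'o"
  tgt :: "'m \<Rightarrow> 'o"
  dom2 :: "'t \<Rightarrow> 'm"
  cod2 :: "'t \<Rightarrow> 'm"
  id1 :: "'o \<Rightarrow> 'm"
  id2 :: "'m \<Rightarrow> 't"
  comp :: "'m \<Rightarrow> 'm \<Rightarrow> 'm" (infixr "\<cdot>\<index>" 70)
  vcomp :: "'t \<Rightarrow> 't \<Rightarrow> 't" (infixr "\<bullet>\<index>" 65)
  hcomp :: "'t \<Rightarrow> 't \<Rightarrow> 't" (infixr "\<star>\<index>" 70)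

definition hom1 :: "('o, 'm, 't) two_cat \<Rightarrow> 'o \<Rightarrow> 'o \<Rightarrow> 'm set" where
  "hom1 C X Y = {f \<in> Mor C. src C f = X \<and> tgt C f = Y}"

definition hom2 :: "('o, 'm, 't) two_cat \<Rightarrow> 'm \<Rightarrow> 'm \<Rightarrow> 't set" where
  "hom2 C f g = {\<alpha> \<in> Cell C. dom2 C \<alpha> = f \<and> cod2 C \<alpha> = g}"

definition composable :: "('o, 'm, 't) two_cat \<Rightarrow> ('m \<times> 'm) set" where
  "composable C = {(g, f). f \<in> Mor C \<and> g \<in> Mor C \<and> tgt C f = src C g}"

locale two_category =
  fixes C :: "('o, 'm, 't) two_cat" (structure)
  assumes src_tgt: "f \<in> Mor C \<Longrightarrow> src C f \<in> Obj C \<and> tgt C f \<in> Obj C"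
    and dom_cod: "\<alpha> \<in> Cell C \<Longrightarrow> dom2 C \<alpha> \<in> Mor C \<and> cod2 C \<alpha> \<in> Mor C"
    and globular: "\<alpha> \<in> Cell C \<Longrightarrow>
      src C (dom2 C \<alpha>) = src C (cod2 C \<alpha>) \<and> tgt C (dom2 C \<alpha>) = tgt C (cod2 C \<alpha>)"
    and id1_hom: "X \<in> Obj C \<Longrightarrow> id1 C X \<in> hom1 C X X"
    and comp_hom: "f \<in> hom1 C X Y \<Longrightarrow> g \<in> hom1 C Y Z \<Longrightarrow> g \<cdot> f \<in> hom1 C X Z"
    and comp_id_left: "f \<in> hom1 C X Y \<Longrightarrow> id1 C Y \<cdot> f = f"
    and comp_id_right: "f \<in> hom1 C X Y \<Longrightarrow> f \<cdot> id1 C X = f"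
    and comp_assoc: "f \<in> hom1 C X Y \<Longrightarrow> g \<in> hom1 C Y Z \<Longrightarrow> h \<in> hom1 C Z W \<Longrightarrow>
      (h \<cdot> g) \<cdot> f = h \<cdot> (g \<cdot> f)"
    and id2_hom: "f \<in> Mor C \<Longrightarrow> id2 C f \<in> hom2 C f f"
    and vcomp_hom: "\<alpha> \<in> hom2 C f g \<Longrightarrow> \<beta> \<in> hom2 C g h \<Longrightarrow> \<beta> \<bullet> \<alpha> \<in> hom2 C f h"
    and vcomp_id_left: "\<alpha> \<in> hom2 C f g \<Longrightarrow> id2 C g \<bullet> \<alpha> = \<alpha>"
    and vcomp_id_right: "\<alpha> \<in> hom2 C f g \<Longrightarrow> \<alpha> \<bullet> id2 C f = \<alpha>"
    and vcomp_assoc: "\<alpha> \<in> hom2 C f g \<Longrightarrow> \<beta> \<in> hom2 C g h \<Longrightarrow> \<gamma> \<in> hom2 C h k \<Longrightarrow>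
      (\<gamma> \<bullet> \<beta>) \<bullet> \<alpha> = \<gamma> \<bullet> (\<beta> \<bullet> \<alpha>)"
    and hcomp_hom: "\<alpha> \<in> hom2 C f f' \<Longrightarrow> \<beta> \<in> hom2 C g g' \<Longrightarrow> tgt C f = src C g \<Longrightarrow>
      \<beta> \<star> \<alpha> \<in> hom2 C (g \<cdot> f) (g' \<cdot> f')"
    and hcomp_id_left: "\<alpha> \<in> Cell C \<Longrightarrow> id2 C (id1 C (tgt C (dom2 C \<alpha>))) \<star> \<alpha> = \<alpha>"
    and hcomp_id_right: "\<alpha> \<in> Cell C \<Longrightarrow> \<alpha> \<star> id2 C (id1 C (src C (dom2 C \<alpha>))) = \<alpha>"
    and hcomp_assoc: "\<alpha> \<in> Cell C \<Longrightarrow> \<beta> \<in> Cell C \<Longrightarrow> \<gamma> \<in> Cell C \<Longrightarrow>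
      tgt C (dom2 C \<alpha>) = src C (dom2 C \<beta>) \<Longrightarrow> tgt C (dom2 C \<beta>) = src C (dom2 C \<gamma>) \<Longrightarrow>
      (\<gamma> \<star> \<beta>) \<star> \<alpha> = \<gamma> \<star> (\<beta> \<star> \<alpha>)"
    and hcomp_id2: "f \<in> hom1 C X Y \<Longrightarrow> g \<in> hom1 C Y Z \<Longrightarrow> id2 C g \<star> id2 C f = id2 C (g \<cdot> f)"
    and interchange: "\<alpha> \<in> hom2 C f g \<Longrightarrow> \<beta> \<in> hom2 C g h \<Longrightarrow>
      \<alpha>' \<in> hom2 C f' g' \<Longrightarrow> \<beta>' \<in> hom2 C g' h' \<Longrightarrow> tgt C f = src C f' \<Longrightarrow>
      (\<beta>' \<bullet> \<alpha>') \<star> (\<beta> \<bullet> \<alpha>) = (\<beta>' \<star> \<beta>) \<bullet> (\<alpha>' \<star> \<alpha>)"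

definition inverse2 :: "('o, 'm, 't) two_cat \<Rightarrow> 't \<Rightarrow> 't \<Rightarrow> bool" where
  "inverse2 C \<alpha> \<beta> \<longleftrightarrow> \<beta> \<in> hom2 C (cod2 C \<alpha>) (dom2 C \<alpha>) \<and>
     \<beta> \<bullet>\<^bsub>C\<^esub> \<alpha> = id2 C (dom2 C \<alpha>) \<and> \<alpha> \<bullet>\<^bsub>C\<^esub> \<beta> = id2 C (cod2 C \<alpha>)"

definition invertible2 :: "('o, 'm, 't) two_cat \<Rightarrow> 't \<Rightarrow> bool" where
  "invertible2 C \<alpha> \<longleftrightarrow> \<alpha> \<in> Cell C \<and> (\<exists>\<beta>. inverse2 C \<alpha> \<beta>)"

definition inv2 :: "('o, 'm, 't) two_cat \<Rightarrow> 't \<Rightarrow> 't" where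
  "inv2 C \<alpha> = (THE \<beta>. inverse2 C \<alpha> \<beta>)"

definition op2 :: "('o, 'm, 't) two_cat \<Rightarrow> ('o, 'm, 't) two_cat" where
  "op2 C = C\<lparr>src := tgt C, tgt := src C, comp := (\<lambda>g f. f \<cdot>\<^bsub>C\<^esub> g), hcomp := (\<lambda>\<beta> \<alpha>. \<alpha> \<star>\<^bsub>C\<^esub> \<beta>)\<rparr>"

definition hom_cat :: "('o, 'm, 't) two_cat \<Rightarrow> 'o \<Rightarrow> 'o \<Rightarrow> ('m, 't) cat" where
  "hom_cat C X Y = \<lparr>
     cOb = hom1 C X Y,
     cAr = {\<alpha> \<in> Cell C. dom2 C \<alpha> \<in> hom1 C X Y \<and> cod2 C \<alpha> \<in> hom1 C X Y},
     cdom = dom2 C, ccod = cod2 C, cid = id2 C, ccomp = vcomp C\<rparr>"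


section \<open>The 2-category of categories\<close>

record ('a, 'b, 'c, 'd) fctr =
  fob :: "'a \<Rightarrow> 'c"
  far :: "'b \<Rightarrow> 'd"

definition is_functor :: "('a, 'b) cat \<Rightarrow> ('c, 'd) cat \<Rightarrow> ('a, 'b, 'c, 'd) fctr \<Rightarrow> bool" where
  "is_functor A B F \<longleftrightarrow>
     fob F \<in> cOb A \<rightarrow>\<^sub>E cOb B \<and> far F \<in> cAr A \<rightarrow>\<^sub>E cAr B \<and>
     (\<forall>u\<in>cAr A. far F u \<in> chom B (fob F (cdom A u)) (fob F (ccod A u))) \<and>
     (\<forall>x\<in>cOb A. far F (cid A x) = cid B (fob F x)) \<and>
     (\<forall>u\<in>cAr A. \<forall>v\<in>cAr A. ccod A u = cdom A v \<longrightarrow>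
        far F (v \<odot>\<^bsub>A\<^esub> u) = far F v \<odot>\<^bsub>B\<^esub> far F u)"

definition is_nat_trans ::
  "('a, 'b) cat \<Rightarrow> ('c, 'd) cat \<Rightarrow> ('a, 'b, 'c, 'd) fctr \<Rightarrow> ('a, 'b, 'c, 'd) fctr \<Rightarrow> ('a \<Rightarrow> 'd) \<Rightarrow> bool"
where
  "is_nat_trans A B F G \<eta> \<longleftrightarrow>
     \<eta> \<in> extensional (cOb A) \<and>
     (\<forall>x\<in>cOb A. \<eta> x \<in> chom B (fob F x) (fob G x)) \<and>
     (\<forall>u\<in>cAr A. far G u \<odot>\<^bsub>B\<^esub> \<eta> (cdom A u) = \<eta> (ccod A u) \<odot>\<^bsub>B\<^esub> far F u)"

definition fctr_id :: "('a, 'b) cat \<Rightarrow> ('a, 'b, 'a, 'b) fctr" where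
  "fctr_id A = \<lparr>fob = (\<lambda>x\<in>cOb A. x), far = (\<lambda>u\<in>cAr A. u)\<rparr>"

definition fctr_comp ::
  "('a, 'b) cat \<Rightarrow> ('c, 'd, 'e, 'f) fctr \<Rightarrow> ('a, 'b, 'c, 'd) fctr \<Rightarrow> ('a, 'b, 'e, 'f) fctr" where
  "fctr_comp A G F = \<lparr>fob = (\<lambda>x\<in>cOb A. fob G (fob F x)), far = (\<lambda>u\<in>cAr A. far G (far F u))\<rparr>"

definition is_nat_iso ::
  "('a, 'b) cat \<Rightarrow> ('c, 'd) cat \<Rightarrow> ('a, 'b, 'c, 'd) fctr \<Rightarrow> ('a, 'b, 'c, 'd) fctr \<Rightarrow> ('a \<Rightarrow> 'd) \<Rightarrow> bool"
where
  "is_nat_iso A B F G \<eta> \<longleftrightarrow> is_nat_trans A B F G \<eta> \<and>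
     (\<forall>x\<in>cOb A. \<exists>v\<in>chom B (fob G x) (fob F x).
        v \<odot>\<^bsub>B\<^esub> \<eta> x = cid B (fob F x) \<and> \<eta> x \<odot>\<^bsub>B\<^esub> v = cid B (fob G x))"

definition adjoint_equivalence ::
  "('a, 'b) cat \<Rightarrow> ('c, 'd) cat \<Rightarrow> ('a, 'b, 'c, 'd) fctr \<Rightarrow> bool" where
  "adjoint_equivalence A B F \<longleftrightarrow> is_functor A B F \<and>
     (\<exists>G \<eta> \<epsilon>. is_functor B A G \<and>
        is_nat_iso A A (fctr_id A) (fctr_comp A G F) \<eta> \<and>
        is_nat_iso B B (fctr_comp B F G) (fctr_id B) \<epsilon> \<and>
        (\<forall>x\<in>cOb A. \<epsilon> (fob F x) \<odot>\<^bsub>B\<^esub> far F (\<eta> x) = cid B (fob F x)) \<and>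
        (\<forall>y\<in>cOb B. far G (\<epsilon> y) \<odot>\<^bsub>A\<^esub> \<eta> (fob G y) = cid A (fob G y)))"

type_synonym ('a, 'b) cat_mor = "(('a, 'b) cat, ('a, 'b, 'a, 'b) fctr) arrow"
type_synonym ('a, 'b) cat_cell = "(('a, 'b) cat_mor, 'a \<Rightarrow> 'b) arrow"

text \<open>
  The 2-category of all categories with objects of type \<open>'a\<close> and arrows of type \<open>'b\<close>.
\<close>

definition Cat_comp :: "('a, 'b) cat_mor \<Rightarrow> ('a, 'b) cat_mor \<Rightarrow> ('a, 'b) cat_mor" where
  "Cat_comp G F = Arrow (source F) (target G) (fctr_comp (source F) (label G) (label F))"

definition Cat :: "(('a, 'b) cat, ('a, 'b) cat_mor, ('a, 'b) cat_cell) two_cat" where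
  "Cat = \<lparr>
     Obj = {A. category A},
     Mor = {Arrow A B F | A B F. category A \<and> category B \<and> is_functor A B F},
     Cell = {Arrow (Arrow A B F) (Arrow A B G) \<eta> | A B F G \<eta>.
       category A \<and> category B \<and> is_functor A B F \<and> is_functor A B G \<and> is_nat_trans A B F G \<eta>},
     src = source, tgt = target, dom2 = source, cod2 = target,
     id1 = (\<lambda>A. Arrow A A (fctr_id A)),
     id2 = (\<lambda>F. Arrow F F (\<lambda>x\<in>cOb (source F). cid (target F) (fob (label F) x))),
     comp = Cat_comp,
     vcomp = (\<lambda>\<beta> \<alpha>. Arrow (source \<alpha>) (target \<beta>)
       (\<lambda>x\<in>cOb (source (source \<alpha>)). label \<beta> x \<odot>\<^bsub>target (source \<alpha>)\<^esub> label \<alpha> x)),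
     hcomp = (\<lambda>\<beta> \<alpha>. Arrow (Cat_comp (source \<beta>) (source \<alpha>)) (Cat_comp (target \<beta>) (target \<alpha>))
       (\<lambda>x\<in>cOb (source (source \<alpha>)).
          label \<beta> (fob (label (target \<alpha>)) x) \<odot>\<^bsub>target (source \<beta>)\<^esub>
          far (label (source \<beta>)) (label \<alpha> x)))\<rparr>"

text \<open>
  The terminal category, with its object and its arrow named by the arbitrary element
  \<open>undefined\<close> so that it is available at every pair of types.
\<close>

definition terminal_cat :: "('a, 'b) cat" where
  "terminal_cat = \<lparr>cOb = {undefined}, cAr = {undefined}, cdom = (\<lambda>_. undefined),
     ccod = (\<lambda>_. undefined), cid = (\<lambda>_. undefined), ccomp = (\<lambda>_ _. undefined)\<rparr>"


section \<open>The 2-category of normal pseudo-functors\<close>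

text \<open>
  \<open>cpt F (a', a)\<close> is the compositor \<open>(F a') (F a) \<Rightarrow> F (a' a)\<close>.
\<close>

record ('i, 'j, 'k, 'o, 'm, 't) psfun =
  on0 :: "'i \<Rightarrow> 'o"
  on1 :: "'j \<Rightarrow> 'm"
  on2 :: "'k \<Rightarrow> 't"
  cpt :: "'j \<times> 'j \<Rightarrow> 't"

definition normal_psfunctor ::
  "('i, 'j, 'k) two_cat \<Rightarrow> ('o, 'm, 't) two_cat \<Rightarrow> ('i, 'j, 'k, 'o, 'm, 't) psfun \<Rightarrow> bool" where
  "normal_psfunctor A B F \<longleftrightarrow>
     on0 F \<in> Obj A \<rightarrow>\<^sub>E Obj B \<and> on1 F \<in> Mor A \<rightarrow>\<^sub>E Mor B \<and> on2 F \<in> Cell A \<rightarrow>\<^sub>E Cell B \<and>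
     cpt F \<in> composable A \<rightarrow>\<^sub>E Cell B \<and>
     (\<forall>a\<in>Mor A. on1 F a \<in> hom1 B (on0 F (src A a)) (on0 F (tgt A a))) \<and>
     (\<forall>\<alpha>\<in>Cell A. on2 F \<alpha> \<in> hom2 B (on1 F (dom2 A \<alpha>)) (on1 F (cod2 A \<alpha>))) \<and>
     (\<forall>a\<in>Mor A. on2 F (id2 A a) = id2 B (on1 F a)) \<and>
     (\<forall>\<alpha>\<in>Cell A. \<forall>\<beta>\<in>Cell A. cod2 A \<alpha> = dom2 A \<beta> \<longrightarrow>
        on2 F (\<beta> \<bullet>\<^bsub>A\<^esub> \<alpha>) = on2 F \<beta> \<bullet>\<^bsub>B\<^esub> on2 F \<alpha>) \<and>
     (\<forall>X\<in>Obj A. on1 F (id1 A X) = id1 B (on0 F X)) \<and>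
     (\<forall>(a', a)\<in>composable A.
        cpt F (a', a) \<in> hom2 B (on1 F a' \<cdot>\<^bsub>B\<^esub> on1 F a) (on1 F (a' \<cdot>\<^bsub>A\<^esub> a)) \<and>
        invertible2 B (cpt F (a', a))) \<and>
     (\<forall>\<alpha>\<in>Cell A. \<forall>\<alpha>'\<in>Cell A. tgt A (dom2 A \<alpha>) = src A (dom2 A \<alpha>') \<longrightarrow>
        cpt F (cod2 A \<alpha>', cod2 A \<alpha>) \<bullet>\<^bsub>B\<^esub> (on2 F \<alpha>' \<star>\<^bsub>B\<^esub> on2 F \<alpha>) =
        on2 F (\<alpha>' \<star>\<^bsub>A\<^esub> \<alpha>) \<bullet>\<^bsub>B\<^esub> cpt F (dom2 A \<alpha>', dom2 A \<alpha>)) \<and>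
     (\<forall>a a' a''. (a', a) \<in> composable A \<longrightarrow> (a'', a') \<in> composable A \<longrightarrow>
        cpt F (a'', a' \<cdot>\<^bsub>A\<^esub> a) \<bullet>\<^bsub>B\<^esub> (id2 B (on1 F a'') \<star>\<^bsub>B\<^esub> cpt F (a', a)) =
        cpt F (a'' \<cdot>\<^bsub>A\<^esub> a', a) \<bullet>\<^bsub>B\<^esub> (cpt F (a'', a') \<star>\<^bsub>B\<^esub> id2 B (on1 F a))) \<and>
     (\<forall>a\<in>Mor A. cpt F (a, id1 A (src A a)) = id2 B (on1 F a) \<and>
        cpt F (id1 A (tgt A a), a) = id2 B (on1 F a))"

text \<open>
  The data of a (strict) 2-functor, as a normal pseudo-functor whose compositors are identities.
\<close>

definition strict_psfun ::
  "('i, 'j, 'k) two_cat \<Rightarrow> ('o, 'm, 't) two_cat \<Rightarrow> ('i \<Rightarrow> 'o) \<Rightarrow> ('j \<Rightarrow> 'm) \<Rightarrow> ('k \<Rightarrow> 't) \<Rightarrow>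
   ('i, 'j, 'k, 'o, 'm, 't) psfun" where
  "strict_psfun A B f0 f1 f2 = \<lparr>
     on0 = restrict f0 (Obj A), on1 = restrict f1 (Mor A), on2 = restrict f2 (Cell A),
     cpt = (\<lambda>(a', a)\<in>composable A. id2 B (f1 (a' \<cdot>\<^bsub>A\<^esub> a)))\<rparr>"

text \<open>
  A pseudo-natural transformation \<open>\<sigma> : F \<Rightarrow> G\<close> has components \<open>pt0 \<sigma> A : F A \<rightarrow> G A\<close> and
  invertible 2-morphisms \<open>pt1 \<sigma> a : (G a) (\<sigma> A) \<Rightarrow> (\<sigma> A') (F a)\<close> for \<open>a : A \<rightarrow> A'\<close>.
\<close>

record ('i, 'j, 'm, 't) pstrans =
  pt0 :: "'i \<Rightarrow> 'm"
  pt1 :: "'j \<Rightarrow> 't"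

definition is_pstrans ::
  "('i, 'j, 'k) two_cat \<Rightarrow> ('o, 'm, 't) two_cat \<Rightarrow> ('i, 'j, 'k, 'o, 'm, 't) psfun \<Rightarrow>
   ('i, 'j, 'k, 'o, 'm, 't) psfun \<Rightarrow> ('i, 'j, 'm, 't) pstrans \<Rightarrow> bool" where
  "is_pstrans A B F G \<sigma> \<longleftrightarrow>
     pt0 \<sigma> \<in> extensional (Obj A) \<and> pt1 \<sigma> \<in> extensional (Mor A) \<and>
     (\<forall>X\<in>Obj A. pt0 \<sigma> X \<in> hom1 B (on0 F X) (on0 G X)) \<and>
     (\<forall>a\<in>Mor A. invertible2 B (pt1 \<sigma> a) \<and>
        pt1 \<sigma> a \<in> hom2 B (on1 G a \<cdot>\<^bsub>B\<^esub> pt0 \<sigma> (src A a)) (pt0 \<sigma> (tgt A a) \<cdot>\<^bsub>B\<^esub> on1 F a)) \<and>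
     (\<forall>\<alpha>\<in>Cell A. let a = dom2 A \<alpha>; b = cod2 A \<alpha> in
        pt1 \<sigma> b \<bullet>\<^bsub>B\<^esub> (on2 G \<alpha> \<star>\<^bsub>B\<^esub> id2 B (pt0 \<sigma> (src A a))) =
        (id2 B (pt0 \<sigma> (tgt A a)) \<star>\<^bsub>B\<^esub> on2 F \<alpha>) \<bullet>\<^bsub>B\<^esub> pt1 \<sigma> a) \<and>
     (\<forall>X\<in>Obj A. pt1 \<sigma> (id1 A X) = id2 B (pt0 \<sigma> X)) \<and>
     (\<forall>(a', a)\<in>composable A.
        pt1 \<sigma> (a' \<cdot>\<^bsub>A\<^esub> a) \<bullet>\<^bsub>B\<^esub> (cpt G (a', a) \<star>\<^bsub>B\<^esub> id2 B (pt0 \<sigma> (src A a))) =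
        (id2 B (pt0 \<sigma> (tgt A a')) \<star>\<^bsub>B\<^esub> cpt F (a', a)) \<bullet>\<^bsub>B\<^esub>
        (pt1 \<sigma> a' \<star>\<^bsub>B\<^esub> id2 B (on1 F a)) \<bullet>\<^bsub>B\<^esub>
        (id2 B (on1 G a') \<star>\<^bsub>B\<^esub> pt1 \<sigma> a))"

definition is_modification ::
  "('i, 'j, 'k) two_cat \<Rightarrow> ('o, 'm, 't) two_cat \<Rightarrow> ('i, 'j, 'k, 'o, 'm, 't) psfun \<Rightarrow>
   ('i, 'j, 'k, 'o, 'm, 't) psfun \<Rightarrow> ('i, 'j, 'm, 't) pstrans \<Rightarrow> ('i, 'j, 'm, 't) pstrans \<Rightarrow>
   ('i \<Rightarrow> 't) \<Rightarrow> bool" where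
  "is_modification A B F G \<sigma> \<tau> \<Gamma> \<longleftrightarrow>
     \<Gamma> \<in> extensional (Obj A) \<and>
     (\<forall>X\<in>Obj A. \<Gamma> X \<in> hom2 B (pt0 \<sigma> X) (pt0 \<tau> X)) \<and>
     (\<forall>a\<in>Mor A. pt1 \<tau> a \<bullet>\<^bsub>B\<^esub> (id2 B (on1 G a) \<star>\<^bsub>B\<^esub> \<Gamma> (src A a)) =
        (\<Gamma> (tgt A a) \<star>\<^bsub>B\<^esub> id2 B (on1 F a)) \<bullet>\<^bsub>B\<^esub> pt1 \<sigma> a)"

type_synonym ('i, 'j, 'k, 'o, 'm, 't) ps_mor =
  "(('i, 'j, 'k, 'o, 'm, 't) psfun, ('i, 'j, 'm, 't) pstrans) arrow"
type_synonym ('i, 'j, 'k, 'o, 'm, 't) ps_cell =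
  "(('i, 'j, 'k, 'o, 'm, 't) ps_mor, 'i \<Rightarrow> 't) arrow"

text \<open>
  For \<open>\<sigma> : F \<Rightarrow> G\<close> and \<open>\<tau> : G \<Rightarrow> H\<close>, the 2-morphism of \<open>\<tau> \<sigma>\<close> at \<open>a : A \<rightarrow> A'\<close> is
  \<open>(H a) (\<tau> A) (\<sigma> A) \<Rightarrow> (\<tau> A') (G a) (\<sigma> A) \<Rightarrow> (\<tau> A') (\<sigma> A') (F a)\<close>.
\<close>

definition Ps_comp ::
  "('i, 'j, 'k) two_cat \<Rightarrow> ('o, 'm, 't) two_cat \<Rightarrow> ('i, 'j, 'k, 'o, 'm, 't) ps_mor \<Rightarrow>
   ('i, 'j, 'k, 'o, 'm, 't) ps_mor \<Rightarrow> ('i, 'j, 'k, 'o, 'm, 't) ps_mor" where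
  "Ps_comp A B \<tau> \<sigma> = Arrow (source \<sigma>) (target \<tau>) \<lparr>
     pt0 = (\<lambda>X\<in>Obj A. pt0 (label \<tau>) X \<cdot>\<^bsub>B\<^esub> pt0 (label \<sigma>) X),
     pt1 = (\<lambda>a\<in>Mor A.
       (id2 B (pt0 (label \<tau>) (tgt A a)) \<star>\<^bsub>B\<^esub> pt1 (label \<sigma>) a) \<bullet>\<^bsub>B\<^esub>
       (pt1 (label \<tau>) a \<star>\<^bsub>B\<^esub> id2 B (pt0 (label \<sigma>) (src A a))))\<rparr>"

definition Ps ::
  "('i, 'j, 'k) two_cat \<Rightarrow> ('o, 'm, 't) two_cat \<Rightarrow>
   (('i, 'j, 'k, 'o, 'm, 't) psfun, ('i, 'j, 'k, 'o, 'm, 't) ps_mor,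
    ('i, 'j, 'k, 'o, 'm, 't) ps_cell) two_cat" where
  "Ps A B = \<lparr>
     Obj = {F. normal_psfunctor A B F},
     Mor = {Arrow F G \<sigma> | F G \<sigma>.
       normal_psfunctor A B F \<and> normal_psfunctor A B G \<and> is_pstrans A B F G \<sigma>},
     Cell = {Arrow (Arrow F G \<sigma>) (Arrow F G \<tau>) \<Gamma> | F G \<sigma> \<tau> \<Gamma>.
       normal_psfunctor A B F \<and> normal_psfunctor A B G \<and>
       is_pstrans A B F G \<sigma> \<and> is_pstrans A B F G \<tau> \<and> is_modification A B F G \<sigma> \<tau> \<Gamma>},
     src = source, tgt = target, dom2 = source, cod2 = target,
     id1 = (\<lambda>F. Arrow F F \<lparr>pt0 = (\<lambda>X\<in>Obj A. id1 B (on0 F X)),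
       pt1 = (\<lambda>a\<in>Mor A. id2 B (on1 F a))\<rparr>),
     id2 = (\<lambda>\<sigma>. Arrow \<sigma> \<sigma> (\<lambda>X\<in>Obj A. id2 B (pt0 (label \<sigma>) X))),
     comp = Ps_comp A B,
     vcomp = (\<lambda>\<Delta> \<Gamma>. Arrow (source \<Gamma>) (target \<Delta>) (\<lambda>X\<in>Obj A. label \<Delta> X \<bullet>\<^bsub>B\<^esub> label \<Gamma> X)),
     hcomp = (\<lambda>\<Delta> \<Gamma>. Arrow (Ps_comp A B (source \<Delta>) (source \<Gamma>))
       (Ps_comp A B (target \<Delta>) (target \<Gamma>)) (\<lambda>X\<in>Obj A. label \<Delta> X \<star>\<^bsub>B\<^esub> label \<Gamma> X))\<rparr>"

definition const_psfun ::
  "('i, 'j, 'k) two_cat \<Rightarrow> ('o, 'm, 't) two_cat \<Rightarrow> 'o \<Rightarrow> ('i, 'j, 'k, 'o, 'm, 't) psfun" where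
  "const_psfun I C X = strict_psfun I C (\<lambda>_. X) (\<lambda>_. id1 C X) (\<lambda>_. id2 C (id1 C X))"

definition const_pstrans ::
  "('i, 'j, 'k) two_cat \<Rightarrow> ('o, 'm, 't) two_cat \<Rightarrow> 'm \<Rightarrow> ('i, 'j, 'k, 'o, 'm, 't) ps_mor" where
  "const_pstrans I C f = Arrow (const_psfun I C (src C f)) (const_psfun I C (tgt C f))
     \<lparr>pt0 = (\<lambda>i\<in>Obj I. f), pt1 = (\<lambda>a\<in>Mor I. id2 C f)\<rparr>"

definition const_modification ::
  "('i, 'j, 'k) two_cat \<Rightarrow> ('o, 'm, 't) two_cat \<Rightarrow> 't \<Rightarrow> ('i, 'j, 'k, 'o, 'm, 't) ps_cell" where
  "const_modification I C \<gamma> =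
     Arrow (const_pstrans I C (dom2 C \<gamma>)) (const_pstrans I C (cod2 C \<gamma>)) (\<lambda>i\<in>Obj I. \<gamma>)"

definition Diag ::
  "('i, 'j, 'k) two_cat \<Rightarrow> ('o, 'm, 't) two_cat \<Rightarrow>
   ('o, 'm, 't, ('i, 'j, 'k, 'o, 'm, 't) psfun, ('i, 'j, 'k, 'o, 'm, 't) ps_mor,
    ('i, 'j, 'k, 'o, 'm, 't) ps_cell) psfun" where
  "Diag I C = strict_psfun C (Ps I C) (const_psfun I C) (const_pstrans I C) (const_modification I C)"


section \<open>Bi-limits\<close>

definition postcomp :: "('o, 'm, 't) two_cat \<Rightarrow> 'o \<Rightarrow> 'm \<Rightarrow> ('m, 't) cat_mor" where
  "postcomp C X f = Arrow (hom_cat C X (src C f)) (hom_cat C X (tgt C f)) \<lparr>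
     fob = (\<lambda>g\<in>hom1 C X (src C f). f \<cdot>\<^bsub>C\<^esub> g),
     far = (\<lambda>\<alpha>\<in>cAr (hom_cat C X (src C f)). id2 C f \<star>\<^bsub>C\<^esub> \<alpha>)\<rparr>"

definition postcomp2 :: "('o, 'm, 't) two_cat \<Rightarrow> 'o \<Rightarrow> 't \<Rightarrow> ('m, 't) cat_cell" where
  "postcomp2 C X \<gamma> = Arrow (postcomp C X (dom2 C \<gamma>)) (postcomp C X (cod2 C \<gamma>))
     (\<lambda>g\<in>hom1 C X (src C (dom2 C \<gamma>)). \<gamma> \<star>\<^bsub>C\<^esub> id2 C g)"

definition precomp :: "('o, 'm, 't) two_cat \<Rightarrow> 'm \<Rightarrow> 'o \<Rightarrow> ('m, 't) cat_mor" where
  "precomp C f Z = Arrow (hom_cat C (tgt C f) Z) (hom_cat C (src C f) Z) \<lparr>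
     fob = (\<lambda>g\<in>hom1 C (tgt C f) Z. g \<cdot>\<^bsub>C\<^esub> f),
     far = (\<lambda>\<alpha>\<in>cAr (hom_cat C (tgt C f) Z). \<alpha> \<star>\<^bsub>C\<^esub> id2 C f)\<rparr>"

definition precomp2 :: "('o, 'm, 't) two_cat \<Rightarrow> 't \<Rightarrow> 'o \<Rightarrow> ('m, 't) cat_cell" where
  "precomp2 C \<gamma> Z = Arrow (precomp C (dom2 C \<gamma>) Z) (precomp C (cod2 C \<gamma>) Z)
     (\<lambda>g\<in>hom1 C (tgt C (dom2 C \<gamma>)) Z. id2 C g \<star>\<^bsub>C\<^esub> \<gamma>)"

text \<open>
  The normal pseudo-functor \<open>C(X, F -) : I \<rightarrow> Cat\<close>, the pseudo-natural transformation
  \<open>C(f, F -) : C(Y, F -) \<Rightarrow> C(X, F -)\<close> for \<open>f : X \<rightarrow> Y\<close>, whose 2-morphism components are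
  identities because composition in \<open>C\<close> is strictly associative, and the modification
  \<open>C(\<gamma>, F -)\<close>.
\<close>

definition hom_psfun ::
  "('i, 'j, 'k) two_cat \<Rightarrow> ('o, 'm, 't) two_cat \<Rightarrow> 'o \<Rightarrow> ('i, 'j, 'k, 'o, 'm, 't) psfun \<Rightarrow>
   ('i, 'j, 'k, ('m, 't) cat, ('m, 't) cat_mor, ('m, 't) cat_cell) psfun" where
  "hom_psfun I C X F = \<lparr>
     on0 = (\<lambda>i\<in>Obj I. hom_cat C X (on0 F i)),
     on1 = (\<lambda>a\<in>Mor I. postcomp C X (on1 F a)),
     on2 = (\<lambda>\<alpha>\<in>Cell I. postcomp2 C X (on2 F \<alpha>)),
     cpt = (\<lambda>p\<in>composable I. postcomp2 C X (cpt F p))\<rparr>"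

definition hom_pstrans ::
  "('i, 'j, 'k) two_cat \<Rightarrow> ('o, 'm, 't) two_cat \<Rightarrow> 'm \<Rightarrow> ('i, 'j, 'k, 'o, 'm, 't) psfun \<Rightarrow>
   ('i, 'j, 'k, ('m, 't) cat, ('m, 't) cat_mor, ('m, 't) cat_cell) ps_mor" where
  "hom_pstrans I C f F = Arrow (hom_psfun I C (tgt C f) F) (hom_psfun I C (src C f) F) \<lparr>
     pt0 = (\<lambda>i\<in>Obj I. precomp C f (on0 F i)),
     pt1 = (\<lambda>a\<in>Mor I. id2 Cat
       (postcomp C (src C f) (on1 F a) \<cdot>\<^bsub>Cat\<^esub> precomp C f (on0 F (src I a))))\<rparr>"

definition hom_modification ::
  "('i, 'j, 'k) two_cat \<Rightarrow> ('o, 'm, 't) two_cat \<Rightarrow> 't \<Rightarrow> ('i, 'j, 'k, 'o, 'm, 't) psfun \<Rightarrow>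
   ('i, 'j, 'k, ('m, 't) cat, ('m, 't) cat_mor, ('m, 't) cat_cell) ps_cell" where
  "hom_modification I C \<gamma> F = Arrow (hom_pstrans I C (dom2 C \<gamma>) F) (hom_pstrans I C (cod2 C \<gamma>) F)
     (\<lambda>i\<in>Obj I. precomp2 C \<gamma> (on0 F i))"

definition bilimit_comparison ::
  "('i, 'j, 'k) two_cat \<Rightarrow> ('o, 'm, 't) two_cat \<Rightarrow> ('i, 'j, 'k, 'o, 'm, 't) psfun \<Rightarrow>
   ('i, 'j, 'k, ('m, 't) cat, ('m, 't) cat_mor, ('m, 't) cat_cell) ps_mor \<Rightarrow> 'o \<Rightarrow> 'o \<Rightarrow>
   ('m, 't,
    ('i, 'j, 'k, ('m, 't) cat, ('m, 't) cat_mor, ('m, 't) cat_cell) ps_mor,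
    ('i, 'j, 'k, ('m, 't) cat, ('m, 't) cat_mor, ('m, 't) cat_cell) ps_cell) fctr" where
  "bilimit_comparison I C F l X Y = \<lparr>
     fob = (\<lambda>f\<in>hom1 C Y X. hom_pstrans I C f F \<cdot>\<^bsub>Ps I Cat\<^esub> l),
     far = (\<lambda>\<gamma>\<in>cAr (hom_cat C Y X). hom_modification I C \<gamma> F \<star>\<^bsub>Ps I Cat\<^esub> id2 (Ps I Cat) l)\<rparr>"

definition weighted_bilimit ::
  "('i, 'j, 'k) two_cat \<Rightarrow> ('o, 'm, 't) two_cat \<Rightarrow>
   ('i, 'j, 'k, ('m, 't) cat, ('m, 't) cat_mor, ('m, 't) cat_cell) psfun \<Rightarrow>
   ('i, 'j, 'k, 'o, 'm, 't) psfun \<Rightarrow> 'o \<Rightarrow>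
   ('i, 'j, 'k, ('m, 't) cat, ('m, 't) cat_mor, ('m, 't) cat_cell) ps_mor \<Rightarrow> bool" where
  "weighted_bilimit I C W F X l \<longleftrightarrow>
     X \<in> Obj C \<and> l \<in> hom1 (Ps I Cat) W (hom_psfun I C X F) \<and>
     (\<forall>Y\<in>Obj C. adjoint_equivalence (hom_cat C Y X)
        (hom_cat (Ps I Cat) W (hom_psfun I C Y F)) (bilimit_comparison I C F l X Y))"

definition bilimit ::
  "('i, 'j, 'k) two_cat \<Rightarrow> ('o, 'm, 't) two_cat \<Rightarrow> ('i, 'j, 'k, 'o, 'm, 't) psfun \<Rightarrow> 'o \<Rightarrow>
   ('i, 'j, 'k, ('m, 't) cat, ('m, 't) cat_mor, ('m, 't) cat_cell) ps_mor \<Rightarrow> bool" where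
  "bilimit I C F X l \<longleftrightarrow> weighted_bilimit I C (const_psfun I Cat terminal_cat) F X l"


section \<open>Pseudo-slice 2-categories and arrow 2-categories\<close>

type_synonym ('o, 'm', 'm, 't') slice_mor = "('o \<times> 'm', 'm \<times> 't') arrow"
type_synonym ('o, 'm', 'm, 't', 't) slice_cell = "(('o, 'm', 'm, 't') slice_mor, 't) arrow"

definition pslice_obj ::
  "('o, 'm, 't) two_cat \<Rightarrow> ('o', 'm', 't') two_cat \<Rightarrow> ('o, 'm, 't, 'o', 'm', 't') psfun \<Rightarrow> 'o' \<Rightarrow>
   ('o \<times> 'm') set" where
  "pslice_obj B A L D = {(X, f). X \<in> Obj B \<and> f \<in> hom1 A (on0 L X) D}"

definition pslice_mor ::
  "('o, 'm, 't) two_cat \<Rightarrow> ('o', 'm', 't') two_cat \<Rightarrow> ('o, 'm, 't, 'o', 'm', 't') psfun \<Rightarrow> 'o' \<Rightarrow>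
   ('o, 'm', 'm, 't') slice_mor set" where
  "pslice_mor B A L D = {Arrow (X, f) (X', f') (c, \<psi>) | X f X' f' c \<psi>.
     (X, f) \<in> pslice_obj B A L D \<and> (X', f') \<in> pslice_obj B A L D \<and>
     c \<in> hom1 B X X' \<and> \<psi> \<in> hom2 A (f' \<cdot>\<^bsub>A\<^esub> on1 L c) f \<and> invertible2 A \<psi>}"

text \<open>
  The composite of \<open>(c, \<psi>) : (X, f) \<rightarrow> (X', f')\<close> and \<open>(c', \<psi>') : (X', f') \<rightarrow> (X'', f'')\<close> has the
  2-morphism \<open>f'' (L (c' c)) \<Rightarrow> f'' (L c') (L c) \<Rightarrow> f' (L c) \<Rightarrow> f\<close>.
\<close>

definition pslice_comp ::
  "('o, 'm, 't) two_cat \<Rightarrow> ('o', 'm', 't') two_cat \<Rightarrow> ('o, 'm, 't, 'o', 'm', 't') psfun \<Rightarrow>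
   ('o, 'm', 'm, 't') slice_mor \<Rightarrow> ('o, 'm', 'm, 't') slice_mor \<Rightarrow> ('o, 'm', 'm, 't') slice_mor"
where
  "pslice_comp B A L q p =
     (let (c, \<psi>) = label p; (c', \<psi>') = label q; f'' = snd (target q) in
      Arrow (source p) (target q)
        (c' \<cdot>\<^bsub>B\<^esub> c,
         \<psi> \<bullet>\<^bsub>A\<^esub> (\<psi>' \<star>\<^bsub>A\<^esub> id2 A (on1 L c)) \<bullet>\<^bsub>A\<^esub> (id2 A f'' \<star>\<^bsub>A\<^esub> inv2 A (cpt L (c', c)))))"

definition pslice ::
  "('o, 'm, 't) two_cat \<Rightarrow> ('o', 'm', 't') two_cat \<Rightarrow> ('o, 'm, 't, 'o', 'm', 't') psfun \<Rightarrow> 'o' \<Rightarrow>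
   ('o \<times> 'm', ('o, 'm', 'm, 't') slice_mor, ('o, 'm', 'm, 't', 't) slice_cell) two_cat" where
  "pslice B A L D = \<lparr>
     Obj = pslice_obj B A L D,
     Mor = pslice_mor B A L D,
     Cell = {Arrow (Arrow x (X', f') (c, \<psi>)) (Arrow x (X', f') (d, \<phi>)) \<beta> | x X' f' c \<psi> d \<phi> \<beta>.
       Arrow x (X', f') (c, \<psi>) \<in> pslice_mor B A L D \<and>
       Arrow x (X', f') (d, \<phi>) \<in> pslice_mor B A L D \<and>
       \<beta> \<in> hom2 B c d \<and> \<phi> \<bullet>\<^bsub>A\<^esub> (id2 A f' \<star>\<^bsub>A\<^esub> on2 L \<beta>) = \<psi>},
     src = source, tgt = target, dom2 = source, cod2 = target,
     id1 = (\<lambda>(X, f). Arrow (X, f) (X, f) (id1 B X, id2 A f)),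
     id2 = (\<lambda>p. Arrow p p (id2 B (fst (label p)))),
     comp = pslice_comp B A L,
     vcomp = (\<lambda>s r. Arrow (source r) (target s) (label s \<bullet>\<^bsub>B\<^esub> label r)),
     hcomp = (\<lambda>s r. Arrow (pslice_comp B A L (source s) (source r))
       (pslice_comp B A L (target s) (target r)) (label s \<star>\<^bsub>B\<^esub> label r))\<rparr>"

text \<open>
  A 2-morphism \<open>Arrow \<alpha> \<beta> (\<sigma>, \<tau>)\<close> of the arrow 2-category is the commutative square with
  \<open>\<sigma>\<close> between the domains and \<open>\<tau>\<close> between the codomains of \<open>\<alpha>\<close> and \<open>\<beta>\<close>.
\<close>

definition Ar ::
  "('o, 'm, 't) two_cat \<Rightarrow> ('o, 't, ('t, 't \<times> 't) arrow) two_cat" where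
  "Ar A = \<lparr>
     Obj = Obj A,
     Mor = Cell A,
     Cell = {Arrow \<alpha> \<beta> (\<sigma>, \<tau>) | \<alpha> \<beta> \<sigma> \<tau>. \<alpha> \<in> Cell A \<and> \<beta> \<in> Cell A \<and>
       \<sigma> \<in> hom2 A (dom2 A \<alpha>) (dom2 A \<beta>) \<and> \<tau> \<in> hom2 A (cod2 A \<alpha>) (cod2 A \<beta>) \<and>
       \<tau> \<bullet>\<^bsub>A\<^esub> \<alpha> = \<beta> \<bullet>\<^bsub>A\<^esub> \<sigma>},
     src = (\<lambda>\<alpha>. src A (dom2 A \<alpha>)), tgt = (\<lambda>\<alpha>. tgt A (dom2 A \<alpha>)),
     dom2 = source, cod2 = target,
     id1 = (\<lambda>X. id2 A (id1 A X)),
     id2 = (\<lambda>\<alpha>. Arrow \<alpha> \<alpha> (id2 A (dom2 A \<alpha>), id2 A (cod2 A \<alpha>))),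
     comp = hcomp A,
     vcomp = (\<lambda>s r. Arrow (source r) (target s)
       (fst (label s) \<bullet>\<^bsub>A\<^esub> fst (label r), snd (label s) \<bullet>\<^bsub>A\<^esub> snd (label r))),
     hcomp = (\<lambda>s r. Arrow (source s \<star>\<^bsub>A\<^esub> source r) (target s \<star>\<^bsub>A\<^esub> target r)
       (fst (label s) \<star>\<^bsub>A\<^esub> fst (label r), snd (label s) \<star>\<^bsub>A\<^esub> snd (label r)))\<rparr>"

definition Ar_psfun ::
  "('i, 'j, 'k) two_cat \<Rightarrow> ('o, 'm, 't) two_cat \<Rightarrow> ('i, 'j, 'k, 'o, 'm, 't) psfun \<Rightarrow>
   ('i, 'k, ('k, 'k \<times> 'k) arrow, 'o, 't, ('t, 't \<times> 't) arrow) psfun" where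
  "Ar_psfun A B L = \<lparr>
     on0 = on0 L,
     on1 = on2 L,
     on2 = (\<lambda>s\<in>Cell (Ar A). Arrow (on2 L (source s)) (on2 L (target s))
       (on2 L (fst (label s)), on2 L (snd (label s)))),
     cpt = (\<lambda>(\<alpha>', \<alpha>)\<in>composable (Ar A).
       Arrow (on2 L \<alpha>' \<star>\<^bsub>B\<^esub> on2 L \<alpha>) (on2 L (\<alpha>' \<star>\<^bsub>A\<^esub> \<alpha>))
         (cpt L (dom2 A \<alpha>', dom2 A \<alpha>), cpt L (cod2 A \<alpha>', cod2 A \<alpha>)))\<rparr>"


section \<open>Bi-initial and bi-terminal objects\<close>

definition coslice_obj :: "('o, 'm, 't) two_cat \<Rightarrow> 'o \<Rightarrow> ('o \<times> 'm) set" where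
  "coslice_obj A Z = {(X, f). X \<in> Obj A \<and> f \<in> hom1 A Z X}"

definition coslice_mor :: "('o, 'm, 't) two_cat \<Rightarrow> 'o \<Rightarrow> ('o, 'm, 'm, 't) slice_mor set" where
  "coslice_mor A Z = {Arrow (X, f) (X', f') (a, \<psi>) | X f X' f' a \<psi>.
     (X, f) \<in> coslice_obj A Z \<and> (X', f') \<in> coslice_obj A Z \<and>
     a \<in> hom1 A X X' \<and> \<psi> \<in> hom2 A f' (a \<cdot>\<^bsub>A\<^esub> f) \<and> invertible2 A \<psi>}"

definition coslice_comp ::
  "('o, 'm, 't) two_cat \<Rightarrow> ('o, 'm, 'm, 't) slice_mor \<Rightarrow> ('o, 'm, 'm, 't) slice_mor \<Rightarrow>
   ('o, 'm, 'm, 't) slice_mor" where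
  "coslice_comp A q p =
     (let (a, \<psi>) = label p; (a', \<psi>') = label q in
      Arrow (source p) (target q) (a' \<cdot>\<^bsub>A\<^esub> a, (id2 A a' \<star>\<^bsub>A\<^esub> \<psi>) \<bullet>\<^bsub>A\<^esub> \<psi>'))"

definition coslice ::
  "('o, 'm, 't) two_cat \<Rightarrow> 'o \<Rightarrow>
   ('o \<times> 'm, ('o, 'm, 'm, 't) slice_mor, ('o, 'm, 'm, 't, 't) slice_cell) two_cat" where
  "coslice A Z = \<lparr>
     Obj = coslice_obj A Z,
     Mor = coslice_mor A Z,
     Cell = {Arrow (Arrow (X, f) y (a, \<psi>)) (Arrow (X, f) y (b, \<phi>)) \<beta> | X f y a \<psi> b \<phi> \<beta>.
       Arrow (X, f) y (a, \<psi>) \<in> coslice_mor A Z \<and> Arrow (X, f) y (b, \<phi>) \<in> coslice_mor A Z \<and>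
       \<beta> \<in> hom2 A a b \<and> (\<beta> \<star>\<^bsub>A\<^esub> id2 A f) \<bullet>\<^bsub>A\<^esub> \<psi> = \<phi>},
     src = source, tgt = target, dom2 = source, cod2 = target,
     id1 = (\<lambda>(X, f). Arrow (X, f) (X, f) (id1 A X, id2 A f)),
     id2 = (\<lambda>p. Arrow p p (id2 A (fst (label p)))),
     comp = coslice_comp A,
     vcomp = (\<lambda>s r. Arrow (source r) (target s) (label s \<bullet>\<^bsub>A\<^esub> label r)),
     hcomp = (\<lambda>s r. Arrow (coslice_comp A (source s) (source r))
       (coslice_comp A (target s) (target r)) (label s \<star>\<^bsub>A\<^esub> label r))\<rparr>"

definition coslice_proj ::
  "('o, 'm, 't) two_cat \<Rightarrow> 'o \<Rightarrow>
   ('o \<times> 'm, ('o, 'm, 'm, 't) slice_mor, ('o, 'm, 'm, 't, 't) slice_cell, 'o, 'm, 't) psfun" where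
  "coslice_proj A Z = strict_psfun (coslice A Z) A fst (\<lambda>p. fst (label p)) label"

definition trivial_fibration ::
  "('i, 'j, 'k) two_cat \<Rightarrow> ('o, 'm, 't) two_cat \<Rightarrow> ('i, 'j, 'k, 'o, 'm, 't) psfun \<Rightarrow> bool" where
  "trivial_fibration A B G \<longleftrightarrow>
     on0 G ` Obj A = Obj B \<and>
     (\<forall>X\<in>Obj A. \<forall>Y\<in>Obj A. \<forall>b\<in>hom1 B (on0 G X) (on0 G Y). \<exists>a\<in>hom1 A X Y. on1 G a = b) \<and>
     (\<forall>X\<in>Obj A. \<forall>Y\<in>Obj A. \<forall>a\<in>hom1 A X Y. \<forall>a'\<in>hom1 A X Y.
        bij_betw (on2 G) (hom2 A a a') (hom2 B (on1 G a) (on1 G a')))"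

definition bi_initial :: "('o, 'm, 't) two_cat \<Rightarrow> 'o \<Rightarrow> bool" where
  "bi_initial A Z \<longleftrightarrow> Z \<in> Obj A \<and> trivial_fibration (coslice A Z) A (coslice_proj A Z)"

definition bi_terminal :: "('o, 'm, 't) two_cat \<Rightarrow> 'o \<Rightarrow> bool" where
  "bi_terminal A Z \<longleftrightarrow> bi_initial (op2 A) Z"


section \<open>Double categories\<close>

text \<open>
  A square has horizontal boundaries \<open>qtop\<close>, \<open>qbot\<close> and vertical boundaries \<open>qleft\<close>, \<open>qright\<close>.
  Squares compose horizontally (\<open>qhcomp\<close>) with units \<open>qhid u\<close> and vertically (\<open>qvcomp\<close>) with
  units \<open>qvid a\<close>. Composites are written in the order of function composition, so
  \<open>qvcomp \<A> \<beta> \<alpha>\<close> is \<open>\<alpha>\<close> pasted above \<open>\<beta>\<close> and \<open>qhcomp \<A> \<beta> \<alpha>\<close> is \<open>\<alpha>\<close> pasted to the left of \<open>\<beta>\<close>.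
\<close>

record ('o, 'h, 'v, 'q) dbl_cat =
  DObj :: "'o set"
  HMor :: "'h set"
  VMor :: "'v set"
  Sq :: "'q set"
  hsrc :: "'h \<Rightarrow> 'o"
  htgt :: "'h \<Rightarrow> 'o"
  vsrc :: "'v \<Rightarrow> 'o"
  vtgt :: "'v \<Rightarrow> 'o"
  qtop :: "'q \<Rightarrow> 'h"
  qbot :: "'q \<Rightarrow> 'h"
  qleft :: "'q \<Rightarrow> 'v"
  qright :: "'q \<Rightarrow> 'v"
  hid :: "'o \<Rightarrow> 'h"
  vid :: "'o \<Rightarrow> 'v"
  hmcomp :: "'h \<Rightarrow> 'h \<Rightarrow> 'h"
  vmcomp :: "'v \<Rightarrow> 'v \<Rightarrow> 'v"
  qhid :: "'v \<Rightarrow> 'q"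
  qvid :: "'h \<Rightarrow> 'q"
  qhcomp :: "'q \<Rightarrow> 'q \<Rightarrow> 'q"
  qvcomp :: "'q \<Rightarrow> 'q \<Rightarrow> 'q"

definition hhom :: "('o, 'h, 'v, 'q) dbl_cat \<Rightarrow> 'o \<Rightarrow> 'o \<Rightarrow> 'h set" where
  "hhom \<A> X Y = {a \<in> HMor \<A>. hsrc \<A> a = X \<and> htgt \<A> a = Y}"

definition vhom :: "('o, 'h, 'v, 'q) dbl_cat \<Rightarrow> 'o \<Rightarrow> 'o \<Rightarrow> 'v set" where
  "vhom \<A> X Y = {u \<in> VMor \<A>. vsrc \<A> u = X \<and> vtgt \<A> u = Y}"

text \<open>
  The squares with given top, bottom, left and right boundaries, in this order.
\<close>

definition squares :: "('o, 'h, 'v, 'q) dbl_cat \<Rightarrow> 'h \<Rightarrow> 'h \<Rightarrow> 'v \<Rightarrow> 'v \<Rightarrow> 'q set" where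
  "squares \<A> a b u v =
     {\<alpha> \<in> Sq \<A>. qtop \<A> \<alpha> = a \<and> qbot \<A> \<alpha> = b \<and> qleft \<A> \<alpha> = u \<and> qright \<A> \<alpha> = v}"

definition boundary :: "('o, 'h, 'v, 'q) dbl_cat \<Rightarrow> 'h \<Rightarrow> 'h \<Rightarrow> 'v \<Rightarrow> 'v \<Rightarrow> bool" where
  "boundary \<A> a b u v \<longleftrightarrow> a \<in> HMor \<A> \<and> b \<in> HMor \<A> \<and> u \<in> VMor \<A> \<and> v \<in> VMor \<A> \<and>
     hsrc \<A> a = vsrc \<A> u \<and> htgt \<A> a = vsrc \<A> v \<and> hsrc \<A> b = vtgt \<A> u \<and> htgt \<A> b = vtgt \<A> v"

definition dbl_op :: "('o, 'h, 'v, 'q) dbl_cat \<Rightarrow> ('o, 'h, 'v, 'q) dbl_cat" where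
  "dbl_op \<A> = \<A>\<lparr>hsrc := htgt \<A>, htgt := hsrc \<A>, qleft := qright \<A>, qright := qleft \<A>,
     hmcomp := (\<lambda>b a. hmcomp \<A> a b), qhcomp := (\<lambda>\<beta> \<alpha>. qhcomp \<A> \<alpha> \<beta>)\<rparr>"

definition vert_invertible :: "('o, 'h, 'v, 'q) dbl_cat \<Rightarrow> 'q \<Rightarrow> bool" where
  "vert_invertible \<A> \<psi> \<longleftrightarrow> \<psi> \<in> Sq \<A> \<and>
     qleft \<A> \<psi> = vid \<A> (hsrc \<A> (qtop \<A> \<psi>)) \<and> qright \<A> \<psi> = vid \<A> (htgt \<A> (qtop \<A> \<psi>)) \<and>
     (\<exists>\<phi> \<in> squares \<A> (qbot \<A> \<psi>) (qtop \<A> \<psi>) (qleft \<A> \<psi>) (qright \<A> \<psi>).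
        qvcomp \<A> \<phi> \<psi> = qvid \<A> (qtop \<A> \<psi>) \<and> qvcomp \<A> \<psi> \<phi> = qvid \<A> (qbot \<A> \<psi>))"

datatype ('h, 'v, 'd) square =
  Square (top_of: 'h) (bot_of: 'h) (left_of: 'v) (right_of: 'v) (label_of: 'd)


section \<open>The pseudo-slice double category over an object of a 2-category\<close>

text \<open>
  For \<open>L : B \<rightarrow> A\<close>, the double category \<open>\<H>L \<down>\<down> D\<close>. As \<open>\<H>B\<close> has only identity vertical
  morphisms, a vertical morphism is a 2-morphism of \<open>A\<close> between objects with the same first
  component, and a square is a 2-morphism of \<open>B\<close>.
\<close>

definition pslice_vmor ::
  "('o, 'm, 't) two_cat \<Rightarrow> ('o', 'm', 't') two_cat \<Rightarrow> ('o, 'm, 't, 'o', 'm', 't') psfun \<Rightarrow> 'o' \<Rightarrow>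
   ('o \<times> 'm', 't') arrow set" where
  "pslice_vmor B A L D = {Arrow (X, \<kappa>) (X, \<mu>) \<Theta> | X \<kappa> \<mu> \<Theta>.
     (X, \<kappa>) \<in> pslice_obj B A L D \<and> (X, \<mu>) \<in> pslice_obj B A L D \<and> \<Theta> \<in> hom2 A \<kappa> \<mu>}"

definition pslice_sq ::
  "('o, 'm, 't) two_cat \<Rightarrow> ('o', 'm', 't') two_cat \<Rightarrow> ('o, 'm, 't, 'o', 'm', 't') psfun \<Rightarrow> 'o' \<Rightarrow>
   (('o, 'm', 'm, 't') slice_mor, ('o \<times> 'm', 't') arrow, 't) square set" where
  "pslice_sq B A L D =
     {Square (Arrow x x' (c, \<Psi>)) (Arrow y y' (d, \<Phi>)) (Arrow x y \<Theta>) (Arrow x' y' \<Theta>') \<gamma>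
        | x x' y y' c \<Psi> d \<Phi> \<Theta> \<Theta>' \<gamma>.
      Arrow x x' (c, \<Psi>) \<in> pslice_mor B A L D \<and> Arrow y y' (d, \<Phi>) \<in> pslice_mor B A L D \<and>
      Arrow x y \<Theta> \<in> pslice_vmor B A L D \<and> Arrow x' y' \<Theta>' \<in> pslice_vmor B A L D \<and>
      \<gamma> \<in> hom2 B c d \<and> \<Theta> \<bullet>\<^bsub>A\<^esub> \<Psi> = \<Phi> \<bullet>\<^bsub>A\<^esub> (\<Theta>' \<star>\<^bsub>A\<^esub> on2 L \<gamma>)}"

definition pslice_dbl ::
  "('o, 'm, 't) two_cat \<Rightarrow> ('o', 'm', 't') two_cat \<Rightarrow> ('o, 'm, 't, 'o', 'm', 't') psfun \<Rightarrow> 'o' \<Rightarrow>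
   ('o \<times> 'm', ('o, 'm', 'm, 't') slice_mor, ('o \<times> 'm', 't') arrow,
    (('o, 'm', 'm, 't') slice_mor, ('o \<times> 'm', 't') arrow, 't) square) dbl_cat" where
  "pslice_dbl B A L D =
     (let hc = pslice_comp B A L; vc = (\<lambda>v u. Arrow (source u) (target v) (label v \<bullet>\<^bsub>A\<^esub> label u)) in
      \<lparr>DObj = pslice_obj B A L D,
       HMor = pslice_mor B A L D,
       VMor = pslice_vmor B A L D,
       Sq = pslice_sq B A L D,
       hsrc = source, htgt = target, vsrc = source, vtgt = target,
       qtop = top_of, qbot = bot_of, qleft = left_of, qright = right_of,
       hid = (\<lambda>(X, f). Arrow (X, f) (X, f) (id1 B X, id2 A f)),
       vid = (\<lambda>(X, f). Arrow (X, f) (X, f) (id2 A f)),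
       hmcomp = hc,
       vmcomp = vc,
       qhid = (\<lambda>u. let (X, \<kappa>) = source u; (X, \<mu>) = target u in
         Square (Arrow (X, \<kappa>) (X, \<kappa>) (id1 B X, id2 A \<kappa>)) (Arrow (X, \<mu>) (X, \<mu>) (id1 B X, id2 A \<mu>))
           u u (id2 B (id1 B X))),
       qvid = (\<lambda>p. let (X, f) = source p; (X', f') = target p in
         Square p p (Arrow (X, f) (X, f) (id2 A f)) (Arrow (X', f') (X', f') (id2 A f'))
           (id2 B (fst (label p)))),
       qhcomp = (\<lambda>s r. Square (hc (top_of s) (top_of r)) (hc (bot_of s) (bot_of r))
         (left_of r) (right_of s) (label_of s \<star>\<^bsub>B\<^esub> label_of r)),
       qvcomp = (\<lambda>s r. Square (top_of r) (bot_of s) (vc (left_of s) (left_of r))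
         (vc (right_of s) (right_of r)) (label_of s \<bullet>\<^bsub>B\<^esub> label_of r))\<rparr>)"


section \<open>Double bi-initial and double bi-terminal objects\<close>

definition dcoslice_obj :: "('o, 'h, 'v, 'q) dbl_cat \<Rightarrow> 'o \<Rightarrow> ('o \<times> 'h) set" where
  "dcoslice_obj \<A> Z = {(X, f). X \<in> DObj \<A> \<and> f \<in> hhom \<A> Z X}"

definition dcoslice_hmor ::
  "('o, 'h, 'v, 'q) dbl_cat \<Rightarrow> 'o \<Rightarrow> ('o \<times> 'h, 'h \<times> 'q) arrow set" where
  "dcoslice_hmor \<A> Z = {Arrow (X, f) (X', f') (a, \<psi>) | X f X' f' a \<psi>.
     (X, f) \<in> dcoslice_obj \<A> Z \<and> (X', f') \<in> dcoslice_obj \<A> Z \<and> a \<in> hhom \<A> X X' \<and>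
     \<psi> \<in> squares \<A> f' (hmcomp \<A> a f) (vid \<A> Z) (vid \<A> X') \<and> vert_invertible \<A> \<psi>}"

definition dcoslice_vmor ::
  "('o, 'h, 'v, 'q) dbl_cat \<Rightarrow> 'o \<Rightarrow> ('o \<times> 'h, 'v \<times> 'q) arrow set" where
  "dcoslice_vmor \<A> Z = {Arrow (X, f) (Y, g) (u, \<gamma>) | X f Y g u \<gamma>.
     (X, f) \<in> dcoslice_obj \<A> Z \<and> (Y, g) \<in> dcoslice_obj \<A> Z \<and> u \<in> vhom \<A> X Y \<and>
     \<gamma> \<in> squares \<A> f g (vid \<A> Z) u}"

definition dcoslice_sq ::
  "('o, 'h, 'v, 'q) dbl_cat \<Rightarrow> 'o \<Rightarrow>
   (('o \<times> 'h, 'h \<times> 'q) arrow, ('o \<times> 'h, 'v \<times> 'q) arrow, 'q) square set" where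
  "dcoslice_sq \<A> Z =
     {Square (Arrow x x' (a, \<psi>)) (Arrow y y' (b, \<phi>)) (Arrow x y (u, \<gamma>)) (Arrow x' y' (u', \<gamma>')) \<alpha>
        | x x' y y' a \<psi> b \<phi> u \<gamma> u' \<gamma>' \<alpha>.
      Arrow x x' (a, \<psi>) \<in> dcoslice_hmor \<A> Z \<and> Arrow y y' (b, \<phi>) \<in> dcoslice_hmor \<A> Z \<and>
      Arrow x y (u, \<gamma>) \<in> dcoslice_vmor \<A> Z \<and> Arrow x' y' (u', \<gamma>') \<in> dcoslice_vmor \<A> Z \<and>
      \<alpha> \<in> squares \<A> a b u u' \<and>
      qvcomp \<A> (qhcomp \<A> \<alpha> \<gamma>) \<psi> = qvcomp \<A> \<phi> \<gamma>'}"

definition dcoslice ::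
  "('o, 'h, 'v, 'q) dbl_cat \<Rightarrow> 'o \<Rightarrow>
   ('o \<times> 'h, ('o \<times> 'h, 'h \<times> 'q) arrow, ('o \<times> 'h, 'v \<times> 'q) arrow,
    (('o \<times> 'h, 'h \<times> 'q) arrow, ('o \<times> 'h, 'v \<times> 'q) arrow, 'q) square) dbl_cat" where
  "dcoslice \<A> Z =
     (let hi = (\<lambda>(X, f). Arrow (X, f) (X, f) (hid \<A> X, qvid \<A> f));
          vi = (\<lambda>(X, f). Arrow (X, f) (X, f) (vid \<A> X, qvid \<A> f));
          hc = (\<lambda>q p. Arrow (source p) (target q)
            (hmcomp \<A> (fst (label q)) (fst (label p)),
             qvcomp \<A> (qhcomp \<A> (qvid \<A> (fst (label q))) (snd (label p))) (snd (label q))));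
          vc = (\<lambda>v u. Arrow (source u) (target v)
            (vmcomp \<A> (fst (label v)) (fst (label u)), qvcomp \<A> (snd (label v)) (snd (label u)))) in
      \<lparr>DObj = dcoslice_obj \<A> Z,
       HMor = dcoslice_hmor \<A> Z,
       VMor = dcoslice_vmor \<A> Z,
       Sq = dcoslice_sq \<A> Z,
       hsrc = source, htgt = target, vsrc = source, vtgt = target,
       qtop = top_of, qbot = bot_of, qleft = left_of, qright = right_of,
       hid = hi, vid = vi, hmcomp = hc, vmcomp = vc,
       qhid = (\<lambda>u. Square (hi (source u)) (hi (target u)) u u (qhid \<A> (fst (label u)))),
       qvid = (\<lambda>p. Square p p (vi (source p)) (vi (target p)) (qvid \<A> (fst (label p)))),
       qhcomp = (\<lambda>s r. Square (hc (top_of s) (top_of r)) (hc (bot_of s) (bot_of r))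
         (left_of r) (right_of s) (qhcomp \<A> (label_of s) (label_of r))),
       qvcomp = (\<lambda>s r. Square (top_of r) (bot_of s) (vc (left_of s) (left_of r))
         (vc (right_of s) (right_of r)) (qvcomp \<A> (label_of s) (label_of r)))\<rparr>)"

record ('o, 'h, 'v, 'q, 'o', 'h', 'v', 'q') dfun =
  don0 :: "'o \<Rightarrow> 'o'"
  donh :: "'h \<Rightarrow> 'h'"
  donv :: "'v \<Rightarrow> 'v'"
  donq :: "'q \<Rightarrow> 'q'"

definition dcoslice_proj ::
  "('o, 'h, 'v, 'q) dbl_cat \<Rightarrow> 'o \<Rightarrow>
   ('o \<times> 'h, ('o \<times> 'h, 'h \<times> 'q) arrow, ('o \<times> 'h, 'v \<times> 'q) arrow,
    (('o \<times> 'h, 'h \<times> 'q) arrow, ('o \<times> 'h, 'v \<times> 'q) arrow, 'q) square, 'o, 'h, 'v, 'q) dfun" where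
  "dcoslice_proj \<A> Z = \<lparr>
     don0 = restrict fst (dcoslice_obj \<A> Z),
     donh = (\<lambda>p\<in>dcoslice_hmor \<A> Z. fst (label p)),
     donv = (\<lambda>u\<in>dcoslice_vmor \<A> Z. fst (label u)),
     donq = restrict label_of (dcoslice_sq \<A> Z)\<rparr>"

definition double_trivial_fibration ::
  "('o, 'h, 'v, 'q) dbl_cat \<Rightarrow> ('o', 'h', 'v', 'q') dbl_cat \<Rightarrow>
   ('o, 'h, 'v, 'q, 'o', 'h', 'v', 'q') dfun \<Rightarrow> bool" where
  "double_trivial_fibration \<A> \<B> G \<longleftrightarrow>
     don0 G ` DObj \<A> = DObj \<B> \<and>
     (\<forall>X\<in>DObj \<A>. \<forall>Y\<in>DObj \<A>. \<forall>b\<in>hhom \<B> (don0 G X) (don0 G Y). \<exists>a\<in>hhom \<A> X Y. donh G a = b) \<and>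
     donv G ` VMor \<A> = VMor \<B> \<and>
     (\<forall>a b u v. boundary \<A> a b u v \<longrightarrow>
        (\<forall>\<beta>\<in>squares \<B> (donh G a) (donh G b) (donv G u) (donv G v).
           \<exists>!\<alpha>. \<alpha> \<in> squares \<A> a b u v \<and> donq G \<alpha> = \<beta>))"

definition double_bi_initial :: "('o, 'h, 'v, 'q) dbl_cat \<Rightarrow> 'o \<Rightarrow> bool" where
  "double_bi_initial \<A> Z \<longleftrightarrow>
     Z \<in> DObj \<A> \<and> double_trivial_fibration (dcoslice \<A> Z) \<A> (dcoslice_proj \<A> Z)"

definition double_bi_terminal :: "('o, 'h, 'v, 'q) dbl_cat \<Rightarrow> 'o \<Rightarrow> bool" where
  "double_bi_terminal \<A> Z \<longleftrightarrow> double_bi_initial (dbl_op \<A>) Z"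

end

theory Submission
  imports Defs
begin

text \<open>
  All the conditions of the theorem express one property of a cone \<open>l : \<Delta>X \<Rightarrow> F\<close>: for every \<open>Y\<close>,
  the functor \<open>T : C(Y, X) \<rightarrow> Ps(I, C)(\<Delta>Y, F)\<close> with \<open>T c = l (\<Delta>c)\<close> and \<open>T \<gamma> = l * \<Delta>\<gamma>\<close> is essentially
  surjective on objects and fully faithful. This property is \<open>biuniversal_arrow\<close>. It makes sense for
  every normal pseudo-functor \<open>L : B \<rightarrow> A\<close> and object \<open>D\<close> of \<open>A\<close> in place of \<open>\<Delta>\<close> and \<open>F\<close>, and the
  statements about slices are proved in this generality.

  \<^item> An object \<open>Z\<close> of a 2-category is bi-terminal iff every \<open>Y\<close> has a morphism to \<open>Z\<close> and any two
    parallel morphisms to \<open>Z\<close> are related by exactly one 2-morphism (\<open>bi_terminal_iff\<close>). An object \<open>Z\<close>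
    of a double category is double bi-terminal iff every object has a horizontal morphism to \<open>Z\<close>
    and every vertical morphism together with two such morphisms at its ends bounds exactly one
    square over the vertical identity of \<open>Z\<close> (\<open>double_bi_terminal_iff\<close>).

  \<^item> In the slice double category, a horizontal morphism from \<open>(Y, \<kappa>)\<close> to \<open>(X, l)\<close> is an object \<open>c\<close> of
    \<open>B(Y, X)\<close> with an isomorphism \<open>\<psi> : T c \<cong> \<kappa>\<close>, and a square from \<open>\<Theta> : \<kappa> \<Rightarrow> \<mu>\<close> to the identity of \<open>l\<close>
    is a \<open>\<gamma>\<close> with \<open>\<phi> \<circ> T \<gamma> = \<Theta> \<circ> \<psi>\<close>. So double bi-terminality is essential surjectivity together with
    unique solvability of \<open>T \<gamma> = \<phi>\<inverse> \<circ> \<Theta> \<circ> \<psi>\<close>, which is full faithfulness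
    (\<open>double_bi_terminal_iff_biuniversal\<close>).

  \<^item> In the slice 2-category only \<open>\<Theta> = id\<close> occurs, so that bi-terminality there says, besides essential
    surjectivity, only that isomorphisms lift uniquely along \<open>T\<close>. The arrow 2-category also reaches
    the other 2-morphisms: a morphism from \<open>\<Theta> : \<kappa> \<Rightarrow> \<mu>\<close> to \<open>id\<^sub>l\<close> is a \<open>\<gamma> : c \<Rightarrow> d\<close> with isomorphisms \<open>T c \<cong> \<kappa>\<close> and
    \<open>T d \<cong> \<mu>\<close> that turn \<open>T \<gamma>\<close> into \<open>\<Theta>\<close>. Its identity objects give back the unique lifting of
    isomorphisms; with that, the existence of \<open>\<gamma>\<close> makes \<open>T\<close> full and the uniqueness of 2-morphisms makes
    \<open>T\<close> faithful (\<open>Ar_bi_terminal_iff_biuniversal\<close>).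

  \<^item> A functor from the terminal category to \<open>C(Y, F i)\<close> is an object of \<open>C(Y, F i)\<close>, and likewise for
    natural transformations. Applied at every \<open>i\<close>, this identifies \<open>Ps(I, Cat)(\<Delta>1, C(Y, F -))\<close>
    with \<open>Ps(I, C)(\<Delta>Y, F)\<close> and the comparison functor of a bi-limit with \<open>T\<close>. A functor is an
    adjoint equivalence iff it is essentially surjective and fully faithful, hence bi-limits are
    biuniversal arrows (\<open>bilimit_iff_biuniversal\<close>).
\<close>

section \<open>Calculating in a 2-category\<close>

text \<open>
  The laws of a 2-category are restated with conditions on sources, targets, domains and codomains
  in place of membership in hom-sets. All conditions are then free of unknowns, so that the
  simplifier can discharge them and bring composites into right-nested form.
\<close>

context two_category
begin

lemma Mor_src [simp]: "f \<in> Mor C \<Longrightarrow> src C f \<in> Obj C"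
  and Mor_tgt [simp]: "f \<in> Mor C \<Longrightarrow> tgt C f \<in> Obj C"
  using src_tgt by auto

lemma Cell_dom2 [simp]: "\<alpha> \<in> Cell C \<Longrightarrow> dom2 C \<alpha> \<in> Mor C"
  and Cell_cod2 [simp]: "\<alpha> \<in> Cell C \<Longrightarrow> cod2 C \<alpha> \<in> Mor C"
  using dom_cod by auto

lemma src_cod2 [simp]: "\<alpha> \<in> Cell C \<Longrightarrow> src C (cod2 C \<alpha>) = src C (dom2 C \<alpha>)"
  and tgt_cod2 [simp]: "\<alpha> \<in> Cell C \<Longrightarrow> tgt C (cod2 C \<alpha>) = tgt C (dom2 C \<alpha>)"
  using globular by auto

lemma id1_simps [simp]:
  assumes "X \<in> Obj C"
  shows "id1 C X \<in> Mor C" and "src C (id1 C X) = X" and "tgt C (id1 C X) = X"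
  using id1_hom[OF assms] by (auto simp: hom1_def)

lemma comp_simps [simp]:
  assumes "f \<in> Mor C" and "g \<in> Mor C" and "tgt C f = src C g"
  shows "g \<cdot> f \<in> Mor C" and "src C (g \<cdot> f) = src C f" and "tgt C (g \<cdot> f) = tgt C g"
  using comp_hom[of f "src C f" "tgt C f" g "tgt C g"] assms by (auto simp: hom1_def)

lemma comp_id1_left [simp]: "f \<in> Mor C \<Longrightarrow> tgt C f = Y \<Longrightarrow> id1 C Y \<cdot> f = f"
  and comp_id1_right [simp]: "f \<in> Mor C \<Longrightarrow> src C f = X \<Longrightarrow> f \<cdot> id1 C X = f"
  using comp_id_left[of f] comp_id_right[of f] by (auto simp: hom1_def)

lemma comp_assoc' [simp]:
  "f \<in> Mor C \<Longrightarrow> g \<in> Mor C \<Longrightarrow> h \<in> Mor C \<Longrightarrow> tgt C f = src C g \<Longrightarrow> tgt C g = src C h \<Longrightarrow>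
    (h \<cdot> g) \<cdot> f = h \<cdot> (g \<cdot> f)"
  using comp_assoc[of f "src C f" "tgt C f" g "tgt C g" h "tgt C h"] by (auto simp: hom1_def)

lemma id2_simps [simp]:
  assumes "f \<in> Mor C"
  shows "id2 C f \<in> Cell C" and "dom2 C (id2 C f) = f" and "cod2 C (id2 C f) = f"
  using id2_hom[OF assms] by (auto simp: hom2_def)

lemma vcomp_simps [simp]:
  assumes "\<alpha> \<in> Cell C" and "\<beta> \<in> Cell C" and "cod2 C \<alpha> = dom2 C \<beta>"
  shows "\<beta> \<bullet> \<alpha> \<in> Cell C" and "dom2 C (\<beta> \<bullet> \<alpha>) = dom2 C \<alpha>" and "cod2 C (\<beta> \<bullet> \<alpha>) = cod2 C \<beta>"
  using vcomp_hom[of \<alpha> "dom2 C \<alpha>" "cod2 C \<alpha>" \<beta> "cod2 C \<beta>"] assms by (auto simp: hom2_def)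

lemma vcomp_id2_left [simp]: "\<alpha> \<in> Cell C \<Longrightarrow> cod2 C \<alpha> = g \<Longrightarrow> id2 C g \<bullet> \<alpha> = \<alpha>"
  and vcomp_id2_right [simp]: "\<alpha> \<in> Cell C \<Longrightarrow> dom2 C \<alpha> = f \<Longrightarrow> \<alpha> \<bullet> id2 C f = \<alpha>"
  using vcomp_id_left[of \<alpha>] vcomp_id_right[of \<alpha>] by (auto simp: hom2_def)

lemma vcomp_assoc' [simp]:
  "\<alpha> \<in> Cell C \<Longrightarrow> \<beta> \<in> Cell C \<Longrightarrow> \<gamma> \<in> Cell C \<Longrightarrow> cod2 C \<alpha> = dom2 C \<beta> \<Longrightarrow> cod2 C \<beta> = dom2 C \<gamma> \<Longrightarrow>
    (\<gamma> \<bullet> \<beta>) \<bullet> \<alpha> = \<gamma> \<bullet> (\<beta> \<bullet> \<alpha>)"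
  using vcomp_assoc[of \<alpha> "dom2 C \<alpha>" "cod2 C \<alpha>" \<beta> "cod2 C \<beta>" \<gamma> "cod2 C \<gamma>"]
  by (auto simp: hom2_def)

lemma hcomp_simps [simp]:
  assumes "\<alpha> \<in> Cell C" and "\<beta> \<in> Cell C" and "tgt C (dom2 C \<alpha>) = src C (dom2 C \<beta>)"
  shows "\<beta> \<star> \<alpha> \<in> Cell C"
    and "dom2 C (\<beta> \<star> \<alpha>) = dom2 C \<beta> \<cdot> dom2 C \<alpha>"
    and "cod2 C (\<beta> \<star> \<alpha>) = cod2 C \<beta> \<cdot> cod2 C \<alpha>"
  using hcomp_hom[of \<alpha> "dom2 C \<alpha>" "cod2 C \<alpha>" \<beta> "dom2 C \<beta>" "cod2 C \<beta>"] assms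
  by (auto simp: hom2_def)

lemma hcomp_id1_left [simp]:
    "\<alpha> \<in> Cell C \<Longrightarrow> tgt C (dom2 C \<alpha>) = Y \<Longrightarrow> id2 C (id1 C Y) \<star> \<alpha> = \<alpha>"
  and hcomp_id1_right [simp]:
    "\<alpha> \<in> Cell C \<Longrightarrow> src C (dom2 C \<alpha>) = X \<Longrightarrow> \<alpha> \<star> id2 C (id1 C X) = \<alpha>"
  using hcomp_id_left hcomp_id_right by auto

lemma hcomp_assoc' [simp]:
  "\<alpha> \<in> Cell C \<Longrightarrow> \<beta> \<in> Cell C \<Longrightarrow> \<gamma> \<in> Cell C \<Longrightarrow> tgt C (dom2 C \<alpha>) = src C (dom2 C \<beta>) \<Longrightarrow>
    tgt C (dom2 C \<beta>) = src C (dom2 C \<gamma>) \<Longrightarrow> (\<gamma> \<star> \<beta>) \<star> \<alpha> = \<gamma> \<star> (\<beta> \<star> \<alpha>)"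
  by (rule hcomp_assoc)

lemma hcomp_id2' [simp]:
  "f \<in> Mor C \<Longrightarrow> g \<in> Mor C \<Longrightarrow> tgt C f = src C g \<Longrightarrow> id2 C g \<star> id2 C f = id2 C (g \<cdot> f)"
  using hcomp_id2[of f "src C f" "tgt C f" g "tgt C g"] by (auto simp: hom1_def)

text \<open>
  Closes the critical pair between associativity and the composition of identities, both of which
  are rewrite rules.
\<close>

lemma hcomp_id2_assoc [simp]:
  assumes "f \<in> Mor C" "g \<in> Mor C" "tgt C f = src C g" "\<alpha> \<in> Cell C" "tgt C (dom2 C \<alpha>) = src C f"
  shows "id2 C g \<star> (id2 C f \<star> \<alpha>) = id2 C (g \<cdot> f) \<star> \<alpha>"
  using hcomp_assoc[of \<alpha> "id2 C f" "id2 C g"] assms by simp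

lemma interchange':
  assumes "\<alpha> \<in> Cell C" "\<beta> \<in> Cell C" "\<alpha>' \<in> Cell C" "\<beta>' \<in> Cell C"
    and "cod2 C \<alpha> = dom2 C \<beta>" "cod2 C \<alpha>' = dom2 C \<beta>'" "tgt C (dom2 C \<alpha>) = src C (dom2 C \<alpha>')"
  shows "(\<beta>' \<star> \<beta>) \<bullet> (\<alpha>' \<star> \<alpha>) = (\<beta>' \<bullet> \<alpha>') \<star> (\<beta> \<bullet> \<alpha>)"
  using interchange[of \<alpha> "dom2 C \<alpha>" "cod2 C \<alpha>" \<beta> "cod2 C \<beta>" \<alpha>' "dom2 C \<alpha>'" "cod2 C \<alpha>'" \<beta>'
      "cod2 C \<beta>'"] assms by (auto simp: hom2_def)

text \<open>
  Interchange inside a right-nested composite.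
\<close>

lemma interchange_assoc:
  assumes "\<alpha> \<in> Cell C" "\<beta> \<in> Cell C" "\<alpha>' \<in> Cell C" "\<beta>' \<in> Cell C"
    and "cod2 C \<alpha> = dom2 C \<beta>" "cod2 C \<alpha>' = dom2 C \<beta>'" "tgt C (dom2 C \<alpha>) = src C (dom2 C \<alpha>')"
    and "\<delta> \<in> Cell C" "cod2 C \<delta> = dom2 C \<alpha>' \<cdot> dom2 C \<alpha>"
  shows "(\<beta>' \<star> \<beta>) \<bullet> ((\<alpha>' \<star> \<alpha>) \<bullet> \<delta>) = ((\<beta>' \<bullet> \<alpha>') \<star> (\<beta> \<bullet> \<alpha>)) \<bullet> \<delta>"
proof -
  have t: "tgt C (dom2 C \<beta>) = src C (dom2 C \<beta>')"
    by (metis assms(1-3,5-7) src_cod2 tgt_cod2)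
  have "(\<beta>' \<star> \<beta>) \<bullet> ((\<alpha>' \<star> \<alpha>) \<bullet> \<delta>) = ((\<beta>' \<star> \<beta>) \<bullet> (\<alpha>' \<star> \<alpha>)) \<bullet> \<delta>"
    using assms t by simp
  then show ?thesis using interchange'[OF assms(1-7)] by simp
qed

lemma whisker_left:
  assumes "\<alpha> \<in> Cell C" "\<beta> \<in> Cell C" "cod2 C \<alpha> = dom2 C \<beta>" "h \<in> Mor C" "tgt C (dom2 C \<alpha>) = src C h"
  shows "id2 C h \<star> (\<beta> \<bullet> \<alpha>) = (id2 C h \<star> \<beta>) \<bullet> (id2 C h \<star> \<alpha>)"
  using interchange'[of \<alpha> \<beta> "id2 C h" "id2 C h"] assms by simp

lemma whisker_right:
  assumes "\<alpha> \<in> Cell C" "\<beta> \<in> Cell C" "cod2 C \<alpha> = dom2 C \<beta>" "h \<in> Mor C" "src C (dom2 C \<alpha>) = tgt C h"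
  shows "(\<beta> \<bullet> \<alpha>) \<star> id2 C h = (\<beta> \<star> id2 C h) \<bullet> (\<alpha> \<star> id2 C h)"
  using interchange'[of "id2 C h" "id2 C h" \<alpha> \<beta>] assms by simp

lemma hcomp_whiskers:
  assumes "\<alpha> \<in> Cell C" "\<beta> \<in> Cell C" "tgt C (dom2 C \<alpha>) = src C (dom2 C \<beta>)"
  shows "(id2 C (cod2 C \<beta>) \<star> \<alpha>) \<bullet> (\<beta> \<star> id2 C (dom2 C \<alpha>)) = \<beta> \<star> \<alpha>"
    and "(\<beta> \<star> id2 C (cod2 C \<alpha>)) \<bullet> (id2 C (dom2 C \<beta>) \<star> \<alpha>) = \<beta> \<star> \<alpha>"
  using interchange'[of "id2 C (dom2 C \<alpha>)" \<alpha> \<beta> "id2 C (cod2 C \<beta>)"]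
    interchange'[of \<alpha> "id2 C (cod2 C \<alpha>)" "id2 C (dom2 C \<beta>)" \<beta>] assms by auto

subsection \<open>Invertible 2-morphisms\<close>

lemma inverse2_unique:
  assumes "\<alpha> \<in> Cell C" "inverse2 C \<alpha> \<beta>" "inverse2 C \<alpha> \<beta>'"
  shows "\<beta> = \<beta>'"
proof -
  have c: "\<beta> \<in> Cell C" "dom2 C \<beta> = cod2 C \<alpha>" "cod2 C \<beta> = dom2 C \<alpha>"
    "\<beta>' \<in> Cell C" "dom2 C \<beta>' = cod2 C \<alpha>" "cod2 C \<beta>' = dom2 C \<alpha>"
    using assms by (auto simp: inverse2_def hom2_def)
  have "\<beta> = (\<beta>' \<bullet> \<alpha>) \<bullet> \<beta>" using assms(3) c by (simp add: inverse2_def del: vcomp_assoc')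
  also have "\<dots> = \<beta>' \<bullet> (\<alpha> \<bullet> \<beta>)" using assms(1) c by simp
  also have "\<dots> = \<beta>'" using assms(1,2) c by (simp add: inverse2_def)
  finally show ?thesis .
qed

lemma inv2_eqI: "\<alpha> \<in> Cell C \<Longrightarrow> inverse2 C \<alpha> \<beta> \<Longrightarrow> inv2 C \<alpha> = \<beta>"
  unfolding inv2_def using inverse2_unique by blast

lemma inverse2_inv2: "invertible2 C \<alpha> \<Longrightarrow> inverse2 C \<alpha> (inv2 C \<alpha>)"
  unfolding invertible2_def using inv2_eqI by metis

lemma invertible2_Cell [simp]: "invertible2 C \<alpha> \<Longrightarrow> \<alpha> \<in> Cell C"
  by (simp add: invertible2_def)

lemma inv2_simps [simp]:
  assumes "invertible2 C \<alpha>"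
  shows "inv2 C \<alpha> \<in> Cell C" "dom2 C (inv2 C \<alpha>) = cod2 C \<alpha>" "cod2 C (inv2 C \<alpha>) = dom2 C \<alpha>"
    "inv2 C \<alpha> \<bullet> \<alpha> = id2 C (dom2 C \<alpha>)" "\<alpha> \<bullet> inv2 C \<alpha> = id2 C (cod2 C \<alpha>)"
  using inverse2_inv2[OF assms] by (auto simp: inverse2_def hom2_def)

lemma inv2_cancel [simp]:
  assumes "invertible2 C \<alpha>" "\<delta> \<in> Cell C"
  shows "cod2 C \<delta> = dom2 C \<alpha> \<Longrightarrow> inv2 C \<alpha> \<bullet> (\<alpha> \<bullet> \<delta>) = \<delta>"
    "cod2 C \<delta> = cod2 C \<alpha> \<Longrightarrow> \<alpha> \<bullet> (inv2 C \<alpha> \<bullet> \<delta>) = \<delta>"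
proof -
  show "inv2 C \<alpha> \<bullet> (\<alpha> \<bullet> \<delta>) = \<delta>" if "cod2 C \<delta> = dom2 C \<alpha>"
  proof -
    have "inv2 C \<alpha> \<bullet> (\<alpha> \<bullet> \<delta>) = (inv2 C \<alpha> \<bullet> \<alpha>) \<bullet> \<delta>"
      by (rule vcomp_assoc'[symmetric]) (use assms that in simp_all)
    then show ?thesis using assms that by simp
  qed
  show "\<alpha> \<bullet> (inv2 C \<alpha> \<bullet> \<delta>) = \<delta>" if "cod2 C \<delta> = cod2 C \<alpha>"
  proof -
    have "\<alpha> \<bullet> (inv2 C \<alpha> \<bullet> \<delta>) = (\<alpha> \<bullet> inv2 C \<alpha>) \<bullet> \<delta>"
      by (rule vcomp_assoc'[symmetric]) (use assms that in simp_all)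
    then show ?thesis using assms that by simp
  qed
qed

lemma invertible2I:
  assumes "\<alpha> \<in> Cell C" "\<beta> \<in> Cell C" "dom2 C \<beta> = cod2 C \<alpha>" "cod2 C \<beta> = dom2 C \<alpha>"
    "\<beta> \<bullet> \<alpha> = id2 C (dom2 C \<alpha>)" "\<alpha> \<bullet> \<beta> = id2 C (cod2 C \<alpha>)"
  shows "invertible2 C \<alpha>"
  unfolding invertible2_def inverse2_def hom2_def using assms by (intro conjI exI[of _ \<beta>]) simp_all

lemma invertible2_inv2 [simp]: "invertible2 C \<alpha> \<Longrightarrow> invertible2 C (inv2 C \<alpha>)"
  by (rule invertible2I[of _ \<alpha>]) simp_all

lemma invertible2_id2 [simp]: "f \<in> Mor C \<Longrightarrow> invertible2 C (id2 C f)"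
  by (rule invertible2I[of _ "id2 C f"]) simp_all

lemma inv2_id2 [simp]: "f \<in> Mor C \<Longrightarrow> inv2 C (id2 C f) = id2 C f"
  by (rule inv2_eqI) (auto simp: inverse2_def hom2_def)

lemma invertible2_vcomp [simp]:
  assumes "invertible2 C \<alpha>" "invertible2 C \<beta>" "cod2 C \<alpha> = dom2 C \<beta>"
  shows "invertible2 C (\<beta> \<bullet> \<alpha>)"
  by (rule invertible2I[of _ "inv2 C \<alpha> \<bullet> inv2 C \<beta>"]) (use assms in simp_all)

lemma invertible2_hcomp [simp]:
  assumes "invertible2 C \<alpha>" "invertible2 C \<beta>" "tgt C (dom2 C \<alpha>) = src C (dom2 C \<beta>)"
  shows "invertible2 C (\<beta> \<star> \<alpha>)"
proof -
  note c = assms(1,2)[THEN invertible2_Cell]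
  show ?thesis
    by (rule invertible2I[of _ "inv2 C \<beta> \<star> inv2 C \<alpha>"])
      (use assms c in \<open>simp_all add: interchange'\<close>)
qed

end

section \<open>Normal pseudo-functors and pseudo-natural transformations\<close>

lemma composable_iff [simp]:
  "(g, f) \<in> composable C \<longleftrightarrow> f \<in> Mor C \<and> g \<in> Mor C \<and> tgt C f = src C g"
  by (simp add: composable_def)

locale psfunctor = A: two_category A + B: two_category B
  for A :: "('i, 'j, 'k) two_cat" and B :: "('o, 'm, 't) two_cat" (structure)
    and F :: "('i, 'j, 'k, 'o, 'm, 't) psfun" +
  assumes psfunctor: "normal_psfunctor A B F"
begin

lemma on0_Obj [simp]: "X \<in> Obj A \<Longrightarrow> on0 F X \<in> Obj B"
  using psfunctor by (auto simp: normal_psfunctor_def)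

lemma on1_simps [simp]:
  assumes "a \<in> Mor A"
  shows "on1 F a \<in> Mor B" "src B (on1 F a) = on0 F (src A a)" "tgt B (on1 F a) = on0 F (tgt A a)"
  using psfunctor assms by (auto simp: normal_psfunctor_def hom1_def)

lemma on2_simps [simp]:
  assumes "\<alpha> \<in> Cell A"
  shows "on2 F \<alpha> \<in> Cell B" "dom2 B (on2 F \<alpha>) = on1 F (dom2 A \<alpha>)"
    "cod2 B (on2 F \<alpha>) = on1 F (cod2 A \<alpha>)"
  using psfunctor assms by (auto simp: normal_psfunctor_def hom2_def)

lemma on1_id1 [simp]: "X \<in> Obj A \<Longrightarrow> on1 F (id1 A X) = id1 B (on0 F X)"
  and on2_id2 [simp]: "a \<in> Mor A \<Longrightarrow> on2 F (id2 A a) = id2 B (on1 F a)"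
  using psfunctor by (auto simp: normal_psfunctor_def)

lemma on2_vcomp:
  "\<alpha> \<in> Cell A \<Longrightarrow> \<beta> \<in> Cell A \<Longrightarrow> cod2 A \<alpha> = dom2 A \<beta> \<Longrightarrow>
    on2 F (\<beta> \<bullet>\<^bsub>A\<^esub> \<alpha>) = on2 F \<beta> \<bullet> on2 F \<alpha>"
  using psfunctor by (auto simp: normal_psfunctor_def)

lemma cpt_simps [simp]:
  assumes "a \<in> Mor A" "a' \<in> Mor A" "tgt A a = src A a'"
  shows "invertible2 B (cpt F (a', a))" "cpt F (a', a) \<in> Cell B"
    "dom2 B (cpt F (a', a)) = on1 F a' \<cdot> on1 F a"
    "cod2 B (cpt F (a', a)) = on1 F (a' \<cdot>\<^bsub>A\<^esub> a)"
proof -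
  have "(a', a) \<in> composable A" using assms by simp
  with psfunctor show "invertible2 B (cpt F (a', a))" "cpt F (a', a) \<in> Cell B"
    "dom2 B (cpt F (a', a)) = on1 F a' \<cdot> on1 F a"
    "cod2 B (cpt F (a', a)) = on1 F (a' \<cdot>\<^bsub>A\<^esub> a)"
    unfolding normal_psfunctor_def hom2_def by blast+
qed

lemma cpt_natural:
  "\<alpha> \<in> Cell A \<Longrightarrow> \<alpha>' \<in> Cell A \<Longrightarrow> tgt A (dom2 A \<alpha>) = src A (dom2 A \<alpha>') \<Longrightarrow>
    cpt F (cod2 A \<alpha>', cod2 A \<alpha>) \<bullet> (on2 F \<alpha>' \<star> on2 F \<alpha>) =
    on2 F (\<alpha>' \<star>\<^bsub>A\<^esub> \<alpha>) \<bullet> cpt F (dom2 A \<alpha>', dom2 A \<alpha>)"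
  using psfunctor by (auto simp: normal_psfunctor_def)

lemma cpt_assoc:
  "a \<in> Mor A \<Longrightarrow> a' \<in> Mor A \<Longrightarrow> a'' \<in> Mor A \<Longrightarrow> tgt A a = src A a' \<Longrightarrow> tgt A a' = src A a'' \<Longrightarrow>
    cpt F (a'', a' \<cdot>\<^bsub>A\<^esub> a) \<bullet> (id2 B (on1 F a'') \<star> cpt F (a', a)) =
    cpt F (a'' \<cdot>\<^bsub>A\<^esub> a', a) \<bullet> (cpt F (a'', a') \<star> id2 B (on1 F a))"
  using psfunctor by (auto simp: normal_psfunctor_def)

lemma cpt_id1 [simp]:
  assumes "a \<in> Mor A"
  shows "src A a = X \<Longrightarrow> cpt F (a, id1 A X) = id2 B (on1 F a)"
    "tgt A a = X \<Longrightarrow> cpt F (id1 A X, a) = id2 B (on1 F a)"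
  using psfunctor assms by (auto simp: normal_psfunctor_def)

end

locale pstransformation = F: psfunctor A B F + G: psfunctor A B G
  for A :: "('i, 'j, 'k) two_cat" and B :: "('o, 'm, 't) two_cat" (structure)
    and F G :: "('i, 'j, 'k, 'o, 'm, 't) psfun" and \<sigma> :: "('i, 'j, 'm, 't) pstrans" +
  assumes pstrans: "is_pstrans A B F G \<sigma>"
begin

lemma pt0_simps [simp]:
  assumes "X \<in> Obj A"
  shows "pt0 \<sigma> X \<in> Mor B" "src B (pt0 \<sigma> X) = on0 F X" "tgt B (pt0 \<sigma> X) = on0 G X"
  using pstrans assms by (auto simp: is_pstrans_def hom1_def)

lemma pt1_simps [simp]:
  assumes "a \<in> Mor A"
  shows "invertible2 B (pt1 \<sigma> a)" "pt1 \<sigma> a \<in> Cell B"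
    "dom2 B (pt1 \<sigma> a) = on1 G a \<cdot> pt0 \<sigma> (src A a)"
    "cod2 B (pt1 \<sigma> a) = pt0 \<sigma> (tgt A a) \<cdot> on1 F a"
  using pstrans assms by (auto simp: is_pstrans_def hom2_def)

lemma pt1_natural:
  "\<alpha> \<in> Cell A \<Longrightarrow>
    pt1 \<sigma> (cod2 A \<alpha>) \<bullet> (on2 G \<alpha> \<star> id2 B (pt0 \<sigma> (src A (dom2 A \<alpha>)))) =
    (id2 B (pt0 \<sigma> (tgt A (dom2 A \<alpha>))) \<star> on2 F \<alpha>) \<bullet> pt1 \<sigma> (dom2 A \<alpha>)"
  using pstrans by (auto simp: is_pstrans_def Let_def)

lemma pt1_id1 [simp]: "X \<in> Obj A \<Longrightarrow> pt1 \<sigma> (id1 A X) = id2 B (pt0 \<sigma> X)"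
  using pstrans by (auto simp: is_pstrans_def)

lemma pt1_comp:
  assumes "a \<in> Mor A" "a' \<in> Mor A" "tgt A a = src A a'"
  shows "pt1 \<sigma> (a' \<cdot>\<^bsub>A\<^esub> a) \<bullet> (cpt G (a', a) \<star> id2 B (pt0 \<sigma> (src A a))) =
    (id2 B (pt0 \<sigma> (tgt A a')) \<star> cpt F (a', a)) \<bullet>
    (pt1 \<sigma> a' \<star> id2 B (on1 F a)) \<bullet> (id2 B (on1 G a') \<star> pt1 \<sigma> a)"
proof -
  have "(a', a) \<in> composable A" using assms by simp
  with pstrans show ?thesis unfolding is_pstrans_def by blast
qed

end

lemma pstransformationI:
  "\<lbrakk>two_category A; two_category B; normal_psfunctor A B F; normal_psfunctor A B G;
    is_pstrans A B F G \<sigma>\<rbrakk> \<Longrightarrow> pstransformation A B F G \<sigma>"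
  by (simp add: pstransformation_def pstransformation_axioms_def psfunctor_def psfunctor_axioms_def)

subsection \<open>The 2-category of normal pseudo-functors\<close>

lemma arrow_eqI:
  "source p = source q \<Longrightarrow> target p = target q \<Longrightarrow> label p = label q \<Longrightarrow> p = q"
  by (cases p; cases q) simp

lemma Ps_sel [simp]:
  "src (Ps A B) = source" "tgt (Ps A B) = target" "dom2 (Ps A B) = source" "cod2 (Ps A B) = target"
  "comp (Ps A B) = Ps_comp A B"
  by (simp_all add: Ps_def)

lemma Obj_Ps [simp]: "F \<in> Obj (Ps A B) \<longleftrightarrow> normal_psfunctor A B F"
  by (simp add: Ps_def)

lemma Mor_Ps: "p \<in> Mor (Ps A B) \<longleftrightarrow> normal_psfunctor A B (source p) \<and> normal_psfunctor A B (target p)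
    \<and> is_pstrans A B (source p) (target p) (label p)"
  by (cases p) (simp add: Ps_def)

lemma Cell_Ps: "\<Gamma> \<in> Cell (Ps A B) \<longleftrightarrow> source \<Gamma> \<in> Mor (Ps A B) \<and> target \<Gamma> \<in> Mor (Ps A B) \<and>
    source (target \<Gamma>) = source (source \<Gamma>) \<and> target (target \<Gamma>) = target (source \<Gamma>) \<and>
    is_modification A B (source (source \<Gamma>)) (target (source \<Gamma>)) (label (source \<Gamma>))
      (label (target \<Gamma>)) (label \<Gamma>)"
proof (cases \<Gamma>)
  case (Arrow p q g)
  then show ?thesis by (cases p; cases q) (auto simp: Ps_def)
qed

lemma id1_Ps: "id1 (Ps A B) F = Arrow F F \<lparr>pt0 = (\<lambda>X\<in>Obj A. id1 B (on0 F X)),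
       pt1 = (\<lambda>a\<in>Mor A. id2 B (on1 F a))\<rparr>"
  and id2_Ps: "id2 (Ps A B) p = Arrow p p (\<lambda>X\<in>Obj A. id2 B (pt0 (label p) X))"
  and vcomp_Ps: "\<Delta> \<bullet>\<^bsub>Ps A B\<^esub> \<Gamma> =
    Arrow (source \<Gamma>) (target \<Delta>) (\<lambda>X\<in>Obj A. label \<Delta> X \<bullet>\<^bsub>B\<^esub> label \<Gamma> X)"
  and hcomp_Ps: "\<Delta> \<star>\<^bsub>Ps A B\<^esub> \<Gamma> = Arrow (Ps_comp A B (source \<Delta>) (source \<Gamma>))
       (Ps_comp A B (target \<Delta>) (target \<Gamma>)) (\<lambda>X\<in>Obj A. label \<Delta> X \<star>\<^bsub>B\<^esub> label \<Gamma> X)"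
  by (simp_all add: Ps_def)

lemma Ps_comp_sel [simp]:
  "source (Ps_comp A B q p) = source p" "target (Ps_comp A B q p) = target q"
  "X \<in> Obj A \<Longrightarrow> pt0 (label (Ps_comp A B q p)) X = pt0 (label q) X \<cdot>\<^bsub>B\<^esub> pt0 (label p) X"
  "a \<in> Mor A \<Longrightarrow> pt1 (label (Ps_comp A B q p)) a =
     (id2 B (pt0 (label q) (tgt A a)) \<star>\<^bsub>B\<^esub> pt1 (label p) a) \<bullet>\<^bsub>B\<^esub>
     (pt1 (label q) a \<star>\<^bsub>B\<^esub> id2 B (pt0 (label p) (src A a)))"
  by (simp_all add: Ps_comp_def)

text \<open>
  The 2-morphism of \<open>\<tau>\<sigma>\<close> at \<open>a\<close> pastes that of \<open>\<tau>\<close>, whiskered by \<open>\<sigma>\<close>, with that of \<open>\<sigma>\<close>, whiskered by \<open>\<tau>\<close>.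
  So each axiom follows from the whiskered axiom of \<open>\<tau>\<close> followed by the whiskered axiom of \<open>\<sigma>\<close>; for a
  composite \<open>a' a\<close>, the 2-morphisms of \<open>\<sigma>\<close> at \<open>a\<close> and of \<open>\<tau>\<close> at \<open>a'\<close> have to be exchanged in between.
\<close>

lemma is_pstrans_comp:
  fixes B :: "('o, 'm, 't) two_cat" (structure)
  assumes "pstransformation A B F G \<sigma>" and "pstransformation A B G H \<tau>"
  shows "is_pstrans A B F H (label (Ps_comp A B (Arrow G H \<tau>) (Arrow F G \<sigma>)))"
proof -
  interpret s: pstransformation A B F G \<sigma> by fact
  interpret t: pstransformation A B G H \<tau> by fact
  let ?r = "label (Ps_comp A B (Arrow G H \<tau>) (Arrow F G \<sigma>))"
  note w = s.F.B.whisker_left s.F.B.whisker_right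
  have nat: "pt1 ?r (cod2 A \<alpha>) \<bullet> (on2 H \<alpha> \<star> id2 B (pt0 ?r (src A (dom2 A \<alpha>)))) =
      (id2 B (pt0 ?r (tgt A (dom2 A \<alpha>))) \<star> on2 F \<alpha>) \<bullet> pt1 ?r (dom2 A \<alpha>)"
    if \<alpha> [simp]: "\<alpha> \<in> Cell A" for \<alpha>
  proof -
    define a b X Y where ab: "a = dom2 A \<alpha>" "b = cod2 A \<alpha>" "X = src A a" "Y = tgt A a"
    have [simp]: "a \<in> Mor A" "b \<in> Mor A" "X \<in> Obj A" "Y \<in> Obj A" "src A a = X" "tgt A a = Y"
      "src A b = X" "tgt A b = Y" "dom2 A \<alpha> = a" "cod2 A \<alpha> = b"
      by (simp_all add: ab)
    have 1: "(pt1 \<tau> b \<star> id2 B (pt0 \<sigma> X)) \<bullet> (on2 H \<alpha> \<star> id2 B (pt0 \<tau> X \<cdot> pt0 \<sigma> X)) =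
      (id2 B (pt0 \<tau> Y) \<star> on2 G \<alpha> \<star> id2 B (pt0 \<sigma> X)) \<bullet> (pt1 \<tau> a \<star> id2 B (pt0 \<sigma> X))"
      using arg_cong[OF t.pt1_natural[OF \<alpha>], of "\<lambda>x. x \<star> id2 B (pt0 \<sigma> X)"] by (simp add: w)
    have 2: "(id2 B (pt0 \<tau> Y) \<star> pt1 \<sigma> b) \<bullet> (id2 B (pt0 \<tau> Y) \<star> on2 G \<alpha> \<star> id2 B (pt0 \<sigma> X)) =
      (id2 B (pt0 \<tau> Y \<cdot> pt0 \<sigma> Y) \<star> on2 F \<alpha>) \<bullet> (id2 B (pt0 \<tau> Y) \<star> pt1 \<sigma> a)"
      using arg_cong[OF s.pt1_natural[OF \<alpha>], of "\<lambda>x. id2 B (pt0 \<tau> Y) \<star> x"] by (simp add: w)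
    have "pt1 ?r b \<bullet> (on2 H \<alpha> \<star> id2 B (pt0 ?r X)) =
      (id2 B (pt0 \<tau> Y) \<star> pt1 \<sigma> b) \<bullet> ((pt1 \<tau> b \<star> id2 B (pt0 \<sigma> X)) \<bullet> (on2 H \<alpha> \<star> id2 B (pt0 \<tau> X \<cdot> pt0 \<sigma> X)))"
      by simp
    also have "\<dots> = ((id2 B (pt0 \<tau> Y) \<star> pt1 \<sigma> b) \<bullet> (id2 B (pt0 \<tau> Y) \<star> on2 G \<alpha> \<star> id2 B (pt0 \<sigma> X))) \<bullet> (pt1 \<tau> a \<star> id2 B (pt0 \<sigma> X))"
      unfolding 1 by simp
    also have "\<dots> = (id2 B (pt0 ?r Y) \<star> on2 F \<alpha>) \<bullet> pt1 ?r a"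
      unfolding 2 by simp
    finally show ?thesis by simp
  qed
  have comp: "pt1 ?r (a' \<cdot>\<^bsub>A\<^esub> a) \<bullet> (cpt H (a', a) \<star> id2 B (pt0 ?r (src A a))) =
    (id2 B (pt0 ?r (tgt A a')) \<star> cpt F (a', a)) \<bullet>
    (pt1 ?r a' \<star> id2 B (on1 F a)) \<bullet> (id2 B (on1 H a') \<star> pt1 ?r a)"
    if c [simp]: "a \<in> Mor A" "a' \<in> Mor A" "tgt A a = src A a'" for a a'
  proof -
    define X Y Z where XYZ: "X = src A a" "Y = src A a'" "Z = tgt A a'"
    have [simp]: "X \<in> Obj A" "Y \<in> Obj A" "Z \<in> Obj A" "src A a = X" "tgt A a = Y"
      "src A a' = Y" "tgt A a' = Z" by (simp_all add: XYZ)
    let ?sX = "id2 B (pt0 \<sigma> X)" and ?tZ = "id2 B (pt0 \<tau> Z)" and ?Ha = "id2 B (on1 H a')"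
      and ?Fa = "id2 B (on1 F a)"
    have 1: "(pt1 \<tau> (a' \<cdot>\<^bsub>A\<^esub> a) \<star> ?sX) \<bullet> (cpt H (a', a) \<star> id2 B (pt0 \<tau> X \<cdot> pt0 \<sigma> X)) =
      (?tZ \<star> cpt G (a', a) \<star> ?sX) \<bullet> (pt1 \<tau> a' \<star> id2 B (on1 G a \<cdot> pt0 \<sigma> X)) \<bullet>
      (?Ha \<star> pt1 \<tau> a \<star> ?sX)"
      using arg_cong[OF t.pt1_comp[OF c], of "\<lambda>x. x \<star> ?sX"] by (simp add: w)
    have 2: "(?tZ \<star> pt1 \<sigma> (a' \<cdot>\<^bsub>A\<^esub> a)) \<bullet> (?tZ \<star> cpt G (a', a) \<star> ?sX) =
      (id2 B (pt0 \<tau> Z \<cdot> pt0 \<sigma> Z) \<star> cpt F (a', a)) \<bullet> (?tZ \<star> pt1 \<sigma> a' \<star> ?Fa) \<bullet>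
      (id2 B (pt0 \<tau> Z \<cdot> on1 G a') \<star> pt1 \<sigma> a)"
      using arg_cong[OF s.pt1_comp[OF c], of "\<lambda>x. ?tZ \<star> x"] by (simp add: w)
    \<comment> \<open>the two 2-morphisms act on different factors\<close>
    have 3: "(id2 B (pt0 \<tau> Z \<cdot> on1 G a') \<star> pt1 \<sigma> a) \<bullet> (pt1 \<tau> a' \<star> id2 B (on1 G a \<cdot> pt0 \<sigma> X)) =
      (pt1 \<tau> a' \<star> id2 B (pt0 \<sigma> Y \<cdot> on1 F a)) \<bullet> (id2 B (on1 H a' \<cdot> pt0 \<tau> Y) \<star> pt1 \<sigma> a)"
      using s.F.B.hcomp_whiskers[of "pt1 \<sigma> a" "pt1 \<tau> a'"] by simp
    have "pt1 ?r (a' \<cdot>\<^bsub>A\<^esub> a) \<bullet> (cpt H (a', a) \<star> id2 B (pt0 ?r X)) =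
      (?tZ \<star> pt1 \<sigma> (a' \<cdot>\<^bsub>A\<^esub> a)) \<bullet> ((pt1 \<tau> (a' \<cdot>\<^bsub>A\<^esub> a) \<star> ?sX) \<bullet>
        (cpt H (a', a) \<star> id2 B (pt0 \<tau> X \<cdot> pt0 \<sigma> X)))"
      by simp
    also have "\<dots> = ((?tZ \<star> pt1 \<sigma> (a' \<cdot>\<^bsub>A\<^esub> a)) \<bullet> (?tZ \<star> cpt G (a', a) \<star> ?sX)) \<bullet>
        (pt1 \<tau> a' \<star> id2 B (on1 G a \<cdot> pt0 \<sigma> X)) \<bullet> (?Ha \<star> pt1 \<tau> a \<star> ?sX)"
      unfolding 1 by simp
    also have "\<dots> = (id2 B (pt0 \<tau> Z \<cdot> pt0 \<sigma> Z) \<star> cpt F (a', a)) \<bullet> (?tZ \<star> pt1 \<sigma> a' \<star> ?Fa) \<bullet>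
        ((id2 B (pt0 \<tau> Z \<cdot> on1 G a') \<star> pt1 \<sigma> a) \<bullet> (pt1 \<tau> a' \<star> id2 B (on1 G a \<cdot> pt0 \<sigma> X))) \<bullet>
        (?Ha \<star> pt1 \<tau> a \<star> ?sX)"
      unfolding 2 by simp
    also have "\<dots> = (id2 B (pt0 ?r Z) \<star> cpt F (a', a)) \<bullet> (pt1 ?r a' \<star> ?Fa) \<bullet> (?Ha \<star> pt1 ?r a)"
      unfolding 3 by (simp add: w)
    finally show ?thesis by simp
  qed
  show ?thesis
    unfolding is_pstrans_def Let_def hom1_def hom2_def
    using nat comp
    by (auto simp: Ps_comp_def simp del: Ps_comp_sel)
qed

lemma pstransformation_Ps:
  "two_category A \<Longrightarrow> two_category B \<Longrightarrow> p \<in> Mor (Ps A B) \<Longrightarrow>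
    pstransformation A B (source p) (target p) (label p)"
  by (simp add: Mor_Ps pstransformationI)

text \<open>
  Components are extensional functions, so that agreement on the carriers suffices.
\<close>

lemma Mor_Ps_eqI:
  assumes "p \<in> Mor (Ps A B)" "q \<in> Mor (Ps A B)" "source p = source q" "target p = target q"
    and "\<And>X. X \<in> Obj A \<Longrightarrow> pt0 (label p) X = pt0 (label q) X"
    and "\<And>a. a \<in> Mor A \<Longrightarrow> pt1 (label p) a = pt1 (label q) a"
  shows "p = q"
proof (rule arrow_eqI)
  show "label p = label q"
  proof (rule pstrans.equality)
    show "pt0 (label p) = pt0 (label q)"
      by (rule extensionalityI[of _ "Obj A"]) (use assms in \<open>auto simp: Mor_Ps is_pstrans_def\<close>)
    show "pt1 (label p) = pt1 (label q)"
      by (rule extensionalityI[of _ "Mor A"]) (use assms in \<open>auto simp: Mor_Ps is_pstrans_def\<close>)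
  qed simp
qed (use assms in auto)

lemma Cell_Ps_eqI:
  assumes "\<Gamma> \<in> Cell (Ps A B)" "\<Delta> \<in> Cell (Ps A B)" "source \<Gamma> = source \<Delta>" "target \<Gamma> = target \<Delta>"
    and "\<And>X. X \<in> Obj A \<Longrightarrow> label \<Gamma> X = label \<Delta> X"
  shows "\<Gamma> = \<Delta>"
proof (rule arrow_eqI)
  show "label \<Gamma> = label \<Delta>"
    by (rule extensionalityI[of _ "Obj A"]) (use assms in \<open>auto simp: Cell_Ps is_modification_def\<close>)
qed (use assms in auto)

lemma Cell_PsD:
  assumes "\<Gamma> \<in> Cell (Ps A B)"
  shows "source \<Gamma> \<in> Mor (Ps A B)" "target \<Gamma> \<in> Mor (Ps A B)"
    "source (target \<Gamma>) = source (source \<Gamma>)" "target (target \<Gamma>) = target (source \<Gamma>)"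
    "X \<in> Obj A \<Longrightarrow> label \<Gamma> X \<in> Cell B"
    "X \<in> Obj A \<Longrightarrow> dom2 B (label \<Gamma> X) = pt0 (label (source \<Gamma>)) X"
    "X \<in> Obj A \<Longrightarrow> cod2 B (label \<Gamma> X) = pt0 (label (target \<Gamma>)) X"
  using assms by (auto simp: Cell_Ps is_modification_def hom2_def)

lemma modification_natural:
  "\<Gamma> \<in> Cell (Ps A B) \<Longrightarrow> a \<in> Mor A \<Longrightarrow>
    pt1 (label (target \<Gamma>)) a \<bullet>\<^bsub>B\<^esub>
      (id2 B (on1 (target (source \<Gamma>)) a) \<star>\<^bsub>B\<^esub> label \<Gamma> (src A a)) =
    (label \<Gamma> (tgt A a) \<star>\<^bsub>B\<^esub> id2 B (on1 (source (source \<Gamma>)) a)) \<bullet>\<^bsub>B\<^esub> pt1 (label (source \<Gamma>)) a"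
  by (auto simp: Cell_Ps is_modification_def)

lemma Cell_PsI:
  assumes "source \<Gamma> \<in> Mor (Ps A B)" "target \<Gamma> \<in> Mor (Ps A B)"
    "source (target \<Gamma>) = source (source \<Gamma>)" "target (target \<Gamma>) = target (source \<Gamma>)"
    "label \<Gamma> \<in> extensional (Obj A)"
    "\<And>X. X \<in> Obj A \<Longrightarrow> label \<Gamma> X \<in> Cell B"
    "\<And>X. X \<in> Obj A \<Longrightarrow> dom2 B (label \<Gamma> X) = pt0 (label (source \<Gamma>)) X"
    "\<And>X. X \<in> Obj A \<Longrightarrow> cod2 B (label \<Gamma> X) = pt0 (label (target \<Gamma>)) X"
    "\<And>a. a \<in> Mor A \<Longrightarrow> pt1 (label (target \<Gamma>)) a \<bullet>\<^bsub>B\<^esub>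
        (id2 B (on1 (target (source \<Gamma>)) a) \<star>\<^bsub>B\<^esub> label \<Gamma> (src A a)) =
      (label \<Gamma> (tgt A a) \<star>\<^bsub>B\<^esub> id2 B (on1 (source (source \<Gamma>)) a)) \<bullet>\<^bsub>B\<^esub> pt1 (label (source \<Gamma>)) a"
  shows "\<Gamma> \<in> Cell (Ps A B)"
  using assms by (auto simp: Cell_Ps is_modification_def hom2_def)

lemma Ps_cell_sel [simp]:
  "source (id2 (Ps A B) p) = p" "target (id2 (Ps A B) p) = p"
  "source (\<Delta> \<bullet>\<^bsub>Ps A B\<^esub> \<Gamma>) = source \<Gamma>" "target (\<Delta> \<bullet>\<^bsub>Ps A B\<^esub> \<Gamma>) = target \<Delta>"
  "source (\<Delta> \<star>\<^bsub>Ps A B\<^esub> \<Gamma>) = Ps_comp A B (source \<Delta>) (source \<Gamma>)"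
  "target (\<Delta> \<star>\<^bsub>Ps A B\<^esub> \<Gamma>) = Ps_comp A B (target \<Delta>) (target \<Gamma>)"
  "X \<in> Obj A \<Longrightarrow> label (id2 (Ps A B) p) X = id2 B (pt0 (label p) X)"
  "X \<in> Obj A \<Longrightarrow> label (\<Delta> \<bullet>\<^bsub>Ps A B\<^esub> \<Gamma>) X = label \<Delta> X \<bullet>\<^bsub>B\<^esub> label \<Gamma> X"
  "X \<in> Obj A \<Longrightarrow> label (\<Delta> \<star>\<^bsub>Ps A B\<^esub> \<Gamma>) X = label \<Delta> X \<star>\<^bsub>B\<^esub> label \<Gamma> X"
  by (simp_all add: id2_Ps vcomp_Ps hcomp_Ps)

lemma Ps_id1_sel [simp]:
  "source (id1 (Ps A B) F) = F" "target (id1 (Ps A B) F) = F"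
  "X \<in> Obj A \<Longrightarrow> pt0 (label (id1 (Ps A B) F)) X = id1 B (on0 F X)"
  "a \<in> Mor A \<Longrightarrow> pt1 (label (id1 (Ps A B) F)) a = id2 B (on1 F a)"
  by (simp_all add: id1_Ps)

lemma is_pstrans_id:
  assumes "psfunctor A B F"
  shows "is_pstrans A B F F (label (id1 (Ps A B) F))"
proof -
  interpret psfunctor A B F by fact
  show ?thesis
    unfolding is_pstrans_def by (auto simp: id1_Ps Let_def hom1_def hom2_def)
qed

context
  fixes A :: "('i, 'j, 'k) two_cat" and B :: "('o, 'm, 't) two_cat" (structure)
  assumes two_cats: "two_category A" "two_category B"
begin

interpretation A: two_category A by (rule two_cats)
interpretation B: two_category B by (rule two_cats)

lemma id1_Ps_Mor: "normal_psfunctor A B F \<Longrightarrow> id1 (Ps A B) F \<in> Mor (Ps A B)"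
  using is_pstrans_id[of A B F] two_cats
  by (simp add: Mor_Ps psfunctor_def psfunctor_axioms_def)

lemma comp_Ps_Mor:
  assumes "p \<in> Mor (Ps A B)" "q \<in> Mor (Ps A B)" "target p = source q"
  shows "Ps_comp A B q p \<in> Mor (Ps A B)"
proof -
  have "pstransformation A B (source p) (source q) (label p)"
    "pstransformation A B (source q) (target q) (label q)"
    using assms pstransformation_Ps[OF two_cats] by metis+
  from is_pstrans_comp[OF this] show ?thesis
    using assms by (cases p; cases q) (simp add: Mor_Ps)
qed

lemma id2_Ps_Cell:
  assumes "p \<in> Mor (Ps A B)"
  shows "id2 (Ps A B) p \<in> Cell (Ps A B)"
proof -
  interpret p: pstransformation A B "source p" "target p" "label p"
    by (rule pstransformation_Ps[OF two_cats assms])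
  show ?thesis by (rule Cell_PsI) (use assms in \<open>simp_all\<close>, simp add: id2_Ps)
qed

lemma vcomp_Ps_Cell:
  assumes "\<Gamma> \<in> Cell (Ps A B)" "\<Delta> \<in> Cell (Ps A B)" "target \<Gamma> = source \<Delta>"
  shows "\<Delta> \<bullet>\<^bsub>Ps A B\<^esub> \<Gamma> \<in> Cell (Ps A B)"
proof -
  note [simp] = Cell_PsD[OF assms(1)] Cell_PsD[OF assms(2)] assms(3)
  interpret p: pstransformation A B "source (source \<Gamma>)" "target (source \<Gamma>)" "label (source \<Gamma>)"
    by (rule pstransformation_Ps[OF two_cats]) simp
  interpret q: pstransformation A B "source (source \<Gamma>)" "target (source \<Gamma>)" "label (source \<Delta>)"
    using pstransformation_Ps[OF two_cats, of "target \<Gamma>"] Cell_PsD[OF assms(1)] by simp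
  interpret r: pstransformation A B "source (source \<Gamma>)" "target (source \<Gamma>)" "label (target \<Delta>)"
    using pstransformation_Ps[OF two_cats, of "target \<Delta>"] Cell_PsD[OF assms(2)] Cell_PsD[OF assms(1)]
    by simp
  have st: "source (source \<Delta>) = source (source \<Gamma>)" "target (source \<Delta>) = target (source \<Gamma>)"
    using Cell_PsD[OF assms(1)] by simp_all
  have nat: "pt1 (label (target \<Delta>)) a \<bullet> (id2 B (on1 (target (source \<Gamma>)) a) \<star>
        (label \<Delta> (src A a) \<bullet> label \<Gamma> (src A a))) =
      ((label \<Delta> (tgt A a) \<bullet> label \<Gamma> (tgt A a)) \<star> id2 B (on1 (source (source \<Gamma>)) a)) \<bullet>
        pt1 (label (source \<Gamma>)) a" if [simp]: "a \<in> Mor A" for a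
  proof -
    let ?G = "id2 B (on1 (target (source \<Gamma>)) a)" and ?F = "id2 B (on1 (source (source \<Gamma>)) a)"
    note 1 = modification_natural[OF assms(1) that] and 2 = modification_natural[OF assms(2) that]
    have "pt1 (label (target \<Delta>)) a \<bullet> (?G \<star> (label \<Delta> (src A a) \<bullet> label \<Gamma> (src A a))) =
      (pt1 (label (target \<Delta>)) a \<bullet> (?G \<star> label \<Delta> (src A a))) \<bullet> (?G \<star> label \<Gamma> (src A a))"
      by (simp add: B.whisker_left st)
    also have "\<dots> = (label \<Delta> (tgt A a) \<star> ?F) \<bullet> (pt1 (label (source \<Delta>)) a \<bullet> (?G \<star> label \<Gamma> (src A a)))"
      unfolding 2[unfolded st] by (simp add: st)
    also have "\<dots> = (label \<Delta> (tgt A a) \<star> ?F) \<bullet> ((label \<Gamma> (tgt A a) \<star> ?F) \<bullet> pt1 (label (source \<Gamma>)) a)"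
      unfolding 1[unfolded assms(3)] by (simp add: st)
    also have "\<dots> = ((label \<Delta> (tgt A a) \<bullet> label \<Gamma> (tgt A a)) \<star> ?F) \<bullet> pt1 (label (source \<Gamma>)) a"
      by (simp add: B.whisker_right st)
    finally show ?thesis .
  qed
  show ?thesis by (rule Cell_PsI) (use nat st in \<open>auto simp: vcomp_Ps\<close>)
qed

text \<open>
  Interchange merges the component of \<open>\<Gamma>\<close> into the modification axiom of \<open>\<Delta>\<close>; after that axiom is
  applied, it merges the component of \<open>\<Delta>\<close> into the modification axiom of \<open>\<Gamma>\<close>.
\<close>

lemma hcomp_Ps_Cell:
  assumes "\<Gamma> \<in> Cell (Ps A B)" "\<Delta> \<in> Cell (Ps A B)" "target (source \<Gamma>) = source (source \<Delta>)"
  shows "\<Delta> \<star>\<^bsub>Ps A B\<^esub> \<Gamma> \<in> Cell (Ps A B)"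
proof -
  define F G H where FGH: "F = source (source \<Gamma>)" "G = source (source \<Delta>)" "H = target (source \<Delta>)"
  note [simp] = Cell_PsD[OF assms(1)] Cell_PsD[OF assms(2)] FGH[symmetric] assms(3)
  define \<sigma> \<sigma>' \<tau> \<tau>' where st: "\<sigma> = label (source \<Gamma>)" "\<sigma>' = label (target \<Gamma>)"
    "\<tau> = label (source \<Delta>)" "\<tau>' = label (target \<Delta>)"
  note [simp] = st[symmetric]
  interpret s: pstransformation A B F G \<sigma>
    using pstransformation_Ps[OF two_cats, of "source \<Gamma>"] by simp
  interpret s': pstransformation A B F G \<sigma>'
    using pstransformation_Ps[OF two_cats, of "target \<Gamma>"] by simp
  interpret t: pstransformation A B G H \<tau>
    using pstransformation_Ps[OF two_cats, of "source \<Delta>"] by simp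
  interpret t': pstransformation A B G H \<tau>'
    using pstransformation_Ps[OF two_cats, of "target \<Delta>"] by simp
  have nat: "((id2 B (pt0 \<tau>' (tgt A a)) \<star> pt1 \<sigma>' a) \<bullet> (pt1 \<tau>' a \<star> id2 B (pt0 \<sigma>' (src A a)))) \<bullet>
      (id2 B (on1 H a) \<star> (label \<Delta> (src A a) \<star> label \<Gamma> (src A a))) =
      ((label \<Delta> (tgt A a) \<star> label \<Gamma> (tgt A a)) \<star> id2 B (on1 F a)) \<bullet>
      ((id2 B (pt0 \<tau> (tgt A a)) \<star> pt1 \<sigma> a) \<bullet> (pt1 \<tau> a \<star> id2 B (pt0 \<sigma> (src A a))))"
    if [simp]: "a \<in> Mor A" for a
  proof -
    define X Y where XY: "X = src A a" "Y = tgt A a"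
    have [simp]: "X \<in> Obj A" "Y \<in> Obj A" "src A a = X" "tgt A a = Y" by (simp_all add: XY)
    let ?H = "id2 B (on1 H a)" and ?G = "id2 B (on1 G a)" and ?F = "id2 B (on1 F a)"
    have 1: "pt1 \<sigma>' a \<bullet> (?G \<star> label \<Gamma> X) = (label \<Gamma> Y \<star> ?F) \<bullet> pt1 \<sigma> a"
      using modification_natural[OF assms(1) that] by simp
    have 2: "pt1 \<tau>' a \<bullet> (?H \<star> label \<Delta> X) = (label \<Delta> Y \<star> ?G) \<bullet> pt1 \<tau> a"
      using modification_natural[OF assms(2) that] by simp
    have "((id2 B (pt0 \<tau>' Y) \<star> pt1 \<sigma>' a) \<bullet> (pt1 \<tau>' a \<star> id2 B (pt0 \<sigma>' X))) \<bullet>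
        (?H \<star> (label \<Delta> X \<star> label \<Gamma> X)) =
      (id2 B (pt0 \<tau>' Y) \<star> pt1 \<sigma>' a) \<bullet> ((pt1 \<tau>' a \<bullet> (?H \<star> label \<Delta> X)) \<star> label \<Gamma> X)"
      using B.interchange'[of "label \<Gamma> X" "id2 B (pt0 \<sigma>' X)" "?H \<star> label \<Delta> X" "pt1 \<tau>' a"] by simp
    also have "\<dots> = (id2 B (pt0 \<tau>' Y) \<star> pt1 \<sigma>' a) \<bullet>
        ((label \<Delta> Y \<star> ?G \<star> label \<Gamma> X) \<bullet> (pt1 \<tau> a \<star> id2 B (pt0 \<sigma> X)))"
      unfolding 2
      using B.interchange'[of "id2 B (pt0 \<sigma> X)" "label \<Gamma> X" "pt1 \<tau> a" "label \<Delta> Y \<star> ?G"] by simp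
    also have "\<dots> = (label \<Delta> Y \<star> (pt1 \<sigma>' a \<bullet> (?G \<star> label \<Gamma> X))) \<bullet> (pt1 \<tau> a \<star> id2 B (pt0 \<sigma> X))"
      using B.interchange_assoc[of "?G \<star> label \<Gamma> X" "pt1 \<sigma>' a" "label \<Delta> Y" "id2 B (pt0 \<tau>' Y)"
          "pt1 \<tau> a \<star> id2 B (pt0 \<sigma> X)"] by simp
    also have "\<dots> = ((label \<Delta> Y \<star> label \<Gamma> Y) \<star> ?F) \<bullet>
        ((id2 B (pt0 \<tau> Y) \<star> pt1 \<sigma> a) \<bullet> (pt1 \<tau> a \<star> id2 B (pt0 \<sigma> X)))"
      unfolding 1
      using B.interchange_assoc[of "pt1 \<sigma> a" "label \<Gamma> Y \<star> ?F" "id2 B (pt0 \<tau> Y)" "label \<Delta> Y"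
          "pt1 \<tau> a \<star> id2 B (pt0 \<sigma> X)"] by simp
    finally show ?thesis by simp
  qed
  show ?thesis by (rule Cell_PsI) (use nat in \<open>auto simp: hcomp_Ps comp_Ps_Mor\<close>)
qed

lemma comp_id_Ps:
  assumes "p \<in> Mor (Ps A B)"
  shows "Ps_comp A B (id1 (Ps A B) (target p)) p = p" "Ps_comp A B p (id1 (Ps A B) (source p)) = p"
proof -
  interpret p: pstransformation A B "source p" "target p" "label p"
    by (rule pstransformation_Ps[OF two_cats assms])
  have [simp]: "normal_psfunctor A B (source p)" "normal_psfunctor A B (target p)"
    using assms by (simp_all add: Mor_Ps)
  show "Ps_comp A B (id1 (Ps A B) (target p)) p = p"
    by (rule Mor_Ps_eqI[of _ A B]) (use assms in \<open>simp_all add: comp_Ps_Mor id1_Ps_Mor\<close>)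
  show "Ps_comp A B p (id1 (Ps A B) (source p)) = p"
    by (rule Mor_Ps_eqI[of _ A B]) (use assms in \<open>simp_all add: comp_Ps_Mor id1_Ps_Mor\<close>)
qed

lemma comp_assoc_Ps:
  assumes "p \<in> Mor (Ps A B)" "q \<in> Mor (Ps A B)" "r \<in> Mor (Ps A B)"
    "target p = source q" "target q = source r"
  shows "Ps_comp A B (Ps_comp A B r q) p = Ps_comp A B r (Ps_comp A B q p)"
proof -
  interpret p: pstransformation A B "source p" "source q" "label p"
    using pstransformation_Ps[OF two_cats assms(1)] assms(4) by simp
  interpret q: pstransformation A B "source q" "source r" "label q"
    using pstransformation_Ps[OF two_cats assms(2)] assms(5) by simp
  interpret r: pstransformation A B "source r" "target r" "label r"
    by (rule pstransformation_Ps[OF two_cats assms(3)])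
  show ?thesis
    by (rule Mor_Ps_eqI[of _ A B])
      (use assms in \<open>simp_all add: comp_Ps_Mor B.whisker_left B.whisker_right\<close>)
qed

text \<open>
  Both compositions of modifications are computed componentwise, so that every law between
  2-morphisms is the same law in \<open>B\<close>.
\<close>

theorem two_category_Ps: "two_category (Ps A B)"
proof
  note [simp] = id1_Ps_Mor comp_Ps_Mor id2_Ps_Cell vcomp_Ps_Cell hcomp_Ps_Cell comp_id_Ps comp_assoc_Ps
  note [simp] = hom1_def hom2_def
  note D = Cell_PsD
  fix F G H K :: "('i, 'j, 'k, 'o, 'm, 't) psfun" and p q r p' q' r' :: "('i, 'j, 'k, 'o, 'm, 't) ps_mor"
    and \<Gamma> \<Delta> \<Theta> \<Gamma>' \<Delta>' :: "('i, 'j, 'k, 'o, 'm, 't) ps_cell"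
  show "p \<in> Mor (Ps A B) \<Longrightarrow> src (Ps A B) p \<in> Obj (Ps A B) \<and> tgt (Ps A B) p \<in> Obj (Ps A B)"
    by (simp add: Mor_Ps)
  show "\<Gamma> \<in> Cell (Ps A B) \<Longrightarrow> dom2 (Ps A B) \<Gamma> \<in> Mor (Ps A B) \<and> cod2 (Ps A B) \<Gamma> \<in> Mor (Ps A B)"
    by (simp add: Cell_Ps)
  show "\<Gamma> \<in> Cell (Ps A B) \<Longrightarrow> src (Ps A B) (dom2 (Ps A B) \<Gamma>) = src (Ps A B) (cod2 (Ps A B) \<Gamma>) \<and>
      tgt (Ps A B) (dom2 (Ps A B) \<Gamma>) = tgt (Ps A B) (cod2 (Ps A B) \<Gamma>)"
    by (simp add: Cell_Ps)
  show "F \<in> Obj (Ps A B) \<Longrightarrow> id1 (Ps A B) F \<in> hom1 (Ps A B) F F" by simp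
  show "p \<in> hom1 (Ps A B) F G \<Longrightarrow> q \<in> hom1 (Ps A B) G H \<Longrightarrow> q \<cdot>\<^bsub>Ps A B\<^esub> p \<in> hom1 (Ps A B) F H" by simp
  show "p \<in> hom1 (Ps A B) F G \<Longrightarrow> id1 (Ps A B) G \<cdot>\<^bsub>Ps A B\<^esub> p = p" by auto
  show "p \<in> hom1 (Ps A B) F G \<Longrightarrow> p \<cdot>\<^bsub>Ps A B\<^esub> id1 (Ps A B) F = p" by auto
  show "p \<in> hom1 (Ps A B) F G \<Longrightarrow> q \<in> hom1 (Ps A B) G H \<Longrightarrow> r \<in> hom1 (Ps A B) H K \<Longrightarrow>
      (r \<cdot>\<^bsub>Ps A B\<^esub> q) \<cdot>\<^bsub>Ps A B\<^esub> p = r \<cdot>\<^bsub>Ps A B\<^esub> (q \<cdot>\<^bsub>Ps A B\<^esub> p)" by simp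
  show "p \<in> Mor (Ps A B) \<Longrightarrow> id2 (Ps A B) p \<in> hom2 (Ps A B) p p" by simp
  show "\<Gamma> \<in> hom2 (Ps A B) p q \<Longrightarrow> \<Delta> \<in> hom2 (Ps A B) q r \<Longrightarrow> \<Delta> \<bullet>\<^bsub>Ps A B\<^esub> \<Gamma> \<in> hom2 (Ps A B) p r" by simp
  show "id2 (Ps A B) q \<bullet>\<^bsub>Ps A B\<^esub> \<Gamma> = \<Gamma>" if "\<Gamma> \<in> hom2 (Ps A B) p q"
  proof -
    have c: "\<Gamma> \<in> Cell (Ps A B)" using that by simp
    show ?thesis by (rule Cell_Ps_eqI[of _ A B]) (use that D[OF c] in auto)
  qed
  show "\<Gamma> \<bullet>\<^bsub>Ps A B\<^esub> id2 (Ps A B) p = \<Gamma>" if "\<Gamma> \<in> hom2 (Ps A B) p q"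
  proof -
    have c: "\<Gamma> \<in> Cell (Ps A B)" using that by simp
    show ?thesis by (rule Cell_Ps_eqI[of _ A B]) (use that D[OF c] in auto)
  qed
  show "(\<Theta> \<bullet>\<^bsub>Ps A B\<^esub> \<Delta>) \<bullet>\<^bsub>Ps A B\<^esub> \<Gamma> = \<Theta> \<bullet>\<^bsub>Ps A B\<^esub> (\<Delta> \<bullet>\<^bsub>Ps A B\<^esub> \<Gamma>)"
    if "\<Gamma> \<in> hom2 (Ps A B) p q" "\<Delta> \<in> hom2 (Ps A B) q r" "\<Theta> \<in> hom2 (Ps A B) r r'"
  proof -
    have c: "\<Gamma> \<in> Cell (Ps A B)" "\<Delta> \<in> Cell (Ps A B)" "\<Theta> \<in> Cell (Ps A B)" using that by simp_all
    show ?thesis by (rule Cell_Ps_eqI[of _ A B]) (use that D[OF c(1)] D[OF c(2)] D[OF c(3)] in simp_all)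
  qed
  show "\<Delta> \<star>\<^bsub>Ps A B\<^esub> \<Gamma> \<in> hom2 (Ps A B) (q \<cdot>\<^bsub>Ps A B\<^esub> p) (q' \<cdot>\<^bsub>Ps A B\<^esub> p')"
    if "\<Gamma> \<in> hom2 (Ps A B) p p'" "\<Delta> \<in> hom2 (Ps A B) q q'" "tgt (Ps A B) p = src (Ps A B) q"
    using that by auto
  show "id2 (Ps A B) (id1 (Ps A B) (tgt (Ps A B) (dom2 (Ps A B) \<Gamma>))) \<star>\<^bsub>Ps A B\<^esub> \<Gamma> = \<Gamma>"
    if c: "\<Gamma> \<in> Cell (Ps A B)"
  proof -
    note [simp] = D[OF c]
    interpret p: pstransformation A B "source (source \<Gamma>)" "target (source \<Gamma>)" "label (source \<Gamma>)"
      by (rule pstransformation_Ps[OF two_cats]) simp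
    have [simp]: "normal_psfunctor A B (target (source \<Gamma>))" by (rule p.G.psfunctor)
    have [simp]: "Ps_comp A B (id1 (Ps A B) (target (source \<Gamma>))) (target \<Gamma>) = target \<Gamma>"
      using comp_id_Ps(1)[of "target \<Gamma>"] by simp
    show ?thesis by (rule Cell_Ps_eqI[OF _ c]) (use c in simp_all)
  qed
  show "\<Gamma> \<star>\<^bsub>Ps A B\<^esub> id2 (Ps A B) (id1 (Ps A B) (src (Ps A B) (dom2 (Ps A B) \<Gamma>))) = \<Gamma>"
    if c: "\<Gamma> \<in> Cell (Ps A B)"
  proof -
    note [simp] = D[OF c]
    interpret p: pstransformation A B "source (source \<Gamma>)" "target (source \<Gamma>)" "label (source \<Gamma>)"
      by (rule pstransformation_Ps[OF two_cats]) simp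
    have [simp]: "normal_psfunctor A B (source (source \<Gamma>))" by (rule p.F.psfunctor)
    have [simp]: "Ps_comp A B (target \<Gamma>) (id1 (Ps A B) (source (source \<Gamma>))) = target \<Gamma>"
      using comp_id_Ps(2)[of "target \<Gamma>"] by simp
    show ?thesis by (rule Cell_Ps_eqI[OF _ c]) (use c in simp_all)
  qed
  show "(\<Theta> \<star>\<^bsub>Ps A B\<^esub> \<Delta>) \<star>\<^bsub>Ps A B\<^esub> \<Gamma> = \<Theta> \<star>\<^bsub>Ps A B\<^esub> (\<Delta> \<star>\<^bsub>Ps A B\<^esub> \<Gamma>)"
    if c: "\<Gamma> \<in> Cell (Ps A B)" "\<Delta> \<in> Cell (Ps A B)" "\<Theta> \<in> Cell (Ps A B)"
      and t: "tgt (Ps A B) (dom2 (Ps A B) \<Gamma>) = src (Ps A B) (dom2 (Ps A B) \<Delta>)"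
        "tgt (Ps A B) (dom2 (Ps A B) \<Delta>) = src (Ps A B) (dom2 (Ps A B) \<Theta>)"
  proof -
    note [simp] = D[OF c(1)] D[OF c(2)] D[OF c(3)] t[simplified]
    interpret p: pstransformation A B "source (source \<Gamma>)" "source (source \<Delta>)" "label (source \<Gamma>)"
      using pstransformation_Ps[OF two_cats, of "source \<Gamma>"] by simp
    interpret q: pstransformation A B "source (source \<Delta>)" "source (source \<Theta>)" "label (source \<Delta>)"
      using pstransformation_Ps[OF two_cats, of "source \<Delta>"] by simp
    interpret r: pstransformation A B "source (source \<Theta>)" "target (source \<Theta>)" "label (source \<Theta>)"
      using pstransformation_Ps[OF two_cats, of "source \<Theta>"] by simp
    show ?thesis by (rule Cell_Ps_eqI[of _ A B]) (use c in simp_all)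
  qed
  show "id2 (Ps A B) q \<star>\<^bsub>Ps A B\<^esub> id2 (Ps A B) p = id2 (Ps A B) (q \<cdot>\<^bsub>Ps A B\<^esub> p)"
    if c: "p \<in> hom1 (Ps A B) F G" "q \<in> hom1 (Ps A B) G H"
  proof -
    interpret p: pstransformation A B "source p" "source q" "label p"
      using pstransformation_Ps[OF two_cats, of p] c by simp
    interpret q: pstransformation A B "source q" "target q" "label q"
      using pstransformation_Ps[OF two_cats, of q] c by simp
    show ?thesis by (rule Cell_Ps_eqI[of _ A B]) (use c in simp_all)
  qed
  show "(\<Delta>' \<bullet>\<^bsub>Ps A B\<^esub> \<Delta>) \<star>\<^bsub>Ps A B\<^esub> (\<Gamma>' \<bullet>\<^bsub>Ps A B\<^esub> \<Gamma>) = (\<Delta>' \<star>\<^bsub>Ps A B\<^esub> \<Gamma>') \<bullet>\<^bsub>Ps A B\<^esub> (\<Delta> \<star>\<^bsub>Ps A B\<^esub> \<Gamma>)"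
    if c: "\<Gamma> \<in> hom2 (Ps A B) p q" "\<Gamma>' \<in> hom2 (Ps A B) q r" "\<Delta> \<in> hom2 (Ps A B) p' q'" "\<Delta>' \<in> hom2 (Ps A B) q' r'"
      "tgt (Ps A B) p = src (Ps A B) p'"
  proof -
    have d: "\<Gamma> \<in> Cell (Ps A B)" "\<Gamma>' \<in> Cell (Ps A B)" "\<Delta> \<in> Cell (Ps A B)" "\<Delta>' \<in> Cell (Ps A B)"
      using c by simp_all
    have e: "source \<Gamma> = p" "target \<Gamma> = q" "source \<Gamma>' = q" "target \<Gamma>' = r"
      "source \<Delta> = p'" "target \<Delta> = q'" "source \<Delta>' = q'" "target \<Delta>' = r'"
      "target p = source p'"
      using c by simp_all
    note f = D[OF d(1), unfolded e] D[OF d(2), unfolded e] D[OF d(3), unfolded e] D[OF d(4), unfolded e]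
    interpret p: pstransformation A B "source p" "source p'" "label p"
      using pstransformation_Ps[OF two_cats, of p] f e by simp
    interpret p': pstransformation A B "source p'" "target p'" "label p'"
      using pstransformation_Ps[OF two_cats, of p'] f e by simp
    show ?thesis
      by (rule Cell_Ps_eqI[of _ A B]) (simp_all add: d e f B.interchange')
  qed
qed

end

section \<open>Arrow 2-categories\<close>

lemma Ar_sel [simp]:
  "Obj (Ar A) = Obj A" "Mor (Ar A) = Cell A"
  "src (Ar A) \<alpha> = src A (dom2 A \<alpha>)" "tgt (Ar A) \<alpha> = tgt A (dom2 A \<alpha>)"
  "dom2 (Ar A) = source" "cod2 (Ar A) = target"
  "id1 (Ar A) X = id2 A (id1 A X)" "comp (Ar A) = hcomp A"
  by (simp_all add: Ar_def)

lemma Ar_ops: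
  "id2 (Ar A) \<alpha> = Arrow \<alpha> \<alpha> (id2 A (dom2 A \<alpha>), id2 A (cod2 A \<alpha>))"
  "s \<bullet>\<^bsub>Ar A\<^esub> r = Arrow (source r) (target s)
     (fst (label s) \<bullet>\<^bsub>A\<^esub> fst (label r), snd (label s) \<bullet>\<^bsub>A\<^esub> snd (label r))"
  "s \<star>\<^bsub>Ar A\<^esub> r = Arrow (source s \<star>\<^bsub>A\<^esub> source r) (target s \<star>\<^bsub>A\<^esub> target r)
     (fst (label s) \<star>\<^bsub>A\<^esub> fst (label r), snd (label s) \<star>\<^bsub>A\<^esub> snd (label r))"
  by (simp_all add: Ar_def)

lemma Cell_Ar: "s \<in> Cell (Ar A) \<longleftrightarrow> source s \<in> Cell A \<and> target s \<in> Cell A \<and>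
   fst (label s) \<in> Cell A \<and> dom2 A (fst (label s)) = dom2 A (source s) \<and>
     cod2 A (fst (label s)) = dom2 A (target s) \<and>
   snd (label s) \<in> Cell A \<and> dom2 A (snd (label s)) = cod2 A (source s) \<and>
     cod2 A (snd (label s)) = cod2 A (target s) \<and>
   snd (label s) \<bullet>\<^bsub>A\<^esub> source s = target s \<bullet>\<^bsub>A\<^esub> fst (label s)"
  by (cases s) (auto simp: Ar_def hom2_def)

text \<open>
  All operations act separately on the two sides \<open>(\<sigma>, \<tau>)\<close> of a square, so the laws are those of \<open>A\<close>.
  Vertical composites of commutative squares commute by pasting, horizontal ones by interchange.
\<close>

theorem two_category_Ar:
  assumes "two_category A"
  shows "two_category (Ar A)"
proof -
  interpret two_category A by fact
  have vc: "s \<bullet>\<^bsub>Ar A\<^esub> r \<in> Cell (Ar A)"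
    if r: "r \<in> Cell (Ar A)" and s: "s \<in> Cell (Ar A)" and t: "target r = source s" for r s
  proof -
    note [simp] = r[unfolded Cell_Ar] s[unfolded Cell_Ar] t
    have 1: "snd (label r) \<bullet>\<^bsub>A\<^esub> source r = source s \<bullet>\<^bsub>A\<^esub> fst (label r)"
      and 2: "snd (label s) \<bullet>\<^bsub>A\<^esub> source s = target s \<bullet>\<^bsub>A\<^esub> fst (label s)"
      using r s t by (simp_all only: Cell_Ar)
    have "(snd (label s) \<bullet>\<^bsub>A\<^esub> snd (label r)) \<bullet>\<^bsub>A\<^esub> source r
        = (snd (label s) \<bullet>\<^bsub>A\<^esub> source s) \<bullet>\<^bsub>A\<^esub> fst (label r)" by (simp del: 2)
    also have "\<dots> = target s \<bullet>\<^bsub>A\<^esub> (fst (label s) \<bullet>\<^bsub>A\<^esub> fst (label r))" unfolding 2 by simp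
    finally show ?thesis unfolding Cell_Ar by (simp add: Ar_ops)
  qed
  have hc: "s \<star>\<^bsub>Ar A\<^esub> r \<in> Cell (Ar A)"
    if r: "r \<in> Cell (Ar A)" and s: "s \<in> Cell (Ar A)"
      and t: "tgt A (dom2 A (source r)) = src A (dom2 A (source s))" for r s
  proof -
    have e: "tgt A (dom2 A (target r)) = src A (dom2 A (target s))"
      using r s t src_cod2[of "fst (label s)"] tgt_cod2[of "fst (label r)"] by (simp add: Cell_Ar)
    then show ?thesis using r s t by (simp add: Ar_ops Cell_Ar interchange')
  qed
  show ?thesis
  proof
    show "(\<beta>' \<bullet>\<^bsub>Ar A\<^esub> \<alpha>') \<star>\<^bsub>Ar A\<^esub> (\<beta> \<bullet>\<^bsub>Ar A\<^esub> \<alpha>) = (\<beta>' \<star>\<^bsub>Ar A\<^esub> \<beta>) \<bullet>\<^bsub>Ar A\<^esub> (\<alpha>' \<star>\<^bsub>Ar A\<^esub> \<alpha>)"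
      if "\<alpha> \<in> hom2 (Ar A) f g" "\<beta> \<in> hom2 (Ar A) g h" "\<alpha>' \<in> hom2 (Ar A) f' g'"
        "\<beta>' \<in> hom2 (Ar A) g' h'" "tgt (Ar A) f = src (Ar A) f'"
      for \<alpha> \<beta> \<alpha>' \<beta>' f g h f' g' h'
      using that by (auto simp: Ar_ops hom2_def Cell_Ar interchange')
    show "\<beta> \<star>\<^bsub>Ar A\<^esub> \<alpha> \<in> hom2 (Ar A) (g \<cdot>\<^bsub>Ar A\<^esub> f) (g' \<cdot>\<^bsub>Ar A\<^esub> f')"
      if "\<alpha> \<in> hom2 (Ar A) f f'" "\<beta> \<in> hom2 (Ar A) g g'" "tgt (Ar A) f = src (Ar A) g"
      for \<alpha> \<beta> f f' g g'
      using that hc[of \<alpha> \<beta>] by (auto simp: hom2_def Ar_ops)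
    show "\<beta> \<bullet>\<^bsub>Ar A\<^esub> \<alpha> \<in> hom2 (Ar A) f h"
      if "\<alpha> \<in> hom2 (Ar A) f g" "\<beta> \<in> hom2 (Ar A) g h" for \<alpha> \<beta> f g h
      using that vc[of \<alpha> \<beta>] by (auto simp: hom2_def Ar_ops)
    show "(\<gamma> \<star>\<^bsub>Ar A\<^esub> \<beta>) \<star>\<^bsub>Ar A\<^esub> \<alpha> = \<gamma> \<star>\<^bsub>Ar A\<^esub> (\<beta> \<star>\<^bsub>Ar A\<^esub> \<alpha>)"
      if "\<alpha> \<in> Cell (Ar A)" "\<beta> \<in> Cell (Ar A)" "\<gamma> \<in> Cell (Ar A)"
        "tgt (Ar A) (dom2 (Ar A) \<alpha>) = src (Ar A) (dom2 (Ar A) \<beta>)"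
        "tgt (Ar A) (dom2 (Ar A) \<beta>) = src (Ar A) (dom2 (Ar A) \<gamma>)" for \<alpha> \<beta> \<gamma>
    proof -
      have "tgt A (dom2 A (target \<alpha>)) = src A (dom2 A (target \<beta>))"
        "tgt A (dom2 A (target \<beta>)) = src A (dom2 A (target \<gamma>))"
        using that src_cod2[of "fst (label \<beta>)"] tgt_cod2[of "fst (label \<alpha>)"]
          src_cod2[of "fst (label \<gamma>)"] tgt_cod2[of "fst (label \<beta>)"] by (simp_all add: Cell_Ar)
      with that show ?thesis by (simp add: Ar_ops Cell_Ar)
    qed
    show "id2 (Ar A) (id1 (Ar A) (tgt (Ar A) (dom2 (Ar A) \<alpha>))) \<star>\<^bsub>Ar A\<^esub> \<alpha> = \<alpha>"
      "\<alpha> \<star>\<^bsub>Ar A\<^esub> id2 (Ar A) (id1 (Ar A) (src (Ar A) (dom2 (Ar A) \<alpha>))) = \<alpha>"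
      "src (Ar A) (dom2 (Ar A) \<alpha>) = src (Ar A) (cod2 (Ar A) \<alpha>) \<and>
      tgt (Ar A) (dom2 (Ar A) \<alpha>) = tgt (Ar A) (cod2 (Ar A) \<alpha>)"
      if "\<alpha> \<in> Cell (Ar A)" for \<alpha>
    proof -
      have "tgt A (dom2 A (source \<alpha>)) = tgt A (dom2 A (target \<alpha>))"
        "src A (dom2 A (source \<alpha>)) = src A (dom2 A (target \<alpha>))"
        using that src_cod2[of "fst (label \<alpha>)"] tgt_cod2[of "fst (label \<alpha>)"] by (simp_all add: Cell_Ar)
      with that show "id2 (Ar A) (id1 (Ar A) (tgt (Ar A) (dom2 (Ar A) \<alpha>))) \<star>\<^bsub>Ar A\<^esub> \<alpha> = \<alpha>"
      "\<alpha> \<star>\<^bsub>Ar A\<^esub> id2 (Ar A) (id1 (Ar A) (src (Ar A) (dom2 (Ar A) \<alpha>))) = \<alpha>"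
      "src (Ar A) (dom2 (Ar A) \<alpha>) = src (Ar A) (cod2 (Ar A) \<alpha>) \<and>
      tgt (Ar A) (dom2 (Ar A) \<alpha>) = tgt (Ar A) (cod2 (Ar A) \<alpha>)"
        by (simp_all add: Ar_ops Cell_Ar arrow.expand prod_eq_iff)
    qed
  qed (auto simp: Ar_ops hom1_def hom2_def Cell_Ar arrow.expand prod_eq_iff)
qed

text \<open>
  If both sides of a commutative square are invertible, then the square formed by their inverses
  commutes as well.
\<close>

lemma invertible2_Ar:
  assumes "two_category A" "s \<in> Cell (Ar A)"
  shows "invertible2 (Ar A) s \<longleftrightarrow> invertible2 A (fst (label s)) \<and> invertible2 A (snd (label s))"
proof -
  interpret two_category A by fact
  interpret Ar: two_category "Ar A" using two_category_Ar[OF assms(1)] .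
  note [simp] = assms(2)[unfolded Cell_Ar]
  have 1: "snd (label s) \<bullet>\<^bsub>A\<^esub> source s = target s \<bullet>\<^bsub>A\<^esub> fst (label s)"
    using assms(2) by (simp only: Cell_Ar)
  show ?thesis
  proof
    assume s: "invertible2 (Ar A) s"
    define r where "r = inv2 (Ar A) s"
    note r = Ar.inv2_simps[OF s, folded r_def, unfolded Ar_sel(5,6)]
    from r(1) have r1: "fst (label r) \<in> Cell A" "snd (label r) \<in> Cell A"
      "dom2 A (fst (label r)) = dom2 A (target s)" "cod2 A (fst (label r)) = dom2 A (source s)"
      "dom2 A (snd (label r)) = cod2 A (target s)" "cod2 A (snd (label r)) = cod2 A (source s)"
      using r(2,3) by (simp_all add: Cell_Ar)
    show "invertible2 A (fst (label s)) \<and> invertible2 A (snd (label s))"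
      using invertible2I[of "fst (label s)" "fst (label r)"] invertible2I[of "snd (label s)" "snd (label r)"]
        r(4,5) r1 by (simp add: Ar_ops)
  next
    assume i: "invertible2 A (fst (label s)) \<and> invertible2 A (snd (label s))"
    then have i1 [simp]: "invertible2 A (fst (label s))" and i2 [simp]: "invertible2 A (snd (label s))"
      by auto
    let ?f = "fst (label s)" and ?g = "snd (label s)"
    have "source s \<bullet>\<^bsub>A\<^esub> inv2 A ?f = inv2 A ?g \<bullet>\<^bsub>A\<^esub> ((?g \<bullet>\<^bsub>A\<^esub> source s) \<bullet>\<^bsub>A\<^esub> inv2 A ?f)"
      by (simp del: 1)
    also have "\<dots> = inv2 A ?g \<bullet>\<^bsub>A\<^esub> target s"
      unfolding 1 by simp
    finally have c: "Arrow (target s) (source s) (inv2 A ?f, inv2 A ?g) \<in> Cell (Ar A)"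
      unfolding Cell_Ar by (simp add: Ar_ops)
    show "invertible2 (Ar A) s"
      by (rule Ar.invertible2I[OF assms(2) c]) (simp_all add: Ar_ops)
  qed
qed

lemma Ar_psfun_sel [simp]:
  "on0 (Ar_psfun A B L) = on0 L" "on1 (Ar_psfun A B L) = on2 L"
  "s \<in> Cell (Ar A) \<Longrightarrow> on2 (Ar_psfun A B L) s = Arrow (on2 L (source s)) (on2 L (target s))
       (on2 L (fst (label s)), on2 L (snd (label s)))"
  "\<alpha> \<in> Cell A \<Longrightarrow> \<alpha>' \<in> Cell A \<Longrightarrow> tgt A (dom2 A \<alpha>) = src A (dom2 A \<alpha>') \<Longrightarrow>
    cpt (Ar_psfun A B L) (\<alpha>', \<alpha>) = Arrow (on2 L \<alpha>' \<star>\<^bsub>B\<^esub> on2 L \<alpha>) (on2 L (\<alpha>' \<star>\<^bsub>A\<^esub> \<alpha>))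
         (cpt L (dom2 A \<alpha>', dom2 A \<alpha>), cpt L (cod2 A \<alpha>', cod2 A \<alpha>))"
  by (simp_all add: Ar_psfun_def)

text \<open>
  Naturality of the compositors of \<open>L\<close> says that the compositors at the domains and at the codomains
  form a commutative square, which is the compositor of the functor on arrow 2-categories.
\<close>

lemma normal_psfunctor_Ar_psfun:
  assumes "psfunctor A B L"
  shows "normal_psfunctor (Ar A) (Ar B) (Ar_psfun A B L)" (is "normal_psfunctor _ _ ?L")
proof -
  interpret psfunctor A B L by fact
  interpret AA: two_category "Ar A" by (rule two_category_Ar) (rule A.two_category_axioms)
  interpret AB: two_category "Ar B" by (rule two_category_Ar) (rule B.two_category_axioms)
  have cell: "Arrow (on2 L (source s)) (on2 L (target s)) (on2 L (fst (label s)), on2 L (snd (label s)))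
      \<in> Cell (Ar B)" if "s \<in> Cell (Ar A)" for s
    using that on2_vcomp[of "source s" "snd (label s)"] on2_vcomp[of "fst (label s)" "target s"]
    by (simp add: Cell_Ar)
  have cpt: "cpt ?L (\<alpha>', \<alpha>) \<in> Cell (Ar B)" "invertible2 (Ar B) (cpt ?L (\<alpha>', \<alpha>))"
    if "\<alpha> \<in> Cell A" "\<alpha>' \<in> Cell A" "tgt A (dom2 A \<alpha>) = src A (dom2 A \<alpha>')" for \<alpha> \<alpha>'
  proof -
    show 1: "cpt ?L (\<alpha>', \<alpha>) \<in> Cell (Ar B)"
      using that cpt_natural[of \<alpha> \<alpha>'] by (simp add: Cell_Ar)
    show "invertible2 (Ar B) (cpt ?L (\<alpha>', \<alpha>))"
      unfolding invertible2_Ar[OF B.two_category_axioms 1] using that by simp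
  qed
  have st: "src A (dom2 A (target s)) = src A (dom2 A (source s))"
      "tgt A (dom2 A (target s)) = tgt A (dom2 A (source s))" if "s \<in> Cell (Ar A)" for s
    using that AA.src_cod2[of s] AA.tgt_cod2[of s] by simp_all
  have ext: "on0 L \<in> Obj A \<rightarrow>\<^sub>E Obj B" "on2 L \<in> Cell A \<rightarrow>\<^sub>E Cell B"
    using psfunctor by (auto simp: normal_psfunctor_def)
  have ext2: "on2 ?L \<in> Cell (Ar A) \<rightarrow>\<^sub>E Cell (Ar B)" "cpt ?L \<in> composable (Ar A) \<rightarrow>\<^sub>E Cell (Ar B)"
    using cell cpt by (auto simp: Ar_psfun_def)
  have id2: "on2 ?L (id2 (Ar A) \<alpha>) = id2 (Ar B) (on1 ?L \<alpha>)" if "\<alpha> \<in> Mor (Ar A)" for \<alpha>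
    using that AA.id2_simps[OF that] by simp (simp add: Ar_ops)
  have vcomp: "on2 ?L (r \<bullet>\<^bsub>Ar A\<^esub> s) = on2 ?L r \<bullet>\<^bsub>Ar B\<^esub> on2 ?L s"
    if c: "s \<in> Cell (Ar A)" "r \<in> Cell (Ar A)" "target s = source r" for r s
    using c AA.vcomp_simps[of s r] by simp (simp add: Ar_ops on2_vcomp Cell_Ar)
  have nat: "cpt ?L (target r, target s) \<bullet>\<^bsub>Ar B\<^esub> (on2 ?L r \<star>\<^bsub>Ar B\<^esub> on2 ?L s) =
      on2 ?L (r \<star>\<^bsub>Ar A\<^esub> s) \<bullet>\<^bsub>Ar B\<^esub> cpt ?L (source r, source s)"
    if c: "s \<in> Cell (Ar A)" "r \<in> Cell (Ar A)" "tgt A (dom2 A (source s)) = src A (dom2 A (source r))"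
    for r s
  proof -
    have d: "source r \<in> Cell A" "source s \<in> Cell A" "target r \<in> Cell A" "target s \<in> Cell A"
      using c by (simp_all add: Cell_Ar)
    show ?thesis
      using c st[OF c(1)] st[OF c(2)] AA.hcomp_simps(1)[of s r] d
      by simp (use c cpt_natural[of "fst (label s)" "fst (label r)"]
          cpt_natural[of "snd (label s)" "snd (label r)"] in \<open>simp add: Ar_ops Cell_Ar\<close>)
  qed
  have assoc: "cpt ?L (\<alpha>'', \<alpha>' \<star>\<^bsub>A\<^esub> \<alpha>) \<bullet>\<^bsub>Ar B\<^esub> (id2 (Ar B) (on1 ?L \<alpha>'') \<star>\<^bsub>Ar B\<^esub> cpt ?L (\<alpha>', \<alpha>)) =
      cpt ?L (\<alpha>'' \<star>\<^bsub>A\<^esub> \<alpha>', \<alpha>) \<bullet>\<^bsub>Ar B\<^esub> (cpt ?L (\<alpha>'', \<alpha>') \<star>\<^bsub>Ar B\<^esub> id2 (Ar B) (on1 ?L \<alpha>))"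
    if c: "\<alpha> \<in> Cell A" "\<alpha>' \<in> Cell A" "\<alpha>'' \<in> Cell A" "tgt A (dom2 A \<alpha>) = src A (dom2 A \<alpha>')"
      "tgt A (dom2 A \<alpha>') = src A (dom2 A \<alpha>'')" for \<alpha> \<alpha>' \<alpha>''
    using c cpt_assoc[of "dom2 A \<alpha>" "dom2 A \<alpha>'" "dom2 A \<alpha>''"]
      cpt_assoc[of "cod2 A \<alpha>" "cod2 A \<alpha>'" "cod2 A \<alpha>''"] by (simp add: Ar_ops)
  have unit: "cpt ?L (\<alpha>, id1 (Ar A) (src (Ar A) \<alpha>)) = id2 (Ar B) (on1 ?L \<alpha>)"
    "cpt ?L (id1 (Ar A) (tgt (Ar A) \<alpha>), \<alpha>) = id2 (Ar B) (on1 ?L \<alpha>)" if "\<alpha> \<in> Cell A" for \<alpha>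
    using that by (simp_all add: Ar_ops)
  have hom: "on2 ?L s \<in> hom2 (Ar B) (on1 ?L (source s)) (on1 ?L (target s))" if "s \<in> Cell (Ar A)" for s
    using that cell by (simp add: hom2_def)
  have cpt_hom: "cpt ?L (\<alpha>', \<alpha>) \<in> hom2 (Ar B) (on2 L \<alpha>' \<star>\<^bsub>B\<^esub> on2 L \<alpha>) (on2 L (\<alpha>' \<star>\<^bsub>A\<^esub> \<alpha>))"
    if "\<alpha> \<in> Cell A" "\<alpha>' \<in> Cell A" "tgt A (dom2 A \<alpha>) = src A (dom2 A \<alpha>')" for \<alpha> \<alpha>'
    using cpt(1)[OF that] that by (simp add: hom2_def)
  show ?thesis
    unfolding normal_psfunctor_def Ar_sel(1-6,8) Ar_psfun_sel(1,2)
    using ext ext2 id2 vcomp nat assoc cpt unit hom cpt_hom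
    by (auto simp: hom1_def simp del: Ar_psfun_sel(3,4))
qed

section \<open>Strict 2-functors and the diagonal\<close>

lemma normal_psfunctor_strict:
  assumes "two_category A" "two_category B"
    and f0: "\<And>X. X \<in> Obj A \<Longrightarrow> f0 X \<in> Obj B"
    and f1: "\<And>a. a \<in> Mor A \<Longrightarrow> f1 a \<in> hom1 B (f0 (src A a)) (f0 (tgt A a))"
    and f2: "\<And>\<alpha>. \<alpha> \<in> Cell A \<Longrightarrow> f2 \<alpha> \<in> hom2 B (f1 (dom2 A \<alpha>)) (f1 (cod2 A \<alpha>))"
    and id1: "\<And>X. X \<in> Obj A \<Longrightarrow> f1 (id1 A X) = id1 B (f0 X)"
    and id2: "\<And>a. a \<in> Mor A \<Longrightarrow> f2 (id2 A a) = id2 B (f1 a)"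
    and comp: "\<And>a a'. a \<in> Mor A \<Longrightarrow> a' \<in> Mor A \<Longrightarrow> tgt A a = src A a' \<Longrightarrow>
      f1 (a' \<cdot>\<^bsub>A\<^esub> a) = f1 a' \<cdot>\<^bsub>B\<^esub> f1 a"
    and vcomp: "\<And>\<alpha> \<beta>. \<alpha> \<in> Cell A \<Longrightarrow> \<beta> \<in> Cell A \<Longrightarrow> cod2 A \<alpha> = dom2 A \<beta> \<Longrightarrow>
      f2 (\<beta> \<bullet>\<^bsub>A\<^esub> \<alpha>) = f2 \<beta> \<bullet>\<^bsub>B\<^esub> f2 \<alpha>"
    and hcomp: "\<And>\<alpha> \<beta>. \<alpha> \<in> Cell A \<Longrightarrow> \<beta> \<in> Cell A \<Longrightarrow> tgt A (dom2 A \<alpha>) = src A (dom2 A \<beta>) \<Longrightarrow>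
      f2 (\<beta> \<star>\<^bsub>A\<^esub> \<alpha>) = f2 \<beta> \<star>\<^bsub>B\<^esub> f2 \<alpha>"
  shows "normal_psfunctor A B (strict_psfun A B f0 f1 f2)"
proof -
  interpret A: two_category A by fact
  interpret B: two_category B by fact
  have [simp]: "f1 a \<in> Mor B" "src B (f1 a) = f0 (src A a)" "tgt B (f1 a) = f0 (tgt A a)"
    if "a \<in> Mor A" for a
    using f1[OF that] by (simp_all add: hom1_def)
  have [simp]: "f2 \<alpha> \<in> Cell B" "dom2 B (f2 \<alpha>) = f1 (dom2 A \<alpha>)" "cod2 B (f2 \<alpha>) = f1 (cod2 A \<alpha>)"
    if "\<alpha> \<in> Cell A" for \<alpha>
    using f2[OF that] by (simp_all add: hom2_def)
  show ?thesis
    unfolding normal_psfunctor_def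
    by (auto simp: strict_psfun_def f0 id1 id2 comp vcomp hcomp hom1_def hom2_def)
qed

lemma strict_psfun_sel [simp]:
  "X \<in> Obj A \<Longrightarrow> on0 (strict_psfun A B f0 f1 f2) X = f0 X"
  "a \<in> Mor A \<Longrightarrow> on1 (strict_psfun A B f0 f1 f2) a = f1 a"
  "\<alpha> \<in> Cell A \<Longrightarrow> on2 (strict_psfun A B f0 f1 f2) \<alpha> = f2 \<alpha>"
  "a \<in> Mor A \<Longrightarrow> a' \<in> Mor A \<Longrightarrow> tgt A a = src A a' \<Longrightarrow>
    cpt (strict_psfun A B f0 f1 f2) (a', a) = id2 B (f1 (a' \<cdot>\<^bsub>A\<^esub> a))"
  by (simp_all add: strict_psfun_def)

context
  fixes I :: "('i, 'j, 'k) two_cat" and C :: "('o, 'm, 't) two_cat"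
  assumes two_cats: "two_category I" "two_category C"
begin

interpretation I: two_category I by (rule two_cats)
interpretation C: two_category C by (rule two_cats)
interpretation Ps: two_category "Ps I C" by (rule two_category_Ps[OF two_cats])

lemma const_psfun_sel [simp]:
  "i \<in> Obj I \<Longrightarrow> on0 (const_psfun I C X) i = X"
  "a \<in> Mor I \<Longrightarrow> on1 (const_psfun I C X) a = id1 C X"
  "\<alpha> \<in> Cell I \<Longrightarrow> on2 (const_psfun I C X) \<alpha> = id2 C (id1 C X)"
  "a \<in> Mor I \<Longrightarrow> a' \<in> Mor I \<Longrightarrow> tgt I a = src I a' \<Longrightarrow>
    cpt (const_psfun I C X) (a', a) = id2 C (id1 C X)"
  by (simp_all add: const_psfun_def)

lemma normal_const_psfun [simp]: "X \<in> Obj C \<Longrightarrow> normal_psfunctor I C (const_psfun I C X)"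
  unfolding const_psfun_def
  by (rule normal_psfunctor_strict) (auto simp: two_cats hom1_def hom2_def)

lemma const_pstrans_sel [simp]:
  "source (const_pstrans I C f) = const_psfun I C (src C f)"
  "target (const_pstrans I C f) = const_psfun I C (tgt C f)"
  "i \<in> Obj I \<Longrightarrow> pt0 (label (const_pstrans I C f)) i = f"
  "a \<in> Mor I \<Longrightarrow> pt1 (label (const_pstrans I C f)) a = id2 C f"
  by (simp_all add: const_pstrans_def)

lemma const_pstrans_Mor [simp]: "f \<in> Mor C \<Longrightarrow> const_pstrans I C f \<in> Mor (Ps I C)"
  unfolding Mor_Ps is_pstrans_def
  by (auto simp: hom1_def hom2_def Let_def) (simp_all add: const_pstrans_def)

lemma const_modification_sel [simp]:
  "source (const_modification I C \<gamma>) = const_pstrans I C (dom2 C \<gamma>)"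
  "target (const_modification I C \<gamma>) = const_pstrans I C (cod2 C \<gamma>)"
  "i \<in> Obj I \<Longrightarrow> label (const_modification I C \<gamma>) i = \<gamma>"
  by (simp_all add: const_modification_def)

lemma const_modification_Cell [simp]: "\<gamma> \<in> Cell C \<Longrightarrow> const_modification I C \<gamma> \<in> Cell (Ps I C)"
  by (rule Cell_PsI) (simp_all, simp add: const_modification_def)

theorem normal_psfunctor_Diag: "normal_psfunctor C (Ps I C) (Diag I C)"
  unfolding Diag_def
proof (rule normal_psfunctor_strict)
  show "const_pstrans I C (id1 C X) = id1 (Ps I C) (const_psfun I C X)" if "X \<in> Obj C" for X
    by (rule Mor_Ps_eqI[of _ I C]) (use that Ps.id1_simps in simp_all)
  show "const_modification I C (id2 C f) = id2 (Ps I C) (const_pstrans I C f)" if "f \<in> Mor C" for f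
    by (rule Cell_Ps_eqI[of _ I C]) (use that in simp_all)
  show cmp: "const_pstrans I C (g \<cdot>\<^bsub>C\<^esub> f) = const_pstrans I C g \<cdot>\<^bsub>Ps I C\<^esub> const_pstrans I C f"
    if "f \<in> Mor C" "g \<in> Mor C" "tgt C f = src C g" for f g
    by (rule Mor_Ps_eqI[of _ I C])
      (use that Ps.comp_simps[of "const_pstrans I C f" "const_pstrans I C g"] in simp_all)
  show "const_modification I C (\<beta> \<bullet>\<^bsub>C\<^esub> \<alpha>) = const_modification I C \<beta> \<bullet>\<^bsub>Ps I C\<^esub> const_modification I C \<alpha>"
    if "\<alpha> \<in> Cell C" "\<beta> \<in> Cell C" "cod2 C \<alpha> = dom2 C \<beta>" for \<alpha> \<beta>
    by (rule Cell_Ps_eqI[of _ I C]) (use that in simp_all)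
  show "const_modification I C (\<beta> \<star>\<^bsub>C\<^esub> \<alpha>) = const_modification I C \<beta> \<star>\<^bsub>Ps I C\<^esub> const_modification I C \<alpha>"
    if "\<alpha> \<in> Cell C" "\<beta> \<in> Cell C" "tgt C (dom2 C \<alpha>) = src C (dom2 C \<beta>)" for \<alpha> \<beta>
    using that Ps.hcomp_simps(1)[of "const_modification I C \<alpha>" "const_modification I C \<beta>"]
    by (intro Cell_Ps_eqI[of _ I C]) (simp_all add: cmp[simplified])
qed (simp_all add: two_cats two_category_Ps hom1_def hom2_def)

end

section \<open>Bi-terminal objects\<close>

text \<open>
  The closure and unit laws from which bi-terminality is computed. In a slice, closure under horizontal
  composition is the law that needs an argument.
\<close>

locale unital_two_graph =
  fixes A :: "('o, 'm, 't) two_cat" (structure)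
  assumes id1_hom: "X \<in> Obj A \<Longrightarrow> id1 A X \<in> hom1 A X X"
    and hom1_Obj: "f \<in> hom1 A X Y \<Longrightarrow> X \<in> Obj A \<and> Y \<in> Obj A"
    and comp_hom: "f \<in> hom1 A X Y \<Longrightarrow> g \<in> hom1 A Y W \<Longrightarrow> g \<cdot> f \<in> hom1 A X W"
    and comp_id_left: "f \<in> hom1 A X Y \<Longrightarrow> id1 A Y \<cdot> f = f"
    and comp_id_right: "f \<in> hom1 A X Y \<Longrightarrow> f \<cdot> id1 A X = f"
    and id2_hom: "f \<in> hom1 A X Y \<Longrightarrow> id2 A f \<in> hom2 A f f"
    and vcomp_hom: "\<alpha> \<in> hom2 A f g \<Longrightarrow> \<beta> \<in> hom2 A g h \<Longrightarrow> \<beta> \<bullet> \<alpha> \<in> hom2 A f h"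
    and vcomp_id_right: "\<alpha> \<in> hom2 A f g \<Longrightarrow> \<alpha> \<bullet> id2 A f = \<alpha>"
    and hcomp_hom: "f \<in> hom1 A X Y \<Longrightarrow> g \<in> hom1 A Y W \<Longrightarrow> f' \<in> hom1 A X Y \<Longrightarrow>
      \<alpha> \<in> hom2 A f f' \<Longrightarrow> id2 A g \<star> \<alpha> \<in> hom2 A (g \<cdot> f) (g \<cdot> f')"
    and hcomp_id_left: "f \<in> hom1 A X Y \<Longrightarrow> g \<in> hom1 A X Y \<Longrightarrow> \<alpha> \<in> hom2 A f g \<Longrightarrow>
      id2 A (id1 A Y) \<star> \<alpha> = \<alpha>"

lemma invertible2_hom2I:
  assumes "\<psi> \<in> hom2 A f g" "\<phi> \<in> hom2 A g f" "\<phi> \<bullet>\<^bsub>A\<^esub> \<psi> = id2 A f" "\<psi> \<bullet>\<^bsub>A\<^esub> \<phi> = id2 A g"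
  shows "invertible2 A \<psi>"
proof -
  have \<psi>: "\<psi> \<in> Cell A" "dom2 A \<psi> = f" "cod2 A \<psi> = g" using assms(1) by (simp_all add: hom2_def)
  have "inverse2 A \<psi> \<phi>" unfolding inverse2_def \<psi>(2,3) by (intro conjI assms(2-4))
  with \<psi>(1) show ?thesis unfolding invertible2_def by blast
qed

lemma op2_simps [simp]:
  "Obj (op2 A) = Obj A" "hom1 (op2 A) X Y = hom1 A Y X" "hom2 (op2 A) f g = hom2 A f g"
  "comp (op2 A) g f = f \<cdot>\<^bsub>A\<^esub> g" "hcomp (op2 A) \<beta> \<alpha> = \<alpha> \<star>\<^bsub>A\<^esub> \<beta>" "vcomp (op2 A) = vcomp A"
  "id1 (op2 A) = id1 A" "id2 (op2 A) = id2 A" "invertible2 (op2 A) \<psi> = invertible2 A \<psi>"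
  by (auto simp: op2_def hom1_def hom2_def invertible2_def inverse2_def)

lemma coslice_proj_sel [simp]:
  "x \<in> coslice_obj A Z \<Longrightarrow> on0 (coslice_proj A Z) x = fst x"
  "p \<in> coslice_mor A Z \<Longrightarrow> on1 (coslice_proj A Z) p = fst (label p)"
  "s \<in> Cell (coslice A Z) \<Longrightarrow> on2 (coslice_proj A Z) s = label s"
  by (simp_all add: coslice_proj_def strict_psfun_def coslice_def)

lemma coslice_sel [simp]:
  "Obj (coslice A Z) = coslice_obj A Z" "Mor (coslice A Z) = coslice_mor A Z"
  "src (coslice A Z) = source" "tgt (coslice A Z) = target"
  "dom2 (coslice A Z) = source" "cod2 (coslice A Z) = target"
  by (simp_all add: coslice_def)

lemma coslice_op_obj: "(X, f) \<in> coslice_obj (op2 A) Z \<longleftrightarrow> X \<in> Obj A \<and> f \<in> hom1 A X Z"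
  by (simp add: coslice_obj_def)

lemma coslice_op_mor: "Arrow (X, f) (X', f') (a, \<psi>) \<in> coslice_mor (op2 A) Z \<longleftrightarrow>
    X \<in> Obj A \<and> X' \<in> Obj A \<and> f \<in> hom1 A X Z \<and> f' \<in> hom1 A X' Z \<and>
    a \<in> hom1 A X' X \<and> \<psi> \<in> hom2 A f' (f \<cdot>\<^bsub>A\<^esub> a) \<and> invertible2 A \<psi>"
  by (auto simp: coslice_mor_def coslice_op_obj)

lemma coslice_op_cell:
  "Arrow (Arrow (X, f) (X', f') (a, \<psi>)) (Arrow (X, f) (X', f') (b, \<phi>)) \<beta> \<in> Cell (coslice (op2 A) Z) \<longleftrightarrow>
    Arrow (X, f) (X', f') (a, \<psi>) \<in> coslice_mor (op2 A) Z \<and>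
    Arrow (X, f) (X', f') (b, \<phi>) \<in> coslice_mor (op2 A) Z \<and>
    \<beta> \<in> hom2 A a b \<and> (id2 A f \<star>\<^bsub>A\<^esub> \<beta>) \<bullet>\<^bsub>A\<^esub> \<psi> = \<phi>"
  by (auto simp: coslice_def)

text \<open>
  In the slice over \<open>Z\<close>, a morphism between \<open>f, g : Y \<rightarrow> Z\<close> that lies over the identity is an invertible
  2-morphism \<open>g \<Rightarrow> f\<close>, so fullness relates any two parallel morphisms to \<open>Z\<close>. A 2-morphism between
  morphisms out of \<open>(Z, id)\<close> is a \<open>\<beta>\<close> with \<open>\<beta> = \<phi>\<close>, so full faithfulness leaves no choice for it.
  Conversely, if 2-morphisms between morphisms to \<open>Z\<close> exist uniquely, then the required ones exist,
  uniqueness makes them invertible, and uniqueness makes every condition on them true.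
\<close>

lemma (in unital_two_graph) bi_terminal_iff:
  "bi_terminal A Z \<longleftrightarrow> Z \<in> Obj A \<and> (\<forall>Y\<in>Obj A. \<exists>f. f \<in> hom1 A Y Z) \<and>
    (\<forall>Y. \<forall>f\<in>hom1 A Y Z. \<forall>g\<in>hom1 A Y Z. \<exists>!\<beta>. \<beta> \<in> hom2 A f g)"
  (is "_ \<longleftrightarrow> _ \<and> ?ex \<and> ?un")
proof
  let ?K = "coslice (op2 A) Z" and ?P = "coslice_proj (op2 A) Z"
  {
    assume "bi_terminal A Z"
    then have Z: "Z \<in> Obj A" and tf: "trivial_fibration ?K (op2 A) ?P"
      by (simp_all add: bi_terminal_def bi_initial_def)
    have ex: ?ex
    proof
      fix Y assume "Y \<in> Obj A"
      then have "Y \<in> on0 ?P ` coslice_obj (op2 A) Z"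
        using tf by (simp add: trivial_fibration_def)
      then show "\<exists>f. f \<in> hom1 A Y Z" by (auto simp: coslice_op_obj)
    qed
    have iso: "\<exists>\<psi>. \<psi> \<in> hom2 A g f \<and> invertible2 A \<psi>"
      if f: "f \<in> hom1 A Y Z" and g: "g \<in> hom1 A Y Z" for Y f g
    proof -
      have Y: "Y \<in> Obj A" using hom1_Obj f by blast
      have o: "(Y, f) \<in> coslice_obj (op2 A) Z" "(Y, g) \<in> coslice_obj (op2 A) Z"
        using f g Y by (simp_all add: coslice_op_obj)
      have "\<exists>p\<in>hom1 ?K (Y, f) (Y, g). on1 ?P p = id1 A Y"
        using tf o id1_hom[OF Y] unfolding trivial_fibration_def
        by (metis (no_types, lifting) coslice_proj_sel(1) coslice_sel(1) fst_conv op2_simps(2))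
      then obtain p where p: "p \<in> coslice_mor (op2 A) Z" "source p = (Y, f)" "target p = (Y, g)"
        "fst (label p) = id1 A Y" by (auto simp: hom1_def)
      then have "p = Arrow (Y, f) (Y, g) (id1 A Y, snd (label p))"
        by (metis arrow.exhaust_sel prod.collapse)
      with p(1) have "Arrow (Y, f) (Y, g) (id1 A Y, snd (label p)) \<in> coslice_mor (op2 A) Z" by simp
      then show ?thesis unfolding coslice_op_mor using comp_id_right[OF f] by auto
    qed
    have ?un
    proof (intro allI ballI)
      fix Y a b assume a: "a \<in> hom1 A Y Z" and b: "b \<in> hom1 A Y Z"
      obtain \<phi> where \<phi>: "\<phi> \<in> hom2 A a b" "invertible2 A \<phi>" using iso[OF b a] by blast
      have Y: "Y \<in> Obj A" using hom1_Obj a by blast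
      let ?p = "Arrow (Z, id1 A Z) (Y, a) (a, id2 A a)" and ?q = "Arrow (Z, id1 A Z) (Y, a) (b, \<phi>)"
      have "invertible2 A (id2 A a)"
        using invertible2_hom2I[OF id2_hom[OF a] id2_hom[OF a]] vcomp_id_right[OF id2_hom[OF a]]
        by blast
      then have p: "?p \<in> coslice_mor (op2 A) Z" and q: "?q \<in> coslice_mor (op2 A) Z"
        using a b Y Z \<phi> id1_hom[OF Z] id2_hom[OF a] comp_id_left[OF a] comp_id_left[OF b]
        by (simp_all add: coslice_op_mor)
      have o: "(Z, id1 A Z) \<in> coslice_obj (op2 A) Z" "(Y, a) \<in> coslice_obj (op2 A) Z"
        using a Y Z id1_hom[OF Z] by (simp_all add: coslice_op_obj)
      have "?p \<in> hom1 ?K (Z, id1 A Z) (Y, a)" "?q \<in> hom1 ?K (Z, id1 A Z) (Y, a)"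
        using p q by (simp_all add: hom1_def)
      then have bij: "bij_betw (on2 ?P) (hom2 ?K ?p ?q) (hom2 A a b)"
        using tf o p q unfolding trivial_fibration_def
        by (metis (no_types, lifting) arrow.sel(3) coslice_proj_sel(2) coslice_sel(1) fst_conv op2_simps(3))
      have "\<beta> = \<phi>" if \<beta>: "\<beta> \<in> hom2 A a b" for \<beta>
      proof -
        have "\<beta> \<in> on2 ?P ` hom2 ?K ?p ?q"
          using \<beta> unfolding bij_betw_imp_surj_on[OF bij] .
        then obtain s where s: "s \<in> hom2 ?K ?p ?q" "\<beta> = on2 ?P s" by (elim imageE)
        have "s \<in> Cell ?K" "source s = ?p" "target s = ?q" using s(1) by (simp_all add: hom2_def)
        moreover from this have "label s = \<beta>" using s(2) by simp
        ultimately have "Arrow ?p ?q \<beta> \<in> Cell ?K" by (cases s) simp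
        then have "(id2 A (id1 A Z) \<star> \<beta>) \<bullet> id2 A a = \<phi>"
          by (simp only: coslice_op_cell)
        then show ?thesis
          using hcomp_id_left[OF a b \<beta>] vcomp_id_right[OF \<beta>] by simp
      qed
      with \<phi>(1) show "\<exists>!\<beta>. \<beta> \<in> hom2 A a b" by blast
    qed
    with Z ex show "Z \<in> Obj A \<and> ?ex \<and> ?un" by blast
  next
    assume "Z \<in> Obj A \<and> ?ex \<and> ?un"
    then have Z: "Z \<in> Obj A" and ex: ?ex and un: ?un by blast+
    have eq: "\<beta> = \<gamma>" if "f \<in> hom1 A Y Z" "g \<in> hom1 A Y Z" "\<beta> \<in> hom2 A f g" "\<gamma> \<in> hom2 A f g"
      for Y f g \<beta> \<gamma>
      using un that by blast
    have surj: "on0 ?P ` Obj ?K = Obj (op2 A)"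
    proof
      show "on0 ?P ` Obj ?K \<subseteq> Obj (op2 A)" by (auto simp: coslice_op_obj)
      show "Obj (op2 A) \<subseteq> on0 ?P ` Obj ?K"
      proof
        fix Y assume Y: "Y \<in> Obj (op2 A)"
        with ex obtain f where "f \<in> hom1 A Y Z" by auto
        with Y have "(Y, f) \<in> coslice_obj (op2 A) Z" by (simp add: coslice_op_obj)
        then show "Y \<in> on0 ?P ` Obj ?K" by (intro image_eqI[of _ _ "(Y, f)"]) simp_all
      qed
    qed
    have full: "\<exists>p\<in>hom1 ?K x y. on1 ?P p = a"
      if x: "x \<in> Obj ?K" and y: "y \<in> Obj ?K" and a: "a \<in> hom1 (op2 A) (on0 ?P x) (on0 ?P y)" for x y a
    proof -
      obtain X f Y g where xy: "x = (X, f)" "y = (Y, g)" by (metis surj_pair)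
      have h: "f \<in> hom1 A X Z" "g \<in> hom1 A Y Z" "X \<in> Obj A" "Y \<in> Obj A" "a \<in> hom1 A Y X"
        using x y a by (auto simp: xy coslice_op_obj)
      have fa: "f \<cdot> a \<in> hom1 A Y Z" using comp_hom h by blast
      obtain \<psi> where \<psi>: "\<psi> \<in> hom2 A g (f \<cdot> a)" using un h(2) fa by blast
      obtain \<phi> where \<phi>: "\<phi> \<in> hom2 A (f \<cdot> a) g" using un h(2) fa by blast
      have inv: "\<phi> \<bullet> \<psi> = id2 A g" "\<psi> \<bullet> \<phi> = id2 A (f \<cdot> a)"
        using eq[OF h(2) h(2) vcomp_hom[OF \<psi> \<phi>] id2_hom[OF h(2)]]
          eq[OF fa fa vcomp_hom[OF \<phi> \<psi>] id2_hom[OF fa]] by blast+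
      have "invertible2 A \<psi>" by (rule invertible2_hom2I[OF \<psi> \<phi> inv])
      with h \<psi> have p: "Arrow (X, f) (Y, g) (a, \<psi>) \<in> coslice_mor (op2 A) Z"
        by (simp add: coslice_op_mor)
      then show ?thesis
        by (intro bexI[of _ "Arrow (X, f) (Y, g) (a, \<psi>)"]) (simp_all add: hom1_def xy)
    qed
    have ff: "bij_betw (on2 ?P) (hom2 ?K p q) (hom2 (op2 A) (on1 ?P p) (on1 ?P q))"
      if p: "p \<in> hom1 ?K x y" and q: "q \<in> hom1 ?K x y" for x y p q
    proof -
      obtain X f Y g where xy: "x = (X, f)" "y = (Y, g)" by (metis surj_pair)
      obtain a \<psi> where pe: "p = Arrow (X, f) (Y, g) (a, \<psi>)"
        using p xy by (cases p) (auto simp: hom1_def)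
      obtain b \<phi> where qe: "q = Arrow (X, f) (Y, g) (b, \<phi>)"
        using q xy by (cases q) (auto simp: hom1_def)
      have pm: "p \<in> coslice_mor (op2 A) Z" and qm: "q \<in> coslice_mor (op2 A) Z"
        using p q by (auto simp: hom1_def)
      note h = pm[unfolded pe coslice_op_mor] qm[unfolded qe coslice_op_mor]
      have cell: "Arrow p q \<beta> \<in> Cell ?K" if \<beta>: "\<beta> \<in> hom2 A a b" for \<beta>
      proof -
        have "(id2 A f \<star> \<beta>) \<bullet> \<psi> = \<phi>"
        proof (rule eq)
          show "(id2 A f \<star> \<beta>) \<bullet> \<psi> \<in> hom2 A g (f \<cdot> b)"
            using h \<beta> hcomp_hom[of a Y X f Z b \<beta>] vcomp_hom by blast
          show "f \<cdot> b \<in> hom1 A Y Z" using h comp_hom by blast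
        qed (use h in auto)
        with \<beta> pm qm show ?thesis by (simp add: pe qe coslice_op_cell)
      qed
      have lab: "on2 ?P s = label s \<and> label s \<in> hom2 A a b \<and> s = Arrow p q (label s)"
        if "s \<in> hom2 ?K p q" for s
      proof -
        have s: "s \<in> Cell ?K" "s = Arrow p q (label s)" using that by (cases s; simp add: hom2_def)+
        then have "label s \<in> hom2 A a b" using coslice_op_cell pe qe by metis
        with s show ?thesis by simp
      qed
      show ?thesis
        unfolding bij_betw_def
      proof
        show "inj_on (on2 ?P) (hom2 ?K p q)" by (rule inj_onI) (metis lab)
        have e: "hom2 (op2 A) (on1 ?P p) (on1 ?P q) = hom2 A a b"
          using pm qm by (simp add: pe qe)
        show "on2 ?P ` hom2 ?K p q = hom2 (op2 A) (on1 ?P p) (on1 ?P q)"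
          unfolding e
        proof
          show "on2 ?P ` hom2 ?K p q \<subseteq> hom2 A a b" using lab by auto
          show "hom2 A a b \<subseteq> on2 ?P ` hom2 ?K p q"
          proof
            fix \<beta> assume "\<beta> \<in> hom2 A a b"
            then have "Arrow p q \<beta> \<in> Cell ?K" by (rule cell)
            then show "\<beta> \<in> on2 ?P ` hom2 ?K p q"
              by (intro image_eqI[of _ _ "Arrow p q \<beta>"]) (simp_all add: hom2_def)
          qed
        qed
      qed
    qed
    show "bi_terminal A Z"
      unfolding bi_terminal_def bi_initial_def trivial_fibration_def
      using Z surj full ff by (auto simp del: op2_simps(2,3))
  }
qed

subsection \<open>Double bi-terminal objects\<close>

text \<open>
  The counterpart of the previous locale for double categories.
\<close>

locale unital_double_graph =
  fixes \<A> :: "('o, 'h, 'v, 'q) dbl_cat"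
  assumes hid_hom: "X \<in> DObj \<A> \<Longrightarrow> hid \<A> X \<in> hhom \<A> X X"
    and vid_hom: "X \<in> DObj \<A> \<Longrightarrow> vid \<A> X \<in> vhom \<A> X X"
    and hhom_DObj: "a \<in> hhom \<A> X Y \<Longrightarrow> X \<in> DObj \<A> \<and> Y \<in> DObj \<A>"
    and vhom_DObj: "u \<in> vhom \<A> X Y \<Longrightarrow> X \<in> DObj \<A> \<and> Y \<in> DObj \<A>"
    and hmcomp_hom: "a \<in> hhom \<A> X Y \<Longrightarrow> b \<in> hhom \<A> Y W \<Longrightarrow> hmcomp \<A> b a \<in> hhom \<A> X W"
    and hmcomp_id_left: "a \<in> hhom \<A> X Y \<Longrightarrow> hmcomp \<A> (hid \<A> Y) a = a"
    and hmcomp_id_right: "a \<in> hhom \<A> X Y \<Longrightarrow> hmcomp \<A> a (hid \<A> X) = a"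
    and vmcomp_id_left: "u \<in> vhom \<A> X Y \<Longrightarrow> vmcomp \<A> (vid \<A> Y) u = u"
    and vmcomp_id_right: "u \<in> vhom \<A> X Y \<Longrightarrow> vmcomp \<A> u (vid \<A> X) = u"
    and qvid_sq: "a \<in> hhom \<A> X Y \<Longrightarrow> qvid \<A> a \<in> squares \<A> a a (vid \<A> X) (vid \<A> Y)"
    and qvcomp_sq: "\<alpha> \<in> squares \<A> a b u v \<Longrightarrow> \<beta> \<in> squares \<A> b c u' v' \<Longrightarrow>
      qvcomp \<A> \<beta> \<alpha> \<in> squares \<A> a c (vmcomp \<A> u' u) (vmcomp \<A> v' v)"
    and qhcomp_sq: "\<alpha> \<in> squares \<A> a b u v \<Longrightarrow> \<beta> \<in> squares \<A> a' b' v w \<Longrightarrow>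
      qhcomp \<A> \<beta> \<alpha> \<in> squares \<A> (hmcomp \<A> a' a) (hmcomp \<A> b' b) u w"
    and qvcomp_id_left: "\<alpha> \<in> squares \<A> a b u v \<Longrightarrow> qvcomp \<A> (qvid \<A> b) \<alpha> = \<alpha>"
    and qvcomp_id_right: "\<alpha> \<in> squares \<A> a b u v \<Longrightarrow> qvcomp \<A> \<alpha> (qvid \<A> a) = \<alpha>"
    and qhcomp_id_left: "Z \<in> DObj \<A> \<Longrightarrow> \<alpha> \<in> squares \<A> a b u (vid \<A> Z) \<Longrightarrow>
      qhcomp \<A> (qvid \<A> (hid \<A> Z)) \<alpha> = \<alpha>"

lemma dbl_op_simps [simp]:
  "DObj (dbl_op \<A>) = DObj \<A>" "VMor (dbl_op \<A>) = VMor \<A>" "hhom (dbl_op \<A>) X Y = hhom \<A> Y X"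
  "vhom (dbl_op \<A>) X Y = vhom \<A> X Y" "squares (dbl_op \<A>) a b u v = squares \<A> a b v u"
  "hmcomp (dbl_op \<A>) b a = hmcomp \<A> a b" "qhcomp (dbl_op \<A>) \<beta> \<alpha> = qhcomp \<A> \<alpha> \<beta>"
  "qvcomp (dbl_op \<A>) = qvcomp \<A>" "vid (dbl_op \<A>) = vid \<A>" "qvid (dbl_op \<A>) = qvid \<A>"
  "vert_invertible (dbl_op \<A>) \<psi> = vert_invertible \<A> \<psi>"
  by (auto simp: dbl_op_def hhom_def vhom_def squares_def vert_invertible_def)

lemma dcoslice_sel [simp]:
  "DObj (dcoslice \<A> Z) = dcoslice_obj \<A> Z" "HMor (dcoslice \<A> Z) = dcoslice_hmor \<A> Z"
  "VMor (dcoslice \<A> Z) = dcoslice_vmor \<A> Z" "Sq (dcoslice \<A> Z) = dcoslice_sq \<A> Z"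
  "hsrc (dcoslice \<A> Z) = source" "htgt (dcoslice \<A> Z) = target"
  "vsrc (dcoslice \<A> Z) = source" "vtgt (dcoslice \<A> Z) = target"
  "qtop (dcoslice \<A> Z) = top_of" "qbot (dcoslice \<A> Z) = bot_of"
  "qleft (dcoslice \<A> Z) = left_of" "qright (dcoslice \<A> Z) = right_of"
  by (simp_all add: dcoslice_def Let_def)

lemma dcoslice_proj_sel [simp]:
  "x \<in> dcoslice_obj \<A> Z \<Longrightarrow> don0 (dcoslice_proj \<A> Z) x = fst x"
  "p \<in> dcoslice_hmor \<A> Z \<Longrightarrow> donh (dcoslice_proj \<A> Z) p = fst (label p)"
  "u \<in> dcoslice_vmor \<A> Z \<Longrightarrow> donv (dcoslice_proj \<A> Z) u = fst (label u)"
  "s \<in> dcoslice_sq \<A> Z \<Longrightarrow> donq (dcoslice_proj \<A> Z) s = label_of s"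
  by (simp_all add: dcoslice_proj_def)

lemma dcoslice_op_obj: "(X, f) \<in> dcoslice_obj (dbl_op \<A>) Z \<longleftrightarrow> X \<in> DObj \<A> \<and> f \<in> hhom \<A> X Z"
  by (simp add: dcoslice_obj_def)

lemma dcoslice_op_hmor: "Arrow (X, f) (X', f') (a, \<psi>) \<in> dcoslice_hmor (dbl_op \<A>) Z \<longleftrightarrow>
    X \<in> DObj \<A> \<and> f \<in> hhom \<A> X Z \<and> X' \<in> DObj \<A> \<and> f' \<in> hhom \<A> X' Z \<and> a \<in> hhom \<A> X' X \<and>
    \<psi> \<in> squares \<A> f' (hmcomp \<A> f a) (vid \<A> X') (vid \<A> Z) \<and> vert_invertible \<A> \<psi>"
  by (auto simp: dcoslice_hmor_def dcoslice_op_obj)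

lemma dcoslice_op_vmor: "Arrow (X, f) (Y, g) (u, \<gamma>) \<in> dcoslice_vmor (dbl_op \<A>) Z \<longleftrightarrow>
    X \<in> DObj \<A> \<and> f \<in> hhom \<A> X Z \<and> Y \<in> DObj \<A> \<and> g \<in> hhom \<A> Y Z \<and> u \<in> vhom \<A> X Y \<and>
    \<gamma> \<in> squares \<A> f g u (vid \<A> Z)"
  by (auto simp: dcoslice_vmor_def dcoslice_op_obj)

lemma dcoslice_op_sq:
  "Square (Arrow x x' (a, \<psi>)) (Arrow y y' (b, \<phi>)) (Arrow x y (u, \<gamma>)) (Arrow x' y' (u', \<gamma>')) \<alpha>
      \<in> dcoslice_sq (dbl_op \<A>) Z \<longleftrightarrow>
    Arrow x x' (a, \<psi>) \<in> dcoslice_hmor (dbl_op \<A>) Z \<and> Arrow y y' (b, \<phi>) \<in> dcoslice_hmor (dbl_op \<A>) Z \<and>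
    Arrow x y (u, \<gamma>) \<in> dcoslice_vmor (dbl_op \<A>) Z \<and> Arrow x' y' (u', \<gamma>') \<in> dcoslice_vmor (dbl_op \<A>) Z \<and>
    \<alpha> \<in> squares \<A> a b u' u \<and> qvcomp \<A> (qhcomp \<A> \<gamma> \<alpha>) \<psi> = qvcomp \<A> \<phi> \<gamma>'"
  by (cases x; cases x'; cases y; cases y') (simp add: dcoslice_sq_def)

lemma (in unital_double_graph) vert_invertibleI:
  assumes "\<psi> \<in> squares \<A> a b (vid \<A> X) (vid \<A> Y)" "\<phi> \<in> squares \<A> b a (vid \<A> X) (vid \<A> Y)"
    and "a \<in> hhom \<A> X Y" "qvcomp \<A> \<phi> \<psi> = qvid \<A> a" "qvcomp \<A> \<psi> \<phi> = qvid \<A> b"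
  shows "vert_invertible \<A> \<psi>"
proof -
  have e: "\<psi> \<in> Sq \<A>" "qtop \<A> \<psi> = a" "qbot \<A> \<psi> = b" "qleft \<A> \<psi> = vid \<A> X" "qright \<A> \<psi> = vid \<A> Y"
    "hsrc \<A> a = X" "htgt \<A> a = Y"
    using assms(1,3) by (simp_all add: squares_def hhom_def)
  show ?thesis unfolding vert_invertible_def e
    by (intro conjI refl e(1) bexI[OF _ assms(2)] assms(4,5))
qed

text \<open>
  The argument of \<open>bi_terminal_iff\<close> with squares in place of 2-morphisms. Surjectivity on vertical morphisms
  gives some square over \<open>u\<close>; its top and bottom are replaced by the given \<open>f\<close> and \<open>g\<close> by pasting the
  squares that fullness provides.
\<close>

lemma (in unital_double_graph) double_bi_terminal_iff:
  "double_bi_terminal \<A> Z \<longleftrightarrow> Z \<in> DObj \<A> \<and> (\<forall>X\<in>DObj \<A>. \<exists>f. f \<in> hhom \<A> X Z) \<and>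
    (\<forall>X Y. \<forall>u\<in>vhom \<A> X Y. \<forall>f\<in>hhom \<A> X Z. \<forall>g\<in>hhom \<A> Y Z.
      \<exists>!\<gamma>. \<gamma> \<in> squares \<A> f g u (vid \<A> Z))"
  (is "_ \<longleftrightarrow> _ \<and> ?ex \<and> ?un")
proof
  let ?O = "dbl_op \<A>"
  let ?K = "dcoslice ?O Z" and ?P = "dcoslice_proj ?O Z"
  have vinv_id: "vert_invertible \<A> (qvid \<A> a)" if "a \<in> hhom \<A> X Y" for a X Y
    using vert_invertibleI[OF qvid_sq[OF that] qvid_sq[OF that] that] qvcomp_id_left[OF qvid_sq[OF that]]
    by blast
  {
    assume "double_bi_terminal \<A> Z"
    then have Z: "Z \<in> DObj \<A>" and tf: "double_trivial_fibration ?K ?O ?P"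
      by (simp_all add: double_bi_terminal_def double_bi_initial_def)
    note tf' = tf[unfolded double_trivial_fibration_def dcoslice_sel dbl_op_simps(1-3)]
    note surj = tf'[THEN conjunct1]
      and vsurj = tf'[THEN conjunct2, THEN conjunct2, THEN conjunct1]
    have full: "\<exists>a\<in>hhom ?K x y. donh ?P a = b"
      if "x \<in> dcoslice_obj ?O Z" "y \<in> dcoslice_obj ?O Z" "b \<in> hhom \<A> (don0 ?P y) (don0 ?P x)" for x y b
      using tf'[THEN conjunct2, THEN conjunct1, rule_format, OF that] .
    have ff: "\<exists>\<alpha>. \<alpha> \<in> squares ?K a b u v \<and> donq ?P \<alpha> = \<beta>"
      if "boundary ?K a b u v" "\<beta> \<in> squares ?O (donh ?P a) (donh ?P b) (donv ?P u) (donv ?P v)"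
      for a b u v \<beta>
      using tf'[THEN conjunct2, THEN conjunct2, THEN conjunct2, rule_format, OF that] by (rule ex1_implies_ex)
    have ex: ?ex
    proof
      fix X assume "X \<in> DObj \<A>"
      then have "X \<in> don0 ?P ` dcoslice_obj ?O Z" using surj by simp
      then show "\<exists>f. f \<in> hhom \<A> X Z" by (auto simp: dcoslice_op_obj)
    qed
    have iso: "\<exists>\<psi>. \<psi> \<in> squares \<A> g f (vid \<A> X) (vid \<A> Z)"
      if f: "f \<in> hhom \<A> X Z" and g: "g \<in> hhom \<A> X Z" for X f g
    proof -
      have X: "X \<in> DObj \<A>" using hhom_DObj f by blast
      have o: "(X, f) \<in> dcoslice_obj ?O Z" "(X, g) \<in> dcoslice_obj ?O Z"
        using f g X by (simp_all add: dcoslice_op_obj)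
      have "\<exists>p\<in>hhom ?K (X, f) (X, g). donh ?P p = hid \<A> X"
        by (rule full[OF o]) (use o hid_hom[OF X] in simp)
      then obtain p where p: "p \<in> dcoslice_hmor ?O Z" "source p = (X, f)" "target p = (X, g)"
        "fst (label p) = hid \<A> X" by (auto simp: hhom_def)
      then have "p = Arrow (X, f) (X, g) (hid \<A> X, snd (label p))"
        by (metis arrow.exhaust_sel prod.collapse)
      with p(1) have "Arrow (X, f) (X, g) (hid \<A> X, snd (label p)) \<in> dcoslice_hmor ?O Z" by simp
      then show ?thesis unfolding dcoslice_op_hmor using hmcomp_id_right[OF f] by auto
    qed
    have ?un
    proof (intro allI ballI)
      fix X Y u f g
      assume u: "u \<in> vhom \<A> X Y" and f: "f \<in> hhom \<A> X Z" and g: "g \<in> hhom \<A> Y Z"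
      have XY: "X \<in> DObj \<A>" "Y \<in> DObj \<A>" using u vhom_DObj by blast+
      have "u \<in> donv ?P ` dcoslice_vmor ?O Z" using u unfolding vsurj by (simp add: vhom_def)
      then obtain w where w: "w \<in> dcoslice_vmor ?O Z" "u = donv ?P w" by (elim imageE)
      obtain X' f0 Y' g0 u' \<gamma>0 where we: "w = Arrow (X', f0) (Y', g0) (u', \<gamma>0)"
        by (metis arrow.exhaust surj_pair)
      have ue: "u' = u" using w we by simp
      note w0 = w(1)[unfolded we ue dcoslice_op_vmor]
      have "X' = X" "Y' = Y" using w0 u by (auto simp: vhom_def)
      with w0 have f0: "f0 \<in> hhom \<A> X Z" and g0: "g0 \<in> hhom \<A> Y Z"
        and \<gamma>0: "\<gamma>0 \<in> squares \<A> f0 g0 u (vid \<A> Z)" by blast+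
      obtain \<psi> where \<psi>: "\<psi> \<in> squares \<A> f f0 (vid \<A> X) (vid \<A> Z)" using iso[OF f0 f] by blast
      obtain \<phi> where \<phi>: "\<phi> \<in> squares \<A> g0 g (vid \<A> Y) (vid \<A> Z)" using iso[OF g g0] by blast
      let ?\<gamma> = "qvcomp \<A> \<phi> (qvcomp \<A> \<gamma>0 \<psi>)"
      have \<gamma>: "?\<gamma> \<in> squares \<A> f g u (vid \<A> Z)"
        using qvcomp_sq[OF qvcomp_sq[OF \<psi> \<gamma>0] \<phi>]
        by (simp add: vmcomp_id_right[OF u] vmcomp_id_left[OF u] vmcomp_id_right[OF vid_hom[OF Z]])
      have "\<gamma>1 = \<gamma>2" if \<gamma>1: "\<gamma>1 \<in> squares \<A> f g u (vid \<A> Z)" and \<gamma>2: "\<gamma>2 \<in> squares \<A> f g u (vid \<A> Z)"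
        for \<gamma>1 \<gamma>2
      proof -
        let ?z = "(Z, hid \<A> Z)"
        let ?a = "Arrow ?z (X, f) (f, qvid \<A> f)" and ?b = "Arrow ?z (Y, g) (g, qvid \<A> g)"
        let ?u = "Arrow ?z ?z (vid \<A> Z, qvid \<A> (hid \<A> Z))" and ?v = "Arrow (X, f) (Y, g) (u, \<gamma>1)"
        have h: "?a \<in> dcoslice_hmor ?O Z" "?b \<in> dcoslice_hmor ?O Z"
          unfolding dcoslice_op_hmor hmcomp_id_left[OF f] hmcomp_id_left[OF g]
          by (intro conjI Z XY f g hid_hom qvid_sq vinv_id[OF f] vinv_id[OF g])+
        have v: "?u \<in> dcoslice_vmor ?O Z" "?v \<in> dcoslice_vmor ?O Z"
          unfolding dcoslice_op_vmor
          by (intro conjI Z XY f g u \<gamma>1 hid_hom vid_hom qvid_sq)+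
        have "boundary ?K ?a ?b ?u ?v" using h v by (simp add: boundary_def)
        then have "\<exists>\<alpha>. \<alpha> \<in> squares ?K ?a ?b ?u ?v \<and> donq ?P \<alpha> = \<gamma>2"
          by (rule ff) (use h v \<gamma>2 in simp)
        then obtain s where s: "s \<in> squares ?K ?a ?b ?u ?v" "donq ?P s = \<gamma>2" by blast
        then have "Square ?a ?b ?u ?v \<gamma>2 \<in> dcoslice_sq ?O Z"
          by (cases s) (simp add: squares_def)
        then have "qvcomp \<A> (qhcomp \<A> (qvid \<A> (hid \<A> Z)) \<gamma>2) (qvid \<A> f) = qvcomp \<A> (qvid \<A> g) \<gamma>1"
          unfolding dcoslice_op_sq by blast
        then show ?thesis
          using qhcomp_id_left[OF Z \<gamma>2] qvcomp_id_left[OF \<gamma>1] qvcomp_id_right[OF \<gamma>2] by simp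
      qed
      with \<gamma> show "\<exists>!\<gamma>. \<gamma> \<in> squares \<A> f g u (vid \<A> Z)" by blast
    qed
    with Z ex show "Z \<in> DObj \<A> \<and> ?ex \<and> ?un" by blast
  next
    assume "Z \<in> DObj \<A> \<and> ?ex \<and> ?un"
    then have Z: "Z \<in> DObj \<A>" and ex: ?ex and un: ?un by blast+
    have eq: "\<beta> = \<gamma>" if "u \<in> vhom \<A> X Y" "f \<in> hhom \<A> X Z" "g \<in> hhom \<A> Y Z"
      "\<beta> \<in> squares \<A> f g u (vid \<A> Z)" "\<gamma> \<in> squares \<A> f g u (vid \<A> Z)" for X Y u f g \<beta> \<gamma>
      using un that by blast
    have vv: "vmcomp \<A> (vid \<A> X) (vid \<A> X) = vid \<A> X" if "X \<in> DObj \<A>" for X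
      by (rule vmcomp_id_right[OF vid_hom[OF that]])
    have surj: "don0 ?P ` DObj ?K = DObj ?O"
    proof
      show "don0 ?P ` DObj ?K \<subseteq> DObj ?O" by (auto simp: dcoslice_op_obj)
      show "DObj ?O \<subseteq> don0 ?P ` DObj ?K"
      proof
        fix X assume X: "X \<in> DObj ?O"
        with ex obtain f where "f \<in> hhom \<A> X Z" by auto
        with X have "(X, f) \<in> dcoslice_obj ?O Z" by (simp add: dcoslice_op_obj)
        then show "X \<in> don0 ?P ` DObj ?K" by (intro image_eqI[of _ _ "(X, f)"]) simp_all
      qed
    qed
    have full: "\<exists>p\<in>hhom ?K x y. donh ?P p = a"
      if x: "x \<in> DObj ?K" and y: "y \<in> DObj ?K" and a: "a \<in> hhom ?O (don0 ?P x) (don0 ?P y)" for x y a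
    proof -
      obtain X f Y g where xy: "x = (X, f)" "y = (Y, g)" by (metis surj_pair)
      have h: "f \<in> hhom \<A> X Z" "g \<in> hhom \<A> Y Z" "X \<in> DObj \<A>" "Y \<in> DObj \<A>" "a \<in> hhom \<A> Y X"
        using x y a by (auto simp: xy dcoslice_op_obj)
      let ?fa = "hmcomp \<A> f a"
      have fa: "?fa \<in> hhom \<A> Y Z" using hmcomp_hom h by blast
      note v = vid_hom[OF h(4)]
      obtain \<psi> where \<psi>: "\<psi> \<in> squares \<A> g ?fa (vid \<A> Y) (vid \<A> Z)" using un v h(2) fa by blast
      obtain \<phi> where \<phi>: "\<phi> \<in> squares \<A> ?fa g (vid \<A> Y) (vid \<A> Z)" using un v h(2) fa by blast
      have inv: "qvcomp \<A> \<phi> \<psi> = qvid \<A> g" "qvcomp \<A> \<psi> \<phi> = qvid \<A> ?fa"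
        using eq[OF v h(2) h(2) qvcomp_sq[OF \<psi> \<phi>, unfolded vv[OF h(4)] vv[OF Z]] qvid_sq[OF h(2)]]
          eq[OF v fa fa qvcomp_sq[OF \<phi> \<psi>, unfolded vv[OF h(4)] vv[OF Z]] qvid_sq[OF fa]] by blast+
      have "vert_invertible \<A> \<psi>" by (rule vert_invertibleI[OF \<psi> \<phi> h(2) inv])
      with h \<psi> have p: "Arrow (X, f) (Y, g) (a, \<psi>) \<in> dcoslice_hmor ?O Z"
        by (simp add: dcoslice_op_hmor)
      then show ?thesis
        by (intro bexI[of _ "Arrow (X, f) (Y, g) (a, \<psi>)"]) (simp_all add: hhom_def xy)
    qed
    have vsurj: "donv ?P ` VMor ?K = VMor ?O"
    proof
      show "donv ?P ` VMor ?K \<subseteq> VMor ?O"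
        by (auto simp: dcoslice_vmor_def dcoslice_proj_def vhom_def)
      show "VMor ?O \<subseteq> donv ?P ` VMor ?K"
      proof
        fix u assume "u \<in> VMor ?O"
        then obtain X Y where u: "u \<in> vhom \<A> X Y" by (auto simp: vhom_def)
        then have XY: "X \<in> DObj \<A>" "Y \<in> DObj \<A>" using vhom_DObj by blast+
        with ex obtain f g where f: "f \<in> hhom \<A> X Z" and g: "g \<in> hhom \<A> Y Z" by blast
        with un u obtain \<gamma> where "\<gamma> \<in> squares \<A> f g u (vid \<A> Z)" by blast
        with u f g XY have "Arrow (X, f) (Y, g) (u, \<gamma>) \<in> dcoslice_vmor ?O Z"
          by (simp add: dcoslice_op_vmor)
        then show "u \<in> donv ?P ` VMor ?K"
          by (intro image_eqI[of _ _ "Arrow (X, f) (Y, g) (u, \<gamma>)"]) simp_all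
      qed
    qed
    have ff: "\<exists>!\<alpha>. \<alpha> \<in> squares ?K p q r s \<and> donq ?P \<alpha> = \<beta>"
      if bd: "boundary ?K p q r s"
        and \<beta>: "\<beta> \<in> squares ?O (donh ?P p) (donh ?P q) (donv ?P r) (donv ?P s)" for p q r s \<beta>
    proof -
      obtain X f X' f' a \<psi> where pe: "p = Arrow (X, f) (X', f') (a, \<psi>)" by (metis arrow.exhaust surj_pair)
      obtain Y g Y' g' b \<phi> where qe: "q = Arrow (Y, g) (Y', g') (b, \<phi>)" by (metis arrow.exhaust surj_pair)
      obtain u \<gamma> where re: "r = Arrow (X, f) (Y, g) (u, \<gamma>)"
        using bd by (cases r) (auto simp: boundary_def pe qe)
      obtain u' \<gamma>' where se: "s = Arrow (X', f') (Y', g') (u', \<gamma>')"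
        using bd by (cases s) (auto simp: boundary_def pe qe)
      have m: "p \<in> dcoslice_hmor ?O Z" "q \<in> dcoslice_hmor ?O Z" "r \<in> dcoslice_vmor ?O Z"
        "s \<in> dcoslice_vmor ?O Z" using bd by (simp_all add: boundary_def)
      have \<beta>: "\<beta> \<in> squares \<A> a b u' u" using \<beta> m by (simp add: pe qe re se)
      note p = m(1)[unfolded pe dcoslice_op_hmor] and q = m(2)[unfolded qe dcoslice_op_hmor]
        and r = m(3)[unfolded re dcoslice_op_vmor] and s = m(4)[unfolded se dcoslice_op_vmor]
      have u': "u' \<in> vhom \<A> X' Y'" using s by blast
      have "qvcomp \<A> (qhcomp \<A> \<gamma> \<beta>) \<psi> = qvcomp \<A> \<phi> \<gamma>'"
      proof (rule eq[OF u'])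
        have "\<psi> \<in> squares \<A> f' (hmcomp \<A> f a) (vid \<A> X') (vid \<A> Z)"
          "\<gamma> \<in> squares \<A> f g u (vid \<A> Z)" using p r by blast+
        from qvcomp_sq[OF this(1) qhcomp_sq[OF \<beta> this(2)]]
        show "qvcomp \<A> (qhcomp \<A> \<gamma> \<beta>) \<psi> \<in> squares \<A> f' (hmcomp \<A> g b) u' (vid \<A> Z)"
          by (simp add: vv[OF Z] vmcomp_id_right[OF u'])
        have "\<phi> \<in> squares \<A> g' (hmcomp \<A> g b) (vid \<A> Y') (vid \<A> Z)"
          "\<gamma>' \<in> squares \<A> f' g' u' (vid \<A> Z)" using q s by blast+
        from qvcomp_sq[OF this(2,1)]
        show "qvcomp \<A> \<phi> \<gamma>' \<in> squares \<A> f' (hmcomp \<A> g b) u' (vid \<A> Z)"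
          by (simp add: vv[OF Z] vmcomp_id_left[OF u'])
        show "f' \<in> hhom \<A> X' Z" "hmcomp \<A> g b \<in> hhom \<A> Y' Z" using p q hmcomp_hom by blast+
      qed
      then have sq: "Square p q r s \<beta> \<in> dcoslice_sq ?O Z"
        using m \<beta> by (simp add: pe qe re se dcoslice_op_sq)
      show ?thesis
      proof (rule ex1I[of _ "Square p q r s \<beta>"])
        show "Square p q r s \<beta> \<in> squares ?K p q r s \<and> donq ?P (Square p q r s \<beta>) = \<beta>"
          using sq by (simp add: squares_def)
        show "\<alpha> = Square p q r s \<beta>" if "\<alpha> \<in> squares ?K p q r s \<and> donq ?P \<alpha> = \<beta>" for \<alpha>
          using that by (cases \<alpha>) (auto simp: squares_def)
      qed
    qed
    show "double_bi_terminal \<A> Z"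
      unfolding double_bi_terminal_def double_bi_initial_def double_trivial_fibration_def
      by (intro conjI ballI allI impI surj vsurj full ff) (simp_all add: Z)
  }
qed

section \<open>Pseudo-slices\<close>

lemma pslice_obj_iff:
  "x \<in> pslice_obj B A L D \<longleftrightarrow> fst x \<in> Obj B \<and> snd x \<in> hom1 A (on0 L (fst x)) D"
  by (cases x) (simp add: pslice_obj_def)

lemma pslice_mor_iff:
  "p \<in> pslice_mor B A L D \<longleftrightarrow> source p \<in> pslice_obj B A L D \<and> target p \<in> pslice_obj B A L D \<and>
    fst (label p) \<in> hom1 B (fst (source p)) (fst (target p)) \<and>
    snd (label p) \<in> hom2 A (snd (target p) \<cdot>\<^bsub>A\<^esub> on1 L (fst (label p))) (snd (source p)) \<and>
    invertible2 A (snd (label p))"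
proof (cases p)
  case (Arrow x y l)
  then show ?thesis by (cases x; cases y; cases l) (auto simp: pslice_mor_def)
qed

lemma pslice_vmor_iff:
  "u \<in> pslice_vmor B A L D \<longleftrightarrow> source u \<in> pslice_obj B A L D \<and> target u \<in> pslice_obj B A L D \<and>
    fst (source u) = fst (target u) \<and> label u \<in> hom2 A (snd (source u)) (snd (target u))"
proof (cases u)
  case (Arrow x y l)
  then show ?thesis by (cases x; cases y) (auto simp: pslice_vmor_def)
qed

lemma pslice_sq_iff:
  "s \<in> pslice_sq B A L D \<longleftrightarrow>
    top_of s \<in> pslice_mor B A L D \<and> bot_of s \<in> pslice_mor B A L D \<and>
    left_of s \<in> pslice_vmor B A L D \<and> right_of s \<in> pslice_vmor B A L D \<and>
    source (left_of s) = source (top_of s) \<and> target (left_of s) = source (bot_of s) \<and>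
    source (right_of s) = target (top_of s) \<and> target (right_of s) = target (bot_of s) \<and>
    label_of s \<in> hom2 B (fst (label (top_of s))) (fst (label (bot_of s))) \<and>
    label (left_of s) \<bullet>\<^bsub>A\<^esub> snd (label (top_of s)) =
      snd (label (bot_of s)) \<bullet>\<^bsub>A\<^esub> (label (right_of s) \<star>\<^bsub>A\<^esub> on2 L (label_of s))"
proof (cases s)
  case (Square t b l r g)
  obtain x x' c \<Psi> where "t = Arrow x x' (c, \<Psi>)" by (metis arrow.exhaust surj_pair)
  moreover obtain y y' d \<Phi> where "b = Arrow y y' (d, \<Phi>)" by (metis arrow.exhaust surj_pair)
  ultimately show ?thesis using Square by (cases l; cases r) (auto simp: pslice_sq_def)
qed

lemma Cell_pslice_iff:
  "s \<in> Cell (pslice B A L D) \<longleftrightarrow>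
    source s \<in> pslice_mor B A L D \<and> target s \<in> pslice_mor B A L D \<and>
    source (target s) = source (source s) \<and> target (target s) = target (source s) \<and>
    label s \<in> hom2 B (fst (label (source s))) (fst (label (target s))) \<and>
    snd (label (target s)) \<bullet>\<^bsub>A\<^esub> (id2 A (snd (target (source s))) \<star>\<^bsub>A\<^esub> on2 L (label s)) =
      snd (label (source s))"
proof (cases s)
  case (Arrow p q g)
  obtain x f x' f' c \<Psi> where "p = Arrow (x, f) (x', f') (c, \<Psi>)" by (metis arrow.exhaust surj_pair)
  moreover obtain y g y' g' d \<Phi> where "q = Arrow (y, g) (y', g') (d, \<Phi>)" by (metis arrow.exhaust surj_pair)
  ultimately show ?thesis using Arrow by (auto simp: pslice_def)
qed

lemma pslice_sel [simp]:
  "Obj (pslice B A L D) = pslice_obj B A L D" "Mor (pslice B A L D) = pslice_mor B A L D"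
  "src (pslice B A L D) = source" "tgt (pslice B A L D) = target"
  "dom2 (pslice B A L D) = source" "cod2 (pslice B A L D) = target"
  "id1 (pslice B A L D) x = Arrow x x (id1 B (fst x), id2 A (snd x))"
  "id2 (pslice B A L D) p = Arrow p p (id2 B (fst (label p)))"
  "comp (pslice B A L D) = pslice_comp B A L"
  "s \<bullet>\<^bsub>pslice B A L D\<^esub> r = Arrow (source r) (target s) (label s \<bullet>\<^bsub>B\<^esub> label r)"
  "s \<star>\<^bsub>pslice B A L D\<^esub> r = Arrow (pslice_comp B A L (source s) (source r))
       (pslice_comp B A L (target s) (target r)) (label s \<star>\<^bsub>B\<^esub> label r)"
  by (simp_all add: pslice_def case_prod_beta)

lemma pslice_dbl_sel [simp]:
  "DObj (pslice_dbl B A L D) = pslice_obj B A L D" "HMor (pslice_dbl B A L D) = pslice_mor B A L D"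
  "VMor (pslice_dbl B A L D) = pslice_vmor B A L D" "Sq (pslice_dbl B A L D) = pslice_sq B A L D"
  "hsrc (pslice_dbl B A L D) = source" "htgt (pslice_dbl B A L D) = target"
  "vsrc (pslice_dbl B A L D) = source" "vtgt (pslice_dbl B A L D) = target"
  "qtop (pslice_dbl B A L D) = top_of" "qbot (pslice_dbl B A L D) = bot_of"
  "qleft (pslice_dbl B A L D) = left_of" "qright (pslice_dbl B A L D) = right_of"
  "hid (pslice_dbl B A L D) x = Arrow x x (id1 B (fst x), id2 A (snd x))"
  "vid (pslice_dbl B A L D) x = Arrow x x (id2 A (snd x))"
  "hmcomp (pslice_dbl B A L D) = pslice_comp B A L"
  "vmcomp (pslice_dbl B A L D) v u = Arrow (source u) (target v) (label v \<bullet>\<^bsub>A\<^esub> label u)"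
  "qvid (pslice_dbl B A L D) p = Square p p (Arrow (source p) (source p) (id2 A (snd (source p))))
     (Arrow (target p) (target p) (id2 A (snd (target p)))) (id2 B (fst (label p)))"
  "qhcomp (pslice_dbl B A L D) s r =
     Square (pslice_comp B A L (top_of s) (top_of r)) (pslice_comp B A L (bot_of s) (bot_of r))
       (left_of r) (right_of s) (label_of s \<star>\<^bsub>B\<^esub> label_of r)"
  "qvcomp (pslice_dbl B A L D) s r = Square (top_of r) (bot_of s)
     (Arrow (source (left_of r)) (target (left_of s)) (label (left_of s) \<bullet>\<^bsub>A\<^esub> label (left_of r)))
     (Arrow (source (right_of r)) (target (right_of s)) (label (right_of s) \<bullet>\<^bsub>A\<^esub> label (right_of r)))
     (label_of s \<bullet>\<^bsub>B\<^esub> label_of r)"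
  by (simp_all add: pslice_dbl_def Let_def case_prod_beta)

lemma pslice_comp_sel [simp]:
  "source (pslice_comp B A L q p) = source p" "target (pslice_comp B A L q p) = target q"
  "fst (label (pslice_comp B A L q p)) = fst (label q) \<cdot>\<^bsub>B\<^esub> fst (label p)"
  "snd (label (pslice_comp B A L q p)) = snd (label p) \<bullet>\<^bsub>A\<^esub>
     (snd (label q) \<star>\<^bsub>A\<^esub> id2 A (on1 L (fst (label p)))) \<bullet>\<^bsub>A\<^esub>
     (id2 A (snd (target q)) \<star>\<^bsub>A\<^esub> inv2 A (cpt L (fst (label q), fst (label p))))"
  by (simp_all add: pslice_comp_def Let_def case_prod_beta)

locale pseudo_slice = B: two_category B + A: two_category A + L: psfunctor B A L
  for B :: "('o, 'm, 't) two_cat" and A :: "('o', 'm', 't') two_cat" (structure)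
    and L :: "('o, 'm, 't, 'o', 'm', 't') psfun" +
  fixes D :: 'o'
begin

abbreviation obj where "obj \<equiv> pslice_obj B A L D"
abbreviation mor where "mor \<equiv> pslice_mor B A L D"
abbreviation vmor where "vmor \<equiv> pslice_vmor B A L D"

lemma objD:
  assumes "x \<in> obj"
  shows "fst x \<in> Obj B" "snd x \<in> Mor A" "src A (snd x) = on0 L (fst x)" "tgt A (snd x) = D"
  using assms by (simp_all add: pslice_obj_iff hom1_def)

lemma morD:
  assumes "p \<in> mor"
  shows "source p \<in> obj" "target p \<in> obj" "fst (label p) \<in> Mor B"
    "src B (fst (label p)) = fst (source p)" "tgt B (fst (label p)) = fst (target p)"
    "snd (label p) \<in> Cell A" "dom2 A (snd (label p)) = snd (target p) \<cdot> on1 L (fst (label p))"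
    "cod2 A (snd (label p)) = snd (source p)" "invertible2 A (snd (label p))"
  using assms by (simp_all add: pslice_mor_iff hom1_def hom2_def)

lemma vmorD:
  assumes "u \<in> vmor"
  shows "source u \<in> obj" "target u \<in> obj" "fst (target u) = fst (source u)"
    "label u \<in> Cell A" "dom2 A (label u) = snd (source u)" "cod2 A (label u) = snd (target u)"
  using assms by (simp_all add: pslice_vmor_iff hom2_def)

lemma morI:
  assumes "source p \<in> obj" "target p \<in> obj" "fst (label p) \<in> Mor B"
    "src B (fst (label p)) = fst (source p)" "tgt B (fst (label p)) = fst (target p)"
    "dom2 A (snd (label p)) = snd (target p) \<cdot> on1 L (fst (label p))"
    "cod2 A (snd (label p)) = snd (source p)" "invertible2 A (snd (label p))"
  shows "p \<in> mor"
  using assms A.invertible2_Cell by (simp add: pslice_mor_iff hom1_def hom2_def)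

lemma id1_mor: "x \<in> obj \<Longrightarrow> Arrow x x (id1 B (fst x), id2 A (snd x)) \<in> mor"
  using objD[of x] by (intro morI) simp_all

lemma comp_mor:
  assumes p: "p \<in> mor" and q: "q \<in> mor" and t: "target p = source q"
  shows "pslice_comp B A L q p \<in> mor"
proof -
  note [simp] = morD[OF p] morD[OF q] objD[OF morD(1)[OF p]] objD[OF morD(1)[OF q]]
    objD[OF morD(2)[OF q]] t
  show ?thesis by (rule morI) simp_all
qed

lemma comp_id_mor:
  assumes p: "p \<in> mor"
  shows "target p = x \<Longrightarrow> pslice_comp B A L (Arrow x x (id1 B (fst x), id2 A (snd x))) p = p"
    and "source p = x \<Longrightarrow> pslice_comp B A L p (Arrow x x (id1 B (fst x), id2 A (snd x))) = p"
proof -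
  note [simp] = morD[OF p] objD[OF morD(1)[OF p]] objD[OF morD(2)[OF p]]
  show "pslice_comp B A L (Arrow x x (id1 B (fst x), id2 A (snd x))) p = p" if "target p = x"
    by (rule arrow_eqI) (simp_all add: prod_eq_iff flip: that)
  show "pslice_comp B A L p (Arrow x x (id1 B (fst x), id2 A (snd x))) = p" if "source p = x"
    by (rule arrow_eqI) (simp_all add: prod_eq_iff flip: that)
qed

text \<open>
  Horizontal pasting of two squares of the slice double category. Naturality moves the compositor of
  \<open>L\<close> past \<open>L (\<gamma>' * \<gamma>)\<close>; the rest is interchange and the two given squares. With identities for \<open>\<Theta>\<close>, \<open>\<Theta>'\<close>
  and \<open>\<Theta>''\<close> it is also the horizontal composition of 2-morphisms of the slice 2-category.
\<close>

lemma slice_square_hcomp: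
  assumes \<gamma>: "\<gamma> \<in> Cell B" "\<gamma>' \<in> Cell B" "tgt B (dom2 B \<gamma>) = src B (dom2 B \<gamma>')"
    and \<Theta>: "\<Theta> \<in> hom2 A f g" "\<Theta>' \<in> hom2 A f' g'" "\<Theta>'' \<in> hom2 A f'' g''"
    and f: "f \<in> hom1 A (on0 L (src B (dom2 B \<gamma>))) D" "f' \<in> hom1 A (on0 L (tgt B (dom2 B \<gamma>))) D"
      "f'' \<in> hom1 A (on0 L (tgt B (dom2 B \<gamma>'))) D"
    and \<Psi>: "\<Psi> \<in> hom2 A (f' \<cdot> on1 L (dom2 B \<gamma>)) f" "\<Psi>' \<in> hom2 A (f'' \<cdot> on1 L (dom2 B \<gamma>')) f'"
    and \<Phi>: "\<Phi> \<in> hom2 A (g' \<cdot> on1 L (cod2 B \<gamma>)) g" "\<Phi>' \<in> hom2 A (g'' \<cdot> on1 L (cod2 B \<gamma>')) g'"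
    and 1: "\<Theta> \<bullet> \<Psi> = \<Phi> \<bullet> (\<Theta>' \<star> on2 L \<gamma>)"
    and 2: "\<Theta>' \<bullet> \<Psi>' = \<Phi>' \<bullet> (\<Theta>'' \<star> on2 L \<gamma>')"
  shows "\<Theta> \<bullet> (\<Psi> \<bullet> (\<Psi>' \<star> id2 A (on1 L (dom2 B \<gamma>))) \<bullet>
      (id2 A f'' \<star> inv2 A (cpt L (dom2 B \<gamma>', dom2 B \<gamma>)))) =
    (\<Phi> \<bullet> (\<Phi>' \<star> id2 A (on1 L (cod2 B \<gamma>))) \<bullet>
      (id2 A g'' \<star> inv2 A (cpt L (cod2 B \<gamma>', cod2 B \<gamma>)))) \<bullet> (\<Theta>'' \<star> on2 L (\<gamma>' \<star>\<^bsub>B\<^esub> \<gamma>))"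
proof -
  define c d c' d' where cd: "c = dom2 B \<gamma>" "d = cod2 B \<gamma>" "c' = dom2 B \<gamma>'" "d' = cod2 B \<gamma>'"
  have [simp]: "\<gamma> \<in> Cell B" "\<gamma>' \<in> Cell B" "c \<in> Mor B" "d \<in> Mor B" "c' \<in> Mor B" "d' \<in> Mor B"
    "tgt B c = src B c'" "dom2 B \<gamma> = c" "cod2 B \<gamma> = d" "dom2 B \<gamma>' = c'" "cod2 B \<gamma>' = d'"
    using \<gamma> by (simp_all add: cd)
  have [simp]: "src B d = src B c" "tgt B d = src B c'" "src B d' = src B c'" "tgt B d' = tgt B c'"
    using B.src_cod2[of \<gamma>] B.tgt_cod2[of \<gamma>] B.src_cod2[of \<gamma>'] B.tgt_cod2[of \<gamma>'] by simp_all
  have [simp]: "f \<in> Mor A" "f' \<in> Mor A" "f'' \<in> Mor A" "src A f = on0 L (src B c)"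
    "src A f' = on0 L (src B c')" "src A f'' = on0 L (tgt B c')" "tgt A f = D" "tgt A f' = D" "tgt A f'' = D"
    using f by (simp_all add: hom1_def)
  have t [simp]: "\<Theta> \<in> Cell A" "\<Theta>' \<in> Cell A" "\<Theta>'' \<in> Cell A" "dom2 A \<Theta> = f" "dom2 A \<Theta>' = f'" "dom2 A \<Theta>'' = f''"
    "cod2 A \<Theta> = g" "cod2 A \<Theta>' = g'" "cod2 A \<Theta>'' = g''"
    using \<Theta> by (simp_all add: hom2_def)
  have [simp]: "g \<in> Mor A" "g' \<in> Mor A" "g'' \<in> Mor A" "src A g = on0 L (src B c)"
    "src A g' = on0 L (src B c')" "src A g'' = on0 L (tgt B c')" "tgt A g = D" "tgt A g' = D" "tgt A g'' = D"
    using A.Cell_cod2[OF t(1)] A.Cell_cod2[OF t(2)] A.Cell_cod2[OF t(3)]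
      A.src_cod2[OF t(1)] A.src_cod2[OF t(2)] A.src_cod2[OF t(3)]
      A.tgt_cod2[OF t(1)] A.tgt_cod2[OF t(2)] A.tgt_cod2[OF t(3)] by simp_all
  have [simp]: "\<Psi> \<in> Cell A" "\<Psi>' \<in> Cell A" "\<Phi> \<in> Cell A" "\<Phi>' \<in> Cell A"
    "dom2 A \<Psi> = f' \<cdot> on1 L c" "cod2 A \<Psi> = f" "dom2 A \<Psi>' = f'' \<cdot> on1 L c'" "cod2 A \<Psi>' = f'"
    "dom2 A \<Phi> = g' \<cdot> on1 L d" "cod2 A \<Phi> = g" "dom2 A \<Phi>' = g'' \<cdot> on1 L d'" "cod2 A \<Phi>' = g'"
    using \<Psi> \<Phi> by (simp_all add: hom2_def)
  let ?i = "inv2 A (cpt L (c', c))" and ?j = "inv2 A (cpt L (d', d))"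
  have n: "cpt L (d', d) \<bullet> (on2 L \<gamma>' \<star> on2 L \<gamma>) = on2 L (\<gamma>' \<star>\<^bsub>B\<^esub> \<gamma>) \<bullet> cpt L (c', c)"
    using L.cpt_natural[of \<gamma> \<gamma>'] by simp
  have "?j \<bullet> on2 L (\<gamma>' \<star>\<^bsub>B\<^esub> \<gamma>) = ?j \<bullet> ((on2 L (\<gamma>' \<star>\<^bsub>B\<^esub> \<gamma>) \<bullet> cpt L (c', c)) \<bullet> ?i)"
    by simp
  also have "\<dots> = (on2 L \<gamma>' \<star> on2 L \<gamma>) \<bullet> ?i" unfolding n[symmetric] by simp
  finally have n': "?j \<bullet> on2 L (\<gamma>' \<star>\<^bsub>B\<^esub> \<gamma>) = (on2 L \<gamma>' \<star> on2 L \<gamma>) \<bullet> ?i" .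
  have s1: "(id2 A g'' \<star> ?j) \<bullet> (\<Theta>'' \<star> on2 L (\<gamma>' \<star>\<^bsub>B\<^esub> \<gamma>)) =
      (\<Theta>'' \<star> on2 L \<gamma>' \<star> on2 L \<gamma>) \<bullet> (id2 A f'' \<star> ?i)"
    using A.interchange'[of "on2 L (\<gamma>' \<star>\<^bsub>B\<^esub> \<gamma>)" ?j \<Theta>'' "id2 A g''"]
      A.interchange'[of ?i "on2 L \<gamma>' \<star> on2 L \<gamma>" "id2 A f''" \<Theta>''] by (simp add: n')
  have s2: "(\<Phi>' \<star> id2 A (on1 L d)) \<bullet> (\<Theta>'' \<star> on2 L \<gamma>' \<star> on2 L \<gamma>) =
      (\<Theta>' \<star> on2 L \<gamma>) \<bullet> (\<Psi>' \<star> id2 A (on1 L c))"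
    using A.interchange'[of "on2 L \<gamma>" "id2 A (on1 L d)" "\<Theta>'' \<star> on2 L \<gamma>'" \<Phi>']
      A.interchange'[of "id2 A (on1 L c)" "on2 L \<gamma>" \<Psi>' \<Theta>'] by (simp add: 2)
  have "(\<Phi> \<bullet> (\<Phi>' \<star> id2 A (on1 L d)) \<bullet> (id2 A g'' \<star> ?j)) \<bullet> (\<Theta>'' \<star> on2 L (\<gamma>' \<star>\<^bsub>B\<^esub> \<gamma>)) =
    \<Phi> \<bullet> (\<Phi>' \<star> id2 A (on1 L d)) \<bullet> ((id2 A g'' \<star> ?j) \<bullet> (\<Theta>'' \<star> on2 L (\<gamma>' \<star>\<^bsub>B\<^esub> \<gamma>)))"
    by simp
  also have "\<dots> = \<Phi> \<bullet> ((\<Phi>' \<star> id2 A (on1 L d)) \<bullet> (\<Theta>'' \<star> on2 L \<gamma>' \<star> on2 L \<gamma>)) \<bullet> (id2 A f'' \<star> ?i)"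
    unfolding s1 by simp
  also have "\<dots> = (\<Phi> \<bullet> (\<Theta>' \<star> on2 L \<gamma>)) \<bullet> (\<Psi>' \<star> id2 A (on1 L c)) \<bullet> (id2 A f'' \<star> ?i)"
    unfolding s2 by simp
  also have "\<dots> = \<Theta> \<bullet> (\<Psi> \<bullet> (\<Psi>' \<star> id2 A (on1 L c)) \<bullet> (id2 A f'' \<star> ?i))"
    unfolding 1[symmetric] by simp
  finally show ?thesis unfolding cd by simp
qed

lemma unital_two_graph_pslice: "unital_two_graph (pslice B A L D)"
proof
  fix x y w :: "'o \<times> 'm'" and p q r p' :: "('o, 'm', 'm, 't') slice_mor"
    and \<alpha> \<beta> :: "('o, 'm', 'm, 't', 't) slice_cell"
  note [simp] = hom1_def hom2_def comp_mor id1_mor comp_id_mor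
  let ?S = "pslice B A L D"
  show "x \<in> Obj ?S \<Longrightarrow> id1 ?S x \<in> hom1 ?S x x" by simp
  show "p \<in> hom1 ?S x y \<Longrightarrow> x \<in> Obj ?S \<and> y \<in> Obj ?S" by (auto dest: morD)
  show "p \<in> hom1 ?S x y \<Longrightarrow> q \<in> hom1 ?S y w \<Longrightarrow> q \<cdot>\<^bsub>?S\<^esub> p \<in> hom1 ?S x w" by simp
  show "p \<in> hom1 ?S x y \<Longrightarrow> id1 ?S y \<cdot>\<^bsub>?S\<^esub> p = p" "p \<in> hom1 ?S x y \<Longrightarrow> p \<cdot>\<^bsub>?S\<^esub> id1 ?S x = p" by simp_all
  show "id2 ?S p \<in> hom2 ?S p p" if "p \<in> hom1 ?S x y"
  proof -
    from that have p: "p \<in> mor" by simp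
    note [simp] = morD[OF p] objD[OF morD(1)[OF p]] objD[OF morD(2)[OF p]]
    show ?thesis using p by (simp add: Cell_pslice_iff)
  qed
  show "\<beta> \<bullet>\<^bsub>?S\<^esub> \<alpha> \<in> hom2 ?S p r" if ab: "\<alpha> \<in> hom2 ?S p q" "\<beta> \<in> hom2 ?S q r"
  proof -
    have a: "source \<alpha> = p" "target \<alpha> = q" "source \<beta> = q" "target \<beta> = r"
      "\<alpha> \<in> Cell ?S" "\<beta> \<in> Cell ?S" using ab by auto
    note c = a(5,6)[unfolded Cell_pslice_iff a(1-4)]
    have m: "p \<in> mor" "q \<in> mor" "r \<in> mor" using c by auto
    note [simp] = morD[OF m(1)] morD[OF m(2)] morD[OF m(3)]
      objD[OF morD(1)[OF m(1)]] objD[OF morD(2)[OF m(1)]]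
    have [simp]: "source q = source p" "target q = target p" "source r = source p" "target r = target p"
      using c by auto
    have lab [simp]: "label \<alpha> \<in> Cell B" "label \<beta> \<in> Cell B" "dom2 B (label \<alpha>) = fst (label p)"
      "cod2 B (label \<alpha>) = fst (label q)" "dom2 B (label \<beta>) = fst (label q)"
      "cod2 B (label \<beta>) = fst (label r)" using c by auto
    let ?f = "id2 A (snd (target p))"
    have 1: "snd (label q) \<bullet> (?f \<star> on2 L (label \<alpha>)) = snd (label p)"
      and 2: "snd (label r) \<bullet> (?f \<star> on2 L (label \<beta>)) = snd (label q)"
      using c by auto
    have "snd (label r) \<bullet> (?f \<star> on2 L (label \<beta> \<bullet>\<^bsub>B\<^esub> label \<alpha>)) =
      (snd (label r) \<bullet> (?f \<star> on2 L (label \<beta>))) \<bullet> (?f \<star> on2 L (label \<alpha>))"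
      by (simp add: L.on2_vcomp A.whisker_left)
    also have "\<dots> = snd (label p)" unfolding 2 1 ..
    finally show ?thesis using m a by (simp add: Cell_pslice_iff)
  qed
  show "\<alpha> \<bullet>\<^bsub>?S\<^esub> id2 ?S p = \<alpha>" if "\<alpha> \<in> hom2 ?S p q"
    using that by (intro arrow_eqI) (auto simp: Cell_pslice_iff)
  show "id2 ?S (id1 ?S y) \<star>\<^bsub>?S\<^esub> \<alpha> = \<alpha>" if pq: "p \<in> hom1 ?S x y" "q \<in> hom1 ?S x y" "\<alpha> \<in> hom2 ?S p q"
  proof -
    have p: "p \<in> mor" and l: "label \<alpha> \<in> Cell B" "dom2 B (label \<alpha>) = fst (label p)"
      using pq by (auto simp: Cell_pslice_iff)
    then show ?thesis using pq morD[OF p] by (intro arrow_eqI) auto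
  qed
  show "id2 ?S q \<star>\<^bsub>?S\<^esub> \<alpha> \<in> hom2 ?S (q \<cdot>\<^bsub>?S\<^esub> p) (q \<cdot>\<^bsub>?S\<^esub> p')"
    if h: "p \<in> hom1 ?S x y" "q \<in> hom1 ?S y w" "p' \<in> hom1 ?S x y" "\<alpha> \<in> hom2 ?S p p'"
  proof -
    have m: "p \<in> mor" "q \<in> mor" "p' \<in> mor" and e: "source p = x" "target p = y" "source q = y"
      "target q = w" "source p' = x" "target p' = y" "source \<alpha> = p" "target \<alpha> = p'"
      and c: "\<alpha> \<in> Cell ?S"
      using h by simp_all
    note [simp] = morD[OF m(1), unfolded e] morD[OF m(2), unfolded e] morD[OF m(3), unfolded e]
      objD[OF morD(1)[OF m(1)], unfolded e] objD[OF morD(2)[OF m(1)], unfolded e]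
      objD[OF morD(2)[OF m(2)], unfolded e] e
    have lab [simp]: "label \<alpha> \<in> Cell B" "dom2 B (label \<alpha>) = fst (label p)"
      "cod2 B (label \<alpha>) = fst (label p')" using c by (auto simp: Cell_pslice_iff)
    let ?q = "fst (label q)"
    have "id2 A (snd x) \<bullet> (snd (label p) \<bullet> (snd (label q) \<star> id2 A (on1 L (dom2 B (label \<alpha>)))) \<bullet>
        (id2 A (snd w) \<star> inv2 A (cpt L (dom2 B (id2 B ?q), dom2 B (label \<alpha>))))) =
      (snd (label p') \<bullet> (snd (label q) \<star> id2 A (on1 L (cod2 B (label \<alpha>)))) \<bullet>
        (id2 A (snd w) \<star> inv2 A (cpt L (cod2 B (id2 B ?q), cod2 B (label \<alpha>))))) \<bullet>
        (id2 A (snd w) \<star> on2 L (id2 B ?q \<star>\<^bsub>B\<^esub> label \<alpha>))"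
      by (rule slice_square_hcomp[where f = "snd x" and f' = "snd y" and g' = "snd y" and \<Theta>' = "id2 A (snd y)"])
        (use c in \<open>simp_all add: Cell_pslice_iff\<close>)
    then have "snd (label (pslice_comp B A L q p)) =
      snd (label (pslice_comp B A L q p')) \<bullet> (id2 A (snd w) \<star> on2 L (id2 B ?q \<star>\<^bsub>B\<^esub> label \<alpha>))"
      by simp
    then show ?thesis using m by (simp add: Cell_pslice_iff)
  qed
qed

lemma id_vmor: "x \<in> obj \<Longrightarrow> Arrow x x (id2 A (snd x)) \<in> vmor"
  using objD[of x] by (simp add: pslice_vmor_iff hom2_def)

lemma pslice_squares:
  "s \<in> squares (pslice_dbl B A L D) p q u v \<longleftrightarrow> s = Square p q u v (label_of s) \<and>
    p \<in> mor \<and> q \<in> mor \<and> u \<in> vmor \<and> v \<in> vmor \<and>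
    source u = source p \<and> target u = source q \<and> source v = target p \<and> target v = target q \<and>
    label_of s \<in> hom2 B (fst (label p)) (fst (label q)) \<and>
    label u \<bullet> snd (label p) = snd (label q) \<bullet> (label v \<star> on2 L (label_of s))"
  by (cases s) (auto simp: squares_def pslice_sq_iff)

lemma pslice_squaresD:
  assumes "s \<in> squares (pslice_dbl B A L D) p q u v"
  shows "p \<in> mor" "q \<in> mor" "u \<in> vmor" "v \<in> vmor"
    "source u = source p" "target u = source q" "source v = target p" "target v = target q"
    "label_of s \<in> Cell B" "dom2 B (label_of s) = fst (label p)" "cod2 B (label_of s) = fst (label q)"
    "label u \<bullet> snd (label p) = snd (label q) \<bullet> (label v \<star> on2 L (label_of s))"
  using assms unfolding pslice_squares hom2_def by blast+

lemma unital_double_graph_pslice_dbl: "unital_double_graph (pslice_dbl B A L D)"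
proof
  fix x y w :: "'o \<times> 'm'" and p q r p' q' :: "('o, 'm', 'm, 't') slice_mor"
    and u v u' v' w' :: "('o \<times> 'm', 't') arrow"
    and \<alpha> \<beta> :: "(('o, 'm', 'm, 't') slice_mor, ('o \<times> 'm', 't') arrow, 't) square"
  note [simp] = hhom_def vhom_def comp_mor id1_mor comp_id_mor id_vmor
  let ?S = "pslice_dbl B A L D"
  show "x \<in> DObj ?S \<Longrightarrow> hid ?S x \<in> hhom ?S x x" by simp
  show "x \<in> DObj ?S \<Longrightarrow> vid ?S x \<in> vhom ?S x x" by simp
  show "p \<in> hhom ?S x y \<Longrightarrow> x \<in> DObj ?S \<and> y \<in> DObj ?S" by (auto dest: morD)
  show "u \<in> vhom ?S x y \<Longrightarrow> x \<in> DObj ?S \<and> y \<in> DObj ?S" by (auto dest: vmorD)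
  show "p \<in> hhom ?S x y \<Longrightarrow> q \<in> hhom ?S y w \<Longrightarrow> hmcomp ?S q p \<in> hhom ?S x w" by simp
  show "p \<in> hhom ?S x y \<Longrightarrow> hmcomp ?S (hid ?S y) p = p"
    "p \<in> hhom ?S x y \<Longrightarrow> hmcomp ?S p (hid ?S x) = p" by simp_all
  show "vmcomp ?S (vid ?S y) u = u" "vmcomp ?S u (vid ?S x) = u" if "u \<in> vhom ?S x y"
  proof -
    from that have u: "u \<in> vmor" "source u = x" "target u = y" by simp_all
    show "vmcomp ?S (vid ?S y) u = u" "vmcomp ?S u (vid ?S x) = u"
      by (rule arrow_eqI; use u vmorD[OF u(1)] in simp)+
  qed
  show "qvid ?S p \<in> squares ?S p p (vid ?S x) (vid ?S y)" if "p \<in> hhom ?S x y"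
  proof -
    have p: "p \<in> mor" "source p = x" "target p = y" using that by simp_all
    note [simp] = morD[OF p(1), unfolded p(2,3)] objD[OF morD(1)[OF p(1)], unfolded p]
      objD[OF morD(2)[OF p(1)], unfolded p]
    show ?thesis by (simp add: pslice_squares p hom2_def)
  qed
  show "qvcomp ?S \<beta> \<alpha> \<in> squares ?S p r (vmcomp ?S u' u) (vmcomp ?S v' v)"
    if a: "\<alpha> \<in> squares ?S p q u v" and b: "\<beta> \<in> squares ?S q r u' v'"
  proof -
    note A = pslice_squaresD[OF a] and B = pslice_squaresD[OF b]
    have m: "p \<in> mor" "q \<in> mor" "r \<in> mor" using A B by blast+
    note [simp] = A(1-11) B(1-11) vmorD[OF A(3)] vmorD[OF A(4)] vmorD[OF B(3)] vmorD[OF B(4)]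
      morD[OF m(1)] morD[OF m(2)] morD[OF m(3)]
      objD[OF morD(1)[OF m(1)]] objD[OF morD(1)[OF m(2)]] objD[OF morD(1)[OF m(3)]]
      objD[OF morD(2)[OF m(1)]] objD[OF morD(2)[OF m(2)]] objD[OF morD(2)[OF m(3)]]
    have [simp]: "fst (source q) = fst (source p)" "fst (source r) = fst (source p)"
      "fst (target q) = fst (target p)" "fst (target r) = fst (target p)"
      using vmorD(3)[OF A(3)] vmorD(3)[OF A(4)] vmorD(3)[OF B(3)] vmorD(3)[OF B(4)] by simp_all
    have "(label u' \<bullet> label u) \<bullet> snd (label p) = label u' \<bullet> (label u \<bullet> snd (label p))"
      by simp
    also have "\<dots> = (label u' \<bullet> snd (label q)) \<bullet> (label v \<star> on2 L (label_of \<alpha>))"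
      unfolding A(12) by simp
    also have "\<dots> = snd (label r) \<bullet> ((label v' \<star> on2 L (label_of \<beta>)) \<bullet> (label v \<star> on2 L (label_of \<alpha>)))"
      unfolding B(12) by simp
    also have "\<dots> = snd (label r) \<bullet> ((label v' \<bullet> label v) \<star> on2 L (label_of \<beta> \<bullet>\<^bsub>B\<^esub> label_of \<alpha>))"
      by (simp add: A.interchange' L.on2_vcomp)
    finally have e: "(label u' \<bullet> label u) \<bullet> snd (label p) =
      snd (label r) \<bullet> ((label v' \<bullet> label v) \<star> on2 L (label_of \<beta> \<bullet>\<^bsub>B\<^esub> label_of \<alpha>))" .
    have s: "top_of \<alpha> = p" "bot_of \<beta> = r" "left_of \<alpha> = u" "left_of \<beta> = u'" "right_of \<alpha> = v" "right_of \<beta> = v'"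
      using a b by (simp_all add: squares_def)
    show ?thesis unfolding pslice_squares using e by (simp add: s pslice_vmor_iff hom2_def)
  qed
  show "qhcomp ?S \<beta> \<alpha> \<in> squares ?S (hmcomp ?S p' p) (hmcomp ?S q' q) u w'"
    if a: "\<alpha> \<in> squares ?S p q u v" and b: "\<beta> \<in> squares ?S p' q' v w'"
  proof -
    note A = pslice_squaresD[OF a] and B = pslice_squaresD[OF b]
    have [simp]: "source p' = target p" "source q' = target q" using A B by simp_all
    note [simp] = A(1-11) B(1-11) vmorD[OF A(3)] vmorD[OF A(4)] vmorD[OF B(4)]
      morD[OF A(1)] morD[OF A(2)] morD[OF B(1)] morD[OF B(2)]
      objD[OF morD(1)[OF A(1)]] objD[OF morD(2)[OF A(1)]] objD[OF morD(2)[OF B(1)]]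
    have t: "tgt B (dom2 B (label_of \<alpha>)) = src B (dom2 B (label_of \<beta>))" by simp
    have "label u \<bullet> (snd (label p) \<bullet> (snd (label p') \<star> id2 A (on1 L (dom2 B (label_of \<alpha>)))) \<bullet>
        (id2 A (snd (target p')) \<star> inv2 A (cpt L (dom2 B (label_of \<beta>), dom2 B (label_of \<alpha>))))) =
      (snd (label q) \<bullet> (snd (label q') \<star> id2 A (on1 L (cod2 B (label_of \<alpha>)))) \<bullet>
        (id2 A (snd (target q')) \<star> inv2 A (cpt L (cod2 B (label_of \<beta>), cod2 B (label_of \<alpha>))))) \<bullet>
        (label w' \<star> on2 L (label_of \<beta> \<star>\<^bsub>B\<^esub> label_of \<alpha>))"
      by (rule slice_square_hcomp[where f = "snd (source p)" and f' = "snd (target p)"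
            and g = "snd (source q)" and g' = "snd (target q)" and \<Theta>' = "label v"])
        (use A(12) B(12) in \<open>simp_all add: hom1_def hom2_def\<close>)
    then have e: "label u \<bullet> snd (label (pslice_comp B A L p' p)) =
        snd (label (pslice_comp B A L q' q)) \<bullet> (label w' \<star> on2 L (label_of \<beta> \<star>\<^bsub>B\<^esub> label_of \<alpha>))"
      by (simp only: pslice_comp_sel A(10,11) B(10,11))
    have s: "top_of \<alpha> = p" "bot_of \<beta> = q'" "top_of \<beta> = p'" "bot_of \<alpha> = q" "left_of \<alpha> = u" "right_of \<beta> = w'"
      using a b by (simp_all add: squares_def)
    show ?thesis unfolding pslice_squares using e t by (simp add: s hom2_def del: pslice_comp_sel(4))
  qed
  show "qvcomp ?S (qvid ?S q) \<alpha> = \<alpha>" "qvcomp ?S \<alpha> (qvid ?S p) = \<alpha>" if a: "\<alpha> \<in> squares ?S p q u v"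
  proof -
    note A = pslice_squaresD[OF a]
    have s: "\<alpha> = Square p q u v (label_of \<alpha>)" using a unfolding pslice_squares by blast
    have uv: "u = Arrow (source p) (source q) (label u)" "v = Arrow (target p) (target q) (label v)"
      using A by (auto intro: arrow_eqI)
    show "qvcomp ?S (qvid ?S q) \<alpha> = \<alpha>" "qvcomp ?S \<alpha> (qvid ?S p) = \<alpha>"
      by (subst (1 2) s, subst (1 2) uv(1), subst (1 2) uv(2), use A vmorD[OF A(3)] vmorD[OF A(4)] in simp)+
  qed
  show "qhcomp ?S (qvid ?S (hid ?S x)) \<alpha> = \<alpha>" if x: "x \<in> DObj ?S" and a: "\<alpha> \<in> squares ?S p q u (vid ?S x)"
  proof -
    note A = pslice_squaresD[OF a]
    have s: "\<alpha> = Square p q u (vid ?S x) (label_of \<alpha>)" using a unfolding pslice_squares by blast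
    have "target p = x" "target q = x" using A by simp_all
    then show ?thesis
      by (subst (1 2) s) (use A x morD[OF A(1)] in simp)
  qed
qed

end

section \<open>Biuniversal arrows\<close>

text \<open>
  Essential surjectivity and full faithfulness of \<open>c \<mapsto> l (L c)\<close>, from \<open>B(Y, X)\<close> to \<open>A(L Y, D)\<close>, for every \<open>Y\<close>.
\<close>

definition biuniversal_arrow ::
  "('o, 'm, 't) two_cat \<Rightarrow> ('o', 'm', 't') two_cat \<Rightarrow> ('o, 'm, 't, 'o', 'm', 't') psfun \<Rightarrow> 'o' \<Rightarrow>
   'o \<Rightarrow> 'm' \<Rightarrow> bool" where
  "biuniversal_arrow B A L D X l \<longleftrightarrow> (X, l) \<in> pslice_obj B A L D \<and> (\<forall>Y\<in>Obj B.
     (\<forall>\<kappa>\<in>hom1 A (on0 L Y) D. \<exists>c\<in>hom1 B Y X. \<exists>\<psi>\<in>hom2 A (l \<cdot>\<^bsub>A\<^esub> on1 L c) \<kappa>. invertible2 A \<psi>) \<and>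
     (\<forall>c\<in>hom1 B Y X. \<forall>d\<in>hom1 B Y X. \<forall>\<Theta>\<in>hom2 A (l \<cdot>\<^bsub>A\<^esub> on1 L c) (l \<cdot>\<^bsub>A\<^esub> on1 L d).
        \<exists>!\<gamma>. \<gamma> \<in> hom2 B c d \<and> id2 A l \<star>\<^bsub>A\<^esub> on2 L \<gamma> = \<Theta>))"

text \<open>
  Squares and 2-morphisms of slices carry their boundary as part of the data. This passes between
  them and their underlying 2-morphisms.
\<close>

lemma ex1_reparametrise:
  assumes "\<And>s. P s \<longleftrightarrow> s = f (g s) \<and> Q (g s)" and "\<And>x. g (f x) = x"
  shows "(\<exists>!s. P s) \<longleftrightarrow> (\<exists>!x. Q x)"
  by (metis assms)

context pseudo_slice
begin

abbreviation whisk where "whisk l \<gamma> \<equiv> id2 A l \<star> on2 L \<gamma>"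

lemma Arrow_mor:
  "Arrow (Y, \<kappa>) (X, l) (c, \<psi>) \<in> mor \<longleftrightarrow> (Y, \<kappa>) \<in> obj \<and> (X, l) \<in> obj \<and> c \<in> hom1 B Y X \<and>
    \<psi> \<in> hom2 A (l \<cdot> on1 L c) \<kappa> \<and> invertible2 A \<psi>"
  by (simp add: pslice_mor_iff)

lemma ex_mor_iff: "(\<exists>p. p \<in> mor \<and> source p = (Y, \<kappa>) \<and> target p = (X, l)) \<longleftrightarrow>
    (\<exists>c \<psi>. Arrow (Y, \<kappa>) (X, l) (c, \<psi>) \<in> mor)"
  by (metis arrow.exhaust_sel arrow.sel(1,2) surj_pair)

lemma bi_terminal_pslice_iff:
  assumes X: "(X, l) \<in> obj"
  shows "bi_terminal (pslice B A L D) (X, l) \<longleftrightarrow>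
    (\<forall>Y \<kappa>. (Y, \<kappa>) \<in> obj \<longrightarrow> (\<exists>c \<psi>. Arrow (Y, \<kappa>) (X, l) (c, \<psi>) \<in> mor)) \<and>
    (\<forall>Y \<kappa> c \<psi> d \<phi>. Arrow (Y, \<kappa>) (X, l) (c, \<psi>) \<in> mor \<longrightarrow> Arrow (Y, \<kappa>) (X, l) (d, \<phi>) \<in> mor \<longrightarrow>
      (\<exists>!\<gamma>. \<gamma> \<in> hom2 B c d \<and> \<phi> \<bullet> whisk l \<gamma> = \<psi>))"
proof -
  interpret S: unital_two_graph "pslice B A L D" by (rule unital_two_graph_pslice)
  let ?S = "pslice B A L D"
  have ex: "(\<forall>y\<in>Obj ?S. \<exists>p. p \<in> hom1 ?S y (X, l)) \<longleftrightarrow>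
    (\<forall>Y \<kappa>. (Y, \<kappa>) \<in> obj \<longrightarrow> (\<exists>c \<psi>. Arrow (Y, \<kappa>) (X, l) (c, \<psi>) \<in> mor))"
    by (simp add: hom1_def Ball_def split_paired_All ex_mor_iff del: split_paired_Ex)
  have un: "(\<exists>!s. s \<in> hom2 ?S p q) \<longleftrightarrow> (\<exists>!\<gamma>. \<gamma> \<in> hom2 B c d \<and> \<phi> \<bullet> whisk l \<gamma> = \<psi>)"
    if "p = Arrow (Y, \<kappa>) (X, l) (c, \<psi>)" "q = Arrow (Y, \<kappa>) (X, l) (d, \<phi>)" "p \<in> mor" "q \<in> mor"
    for p q Y \<kappa> c \<psi> d \<phi>
  proof (rule ex1_reparametrise)
    show "s \<in> hom2 ?S p q \<longleftrightarrow> s = Arrow p q (label s) \<and> label s \<in> hom2 B c d \<and>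
        \<phi> \<bullet> whisk l (label s) = \<psi>" for s
      using that by (cases s) (auto simp: hom2_def[of ?S] Cell_pslice_iff)
  qed simp
  have "(\<forall>y. \<forall>p\<in>hom1 ?S y (X, l). \<forall>q\<in>hom1 ?S y (X, l). \<exists>!s. s \<in> hom2 ?S p q) \<longleftrightarrow>
    (\<forall>Y \<kappa> c \<psi> d \<phi>. Arrow (Y, \<kappa>) (X, l) (c, \<psi>) \<in> mor \<longrightarrow> Arrow (Y, \<kappa>) (X, l) (d, \<phi>) \<in> mor \<longrightarrow>
      (\<exists>!\<gamma>. \<gamma> \<in> hom2 B c d \<and> \<phi> \<bullet> whisk l \<gamma> = \<psi>))" (is "?l \<longleftrightarrow> ?r")
  proof
    assume l: ?l
    show ?r
    proof (intro allI impI)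
      fix Y \<kappa> c \<psi> d \<phi>
      assume p: "Arrow (Y, \<kappa>) (X, l) (c, \<psi>) \<in> mor" and q: "Arrow (Y, \<kappa>) (X, l) (d, \<phi>) \<in> mor"
      have "\<exists>!s. s \<in> hom2 ?S (Arrow (Y, \<kappa>) (X, l) (c, \<psi>)) (Arrow (Y, \<kappa>) (X, l) (d, \<phi>))"
        by (rule l[rule_format, of _ "(Y, \<kappa>)"]) (use p q in \<open>simp_all add: hom1_def\<close>)
      then show "\<exists>!\<gamma>. \<gamma> \<in> hom2 B c d \<and> \<phi> \<bullet> whisk l \<gamma> = \<psi>"
        using un[OF refl refl p q] by simp
    qed
  next
    assume r: ?r
    show ?l
    proof (intro allI ballI)
      fix y p q assume "p \<in> hom1 ?S y (X, l)" "q \<in> hom1 ?S y (X, l)"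
      then have pq: "p \<in> mor" "q \<in> mor" and e: "source p = y" "target p = (X, l)" "source q = y" "target q = (X, l)"
        by (simp_all add: hom1_def)
      obtain c \<psi> d \<phi> where "p = Arrow (fst y, snd y) (X, l) (c, \<psi>)" "q = Arrow (fst y, snd y) (X, l) (d, \<phi>)"
        using e by (metis arrow.exhaust_sel prod.collapse)
      note pe = this
      show "\<exists>!s. s \<in> hom2 ?S p q"
        unfolding un[OF pe pq] by (rule r[rule_format, of "fst y" "snd y"]) (use pq pe in simp_all)
    qed
  qed
  then show ?thesis
    unfolding S.bi_terminal_iff ex using X by simp
qed

lemma double_bi_terminal_pslice_iff:
  assumes X: "(X, l) \<in> obj"
  shows "double_bi_terminal (pslice_dbl B A L D) (X, l) \<longleftrightarrow>
    (\<forall>Y \<kappa>. (Y, \<kappa>) \<in> obj \<longrightarrow> (\<exists>c \<psi>. Arrow (Y, \<kappa>) (X, l) (c, \<psi>) \<in> mor)) \<and>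
    (\<forall>Y \<kappa> \<mu> \<Theta> c \<psi> d \<phi>. \<Theta> \<in> hom2 A \<kappa> \<mu> \<longrightarrow>
      Arrow (Y, \<kappa>) (X, l) (c, \<psi>) \<in> mor \<longrightarrow> Arrow (Y, \<mu>) (X, l) (d, \<phi>) \<in> mor \<longrightarrow>
      (\<exists>!\<gamma>. \<gamma> \<in> hom2 B c d \<and> \<Theta> \<bullet> \<psi> = \<phi> \<bullet> whisk l \<gamma>))"
proof -
  interpret S: unital_double_graph "pslice_dbl B A L D" by (rule unital_double_graph_pslice_dbl)
  let ?S = "pslice_dbl B A L D"
  let ?v = "Arrow (X, l) (X, l) (id2 A l)"
  have ex: "(\<forall>y\<in>DObj ?S. \<exists>p. p \<in> hhom ?S y (X, l)) \<longleftrightarrow>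
    (\<forall>Y \<kappa>. (Y, \<kappa>) \<in> obj \<longrightarrow> (\<exists>c \<psi>. Arrow (Y, \<kappa>) (X, l) (c, \<psi>) \<in> mor))"
    by (simp add: hhom_def Ball_def split_paired_All ex_mor_iff del: split_paired_Ex)
  have v: "?v \<in> vmor" using id_vmor[OF X] by simp
  have un: "(\<exists>!s. s \<in> squares ?S p q u ?v) \<longleftrightarrow>
      (\<exists>!\<gamma>. \<gamma> \<in> hom2 B c d \<and> \<Theta> \<bullet> \<psi> = \<phi> \<bullet> whisk l \<gamma>)"
    if "p = Arrow (Y, \<kappa>) (X, l) (c, \<psi>)" "q = Arrow (Y, \<mu>) (X, l) (d, \<phi>)" "u = Arrow (Y, \<kappa>) (Y, \<mu>) \<Theta>"
      "p \<in> mor" "q \<in> mor" "u \<in> vmor"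
    for p q u Y \<kappa> \<mu> \<Theta> c \<psi> d \<phi>
  proof (rule ex1_reparametrise)
    show "s \<in> squares ?S p q u ?v \<longleftrightarrow> s = Square p q u ?v (label_of s) \<and> label_of s \<in> hom2 B c d \<and>
        \<Theta> \<bullet> \<psi> = \<phi> \<bullet> whisk l (label_of s)" for s
      using that v by (simp add: pslice_squares)
  qed simp
  have "(\<forall>y z. \<forall>u\<in>vhom ?S y z. \<forall>p\<in>hhom ?S y (X, l). \<forall>q\<in>hhom ?S z (X, l). \<exists>!s. s \<in> squares ?S p q u ?v) \<longleftrightarrow>
    (\<forall>Y \<kappa> \<mu> \<Theta> c \<psi> d \<phi>. \<Theta> \<in> hom2 A \<kappa> \<mu> \<longrightarrow>
      Arrow (Y, \<kappa>) (X, l) (c, \<psi>) \<in> mor \<longrightarrow> Arrow (Y, \<mu>) (X, l) (d, \<phi>) \<in> mor \<longrightarrow>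
      (\<exists>!\<gamma>. \<gamma> \<in> hom2 B c d \<and> \<Theta> \<bullet> \<psi> = \<phi> \<bullet> whisk l \<gamma>))" (is "?l \<longleftrightarrow> ?r")
  proof
    assume l: ?l
    show ?r
    proof (intro allI impI)
      fix Y \<kappa> \<mu> \<Theta> c \<psi> d \<phi>
      assume t: "\<Theta> \<in> hom2 A \<kappa> \<mu>" and p: "Arrow (Y, \<kappa>) (X, l) (c, \<psi>) \<in> mor" and q: "Arrow (Y, \<mu>) (X, l) (d, \<phi>) \<in> mor"
      have u: "Arrow (Y, \<kappa>) (Y, \<mu>) \<Theta> \<in> vmor" using t p q by (simp add: pslice_vmor_iff Arrow_mor)
      have "\<exists>!s. s \<in> squares ?S (Arrow (Y, \<kappa>) (X, l) (c, \<psi>)) (Arrow (Y, \<mu>) (X, l) (d, \<phi>)) (Arrow (Y, \<kappa>) (Y, \<mu>) \<Theta>) ?v"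
        by (rule l[rule_format, of _ "(Y, \<kappa>)" "(Y, \<mu>)"]) (use p q u in \<open>simp_all add: hhom_def vhom_def\<close>)
      then show "\<exists>!\<gamma>. \<gamma> \<in> hom2 B c d \<and> \<Theta> \<bullet> \<psi> = \<phi> \<bullet> whisk l \<gamma>"
        unfolding un[OF refl refl refl p q u] .
    qed
  next
    assume r: ?r
    show ?l
    proof (intro allI ballI)
      fix y z u p q assume "u \<in> vhom ?S y z" "p \<in> hhom ?S y (X, l)" "q \<in> hhom ?S z (X, l)"
      then have pq: "p \<in> mor" "q \<in> mor" "u \<in> vmor" and e: "source p = y" "target p = (X, l)" "source q = z"
        "target q = (X, l)" "source u = y" "target u = z"
        by (simp_all add: hhom_def vhom_def)
      have f: "z = (fst y, snd z)" using vmorD(3)[OF pq(3)] e by (metis prod.collapse)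
      obtain c \<psi> where pe: "p = Arrow (fst y, snd y) (X, l) (c, \<psi>)"
        using e by (metis arrow.exhaust_sel prod.collapse)
      obtain d \<phi> where qe: "q = Arrow (fst y, snd z) (X, l) (d, \<phi>)"
        using e f by (metis arrow.exhaust_sel prod.collapse)
      have ue: "u = Arrow (fst y, snd y) (fst y, snd z) (label u)"
        using e f by (metis arrow.exhaust_sel prod.collapse)
      show "\<exists>!s. s \<in> squares ?S p q u ?v"
        unfolding un[OF pe qe ue pq]
        by (rule r[rule_format, of _ "snd y" "snd z" "fst y"])
          (use pq pe qe vmorD[OF pq(3)] e in \<open>simp_all add: hom2_def\<close>)
    qed
  qed
  then show ?thesis
    unfolding S.double_bi_terminal_iff ex using X by simp
qed

lemma biuniversalD:
  assumes u: "biuniversal_arrow B A L D X l"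
  shows "(X, l) \<in> obj"
    and "(Y, \<kappa>) \<in> obj \<Longrightarrow> \<exists>c \<psi>. Arrow (Y, \<kappa>) (X, l) (c, \<psi>) \<in> mor"
    and "c \<in> hom1 B Y X \<Longrightarrow> d \<in> hom1 B Y X \<Longrightarrow> \<Theta> \<in> hom2 A (l \<cdot> on1 L c) (l \<cdot> on1 L d) \<Longrightarrow>
      \<exists>!\<gamma>. \<gamma> \<in> hom2 B c d \<and> whisk l \<gamma> = \<Theta>"
proof -
  show X: "(X, l) \<in> obj" using u by (simp add: biuniversal_arrow_def)
  show "\<exists>c \<psi>. Arrow (Y, \<kappa>) (X, l) (c, \<psi>) \<in> mor" if Y: "(Y, \<kappa>) \<in> obj"
  proof -
    have "Y \<in> Obj B" "\<kappa> \<in> hom1 A (on0 L Y) D" using Y by (simp_all add: pslice_obj_iff)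
    then obtain c \<psi> where "c \<in> hom1 B Y X" "\<psi> \<in> hom2 A (l \<cdot> on1 L c) \<kappa>" "invertible2 A \<psi>"
      using u unfolding biuniversal_arrow_def by blast
    then show ?thesis using X Y by (auto simp: Arrow_mor)
  qed
  show "\<exists>!\<gamma>. \<gamma> \<in> hom2 B c d \<and> whisk l \<gamma> = \<Theta>"
    if c: "c \<in> hom1 B Y X" and d: "d \<in> hom1 B Y X" and t: "\<Theta> \<in> hom2 A (l \<cdot> on1 L c) (l \<cdot> on1 L d)"
  proof -
    have "Y \<in> Obj B" using c by (auto simp: hom1_def)
    then show ?thesis using u c d t unfolding biuniversal_arrow_def by blast
  qed
qed

lemma biuniversalI:
  assumes X: "(X, l) \<in> obj"
    and ex: "\<And>Y \<kappa>. (Y, \<kappa>) \<in> obj \<Longrightarrow> \<exists>c \<psi>. Arrow (Y, \<kappa>) (X, l) (c, \<psi>) \<in> mor"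
    and ff: "\<And>Y c d \<Theta>. c \<in> hom1 B Y X \<Longrightarrow> d \<in> hom1 B Y X \<Longrightarrow>
      \<Theta> \<in> hom2 A (l \<cdot> on1 L c) (l \<cdot> on1 L d) \<Longrightarrow> \<exists>!\<gamma>. \<gamma> \<in> hom2 B c d \<and> whisk l \<gamma> = \<Theta>"
  shows "biuniversal_arrow B A L D X l"
  unfolding biuniversal_arrow_def
proof (intro conjI ballI)
  show "\<exists>c\<in>hom1 B Y X. \<exists>\<psi>\<in>hom2 A (l \<cdot> on1 L c) \<kappa>. invertible2 A \<psi>"
    if "Y \<in> Obj B" "\<kappa> \<in> hom1 A (on0 L Y) D" for Y \<kappa>
  proof -
    have "(Y, \<kappa>) \<in> obj" using that by (simp add: pslice_obj_iff)
    from ex[OF this] show ?thesis unfolding Arrow_mor by blast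
  qed
qed (use X ff in blast)+

text \<open>
  By full faithfulness, since the equation determines the image of \<open>\<gamma>\<close> as \<open>\<phi>\<inverse> \<circ> \<Theta> \<circ> \<psi>\<close>.
\<close>

lemma biuniversal_iso_lift:
  assumes u: "biuniversal_arrow B A L D X l" and t: "\<Theta> \<in> hom2 A \<kappa> \<mu>"
    and p: "Arrow (Y, \<kappa>) (X, l) (c, \<psi>) \<in> mor" and q: "Arrow (Y, \<mu>) (X, l) (d, \<phi>) \<in> mor"
  shows "\<exists>!\<gamma>. \<gamma> \<in> hom2 B c d \<and> \<Theta> \<bullet> \<psi> = \<phi> \<bullet> whisk l \<gamma>"
proof -
  note X = biuniversalD(1)[OF u]
  have cd: "c \<in> hom1 B Y X" "d \<in> hom1 B Y X" using p q by (simp_all add: Arrow_mor)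
  have [simp]: "c \<in> Mor B" "d \<in> Mor B" "src B c = Y" "src B d = Y" "tgt B c = X" "tgt B d = X"
    using cd by (simp_all add: hom1_def)
  have [simp]: "l \<in> Mor A" "src A l = on0 L X" "tgt A l = D" using objD[OF X] by simp_all
  have [simp]: "\<psi> \<in> Cell A" "\<phi> \<in> Cell A" "dom2 A \<psi> = l \<cdot> on1 L c" "cod2 A \<psi> = \<kappa>"
    "dom2 A \<phi> = l \<cdot> on1 L d" "cod2 A \<phi> = \<mu>" "invertible2 A \<phi>"
    "\<Theta> \<in> Cell A" "dom2 A \<Theta> = \<kappa>" "cod2 A \<Theta> = \<mu>"
    using p q t by (simp_all add: Arrow_mor hom2_def)
  have "inv2 A \<phi> \<bullet> \<Theta> \<bullet> \<psi> \<in> hom2 A (l \<cdot> on1 L c) (l \<cdot> on1 L d)"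
    by (simp add: hom2_def)
  note ex1 = biuniversalD(3)[OF u cd this]
  have "(\<Theta> \<bullet> \<psi> = \<phi> \<bullet> whisk l \<gamma>) \<longleftrightarrow> (whisk l \<gamma> = inv2 A \<phi> \<bullet> \<Theta> \<bullet> \<psi>)"
    if "\<gamma> \<in> hom2 B c d" for \<gamma>
  proof -
    have g: "\<gamma> \<in> Cell B" "dom2 B \<gamma> = c" "cod2 B \<gamma> = d" using that by (simp_all add: hom2_def)
    show ?thesis
    proof
      assume e: "\<Theta> \<bullet> \<psi> = \<phi> \<bullet> whisk l \<gamma>"
      show "whisk l \<gamma> = inv2 A \<phi> \<bullet> \<Theta> \<bullet> \<psi>"
        unfolding e using g by simp
    next
      assume e: "whisk l \<gamma> = inv2 A \<phi> \<bullet> \<Theta> \<bullet> \<psi>"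
      show "\<Theta> \<bullet> \<psi> = \<phi> \<bullet> whisk l \<gamma>" unfolding e by simp
    qed
  qed
  with ex1 show ?thesis by blast
qed

text \<open>
  The instance of \<open>biuniversal_iso_lift\<close> at an identity 2-morphism.
\<close>

theorem biuniversal_imp_bi_terminal:
  assumes u: "biuniversal_arrow B A L D X l"
  shows "bi_terminal (pslice B A L D) (X, l)"
  unfolding bi_terminal_pslice_iff[OF biuniversalD(1)[OF u]]
proof (intro conjI allI impI)
  show "(Y, \<kappa>) \<in> obj \<Longrightarrow> \<exists>c \<psi>. Arrow (Y, \<kappa>) (X, l) (c, \<psi>) \<in> mor" for Y \<kappa>
    by (rule biuniversalD(2)[OF u])
  fix Y \<kappa> c \<psi> d \<phi>
  assume p: "Arrow (Y, \<kappa>) (X, l) (c, \<psi>) \<in> mor" and q: "Arrow (Y, \<kappa>) (X, l) (d, \<phi>) \<in> mor"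
  have k: "\<kappa> \<in> Mor A" using objD[of "(Y, \<kappa>)"] p by (simp add: Arrow_mor)
  have "id2 A \<kappa> \<bullet> \<psi> = \<psi>" using p by (simp add: Arrow_mor hom2_def)
  with biuniversal_iso_lift[OF u A.id2_hom[OF k] p q]
  show "\<exists>!\<gamma>. \<gamma> \<in> hom2 B c d \<and> \<phi> \<bullet> whisk l \<gamma> = \<psi>" by metis
qed

lemma id_mor:
  assumes X: "(X, l) \<in> obj" and c: "c \<in> hom1 B Y X"
  shows "Arrow (Y, l \<cdot> on1 L c) (X, l) (c, id2 A (l \<cdot> on1 L c)) \<in> mor"
  using objD[OF X] c X B.Mor_src[of c] by (simp add: Arrow_mor pslice_obj_iff hom1_def hom2_def)

text \<open>
  Full faithfulness is recovered from squares whose horizontal boundaries carry identity isomorphisms.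
\<close>

theorem double_bi_terminal_iff_biuniversal:
  assumes X: "(X, l) \<in> obj"
  shows "double_bi_terminal (pslice_dbl B A L D) (X, l) \<longleftrightarrow> biuniversal_arrow B A L D X l"
proof
  assume "biuniversal_arrow B A L D X l"
  then show "double_bi_terminal (pslice_dbl B A L D) (X, l)"
    unfolding double_bi_terminal_pslice_iff[OF X]
    using biuniversalD(2) biuniversal_iso_lift by blast
next
  assume "double_bi_terminal (pslice_dbl B A L D) (X, l)"
  note dt = this[unfolded double_bi_terminal_pslice_iff[OF X]]
  show "biuniversal_arrow B A L D X l"
  proof (rule biuniversalI[OF X])
    show "(Y, \<kappa>) \<in> obj \<Longrightarrow> \<exists>c \<psi>. Arrow (Y, \<kappa>) (X, l) (c, \<psi>) \<in> mor" for Y \<kappa>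
      using dt by blast
    fix Y c d \<Theta>
    assume c: "c \<in> hom1 B Y X" and d: "d \<in> hom1 B Y X" and t: "\<Theta> \<in> hom2 A (l \<cdot> on1 L c) (l \<cdot> on1 L d)"
    have "\<exists>!\<gamma>. \<gamma> \<in> hom2 B c d \<and> \<Theta> \<bullet> id2 A (l \<cdot> on1 L c) = id2 A (l \<cdot> on1 L d) \<bullet> whisk l \<gamma>"
      by (rule dt[THEN conjunct2, rule_format, OF t id_mor[OF X c] id_mor[OF X d]])
    moreover have "\<Theta> \<bullet> id2 A (l \<cdot> on1 L c) = \<Theta>" by (rule A.vcomp_id_right[OF t])
    moreover have "id2 A (l \<cdot> on1 L d) \<bullet> whisk l \<gamma> = whisk l \<gamma>"
      if "\<gamma> \<in> hom2 B c d" for \<gamma>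
      using that c d objD[OF X] by (simp add: hom1_def hom2_def)
    ultimately show "\<exists>!\<gamma>. \<gamma> \<in> hom2 B c d \<and> whisk l \<gamma> = \<Theta>" by metis
  qed
qed

end

subsection \<open>Biuniversal arrows in arrow 2-categories\<close>

context pseudo_slice
begin

lemma pseudo_slice_Ar: "pseudo_slice (Ar B) (Ar A) (Ar_psfun B A L)"
  using normal_psfunctor_Ar_psfun[OF L.psfunctor_axioms]
  by (simp add: pseudo_slice_def psfunctor_def psfunctor_axioms_def two_category_Ar
      B.two_category_axioms A.two_category_axioms)

abbreviation Ar_obj where "Ar_obj \<equiv> pslice_obj (Ar B) (Ar A) (Ar_psfun B A L) D"
abbreviation Ar_mor where "Ar_mor \<equiv> pslice_mor (Ar B) (Ar A) (Ar_psfun B A L) D"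

lemma Ar_obj_iff:
  "(Y, \<Theta>) \<in> Ar_obj \<longleftrightarrow> \<Theta> \<in> Cell A \<and> (Y, dom2 A \<Theta>) \<in> obj \<and> (Y, cod2 A \<Theta>) \<in> obj"
  by (auto simp: pslice_obj_iff hom1_def)

text \<open>
  Reads the pseudo-slice over arrow 2-categories in terms of \<open>A\<close> and \<open>B\<close>: a morphism to \<open>id\<^sub>l\<close> is a pair of
  morphisms to \<open>l\<close> in the ordinary pseudo-slice, joined by a 2-morphism \<open>\<gamma>\<close>.
\<close>

lemma Ar_mor_iff:
  assumes X: "(X, l) \<in> obj"
  shows "Arrow (Y, \<Theta>) (X, id2 A l) (\<gamma>, s) \<in> Ar_mor \<longleftrightarrow>
    s = Arrow (whisk l \<gamma>) \<Theta> (label s) \<and> \<Theta> \<in> Cell A \<and> \<gamma> \<in> Cell B \<and>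
    Arrow (Y, dom2 A \<Theta>) (X, l) (dom2 B \<gamma>, fst (label s)) \<in> mor \<and>
    Arrow (Y, cod2 A \<Theta>) (X, l) (cod2 B \<gamma>, snd (label s)) \<in> mor \<and>
    snd (label s) \<bullet> whisk l \<gamma> = \<Theta> \<bullet> fst (label s)"
proof -
  interpret R: pseudo_slice "Ar B" "Ar A" "Ar_psfun B A L" D by (rule pseudo_slice_Ar)
  note l [simp] = objD[OF X, simplified]
  have Xr: "(X, id2 A l) \<in> Ar_obj" using X by (simp add: Ar_obj_iff)
  show ?thesis
  proof (cases "\<gamma> \<in> Cell B \<and> src B (dom2 B \<gamma>) = Y \<and> tgt B (dom2 B \<gamma>) = X \<and> (Y, \<Theta>) \<in> Ar_obj")
    case True
    then have g [simp]: "\<gamma> \<in> Cell B" "src B (dom2 B \<gamma>) = Y" "tgt B (dom2 B \<gamma>) = X" and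
      t: "(Y, \<Theta>) \<in> Ar_obj" by simp_all
    have t' [simp]: "\<Theta> \<in> Cell A" "(Y, dom2 A \<Theta>) \<in> obj" "(Y, cod2 A \<Theta>) \<in> obj"
      using t by (simp_all add: Ar_obj_iff)
    have m: "s \<in> hom2 (Ar A) (whisk l \<gamma>) \<Theta> \<longleftrightarrow>
      s = Arrow (whisk l \<gamma>) \<Theta> (label s) \<and>
      fst (label s) \<in> hom2 A (l \<cdot> on1 L (dom2 B \<gamma>)) (dom2 A \<Theta>) \<and>
      snd (label s) \<in> hom2 A (l \<cdot> on1 L (cod2 B \<gamma>)) (cod2 A \<Theta>) \<and>
      snd (label s) \<bullet> whisk l \<gamma> = \<Theta> \<bullet> fst (label s)"
      by (cases s) (auto simp: hom2_def Cell_Ar)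
    have i: "invertible2 (Ar A) s \<longleftrightarrow> invertible2 A (fst (label s)) \<and> invertible2 A (snd (label s))"
      if "s \<in> hom2 (Ar A) (whisk l \<gamma>) \<Theta>"
      by (rule invertible2_Ar[OF A.two_category_axioms]) (use that in \<open>simp add: hom2_def\<close>)
    have "Arrow (Y, \<Theta>) (X, id2 A l) (\<gamma>, s) \<in> Ar_mor \<longleftrightarrow>
      s \<in> hom2 (Ar A) (whisk l \<gamma>) \<Theta> \<and> invertible2 (Ar A) s"
      unfolding R.Arrow_mor using Xr t by (simp add: hom1_def)
    then show ?thesis
      unfolding Arrow_mor using X m i by (auto simp: hom1_def)
  next
    case False
    then show ?thesis
      unfolding R.Arrow_mor Arrow_mor by (auto simp: hom1_def Ar_obj_iff)
  qed
qed

lemma Ar_cell_iff: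
  assumes X: "(X, l) \<in> obj"
    and p: "Arrow (Y, \<Theta>) (X, id2 A l) (\<gamma>, s) \<in> Ar_mor" and q: "Arrow (Y, \<Theta>) (X, id2 A l) (\<delta>, r) \<in> Ar_mor"
  shows "\<beta> \<in> hom2 (Ar B) \<gamma> \<delta> \<and>
      r \<bullet>\<^bsub>Ar A\<^esub> (id2 (Ar A) (id2 A l) \<star>\<^bsub>Ar A\<^esub> on2 (Ar_psfun B A L) \<beta>) = s \<longleftrightarrow>
    \<beta> = Arrow \<gamma> \<delta> (label \<beta>) \<and>
    fst (label \<beta>) \<in> hom2 B (dom2 B \<gamma>) (dom2 B \<delta>) \<and> snd (label \<beta>) \<in> hom2 B (cod2 B \<gamma>) (cod2 B \<delta>) \<and>
    snd (label \<beta>) \<bullet>\<^bsub>B\<^esub> \<gamma> = \<delta> \<bullet>\<^bsub>B\<^esub> fst (label \<beta>) \<and>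
    fst (label r) \<bullet> whisk l (fst (label \<beta>)) = fst (label s) \<and>
    snd (label r) \<bullet> whisk l (snd (label \<beta>)) = snd (label s)" (is "?l \<longleftrightarrow> ?r")
proof -
  note p' = p[unfolded Ar_mor_iff[OF X]] and q' = q[unfolded Ar_mor_iff[OF X]]
  have gd: "\<gamma> \<in> Cell B" "\<delta> \<in> Cell B" using p' q' by blast+
  have s: "s = Arrow (whisk l \<gamma>) \<Theta> (label s)" "target r = \<Theta>" "l \<in> Mor A"
    using p' q' objD[OF X] by (simp, metis arrow.sel(2), simp)
  have b: "\<beta> \<in> hom2 (Ar B) \<gamma> \<delta> \<longleftrightarrow> \<beta> = Arrow \<gamma> \<delta> (label \<beta>) \<and>
    fst (label \<beta>) \<in> hom2 B (dom2 B \<gamma>) (dom2 B \<delta>) \<and> snd (label \<beta>) \<in> hom2 B (cod2 B \<gamma>) (cod2 B \<delta>) \<and>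
    snd (label \<beta>) \<bullet>\<^bsub>B\<^esub> \<gamma> = \<delta> \<bullet>\<^bsub>B\<^esub> fst (label \<beta>)"
    using gd by (cases \<beta>) (auto simp: hom2_def Cell_Ar)
  have "r \<bullet>\<^bsub>Ar A\<^esub> (id2 (Ar A) (id2 A l) \<star>\<^bsub>Ar A\<^esub> on2 (Ar_psfun B A L) \<beta>) =
      Arrow (whisk l \<gamma>) \<Theta>
        (fst (label r) \<bullet> whisk l (fst (label \<beta>)),
         snd (label r) \<bullet> whisk l (snd (label \<beta>)))" if "\<beta> \<in> hom2 (Ar B) \<gamma> \<delta>"
  proof -
    have "\<beta> \<in> Cell (Ar B)" "source \<beta> = \<gamma>" using that by (simp_all add: hom2_def)
    then show ?thesis using s(2,3) by (simp add: Ar_ops)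
  qed
  moreover have "s = Arrow (whisk l \<gamma>) \<Theta> (u, v) \<longleftrightarrow> fst (label s) = u \<and> snd (label s) = v" for u v
    by (subst s(1)) (auto simp: prod_eq_iff)
  ultimately show ?thesis using b by metis
qed

lemma Ar_bi_terminal_iff:
  assumes X: "(X, l) \<in> obj"
  shows "bi_terminal (pslice (Ar B) (Ar A) (Ar_psfun B A L) D) (X, id2 A l) \<longleftrightarrow>
    (\<forall>Y \<Theta>. (Y, \<Theta>) \<in> Ar_obj \<longrightarrow> (\<exists>\<gamma> s. Arrow (Y, \<Theta>) (X, id2 A l) (\<gamma>, s) \<in> Ar_mor)) \<and>
    (\<forall>Y \<Theta> \<gamma> s \<delta> r. Arrow (Y, \<Theta>) (X, id2 A l) (\<gamma>, s) \<in> Ar_mor \<longrightarrow> Arrow (Y, \<Theta>) (X, id2 A l) (\<delta>, r) \<in> Ar_mor \<longrightarrow>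
      (\<exists>!\<beta>. fst \<beta> \<in> hom2 B (dom2 B \<gamma>) (dom2 B \<delta>) \<and> snd \<beta> \<in> hom2 B (cod2 B \<gamma>) (cod2 B \<delta>) \<and>
        snd \<beta> \<bullet>\<^bsub>B\<^esub> \<gamma> = \<delta> \<bullet>\<^bsub>B\<^esub> fst \<beta> \<and>
        fst (label r) \<bullet> whisk l (fst \<beta>) = fst (label s) \<and>
        snd (label r) \<bullet> whisk l (snd \<beta>) = snd (label s)))"
proof -
  interpret R: pseudo_slice "Ar B" "Ar A" "Ar_psfun B A L" D by (rule pseudo_slice_Ar)
  have "(X, id2 A l) \<in> Ar_obj" using X objD[OF X] by (simp add: Ar_obj_iff)
  note bt = R.bi_terminal_pslice_iff[OF this]
  have "(\<exists>!\<beta>. \<beta> \<in> hom2 (Ar B) \<gamma> \<delta> \<and>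
      r \<bullet>\<^bsub>Ar A\<^esub> (id2 (Ar A) (id2 A l) \<star>\<^bsub>Ar A\<^esub> on2 (Ar_psfun B A L) \<beta>) = s) \<longleftrightarrow>
    (\<exists>!\<beta>. fst \<beta> \<in> hom2 B (dom2 B \<gamma>) (dom2 B \<delta>) \<and> snd \<beta> \<in> hom2 B (cod2 B \<gamma>) (cod2 B \<delta>) \<and>
        snd \<beta> \<bullet>\<^bsub>B\<^esub> \<gamma> = \<delta> \<bullet>\<^bsub>B\<^esub> fst \<beta> \<and>
        fst (label r) \<bullet> whisk l (fst \<beta>) = fst (label s) \<and>
        snd (label r) \<bullet> whisk l (snd \<beta>) = snd (label s))"
    if "Arrow (Y, \<Theta>) (X, id2 A l) (\<gamma>, s) \<in> Ar_mor" "Arrow (Y, \<Theta>) (X, id2 A l) (\<delta>, r) \<in> Ar_mor" for Y \<Theta> \<gamma> \<delta> s r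
    by (rule ex1_reparametrise[where f = "Arrow \<gamma> \<delta>" and g = label]) (rule Ar_cell_iff[OF X that], simp)
  then show ?thesis unfolding bt by (simp cong: imp_cong)
qed

text \<open>
  Suppose that \<open>id\<^sub>l\<close> is bi-terminal. A 2-morphism between identities in the arrow 2-category is a single
  2-morphism used twice, so the case of identity objects says that isomorphisms lift uniquely.
  Given \<open>\<Theta> : T c \<Rightarrow> T d\<close>, some \<open>\<gamma>\<close> satisfies \<open>\<psi>\<^sub>2 \<circ> T \<gamma> = \<Theta> \<circ> \<psi>\<^sub>1\<close>; lifting \<open>\<psi>\<^sub>1\<inverse>\<close> and \<open>\<psi>\<^sub>2\<close> and
  composing them with \<open>\<gamma>\<close> gives a preimage of \<open>\<Theta>\<close>. Two preimages of \<open>\<Theta>\<close> are related by a square whose sides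
  lift identities and hence are identities, so they agree.
\<close>

theorem Ar_bi_terminal_iff_biuniversal:
  assumes X: "(X, l) \<in> obj"
  shows "bi_terminal (pslice (Ar B) (Ar A) (Ar_psfun B A L) D) (X, id2 A l) \<longleftrightarrow>
    biuniversal_arrow B A L D X l"
proof
  note l [simp] = objD[OF X, simplified]
  {
    assume u: "biuniversal_arrow B A L D X l"
    show "bi_terminal (pslice (Ar B) (Ar A) (Ar_psfun B A L) D) (X, id2 A l)"
      unfolding Ar_bi_terminal_iff[OF X]
    proof (intro conjI allI impI)
      fix Y \<Theta> assume "(Y, \<Theta>) \<in> Ar_obj"
      then have t: "\<Theta> \<in> Cell A" "(Y, dom2 A \<Theta>) \<in> obj" "(Y, cod2 A \<Theta>) \<in> obj"
        by (simp_all add: Ar_obj_iff)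
      obtain c \<psi> where p: "Arrow (Y, dom2 A \<Theta>) (X, l) (c, \<psi>) \<in> mor"
        using biuniversalD(2)[OF u t(2)] by blast
      obtain d \<phi> where q: "Arrow (Y, cod2 A \<Theta>) (X, l) (d, \<phi>) \<in> mor"
        using biuniversalD(2)[OF u t(3)] by blast
      have "\<Theta> \<in> hom2 A (dom2 A \<Theta>) (cod2 A \<Theta>)" using t by (simp add: hom2_def)
      from biuniversal_iso_lift[OF u this p q] obtain \<gamma>
        where g: "\<gamma> \<in> hom2 B c d" "\<Theta> \<bullet> \<psi> = \<phi> \<bullet> whisk l \<gamma>" by blast
      then have "Arrow (Y, \<Theta>) (X, id2 A l) (\<gamma>, Arrow (whisk l \<gamma>) \<Theta> (\<psi>, \<phi>)) \<in> Ar_mor"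
        unfolding Ar_mor_iff[OF X] using t p q by (simp add: hom2_def)
      then show "\<exists>\<gamma> s. Arrow (Y, \<Theta>) (X, id2 A l) (\<gamma>, s) \<in> Ar_mor" by blast
    next
      fix Y \<Theta> \<gamma> s \<delta> r
      assume p: "Arrow (Y, \<Theta>) (X, id2 A l) (\<gamma>, s) \<in> Ar_mor" and q: "Arrow (Y, \<Theta>) (X, id2 A l) (\<delta>, r) \<in> Ar_mor"
      note p' = p[unfolded Ar_mor_iff[OF X]] and q' = q[unfolded Ar_mor_iff[OF X]]
      define \<psi>1 \<psi>2 \<phi>1 \<phi>2 where ps: "\<psi>1 = fst (label s)" "\<psi>2 = snd (label s)" "\<phi>1 = fst (label r)" "\<phi>2 = snd (label r)"
      have c [simp]: "\<Theta> \<in> Cell A" "\<gamma> \<in> Cell B" "\<delta> \<in> Cell B" using p' q' by blast+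
      have m: "Arrow (Y, dom2 A \<Theta>) (X, l) (dom2 B \<gamma>, \<psi>1) \<in> mor" "Arrow (Y, cod2 A \<Theta>) (X, l) (cod2 B \<gamma>, \<psi>2) \<in> mor"
        "Arrow (Y, dom2 A \<Theta>) (X, l) (dom2 B \<delta>, \<phi>1) \<in> mor" "Arrow (Y, cod2 A \<Theta>) (X, l) (cod2 B \<delta>, \<phi>2) \<in> mor"
        using p' q' unfolding ps by blast+
      have e: "\<psi>2 \<bullet> whisk l \<gamma> = \<Theta> \<bullet> \<psi>1" "\<phi>2 \<bullet> whisk l \<delta> = \<Theta> \<bullet> \<phi>1"
        using p' q' unfolding ps by blast+
      note md = morD[OF m(1), simplified] morD[OF m(2), simplified] morD[OF m(3), simplified] morD[OF m(4), simplified]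
      note [simp] = md
      have lift: "\<exists>!\<beta>. \<beta> \<in> hom2 B a b \<and> \<phi> \<bullet> whisk l \<beta> = \<psi>"
        if "Arrow (Y, \<kappa>) (X, l) (a, \<psi>) \<in> mor" "Arrow (Y, \<kappa>) (X, l) (b, \<phi>) \<in> mor" for \<kappa> a b \<psi> \<phi>
        using biuniversal_imp_bi_terminal[OF u] that unfolding bi_terminal_pslice_iff[OF X] by blast
      obtain \<beta>1 where b1: "\<beta>1 \<in> hom2 B (dom2 B \<gamma>) (dom2 B \<delta>)" "\<phi>1 \<bullet> whisk l \<beta>1 = \<psi>1"
        using lift[OF m(1,3)] by blast
      obtain \<beta>2 where b2: "\<beta>2 \<in> hom2 B (cod2 B \<gamma>) (cod2 B \<delta>)" "\<phi>2 \<bullet> whisk l \<beta>2 = \<psi>2"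
        using lift[OF m(2,4)] by blast
      have [simp]: "\<beta>1 \<in> Cell B" "dom2 B \<beta>1 = dom2 B \<gamma>" "cod2 B \<beta>1 = dom2 B \<delta>"
        "\<beta>2 \<in> Cell B" "dom2 B \<beta>2 = cod2 B \<gamma>" "cod2 B \<beta>2 = cod2 B \<delta>"
        using b1 b2 by (simp_all add: hom2_def)
      have sq: "\<beta>2 \<bullet>\<^bsub>B\<^esub> \<gamma> = \<delta> \<bullet>\<^bsub>B\<^esub> \<beta>1"
      proof -
        have t: "\<Theta> \<in> hom2 A (dom2 A \<Theta>) (cod2 A \<Theta>)" by (simp add: hom2_def)
        have "\<phi>2 \<bullet> whisk l (\<beta>2 \<bullet>\<^bsub>B\<^esub> \<gamma>) = (\<phi>2 \<bullet> whisk l \<beta>2) \<bullet> whisk l \<gamma>"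
          by (simp add: L.on2_vcomp A.whisker_left)
        then have 1: "\<Theta> \<bullet> \<psi>1 = \<phi>2 \<bullet> whisk l (\<beta>2 \<bullet>\<^bsub>B\<^esub> \<gamma>)" unfolding b2 e by simp
        have "\<phi>2 \<bullet> whisk l (\<delta> \<bullet>\<^bsub>B\<^esub> \<beta>1) = (\<phi>2 \<bullet> whisk l \<delta>) \<bullet> whisk l \<beta>1"
          by (simp add: L.on2_vcomp A.whisker_left)
        also have "\<dots> = \<Theta> \<bullet> (\<phi>1 \<bullet> whisk l \<beta>1)" unfolding e by simp
        finally have 2: "\<Theta> \<bullet> \<psi>1 = \<phi>2 \<bullet> whisk l (\<delta> \<bullet>\<^bsub>B\<^esub> \<beta>1)" unfolding b1 by simp
        have "\<beta>2 \<bullet>\<^bsub>B\<^esub> \<gamma> \<in> hom2 B (dom2 B \<gamma>) (cod2 B \<delta>)" "\<delta> \<bullet>\<^bsub>B\<^esub> \<beta>1 \<in> hom2 B (dom2 B \<gamma>) (cod2 B \<delta>)"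
          by (simp_all add: hom2_def)
        with biuniversal_iso_lift[OF u t m(1,4)] 1 2 show ?thesis by blast
      qed
      show "\<exists>!\<beta>. fst \<beta> \<in> hom2 B (dom2 B \<gamma>) (dom2 B \<delta>) \<and> snd \<beta> \<in> hom2 B (cod2 B \<gamma>) (cod2 B \<delta>) \<and>
        snd \<beta> \<bullet>\<^bsub>B\<^esub> \<gamma> = \<delta> \<bullet>\<^bsub>B\<^esub> fst \<beta> \<and>
        fst (label r) \<bullet> whisk l (fst \<beta>) = fst (label s) \<and>
        snd (label r) \<bullet> whisk l (snd \<beta>) = snd (label s)"
        unfolding ps[symmetric]
      proof (rule ex1I[of _ "(\<beta>1, \<beta>2)"])
        fix \<beta> :: "'t \<times> 't"
        assume b: "fst \<beta> \<in> hom2 B (dom2 B \<gamma>) (dom2 B \<delta>) \<and> snd \<beta> \<in> hom2 B (cod2 B \<gamma>) (cod2 B \<delta>) \<and>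
          snd \<beta> \<bullet>\<^bsub>B\<^esub> \<gamma> = \<delta> \<bullet>\<^bsub>B\<^esub> fst \<beta> \<and> \<phi>1 \<bullet> whisk l (fst \<beta>) = \<psi>1 \<and>
          \<phi>2 \<bullet> whisk l (snd \<beta>) = \<psi>2"
        then have "fst \<beta> = \<beta>1" "snd \<beta> = \<beta>2" using b1 b2 lift[OF m(1,3)] lift[OF m(2,4)] by blast+
        then show "\<beta> = (\<beta>1, \<beta>2)" by (simp add: prod_eq_iff)
      qed (use b1 b2 sq in simp)
    qed
  next
    assume bt: "bi_terminal (pslice (Ar B) (Ar A) (Ar_psfun B A L) D) (X, id2 A l)"
    note ex = bt[unfolded Ar_bi_terminal_iff[OF X], THEN conjunct1, rule_format]
      and un = bt[unfolded Ar_bi_terminal_iff[OF X], THEN conjunct2, rule_format]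
    have lift: "\<exists>!\<beta>. \<beta> \<in> hom2 B c d \<and> \<phi> \<bullet> whisk l \<beta> = \<psi>"
      if p: "Arrow (Y, \<kappa>) (X, l) (c, \<psi>) \<in> mor" and q: "Arrow (Y, \<kappa>) (X, l) (d, \<phi>) \<in> mor" for Y \<kappa> c d \<psi> \<phi>
    proof -
      note [simp] = morD[OF p, simplified] morD[OF q, simplified]
      have [simp]: "\<kappa> \<in> Mor A" using objD[of "(Y, \<kappa>)"] by simp
      have m: "Arrow (Y, id2 A \<kappa>) (X, id2 A l) (id2 B c, Arrow (whisk l (id2 B c)) (id2 A \<kappa>) (\<psi>, \<psi>)) \<in> Ar_mor"
        "Arrow (Y, id2 A \<kappa>) (X, id2 A l) (id2 B d, Arrow (whisk l (id2 B d)) (id2 A \<kappa>) (\<phi>, \<phi>)) \<in> Ar_mor"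
        unfolding Ar_mor_iff[OF X] using p q by simp_all
      have "\<exists>!\<beta>. fst \<beta> \<in> hom2 B c d \<and> snd \<beta> \<in> hom2 B c d \<and> snd \<beta> \<bullet>\<^bsub>B\<^esub> id2 B c = id2 B d \<bullet>\<^bsub>B\<^esub> fst \<beta> \<and>
          \<phi> \<bullet> whisk l (fst \<beta>) = \<psi> \<and> \<phi> \<bullet> whisk l (snd \<beta>) = \<psi>"
        using un[OF m] by simp
      moreover have "\<beta> \<bullet>\<^bsub>B\<^esub> id2 B c = \<beta>" "id2 B d \<bullet>\<^bsub>B\<^esub> \<beta> = \<beta>" if "\<beta> \<in> hom2 B c d" for \<beta>
        using B.vcomp_id_left[OF that] B.vcomp_id_right[OF that] by simp_all
      ultimately show ?thesis by (metis fst_conv snd_conv)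
    qed
    show "biuniversal_arrow B A L D X l"
    proof (rule biuniversalI[OF X])
      fix Y \<kappa> assume k: "(Y, \<kappa>) \<in> obj"
      then have "(Y, id2 A \<kappa>) \<in> Ar_obj" using objD[OF k] by (simp add: Ar_obj_iff)
      from ex[OF this] obtain \<gamma> s where "Arrow (Y, id2 A \<kappa>) (X, id2 A l) (\<gamma>, s) \<in> Ar_mor" by blast
      then show "\<exists>c \<psi>. Arrow (Y, \<kappa>) (X, l) (c, \<psi>) \<in> mor"
        unfolding Ar_mor_iff[OF X] using objD[OF k] by auto
    next
      fix Y c d \<Theta>
      assume c: "c \<in> hom1 B Y X" and d: "d \<in> hom1 B Y X" and t: "\<Theta> \<in> hom2 A (l \<cdot> on1 L c) (l \<cdot> on1 L d)"
      let ?c = "l \<cdot> on1 L c" and ?d = "l \<cdot> on1 L d"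
      note ic = id_mor[OF X c] and id = id_mor[OF X d]
      note mc [simp] = morD[OF ic, simplified] morD[OF id, simplified]
      have [simp]: "\<Theta> \<in> Cell A" "dom2 A \<Theta> = ?c" "cod2 A \<Theta> = ?d" using t by (simp_all add: hom2_def)
      have [simp]: "c \<in> Mor B" "d \<in> Mor B" "src B c = Y" "src B d = Y" "tgt B c = X" "tgt B d = X"
        using c d by (simp_all add: hom1_def)
      have "(Y, \<Theta>) \<in> Ar_obj" by (simp add: Ar_obj_iff)
      from ex[OF this] obtain \<gamma> s where g: "Arrow (Y, \<Theta>) (X, id2 A l) (\<gamma>, s) \<in> Ar_mor" by blast
      define \<psi>1 \<psi>2 where ps: "\<psi>1 = fst (label s)" "\<psi>2 = snd (label s)"
      have g': "\<gamma> \<in> Cell B" "Arrow (Y, ?c) (X, l) (dom2 B \<gamma>, \<psi>1) \<in> mor" "Arrow (Y, ?d) (X, l) (cod2 B \<gamma>, \<psi>2) \<in> mor"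
        and e: "\<psi>2 \<bullet> whisk l \<gamma> = \<Theta> \<bullet> \<psi>1"
        using g[unfolded Ar_mor_iff[OF X]] unfolding ps by simp_all
      note [simp] = g'(1) morD[OF g'(2), simplified] morD[OF g'(3), simplified]
      obtain \<beta>1 where b1: "\<beta>1 \<in> hom2 B c (dom2 B \<gamma>)" "\<psi>1 \<bullet> whisk l \<beta>1 = id2 A ?c"
        using lift[OF ic g'(2)] by blast
      obtain \<beta>2 where b2: "\<beta>2 \<in> hom2 B (cod2 B \<gamma>) d" "id2 A ?d \<bullet> whisk l \<beta>2 = \<psi>2"
        using lift[OF g'(3) id] by blast
      have [simp]: "\<beta>1 \<in> Cell B" "dom2 B \<beta>1 = c" "cod2 B \<beta>1 = dom2 B \<gamma>"
        "\<beta>2 \<in> Cell B" "dom2 B \<beta>2 = cod2 B \<gamma>" "cod2 B \<beta>2 = d"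
        using b1 b2 by (simp_all add: hom2_def)
      have b2': "whisk l \<beta>2 = \<psi>2" using b2(2) by simp
      let ?g = "\<beta>2 \<bullet>\<^bsub>B\<^esub> \<gamma> \<bullet>\<^bsub>B\<^esub> \<beta>1"
      have gh: "?g \<in> hom2 B c d" by (simp add: hom2_def)
      have "whisk l ?g = (whisk l \<beta>2 \<bullet> whisk l \<gamma>) \<bullet> whisk l \<beta>1"
        by (simp add: L.on2_vcomp A.whisker_left)
      also have "\<dots> = \<Theta> \<bullet> (\<psi>1 \<bullet> whisk l \<beta>1)" unfolding b2' e by simp
      also have "\<dots> = \<Theta>" unfolding b1 by simp
      finally have gt: "whisk l ?g = \<Theta>" .
      have "\<gamma>1 = \<gamma>2" if g1: "\<gamma>1 \<in> hom2 B c d" "whisk l \<gamma>1 = \<Theta>"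
        and g2: "\<gamma>2 \<in> hom2 B c d" "whisk l \<gamma>2 = \<Theta>" for \<gamma>1 \<gamma>2
      proof -
        have [simp]: "\<gamma>1 \<in> Cell B" "\<gamma>2 \<in> Cell B" "dom2 B \<gamma>1 = c" "cod2 B \<gamma>1 = d" "dom2 B \<gamma>2 = c" "cod2 B \<gamma>2 = d"
          using g1 g2 by (simp_all add: hom2_def)
        let ?s = "Arrow \<Theta> \<Theta> (id2 A ?c, id2 A ?d)"
        have m: "Arrow (Y, \<Theta>) (X, id2 A l) (\<gamma>1, ?s) \<in> Ar_mor" "Arrow (Y, \<Theta>) (X, id2 A l) (\<gamma>2, ?s) \<in> Ar_mor"
          unfolding Ar_mor_iff[OF X] using ic id by (simp_all add: g1(2) g2(2))
        obtain \<beta> where b: "fst \<beta> \<in> hom2 B c c" "snd \<beta> \<in> hom2 B d d" "snd \<beta> \<bullet>\<^bsub>B\<^esub> \<gamma>1 = \<gamma>2 \<bullet>\<^bsub>B\<^esub> fst \<beta>"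
            "id2 A ?c \<bullet> whisk l (fst \<beta>) = id2 A ?c"
            "id2 A ?d \<bullet> whisk l (snd \<beta>) = id2 A ?d"
          using ex1_implies_ex[OF un[OF m]] by auto
        have i: "id2 B c \<in> hom2 B c c" "id2 B d \<in> hom2 B d d" by (simp_all add: hom2_def)
        have i': "id2 A ?c \<bullet> whisk l (id2 B c) = id2 A ?c"
          "id2 A ?d \<bullet> whisk l (id2 B d) = id2 A ?d" by simp_all
        have "fst \<beta> = id2 B c" "snd \<beta> = id2 B d"
          using lift[OF ic ic] lift[OF id id] b i i' by blast+
        with b(3) show ?thesis by simp
      qed
      with gh gt show "\<exists>!\<gamma>. \<gamma> \<in> hom2 B c d \<and> whisk l \<gamma> = \<Theta>" by blast
    qed
  }
qed

end

section \<open>Equivalences of categories\<close>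

lemma chom_iff: "u \<in> chom A x y \<longleftrightarrow> u \<in> cAr A \<and> cdom A u = x \<and> ccod A u = y"
  by (simp add: chom_def)

context category
begin

lemma cAr_simps [simp]:
  assumes "u \<in> cAr A"
  shows "cdom A u \<in> cOb A" "ccod A u \<in> cOb A"
  using dom_cod[OF assms] by auto

lemma cid_simps [simp]:
  assumes "x \<in> cOb A"
  shows "cid A x \<in> cAr A" "cdom A (cid A x) = x" "ccod A (cid A x) = x"
  using id_hom[OF assms] by (simp_all add: chom_iff)

lemma ccomp_simps [simp]:
  assumes "u \<in> cAr A" "v \<in> cAr A" "ccod A u = cdom A v"
  shows "v \<odot> u \<in> cAr A" "cdom A (v \<odot> u) = cdom A u" "ccod A (v \<odot> u) = ccod A v"
  using comp_hom[of u "cdom A u" "ccod A u" v "ccod A v"] assms by (simp_all add: chom_iff)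

lemma ccomp_cid [simp]:
  "u \<in> cAr A \<Longrightarrow> ccod A u = y \<Longrightarrow> cid A y \<odot> u = u"
  "u \<in> cAr A \<Longrightarrow> cdom A u = x \<Longrightarrow> u \<odot> cid A x = u"
  using id_left[of u] id_right[of u] by (auto simp: chom_iff)

lemma ccomp_assoc [simp]:
  "u \<in> cAr A \<Longrightarrow> v \<in> cAr A \<Longrightarrow> w \<in> cAr A \<Longrightarrow> ccod A u = cdom A v \<Longrightarrow> ccod A v = cdom A w \<Longrightarrow>
    (w \<odot> v) \<odot> u = w \<odot> (v \<odot> u)"
  using assoc[of u "cdom A u" "ccod A u" v "ccod A v" w "ccod A w"] by (simp add: chom_iff)

end

definition is_ciso :: "('a, 'b) cat \<Rightarrow> 'b \<Rightarrow> bool" where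
  "is_ciso A u \<longleftrightarrow> u \<in> cAr A \<and> (\<exists>v\<in>chom A (ccod A u) (cdom A u).
     v \<odot>\<^bsub>A\<^esub> u = cid A (cdom A u) \<and> u \<odot>\<^bsub>A\<^esub> v = cid A (ccod A u))"

definition cinv :: "('a, 'b) cat \<Rightarrow> 'b \<Rightarrow> 'b" where
  "cinv A u = (SOME v. v \<in> chom A (ccod A u) (cdom A u) \<and>
     v \<odot>\<^bsub>A\<^esub> u = cid A (cdom A u) \<and> u \<odot>\<^bsub>A\<^esub> v = cid A (ccod A u))"

context category
begin

lemma cinv_simps [simp]:
  assumes "is_ciso A u"
  shows "u \<in> cAr A" "cinv A u \<in> cAr A" "cdom A (cinv A u) = ccod A u" "ccod A (cinv A u) = cdom A u"
    "cinv A u \<odot> u = cid A (cdom A u)" "u \<odot> cinv A u = cid A (ccod A u)"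
proof -
  have "\<exists>v. v \<in> chom A (ccod A u) (cdom A u) \<and>
     v \<odot> u = cid A (cdom A u) \<and> u \<odot> v = cid A (ccod A u)"
    using assms unfolding is_ciso_def by blast
  from someI_ex[OF this, folded cinv_def]
  show "cinv A u \<in> cAr A" "cdom A (cinv A u) = ccod A u" "ccod A (cinv A u) = cdom A u"
    "cinv A u \<odot> u = cid A (cdom A u)" "u \<odot> cinv A u = cid A (ccod A u)"
    by (simp_all add: chom_iff)
  show "u \<in> cAr A" using assms by (simp add: is_ciso_def)
qed

lemma cinv_cancel [simp]:
  assumes "is_ciso A u" "w \<in> cAr A"
  shows "ccod A w = cdom A u \<Longrightarrow> cinv A u \<odot> (u \<odot> w) = w"
    "ccod A w = ccod A u \<Longrightarrow> u \<odot> (cinv A u \<odot> w) = w"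
proof -
  show "cinv A u \<odot> (u \<odot> w) = w" if "ccod A w = cdom A u"
  proof -
    have "cinv A u \<odot> (u \<odot> w) = (cinv A u \<odot> u) \<odot> w"
      by (rule ccomp_assoc[symmetric]) (use assms that in simp_all)
    then show ?thesis using assms that by simp
  qed
  show "u \<odot> (cinv A u \<odot> w) = w" if "ccod A w = ccod A u"
  proof -
    have "u \<odot> (cinv A u \<odot> w) = (u \<odot> cinv A u) \<odot> w"
      by (rule ccomp_assoc[symmetric]) (use assms that in simp_all)
    then show ?thesis using assms that by simp
  qed
qed

lemma is_cisoI:
  assumes "u \<in> chom A x y" "v \<in> chom A y x" "v \<odot> u = cid A x" "u \<odot> v = cid A y"
  shows "is_ciso A u"
proof -
  have u: "u \<in> cAr A" "cdom A u = x" "ccod A u = y" using assms(1) by (simp_all add: chom_iff)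
  show ?thesis unfolding is_ciso_def u(2,3) using u(1) assms(2-4) by blast
qed

lemma is_ciso_cinv [simp]: "is_ciso A u \<Longrightarrow> is_ciso A (cinv A u)"
  by (rule is_cisoI[of _ "ccod A u" "cdom A u" u]) (simp_all add: chom_iff)

end

lemma is_functorD:
  assumes "is_functor A B F"
  shows "x \<in> cOb A \<Longrightarrow> fob F x \<in> cOb B"
    and "u \<in> cAr A \<Longrightarrow> far F u \<in> cAr B"
    and "u \<in> cAr A \<Longrightarrow> cdom B (far F u) = fob F (cdom A u)"
    and "u \<in> cAr A \<Longrightarrow> ccod B (far F u) = fob F (ccod A u)"
    and "x \<in> cOb A \<Longrightarrow> far F (cid A x) = cid B (fob F x)"
    and "u \<in> cAr A \<Longrightarrow> v \<in> cAr A \<Longrightarrow> ccod A u = cdom A v \<Longrightarrow> far F (v \<odot>\<^bsub>A\<^esub> u) = far F v \<odot>\<^bsub>B\<^esub> far F u"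
    and "fob F \<in> extensional (cOb A)" "far F \<in> extensional (cAr A)"
  using assms by (auto simp: is_functor_def chom_iff PiE_def Pi_def)

lemma is_functorI:
  assumes "fob F \<in> extensional (cOb A)" "far F \<in> extensional (cAr A)"
    and "\<And>x. x \<in> cOb A \<Longrightarrow> fob F x \<in> cOb B"
    and "\<And>u. u \<in> cAr A \<Longrightarrow> far F u \<in> cAr B"
    and "\<And>u. u \<in> cAr A \<Longrightarrow> cdom B (far F u) = fob F (cdom A u)"
    and "\<And>u. u \<in> cAr A \<Longrightarrow> ccod B (far F u) = fob F (ccod A u)"
    and "\<And>x. x \<in> cOb A \<Longrightarrow> far F (cid A x) = cid B (fob F x)"
    and "\<And>u v. u \<in> cAr A \<Longrightarrow> v \<in> cAr A \<Longrightarrow> ccod A u = cdom A v \<Longrightarrow> far F (v \<odot>\<^bsub>A\<^esub> u) = far F v \<odot>\<^bsub>B\<^esub> far F u"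
  shows "is_functor A B F"
  using assms unfolding is_functor_def chom_iff PiE_def Pi_def by blast

lemma is_nat_transD:
  assumes "is_nat_trans A B F G \<eta>"
  shows "\<eta> \<in> extensional (cOb A)"
    and "x \<in> cOb A \<Longrightarrow> \<eta> x \<in> cAr B" "x \<in> cOb A \<Longrightarrow> cdom B (\<eta> x) = fob F x"
    "x \<in> cOb A \<Longrightarrow> ccod B (\<eta> x) = fob G x"
    and "u \<in> cAr A \<Longrightarrow> far G u \<odot>\<^bsub>B\<^esub> \<eta> (cdom A u) = \<eta> (ccod A u) \<odot>\<^bsub>B\<^esub> far F u"
  using assms by (auto simp: is_nat_trans_def chom_iff)

lemma is_nat_isoD:
  "is_nat_iso A B F G \<eta> \<Longrightarrow> is_nat_trans A B F G \<eta>"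
  "is_nat_iso A B F G \<eta> \<Longrightarrow> x \<in> cOb A \<Longrightarrow> is_ciso B (\<eta> x)"
  by (auto simp: is_nat_iso_def is_ciso_def is_nat_trans_def chom_iff)

lemma is_nat_isoI:
  assumes "\<eta> \<in> extensional (cOb A)" "\<And>x. x \<in> cOb A \<Longrightarrow> is_ciso B (\<eta> x)"
    "\<And>x. x \<in> cOb A \<Longrightarrow> cdom B (\<eta> x) = fob F x" "\<And>x. x \<in> cOb A \<Longrightarrow> ccod B (\<eta> x) = fob G x"
    "\<And>u. u \<in> cAr A \<Longrightarrow> far G u \<odot>\<^bsub>B\<^esub> \<eta> (cdom A u) = \<eta> (ccod A u) \<odot>\<^bsub>B\<^esub> far F u"
  shows "is_nat_iso A B F G \<eta>"
  unfolding is_nat_iso_def is_nat_trans_def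
proof (intro conjI ballI)
  fix x assume x: "x \<in> cOb A"
  show "\<eta> x \<in> chom B (fob F x) (fob G x)" using assms(2-4)[OF x] by (simp add: chom_iff is_ciso_def)
  show "\<exists>v\<in>chom B (fob G x) (fob F x). v \<odot>\<^bsub>B\<^esub> \<eta> x = cid B (fob F x) \<and> \<eta> x \<odot>\<^bsub>B\<^esub> v = cid B (fob G x)"
    using assms(2)[OF x] unfolding is_ciso_def assms(3,4)[OF x] by blast
qed (use assms in auto)

lemma fctr_id_sel [simp]:
  "x \<in> cOb A \<Longrightarrow> fob (fctr_id A) x = x" "u \<in> cAr A \<Longrightarrow> far (fctr_id A) u = u"
  "x \<in> cOb A \<Longrightarrow> fob (fctr_comp A G F) x = fob G (fob F x)"
  "u \<in> cAr A \<Longrightarrow> far (fctr_comp A G F) u = far G (far F u)"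
  by (simp_all add: fctr_id_def fctr_comp_def)

text \<open>
  The unit identifies \<open>G \<circ> F\<close> with the identity, so that a preimage of \<open>v\<close> can only be \<open>G v\<close> conjugated
  by the unit. The functor \<open>G\<close> sends the image of this candidate to \<open>G v\<close>, and \<open>G\<close> is faithful because
  of the counit.
\<close>

lemma adjoint_equivalence_imp:
  assumes "category A" "category B" and ae: "adjoint_equivalence A B F"
  shows "y \<in> cOb B \<Longrightarrow> \<exists>x\<in>cOb A. \<exists>u\<in>chom B (fob F x) y. is_ciso B u"
    and "x \<in> cOb A \<Longrightarrow> x' \<in> cOb A \<Longrightarrow> v \<in> chom B (fob F x) (fob F x') \<Longrightarrow>
      \<exists>!u. u \<in> chom A x x' \<and> far F u = v"
proof -
  interpret A: category A by fact
  interpret B: category B by fact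
  obtain G \<eta> \<epsilon> where F: "is_functor A B F" and G: "is_functor B A G"
    and n: "is_nat_iso A A (fctr_id A) (fctr_comp A G F) \<eta>"
    and e: "is_nat_iso B B (fctr_comp B F G) (fctr_id B) \<epsilon>"
    using ae unfolding adjoint_equivalence_def by blast
  note [simp] = is_functorD[OF F] is_functorD[OF G]
  note nn = is_nat_transD[OF is_nat_isoD(1)[OF n]] and ee = is_nat_transD[OF is_nat_isoD(1)[OF e]]
  show "\<exists>x\<in>cOb A. \<exists>u\<in>chom B (fob F x) y. is_ciso B u" if y: "y \<in> cOb B" for y
    by (rule bexI[of _ "fob G y"], rule bexI[of _ "\<epsilon> y"])
      (use y ee is_nat_isoD(2)[OF e] in \<open>simp_all add: chom_iff\<close>)
  fix x x' v
  assume x: "x \<in> cOb A" and x': "x' \<in> cOb A" and v: "v \<in> chom B (fob F x) (fob F x')"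
  have [simp]: "v \<in> cAr B" "cdom B v = fob F x" "ccod B v = fob F x'" using v by (simp_all add: chom_iff)
  note [simp] = x x' is_nat_isoD(2)[OF n x] is_nat_isoD(2)[OF n x'] nn(3,4)[OF x, simplified] nn(3,4)[OF x', simplified]
  let ?u = "cinv A (\<eta> x') \<odot>\<^bsub>A\<^esub> (far G v \<odot>\<^bsub>A\<^esub> \<eta> x)"
  have u: "?u \<in> cAr A" "cdom A ?u = x" "ccod A ?u = x'" by simp_all
  have unat: "w = cinv A (\<eta> x') \<odot>\<^bsub>A\<^esub> (far G (far F w) \<odot>\<^bsub>A\<^esub> \<eta> x)"
    if w: "w \<in> cAr A" "cdom A w = x" "ccod A w = x'" for w
  proof -
    have "far G (far F w) \<odot>\<^bsub>A\<^esub> \<eta> x = \<eta> x' \<odot>\<^bsub>A\<^esub> w" using nn(5)[OF w(1)] w by simp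
    then show ?thesis using w by simp
  qed
  have "far G (far F ?u) \<odot>\<^bsub>A\<^esub> \<eta> x = \<eta> x' \<odot>\<^bsub>A\<^esub> ?u" using nn(5)[OF u(1)] u by simp
  also have "\<dots> = far G v \<odot>\<^bsub>A\<^esub> \<eta> x" by simp
  finally have "(far G (far F ?u) \<odot>\<^bsub>A\<^esub> \<eta> x) \<odot>\<^bsub>A\<^esub> cinv A (\<eta> x) = (far G v \<odot>\<^bsub>A\<^esub> \<eta> x) \<odot>\<^bsub>A\<^esub> cinv A (\<eta> x)" by simp
  moreover have "(w \<odot>\<^bsub>A\<^esub> \<eta> x) \<odot>\<^bsub>A\<^esub> cinv A (\<eta> x) = w" if "w \<in> cAr A" "cdom A w = fob G (fob F x)" for w
    using that by simp
  ultimately have gf: "far G (far F ?u) = far G v" using u by simp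
  \<comment> \<open>the functor \<open>G\<close> is faithful because \<open>\<epsilon>\<close> is a natural isomorphism\<close>
  note ey = ee(3,4)[of "fob F x", simplified] ee(3,4)[of "fob F x'", simplified]
    is_nat_isoD(2)[OF e, of "fob F x", simplified] is_nat_isoD(2)[OF e, of "fob F x'", simplified]
  have g: "w = (\<epsilon> (fob F x') \<odot>\<^bsub>B\<^esub> far F (far G w)) \<odot>\<^bsub>B\<^esub> cinv B (\<epsilon> (fob F x))"
    if w: "w \<in> cAr B" "cdom B w = fob F x" "ccod B w = fob F x'" for w
  proof -
    have "\<epsilon> (fob F x') \<odot>\<^bsub>B\<^esub> far F (far G w) = w \<odot>\<^bsub>B\<^esub> \<epsilon> (fob F x)" using ee(5)[OF w(1)] w by simp
    then show ?thesis using w ey by simp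
  qed
  have "far F ?u = (\<epsilon> (fob F x') \<odot>\<^bsub>B\<^esub> far F (far G (far F ?u))) \<odot>\<^bsub>B\<^esub> cinv B (\<epsilon> (fob F x))"
    by (rule g) (use u in \<open>simp_all only: is_functorD(2-4)[OF F]\<close>)
  also have "\<dots> = v" unfolding gf by (rule g[symmetric]) simp_all
  finally have fu: "far F ?u = v" .
  have un: "w = ?u" if "w \<in> cAr A" "cdom A w = x" "ccod A w = x'" "far F w = v" for w
    using unat[OF that(1-3)] unfolding that(4) .
  show "\<exists>!u. u \<in> chom A x x' \<and> far F u = v"
  proof (rule ex1I[of _ ?u])
    show "?u \<in> chom A x x' \<and> far F ?u = v" unfolding chom_iff by (intro conjI u fu)
    show "w = ?u" if "w \<in> chom A x x' \<and> far F w = v" for w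
      using that un[of w] unfolding chom_iff by (elim conjE)
  qed
qed

text \<open>
  Choose for every \<open>y\<close> an object \<open>g y\<close> and an isomorphism \<open>e y : F (g y) \<rightarrow> y\<close>. The action of \<open>G\<close> on arrows and
  the unit are defined as lifts along \<open>F\<close>, so that all equations in \<open>A\<close>, in particular a
  triangle identity, can be checked after applying the faithful functor \<open>F\<close>.
\<close>

lemma adjoint_equivalenceI:
  assumes "category A" "category B" and F: "is_functor A B F"
    and es: "\<And>y. y \<in> cOb B \<Longrightarrow> \<exists>x\<in>cOb A. \<exists>u\<in>chom B (fob F x) y. is_ciso B u"
    and ff: "\<And>x x' v. x \<in> cOb A \<Longrightarrow> x' \<in> cOb A \<Longrightarrow> v \<in> chom B (fob F x) (fob F x') \<Longrightarrow>
      \<exists>!u. u \<in> chom A x x' \<and> far F u = v"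
  shows "adjoint_equivalence A B F"
proof -
  interpret A: category A by fact
  interpret B: category B by fact
  note [simp] = is_functorD[OF F]
  have "\<forall>y\<in>cOb B. \<exists>xu. fst xu \<in> cOb A \<and> snd xu \<in> chom B (fob F (fst xu)) y \<and> is_ciso B (snd xu)"
    using es by fastforce
  then obtain r where r: "\<And>y. y \<in> cOb B \<Longrightarrow> fst (r y) \<in> cOb A \<and> snd (r y) \<in> chom B (fob F (fst (r y))) y \<and> is_ciso B (snd (r y))"
    using bchoice[of "cOb B"] by meson
  define g where "g y = fst (r y)" for y
  define e where "e y = snd (r y)" for y
  have ge [simp]: "g y \<in> cOb A" "is_ciso B (e y)" "cdom B (e y) = fob F (g y)" "ccod B (e y) = y"
    if "y \<in> cOb B" for y
    using r[OF that] by (simp_all add: g_def e_def chom_iff)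
  define lift where "lift x x' v = (THE u. u \<in> chom A x x' \<and> far F u = v)" for x x' v
  have lift: "lift x x' v \<in> cAr A" "cdom A (lift x x' v) = x" "ccod A (lift x x' v) = x'" "far F (lift x x' v) = v"
    if "x \<in> cOb A" "x' \<in> cOb A" "v \<in> cAr B" "cdom B v = fob F x" "ccod B v = fob F x'" for x x' v
  proof -
    have "v \<in> chom B (fob F x) (fob F x')" using that by (simp add: chom_iff)
    from theI'[OF ff[OF that(1,2) this], folded lift_def]
    show "lift x x' v \<in> cAr A" "cdom A (lift x x' v) = x" "ccod A (lift x x' v) = x'" "far F (lift x x' v) = v"
      by (simp_all add: chom_iff)
  qed
  have faithful: "u = w" if "u \<in> cAr A" "w \<in> cAr A" "cdom A u = cdom A w" "ccod A u = ccod A w" "far F u = far F w" for u w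
  proof -
    have "far F u \<in> chom B (fob F (cdom A u)) (fob F (ccod A u))" using that by (simp add: chom_iff)
    from ff[OF _ _ this] that show ?thesis by (auto simp: chom_iff)
  qed
  define ga where "ga w = lift (g (cdom B w)) (g (ccod B w)) (cinv B (e (ccod B w)) \<odot>\<^bsub>B\<^esub> w \<odot>\<^bsub>B\<^esub> e (cdom B w))" for w
  have ga [simp]: "ga w \<in> cAr A" "cdom A (ga w) = g (cdom B w)" "ccod A (ga w) = g (ccod B w)"
    "far F (ga w) = cinv B (e (ccod B w)) \<odot>\<^bsub>B\<^esub> w \<odot>\<^bsub>B\<^esub> e (cdom B w)" if "w \<in> cAr B" for w
    unfolding ga_def by (rule lift; use that in simp)+
  define G where "G = \<lparr>fob = (\<lambda>y\<in>cOb B. g y), far = (\<lambda>w\<in>cAr B. ga w)\<rparr>"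
  have G_sel [simp]: "y \<in> cOb B \<Longrightarrow> fob G y = g y" "w \<in> cAr B \<Longrightarrow> far G w = ga w" for y w
    by (simp_all add: G_def)
  have Gf: "is_functor B A G"
  proof (rule is_functorI)
    show "far G (cid B y) = cid A (fob G y)" if "y \<in> cOb B" for y
      by (rule faithful) (use that in simp_all)
    show "far G (w \<odot>\<^bsub>B\<^esub> v) = far G w \<odot>\<^bsub>A\<^esub> far G v" if "v \<in> cAr B" "w \<in> cAr B" "ccod B v = cdom B w" for v w
      by (rule faithful) (use that in simp_all)
  qed (simp_all add: G_def)
  define h where "h x = lift x (g (fob F x)) (cinv B (e (fob F x)))" for x
  have h [simp]: "h x \<in> cAr A" "cdom A (h x) = x" "ccod A (h x) = g (fob F x)" "far F (h x) = cinv B (e (fob F x))"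
    if "x \<in> cOb A" for x
    unfolding h_def by (rule lift; use that in simp)+
  have hi [simp]: "is_ciso A (h x)" if x: "x \<in> cOb A" for x
  proof -
    define k where "k = lift (g (fob F x)) x (e (fob F x))"
    have k [simp]: "k \<in> cAr A" "cdom A k = g (fob F x)" "ccod A k = x" "far F k = e (fob F x)"
      unfolding k_def by (rule lift; use x in simp)+
    show ?thesis
    proof (rule A.is_cisoI)
      show "h x \<in> chom A x (g (fob F x))" "k \<in> chom A (g (fob F x)) x" using x by (simp_all add: chom_iff)
      show "k \<odot>\<^bsub>A\<^esub> h x = cid A x" by (rule faithful) (use x in simp_all)
      show "h x \<odot>\<^bsub>A\<^esub> k = cid A (g (fob F x))" by (rule faithful) (use x in simp_all)
    qed
  qed
  have n: "is_nat_iso A A (fctr_id A) (fctr_comp A G F) (\<lambda>x\<in>cOb A. h x)"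
  proof (rule is_nat_isoI)
    show "far (fctr_comp A G F) u \<odot>\<^bsub>A\<^esub> (\<lambda>x\<in>cOb A. h x) (cdom A u) =
        (\<lambda>x\<in>cOb A. h x) (ccod A u) \<odot>\<^bsub>A\<^esub> far (fctr_id A) u" if "u \<in> cAr A" for u
      by (rule faithful) (use that in simp_all)
  qed simp_all
  have ee: "is_nat_iso B B (fctr_comp B F G) (fctr_id B) (\<lambda>y\<in>cOb B. e y)"
    by (rule is_nat_isoI) simp_all
  have t1: "(\<lambda>y\<in>cOb B. e y) (fob F x) \<odot>\<^bsub>B\<^esub> far F ((\<lambda>x\<in>cOb A. h x) x) = cid B (fob F x)" if "x \<in> cOb A" for x
    using that by simp
  have t2: "far G ((\<lambda>y\<in>cOb B. e y) y) \<odot>\<^bsub>A\<^esub> (\<lambda>x\<in>cOb A. h x) (fob G y) = cid A (fob G y)" if "y \<in> cOb B" for y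
    by (rule faithful) (use that in simp_all)
  show ?thesis
    unfolding adjoint_equivalence_def using F Gf n ee t1 t2 by blast
qed

section \<open>The 2-category of categories\<close>

lemma Cat_sel [simp]:
  "src Cat = source" "tgt Cat = target" "dom2 Cat = source" "cod2 Cat = target" "comp Cat = Cat_comp"
  "A \<in> Obj Cat \<longleftrightarrow> category A"
  by (simp_all add: Cat_def)

lemma Cat_ops [simp]:
  "source (id1 Cat A) = A" "target (id1 Cat A) = A" "label (id1 Cat A) = fctr_id A"
  "source (id2 Cat p) = p" "target (id2 Cat p) = p"
  "source (Cat_comp q p) = source p" "target (Cat_comp q p) = target q"
  "label (Cat_comp q p) = fctr_comp (source p) (label q) (label p)"
  "source (\<beta> \<bullet>\<^bsub>Cat\<^esub> \<alpha>) = source \<alpha>" "target (\<beta> \<bullet>\<^bsub>Cat\<^esub> \<alpha>) = target \<beta>"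
  "source (\<beta> \<star>\<^bsub>Cat\<^esub> \<alpha>) = Cat_comp (source \<beta>) (source \<alpha>)"
  "target (\<beta> \<star>\<^bsub>Cat\<^esub> \<alpha>) = Cat_comp (target \<beta>) (target \<alpha>)"
  "x \<in> cOb (source p) \<Longrightarrow> label (id2 Cat p) x = cid (target p) (fob (label p) x)"
  "x \<in> cOb (source (source \<alpha>)) \<Longrightarrow>
    label (\<beta> \<bullet>\<^bsub>Cat\<^esub> \<alpha>) x = label \<beta> x \<odot>\<^bsub>target (source \<alpha>)\<^esub> label \<alpha> x"
  "x \<in> cOb (source (source \<alpha>)) \<Longrightarrow> label (\<beta> \<star>\<^bsub>Cat\<^esub> \<alpha>) x =
    label \<beta> (fob (label (target \<alpha>)) x) \<odot>\<^bsub>target (source \<beta>)\<^esub> far (label (source \<beta>)) (label \<alpha> x)"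
  by (simp_all add: Cat_def Cat_comp_def)

lemma Mor_Cat: "p \<in> Mor Cat \<longleftrightarrow> category (source p) \<and> category (target p) \<and> is_functor (source p) (target p) (label p)"
  by (cases p) (simp add: Cat_def)

lemma Cell_Cat: "\<alpha> \<in> Cell Cat \<longleftrightarrow> source \<alpha> \<in> Mor Cat \<and> target \<alpha> \<in> Mor Cat \<and>
    source (target \<alpha>) = source (source \<alpha>) \<and> target (target \<alpha>) = target (source \<alpha>) \<and>
    is_nat_trans (source (source \<alpha>)) (target (source \<alpha>)) (label (source \<alpha>)) (label (target \<alpha>)) (label \<alpha>)"
proof (cases \<alpha>)
  case (Arrow p q g)
  then show ?thesis by (cases p; cases q) (auto simp: Cat_def)
qed

lemma Mor_Cat_eqI:
  assumes "p \<in> Mor Cat" "q \<in> Mor Cat" "source p = source q" "target p = target q"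
    and "\<And>x. x \<in> cOb (source p) \<Longrightarrow> fob (label p) x = fob (label q) x"
    and "\<And>u. u \<in> cAr (source p) \<Longrightarrow> far (label p) u = far (label q) u"
  shows "p = q"
proof (rule arrow_eqI)
  have f: "is_functor (source p) (target p) (label p)" "is_functor (source p) (target p) (label q)"
    using assms by (simp_all add: Mor_Cat)
  show "label p = label q"
  proof (rule fctr.equality)
    show "fob (label p) = fob (label q)"
      by (rule extensionalityI[OF is_functorD(7)[OF f(1)] is_functorD(7)[OF f(2)]]) (rule assms)
    show "far (label p) = far (label q)"
      by (rule extensionalityI[OF is_functorD(8)[OF f(1)] is_functorD(8)[OF f(2)]]) (rule assms)
  qed simp
qed (use assms in simp_all)

lemma Cell_Cat_eqI:
  assumes "\<alpha> \<in> Cell Cat" "\<beta> \<in> Cell Cat" "source \<alpha> = source \<beta>" "target \<alpha> = target \<beta>"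
    and "\<And>x. x \<in> cOb (source (source \<alpha>)) \<Longrightarrow> label \<alpha> x = label \<beta> x"
  shows "\<alpha> = \<beta>"
proof (rule arrow_eqI)
  show "label \<alpha> = label \<beta>"
    by (rule extensionalityI[of _ "cOb (source (source \<alpha>))"])
      (use assms in \<open>simp_all add: Cell_Cat is_nat_trans_def\<close>)
qed (use assms in simp_all)

lemma Mor_CatD:
  assumes "p \<in> Mor Cat"
  shows "category (source p)" "category (target p)" "is_functor (source p) (target p) (label p)"
  using assms by (simp_all add: Mor_Cat)

lemma Cell_CatD:
  assumes "\<alpha> \<in> Cell Cat"
  shows "source \<alpha> \<in> Mor Cat" "target \<alpha> \<in> Mor Cat"
    "source (target \<alpha>) = source (source \<alpha>)" "target (target \<alpha>) = target (source \<alpha>)"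
    "is_nat_trans (source (source \<alpha>)) (target (source \<alpha>)) (label (source \<alpha>)) (label (target \<alpha>)) (label \<alpha>)"
  using assms by (simp_all add: Cell_Cat)

lemma is_functor_id: "category A \<Longrightarrow> is_functor A A (fctr_id A)"
  by (rule is_functorI) (simp_all add: category.ccomp_simps category.cAr_simps category.cid_simps,
      simp_all add: fctr_id_def)

lemma is_functor_comp:
  assumes "category A" "is_functor A B F" "is_functor B C G"
  shows "is_functor A C (fctr_comp A G F)"
proof -
  interpret A: category A by fact
  note [simp] = is_functorD[OF assms(2)] is_functorD[OF assms(3)]
  show ?thesis by (rule is_functorI) (simp_all, simp_all add: fctr_comp_def)
qed

lemma id1_Cat_Mor [simp]: "category A \<Longrightarrow> id1 Cat A \<in> Mor Cat"
  by (simp add: Mor_Cat is_functor_id)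

lemma comp_Cat_Mor [simp]:
  "p \<in> Mor Cat \<Longrightarrow> q \<in> Mor Cat \<Longrightarrow> target p = source q \<Longrightarrow> Cat_comp q p \<in> Mor Cat"
  by (auto simp: Mor_Cat intro: is_functor_comp)

lemma id2_Cat_Cell [simp]:
  assumes "p \<in> Mor Cat"
  shows "id2 Cat p \<in> Cell Cat"
proof -
  note p = Mor_CatD[OF assms]
  interpret A: category "source p" by (rule p)
  interpret B: category "target p" by (rule p)
  note [simp] = is_functorD[OF p(3)]
  have "label (id2 Cat p) \<in> extensional (cOb (source p))" by (simp add: Cat_def)
  then show ?thesis unfolding Cell_Cat is_nat_trans_def chom_iff using assms by simp
qed

lemma vcomp_Cat_Cell [simp]:
  assumes "\<alpha> \<in> Cell Cat" "\<beta> \<in> Cell Cat" "target \<alpha> = source \<beta>"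
  shows "\<beta> \<bullet>\<^bsub>Cat\<^esub> \<alpha> \<in> Cell Cat"
proof -
  note a = Cell_CatD[OF assms(1)] and b = Cell_CatD[OF assms(2)]
  define A B where AB: "A = source (source \<alpha>)" "B = target (source \<alpha>)"
  have st: "source (source \<beta>) = A" "target (source \<beta>) = B" "source (target \<beta>) = A" "target (target \<beta>) = B"
    "source (target \<alpha>) = A" "target (target \<alpha>) = B"
    using a(3,4) b(3,4) assms(3) by (simp_all add: AB)
  interpret A: category A using Mor_CatD[OF a(1)] by (simp add: AB)
  interpret B: category B using Mor_CatD[OF a(1)] by (simp add: AB)
  have F: "is_functor A B (label (source \<alpha>))" "is_functor A B (label (source \<beta>))" "is_functor A B (label (target \<beta>))"
    using Mor_CatD(3)[OF a(1)] Mor_CatD(3)[OF b(1)] Mor_CatD(3)[OF b(2)] by (simp_all add: st AB[symmetric])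
  have n: "is_nat_trans A B (label (source \<alpha>)) (label (source \<beta>)) (label \<alpha>)"
    "is_nat_trans A B (label (source \<beta>)) (label (target \<beta>)) (label \<beta>)"
    using a(5) b(5) assms(3) by (simp_all add: st AB[symmetric])
  note [simp] = is_functorD[OF F(1)] is_functorD[OF F(2)] is_functorD[OF F(3)] is_nat_transD(2-4)[OF n(1)] is_nat_transD(2-4)[OF n(2)]
  have "label (\<beta> \<bullet>\<^bsub>Cat\<^esub> \<alpha>) \<in> extensional (cOb A)" by (simp add: Cat_def AB)
  moreover have "far (label (target \<beta>)) u \<odot>\<^bsub>B\<^esub> (label \<beta> (cdom A u) \<odot>\<^bsub>B\<^esub> label \<alpha> (cdom A u)) =
      (label \<beta> (ccod A u) \<odot>\<^bsub>B\<^esub> label \<alpha> (ccod A u)) \<odot>\<^bsub>B\<^esub> far (label (source \<alpha>)) u" if u [simp]: "u \<in> cAr A" for u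
  proof -
    have "far (label (target \<beta>)) u \<odot>\<^bsub>B\<^esub> (label \<beta> (cdom A u) \<odot>\<^bsub>B\<^esub> label \<alpha> (cdom A u)) =
      (far (label (target \<beta>)) u \<odot>\<^bsub>B\<^esub> label \<beta> (cdom A u)) \<odot>\<^bsub>B\<^esub> label \<alpha> (cdom A u)" by simp
    also have "\<dots> = label \<beta> (ccod A u) \<odot>\<^bsub>B\<^esub> (far (label (source \<beta>)) u \<odot>\<^bsub>B\<^esub> label \<alpha> (cdom A u))"
      unfolding is_nat_transD(5)[OF n(2) u] by simp
    also have "\<dots> = (label \<beta> (ccod A u) \<odot>\<^bsub>B\<^esub> label \<alpha> (ccod A u)) \<odot>\<^bsub>B\<^esub> far (label (source \<alpha>)) u"
      unfolding is_nat_transD(5)[OF n(1) u] by simp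
    finally show ?thesis .
  qed
  ultimately show ?thesis
    unfolding Cell_Cat is_nat_trans_def chom_iff
    using assms a(1) b(2) by (simp add: AB(2)[symmetric] AB(1)[symmetric] st)
qed

lemma hcomp_Cat_Cell [simp]:
  assumes "\<alpha> \<in> Cell Cat" "\<beta> \<in> Cell Cat" "target (source \<alpha>) = source (source \<beta>)"
  shows "\<beta> \<star>\<^bsub>Cat\<^esub> \<alpha> \<in> Cell Cat"
proof -
  note a = Cell_CatD[OF assms(1)] and b = Cell_CatD[OF assms(2)]
  define A B C where ABC: "A = source (source \<alpha>)" "B = source (source \<beta>)" "C = target (source \<beta>)"
  have st: "source (target \<beta>) = B" "target (target \<beta>) = C" "source (target \<alpha>) = A" "target (target \<alpha>) = B"
    "target (source \<alpha>) = B"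
    using a(3,4) b(3,4) assms(3) by (simp_all add: ABC)
  note e = ABC[symmetric] st
  interpret A: category A using Mor_CatD[OF a(1)] by (simp add: ABC)
  interpret C: category C using Mor_CatD[OF b(1)] by (simp add: ABC)
  interpret B: category B using Mor_CatD[OF b(1)] by (simp add: ABC)
  have F: "is_functor A B (label (source \<alpha>))" "is_functor A B (label (target \<alpha>))"
    "is_functor B C (label (source \<beta>))" "is_functor B C (label (target \<beta>))"
    using Mor_CatD(3)[OF a(1)] Mor_CatD(3)[OF a(2)] Mor_CatD(3)[OF b(1)] Mor_CatD(3)[OF b(2)] by (simp_all add: e)
  have n: "is_nat_trans A B (label (source \<alpha>)) (label (target \<alpha>)) (label \<alpha>)"
    "is_nat_trans B C (label (source \<beta>)) (label (target \<beta>)) (label \<beta>)"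
    using a(5) b(5) by (simp_all add: e)
  note [simp] = is_functorD[OF F(1)] is_functorD[OF F(2)] is_functorD[OF F(3)] is_functorD[OF F(4)]
    is_nat_transD(2-4)[OF n(1)] is_nat_transD(2-4)[OF n(2)]
  let ?F = "label (source \<alpha>)" and ?G = "label (target \<alpha>)" and ?H = "label (source \<beta>)" and ?K = "label (target \<beta>)"
  have "label (\<beta> \<star>\<^bsub>Cat\<^esub> \<alpha>) \<in> extensional (cOb A)" by (simp add: Cat_def ABC)
  moreover have "far ?K (far ?G u) \<odot>\<^bsub>C\<^esub> (label \<beta> (fob ?G (cdom A u)) \<odot>\<^bsub>C\<^esub> far ?H (label \<alpha> (cdom A u))) =
      (label \<beta> (fob ?G (ccod A u)) \<odot>\<^bsub>C\<^esub> far ?H (label \<alpha> (ccod A u))) \<odot>\<^bsub>C\<^esub> far ?H (far ?F u)" if u [simp]: "u \<in> cAr A" for u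
  proof -
    have "far ?K (far ?G u) \<odot>\<^bsub>C\<^esub> (label \<beta> (fob ?G (cdom A u)) \<odot>\<^bsub>C\<^esub> far ?H (label \<alpha> (cdom A u))) =
      (far ?K (far ?G u) \<odot>\<^bsub>C\<^esub> label \<beta> (fob ?G (cdom A u))) \<odot>\<^bsub>C\<^esub> far ?H (label \<alpha> (cdom A u))" by simp
    also have "\<dots> = label \<beta> (fob ?G (ccod A u)) \<odot>\<^bsub>C\<^esub> far ?H (far ?G u \<odot>\<^bsub>B\<^esub> label \<alpha> (cdom A u))"
      using is_nat_transD(5)[OF n(2), of "far ?G u"] by simp
    also have "\<dots> = (label \<beta> (fob ?G (ccod A u)) \<odot>\<^bsub>C\<^esub> far ?H (label \<alpha> (ccod A u))) \<odot>\<^bsub>C\<^esub> far ?H (far ?F u)"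
      unfolding is_nat_transD(5)[OF n(1) u] by simp
    finally show ?thesis .
  qed
  ultimately show ?thesis
    unfolding Cell_Cat is_nat_trans_def chom_iff
    using assms a(1,2) b(1,2) by (simp add: e)
qed

text \<open>
  The laws hold componentwise; interchange is naturality of the outer transformation at a component of
  the inner one.
\<close>

theorem two_category_Cat: "two_category Cat"
proof
  note [simp] = hom1_def hom2_def
  fix A B C D :: "('a, 'b) cat" and p q r p' q' r' :: "('a, 'b) cat_mor"
    and \<alpha> \<beta> \<gamma> \<alpha>' \<beta>' :: "('a, 'b) cat_cell"
  show "p \<in> Mor Cat \<Longrightarrow> src Cat p \<in> Obj Cat \<and> tgt Cat p \<in> Obj Cat"
    by (simp add: Mor_Cat)
  show "\<alpha> \<in> Cell Cat \<Longrightarrow> dom2 Cat \<alpha> \<in> Mor Cat \<and> cod2 Cat \<alpha> \<in> Mor Cat" by (simp add: Cell_Cat)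
  show "\<alpha> \<in> Cell Cat \<Longrightarrow> src Cat (dom2 Cat \<alpha>) = src Cat (cod2 Cat \<alpha>) \<and> tgt Cat (dom2 Cat \<alpha>) = tgt Cat (cod2 Cat \<alpha>)"
    by (simp add: Cell_Cat)
  show "A \<in> Obj Cat \<Longrightarrow> id1 Cat A \<in> hom1 Cat A A" by simp
  show "p \<in> hom1 Cat A B \<Longrightarrow> q \<in> hom1 Cat B C \<Longrightarrow> q \<cdot>\<^bsub>Cat\<^esub> p \<in> hom1 Cat A C" by simp
  show "id1 Cat B \<cdot>\<^bsub>Cat\<^esub> p = p" if "p \<in> hom1 Cat A B"
  proof -
    from that have p: "p \<in> Mor Cat" "source p = A" "target p = B" by simp_all
    note [simp] = is_functorD[OF Mor_CatD(3)[OF p(1)]]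
    show ?thesis by (rule Mor_Cat_eqI) (use p Mor_CatD[OF p(1)] in \<open>auto\<close>)
  qed
  show "p \<cdot>\<^bsub>Cat\<^esub> id1 Cat A = p" if "p \<in> hom1 Cat A B"
  proof -
    from that have p: "p \<in> Mor Cat" "source p = A" "target p = B" by simp_all
    show ?thesis by (rule Mor_Cat_eqI) (use p Mor_CatD[OF p(1)] in \<open>auto\<close>)
  qed
  show "(r \<cdot>\<^bsub>Cat\<^esub> q) \<cdot>\<^bsub>Cat\<^esub> p = r \<cdot>\<^bsub>Cat\<^esub> (q \<cdot>\<^bsub>Cat\<^esub> p)"
    if "p \<in> hom1 Cat A B" "q \<in> hom1 Cat B C" "r \<in> hom1 Cat C D"
  proof -
    have p: "p \<in> Mor Cat" using that by simp
    show ?thesis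
      by (rule Mor_Cat_eqI) (use that is_functorD[OF Mor_CatD(3)[OF p]] in simp_all)
  qed
  show "p \<in> Mor Cat \<Longrightarrow> id2 Cat p \<in> hom2 Cat p p" by simp
  show "\<alpha> \<in> hom2 Cat p q \<Longrightarrow> \<beta> \<in> hom2 Cat q r \<Longrightarrow> \<beta> \<bullet>\<^bsub>Cat\<^esub> \<alpha> \<in> hom2 Cat p r" by simp
  show "id2 Cat q \<bullet>\<^bsub>Cat\<^esub> \<alpha> = \<alpha>" "\<alpha> \<bullet>\<^bsub>Cat\<^esub> id2 Cat p = \<alpha>" if "\<alpha> \<in> hom2 Cat p q"
  proof -
    have a: "\<alpha> \<in> Cell Cat" "source \<alpha> = p" "target \<alpha> = q" using that by simp_all
    note c = Cell_CatD[OF a(1), unfolded a(2,3)]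
    interpret B: category "target p" by (rule Mor_CatD[OF c(1)])
    note [simp] = c(1-4) is_nat_transD(2-4)[OF c(5)]
    show "id2 Cat q \<bullet>\<^bsub>Cat\<^esub> \<alpha> = \<alpha>" by (rule Cell_Cat_eqI) (use a in simp_all)
    show "\<alpha> \<bullet>\<^bsub>Cat\<^esub> id2 Cat p = \<alpha>" by (rule Cell_Cat_eqI) (use a in simp_all)
  qed
  show "(\<gamma> \<bullet>\<^bsub>Cat\<^esub> \<beta>) \<bullet>\<^bsub>Cat\<^esub> \<alpha> = \<gamma> \<bullet>\<^bsub>Cat\<^esub> (\<beta> \<bullet>\<^bsub>Cat\<^esub> \<alpha>)"
    if "\<alpha> \<in> hom2 Cat p q" "\<beta> \<in> hom2 Cat q r" "\<gamma> \<in> hom2 Cat r r'"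
  proof -
    have a: "\<alpha> \<in> Cell Cat" "source \<alpha> = p" "target \<alpha> = q" "\<beta> \<in> Cell Cat" "source \<beta> = q" "target \<beta> = r"
      "\<gamma> \<in> Cell Cat" "source \<gamma> = r" "target \<gamma> = r'" using that by simp_all
    note c = Cell_CatD[OF a(1), unfolded a] and d = Cell_CatD[OF a(4), unfolded a] and e = Cell_CatD[OF a(7), unfolded a]
    have st: "source q = source p" "target q = target p" "source r = source p" "target r = target p"
      using c d by simp_all
    interpret B: category "target p" by (rule Mor_CatD[OF c(1)])
    note [simp] = st is_nat_transD(2-4)[OF c(5)] is_nat_transD(2-4)[OF d(5)[unfolded st]] is_nat_transD(2-4)[OF e(5)[unfolded st]]
    show ?thesis by (rule Cell_Cat_eqI) (use a in simp_all)
  qed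
  show "\<beta> \<star>\<^bsub>Cat\<^esub> \<alpha> \<in> hom2 Cat (q \<cdot>\<^bsub>Cat\<^esub> p) (q' \<cdot>\<^bsub>Cat\<^esub> p')"
    if "\<alpha> \<in> hom2 Cat p p'" "\<beta> \<in> hom2 Cat q q'" "tgt Cat p = src Cat q"
    using that by auto
  show "id2 Cat (id1 Cat (tgt Cat (dom2 Cat \<alpha>))) \<star>\<^bsub>Cat\<^esub> \<alpha> = \<alpha>"
    "\<alpha> \<star>\<^bsub>Cat\<^esub> id2 Cat (id1 Cat (src Cat (dom2 Cat \<alpha>))) = \<alpha>" if a: "\<alpha> \<in> Cell Cat"
  proof -
    note c = Cell_CatD[OF a]
    interpret A: category "source (source \<alpha>)" by (rule Mor_CatD[OF c(1)])
    interpret B: category "target (source \<alpha>)" by (rule Mor_CatD[OF c(1)])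
    note f = Mor_CatD(3)[OF c(1)] Mor_CatD(3)[OF c(2), unfolded c(3,4)]
    note [simp] = c(1-4) is_nat_transD(2-4)[OF c(5)] is_functorD[OF f(1)] is_functorD[OF f(2)]
      A.category_axioms B.category_axioms
    have 1: "Cat_comp (id1 Cat (target (source \<alpha>))) p = p" "Cat_comp p (id1 Cat (source (source \<alpha>))) = p"
      if "p \<in> {source \<alpha>, target \<alpha>}" for p
      by (rule Mor_Cat_eqI; use that in auto)+
    show "id2 Cat (id1 Cat (tgt Cat (dom2 Cat \<alpha>))) \<star>\<^bsub>Cat\<^esub> \<alpha> = \<alpha>"
      by (rule Cell_Cat_eqI) (use a in \<open>simp_all add: 1\<close>)
    show "\<alpha> \<star>\<^bsub>Cat\<^esub> id2 Cat (id1 Cat (src Cat (dom2 Cat \<alpha>))) = \<alpha>"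
      by (rule Cell_Cat_eqI) (use a in \<open>simp_all add: 1\<close>)
  qed
  show "(\<gamma> \<star>\<^bsub>Cat\<^esub> \<beta>) \<star>\<^bsub>Cat\<^esub> \<alpha> = \<gamma> \<star>\<^bsub>Cat\<^esub> (\<beta> \<star>\<^bsub>Cat\<^esub> \<alpha>)"
    if a: "\<alpha> \<in> Cell Cat" "\<beta> \<in> Cell Cat" "\<gamma> \<in> Cell Cat"
      and t: "tgt Cat (dom2 Cat \<alpha>) = src Cat (dom2 Cat \<beta>)" "tgt Cat (dom2 Cat \<beta>) = src Cat (dom2 Cat \<gamma>)"
  proof -
    note c = Cell_CatD[OF a(1)] and d = Cell_CatD[OF a(2)] and e = Cell_CatD[OF a(3)]
    have t': "target (source \<alpha>) = source (source \<beta>)" "target (source \<beta>) = source (source \<gamma>)" using t by simp_all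
    interpret E: category "target (source \<gamma>)" by (rule Mor_CatD[OF e(1)])
    note st = c(3,4) d(3,4) e(3,4) t'
    note f = Mor_CatD(3)[OF c(1), unfolded st] Mor_CatD(3)[OF c(2), unfolded st] Mor_CatD(3)[OF d(1), unfolded st]
      Mor_CatD(3)[OF d(2), unfolded st] Mor_CatD(3)[OF e(1), unfolded st] Mor_CatD(3)[OF e(2), unfolded st]
    note [simp] = st c(1,2) d(1,2) e(1,2) is_nat_transD(2-4)[OF c(5), unfolded st] is_nat_transD(2-4)[OF d(5), unfolded st]
      is_nat_transD(2-4)[OF e(5), unfolded st]
      is_functorD[OF f(1)] is_functorD[OF f(2)] is_functorD[OF f(3)] is_functorD[OF f(4)] is_functorD[OF f(5)] is_functorD[OF f(6)]
    have 1: "Cat_comp (Cat_comp (source \<gamma>) (source \<beta>)) (source \<alpha>) = Cat_comp (source \<gamma>) (Cat_comp (source \<beta>) (source \<alpha>))"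
      "Cat_comp (Cat_comp (target \<gamma>) (target \<beta>)) (target \<alpha>) = Cat_comp (target \<gamma>) (Cat_comp (target \<beta>) (target \<alpha>))"
      by (rule Mor_Cat_eqI; simp)+
    show ?thesis by (rule Cell_Cat_eqI) (use a in \<open>simp_all add: 1\<close>)
  qed
  show "id2 Cat q \<star>\<^bsub>Cat\<^esub> id2 Cat p = id2 Cat (q \<cdot>\<^bsub>Cat\<^esub> p)"
    if "p \<in> hom1 Cat A B" "q \<in> hom1 Cat B C"
  proof -
    have a: "p \<in> Mor Cat" "source p = A" "target p = B" "q \<in> Mor Cat" "source q = B" "target q = C" using that by simp_all
    note p = Mor_CatD[OF a(1), unfolded a] and q = Mor_CatD[OF a(4), unfolded a]
    interpret E: category C by (rule q)
    note [simp] = is_functorD[OF p(3)] is_functorD[OF q(3)]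
    show ?thesis by (rule Cell_Cat_eqI) (use a in simp_all)
  qed
  show "(\<beta>' \<bullet>\<^bsub>Cat\<^esub> \<beta>) \<star>\<^bsub>Cat\<^esub> (\<alpha>' \<bullet>\<^bsub>Cat\<^esub> \<alpha>) = (\<beta>' \<star>\<^bsub>Cat\<^esub> \<alpha>') \<bullet>\<^bsub>Cat\<^esub> (\<beta> \<star>\<^bsub>Cat\<^esub> \<alpha>)"
    if h: "\<alpha> \<in> hom2 Cat p q" "\<alpha>' \<in> hom2 Cat q r" "\<beta> \<in> hom2 Cat p' q'" "\<beta>' \<in> hom2 Cat q' r'" "tgt Cat p = src Cat p'"
  proof -
    have a: "\<alpha> \<in> Cell Cat" "\<alpha>' \<in> Cell Cat" "\<beta> \<in> Cell Cat" "\<beta>' \<in> Cell Cat"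
      "source \<alpha> = p" "target \<alpha> = q" "source \<alpha>' = q" "target \<alpha>' = r"
      "source \<beta> = p'" "target \<beta> = q'" "source \<beta>' = q'" "target \<beta>' = r'" "target p = source p'"
      using h by simp_all
    note c = Cell_CatD[OF a(1), unfolded a] and c' = Cell_CatD[OF a(2), unfolded a]
      and d = Cell_CatD[OF a(3), unfolded a] and d' = Cell_CatD[OF a(4), unfolded a]
    note st = c(3,4) c'(3,4) d(3,4) d'(3,4)
    interpret A: category "source p" by (rule Mor_CatD[OF c(1)])
    interpret B: category "source p'" by (rule Mor_CatD[OF d(1)])
    interpret E: category "target p'" by (rule Mor_CatD[OF d(1)])
    note f = Mor_CatD(3)[OF c(1), unfolded a st] Mor_CatD(3)[OF c(2), unfolded a st] Mor_CatD(3)[OF c'(2), unfolded a st]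
      Mor_CatD(3)[OF d(1), unfolded a st] Mor_CatD(3)[OF d(2), unfolded a st] Mor_CatD(3)[OF d'(2), unfolded a st]
    note n = c(5) c'(5)[unfolded a st] d(5) d'(5)[unfolded a st]
    note [simp] = a st c(1,2) c'(2) d(1,2) d'(2) is_nat_transD(2-4)[OF n(1)] is_nat_transD(2-4)[OF n(2)]
      is_nat_transD(2-4)[OF n(3)] is_nat_transD(2-4)[OF n(4)]
      is_functorD[OF f(1)] is_functorD[OF f(2)] is_functorD[OF f(3)] is_functorD[OF f(4)] is_functorD[OF f(5)] is_functorD[OF f(6)]
    have "(label \<beta>' (fob (label r) x) \<odot>\<^bsub>target p'\<^esub> label \<beta> (fob (label r) x)) \<odot>\<^bsub>target p'\<^esub>
        (far (label p') (label \<alpha>' x) \<odot>\<^bsub>target p'\<^esub> far (label p') (label \<alpha> x)) =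
      (label \<beta>' (fob (label r) x) \<odot>\<^bsub>target p'\<^esub> far (label q') (label \<alpha>' x)) \<odot>\<^bsub>target p'\<^esub>
        (label \<beta> (fob (label q) x) \<odot>\<^bsub>target p'\<^esub> far (label p') (label \<alpha> x))" if x: "x \<in> cOb (source p)" for x
    proof -
      have nat: "label \<beta> (fob (label r) x) \<odot>\<^bsub>target p'\<^esub> far (label p') (label \<alpha>' x) =
          far (label q') (label \<alpha>' x) \<odot>\<^bsub>target p'\<^esub> label \<beta> (fob (label q) x)"
        using is_nat_transD(5)[OF n(3), of "label \<alpha>' x"] x by simp
      have "(label \<beta>' (fob (label r) x) \<odot>\<^bsub>target p'\<^esub> label \<beta> (fob (label r) x)) \<odot>\<^bsub>target p'\<^esub>
        (far (label p') (label \<alpha>' x) \<odot>\<^bsub>target p'\<^esub> far (label p') (label \<alpha> x)) =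
        label \<beta>' (fob (label r) x) \<odot>\<^bsub>target p'\<^esub> ((label \<beta> (fob (label r) x) \<odot>\<^bsub>target p'\<^esub>
        far (label p') (label \<alpha>' x)) \<odot>\<^bsub>target p'\<^esub> far (label p') (label \<alpha> x))" using x by simp
      also have "\<dots> = (label \<beta>' (fob (label r) x) \<odot>\<^bsub>target p'\<^esub> far (label q') (label \<alpha>' x)) \<odot>\<^bsub>target p'\<^esub>
        (label \<beta> (fob (label q) x) \<odot>\<^bsub>target p'\<^esub> far (label p') (label \<alpha> x))" unfolding nat using x by simp
      finally show ?thesis .
    qed
    then show ?thesis by (intro Cell_Cat_eqI) simp_all
  qed
qed

lemma hom_cat_sel [simp]:
  "cOb (hom_cat C X Y) = hom1 C X Y" "cdom (hom_cat C X Y) = dom2 C" "ccod (hom_cat C X Y) = cod2 C"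
  "cid (hom_cat C X Y) = id2 C" "ccomp (hom_cat C X Y) = vcomp C"
  by (simp_all add: hom_cat_def)

lemma (in two_category) cAr_hom_cat [simp]:
  "\<alpha> \<in> cAr (hom_cat C X Y) \<longleftrightarrow> \<alpha> \<in> Cell C \<and> src C (dom2 C \<alpha>) = X \<and> tgt C (dom2 C \<alpha>) = Y"
  by (auto simp: hom_cat_def hom1_def)

lemma (in two_category) chom_hom_cat:
  "f \<in> hom1 C X Y \<Longrightarrow> chom (hom_cat C X Y) f g = hom2 C f g"
  by (auto simp: chom_iff hom1_def hom2_def)

lemma (in two_category) category_hom_cat: "category (hom_cat C X Y)"
  by unfold_locales (auto simp: chom_iff hom1_def)

lemma (in two_category) is_ciso_hom_cat:
  assumes "\<alpha> \<in> hom2 C f g" "f \<in> hom1 C X Y"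
  shows "is_ciso (hom_cat C X Y) \<alpha> \<longleftrightarrow> invertible2 C \<alpha>"
proof -
  have a: "\<alpha> \<in> Cell C" "dom2 C \<alpha> = f" "cod2 C \<alpha> = g" "f \<in> Mor C" "src C f = X" "tgt C f = Y"
    using assms by (simp_all add: hom1_def hom2_def)
  have "g \<in> hom1 C X Y" using a Cell_cod2[OF a(1)] src_cod2[OF a(1)] tgt_cod2[OF a(1)] by (simp add: hom1_def)
  from chom_hom_cat[OF this] show ?thesis
    unfolding is_ciso_def invertible2_def inverse2_def using a by auto
qed

section \<open>Representable 2-functors and points\<close>

context two_category
begin

interpretation Cat: two_category Cat by (rule two_category_Cat)

lemmas [simp] = category_hom_cat

lemma postcomp_sel [simp]:
  "source (postcomp C Y f) = hom_cat C Y (src C f)" "target (postcomp C Y f) = hom_cat C Y (tgt C f)"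
  "g \<in> hom1 C Y (src C f) \<Longrightarrow> fob (label (postcomp C Y f)) g = f \<cdot> g"
  "\<alpha> \<in> cAr (hom_cat C Y (src C f)) \<Longrightarrow> far (label (postcomp C Y f)) \<alpha> = id2 C f \<star> \<alpha>"
  by (simp_all add: postcomp_def hom1_def)

lemma precomp_sel [simp]:
  "source (precomp C f Z) = hom_cat C (tgt C f) Z" "target (precomp C f Z) = hom_cat C (src C f) Z"
  "g \<in> hom1 C (tgt C f) Z \<Longrightarrow> fob (label (precomp C f Z)) g = g \<cdot> f"
  "\<alpha> \<in> cAr (hom_cat C (tgt C f) Z) \<Longrightarrow> far (label (precomp C f Z)) \<alpha> = \<alpha> \<star> id2 C f"
  by (simp_all add: precomp_def hom1_def)

lemma postcomp2_sel [simp]: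
  "source (postcomp2 C Y \<gamma>) = postcomp C Y (dom2 C \<gamma>)" "target (postcomp2 C Y \<gamma>) = postcomp C Y (cod2 C \<gamma>)"
  "g \<in> hom1 C Y (src C (dom2 C \<gamma>)) \<Longrightarrow> label (postcomp2 C Y \<gamma>) g = \<gamma> \<star> id2 C g"
  by (simp_all add: postcomp2_def)

lemma precomp2_sel [simp]:
  "source (precomp2 C \<gamma> Z) = precomp C (dom2 C \<gamma>) Z" "target (precomp2 C \<gamma> Z) = precomp C (cod2 C \<gamma>) Z"
  "g \<in> hom1 C (tgt C (dom2 C \<gamma>)) Z \<Longrightarrow> label (precomp2 C \<gamma> Z) g = id2 C g \<star> \<gamma>"
  by (simp_all add: precomp2_def)

lemma postcomp_Mor [simp]:
  assumes f: "f \<in> Mor C"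
  shows "postcomp C Y f \<in> Mor Cat"
proof -
  have "is_functor (hom_cat C Y (src C f)) (hom_cat C Y (tgt C f)) (label (postcomp C Y f))"
    by (rule is_functorI) (use f in \<open>simp_all add: hom1_def whisker_left\<close>, simp_all add: postcomp_def hom1_def)
  then show ?thesis using f by (simp add: Mor_Cat)
qed

lemma precomp_Mor [simp]:
  assumes f: "f \<in> Mor C"
  shows "precomp C f Z \<in> Mor Cat"
proof -
  have "is_functor (hom_cat C (tgt C f) Z) (hom_cat C (src C f) Z) (label (precomp C f Z))"
    by (rule is_functorI) (use f in \<open>simp_all add: hom1_def whisker_right\<close>, simp_all add: precomp_def hom1_def)
  then show ?thesis using f by (simp add: Mor_Cat)
qed

lemma postcomp2_Cell [simp]:
  assumes g: "\<gamma> \<in> Cell C"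
  shows "postcomp2 C Y \<gamma> \<in> Cell Cat"
proof -
  have "label (postcomp2 C Y \<gamma>) \<in> extensional (hom1 C Y (src C (dom2 C \<gamma>)))" by (simp add: postcomp2_def)
  then show ?thesis
    unfolding Cell_Cat is_nat_trans_def chom_iff
    using g by (simp add: hom1_def hcomp_whiskers interchange')
qed

lemma precomp2_Cell [simp]:
  assumes g: "\<gamma> \<in> Cell C"
  shows "precomp2 C \<gamma> Z \<in> Cell Cat"
proof -
  have "label (precomp2 C \<gamma> Z) \<in> extensional (hom1 C (tgt C (dom2 C \<gamma>)) Z)" by (simp add: precomp2_def)
  then show ?thesis
    unfolding Cell_Cat is_nat_trans_def chom_iff
    using g by (simp add: hom1_def hcomp_whiskers interchange')
qed

lemma postcomp_id1: "X \<in> Obj C \<Longrightarrow> postcomp C Y (id1 C X) = id1 Cat (hom_cat C Y X)"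
  by (rule Mor_Cat_eqI) (simp_all add: hom1_def)

lemma postcomp_comp:
  "f \<in> Mor C \<Longrightarrow> g \<in> Mor C \<Longrightarrow> tgt C f = src C g \<Longrightarrow>
    postcomp C Y (g \<cdot> f) = Cat_comp (postcomp C Y g) (postcomp C Y f)"
  by (rule Mor_Cat_eqI) (simp_all add: hom1_def)

lemma postcomp2_id2: "f \<in> Mor C \<Longrightarrow> postcomp2 C Y (id2 C f) = id2 Cat (postcomp C Y f)"
  by (rule Cell_Cat_eqI) (simp_all add: hom1_def)

lemma precomp2_id2: "f \<in> Mor C \<Longrightarrow> precomp2 C (id2 C f) Z = id2 Cat (precomp C f Z)"
  by (rule Cell_Cat_eqI) (simp_all add: hom1_def)

lemma postcomp2_vcomp:
  "\<alpha> \<in> Cell C \<Longrightarrow> \<beta> \<in> Cell C \<Longrightarrow> cod2 C \<alpha> = dom2 C \<beta> \<Longrightarrow>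
    postcomp2 C Y (\<beta> \<bullet> \<alpha>) = postcomp2 C Y \<beta> \<bullet>\<^bsub>Cat\<^esub> postcomp2 C Y \<alpha>"
proof (rule Cell_Cat_eqI)
  assume a: "\<alpha> \<in> Cell C" "\<beta> \<in> Cell C" "cod2 C \<alpha> = dom2 C \<beta>"
  then have [simp]: "src C (dom2 C \<beta>) = src C (dom2 C \<alpha>)" "tgt C (dom2 C \<beta>) = tgt C (dom2 C \<alpha>)"
    using src_cod2[of \<alpha>] tgt_cod2[of \<alpha>] by simp_all
  fix x assume "x \<in> cOb (source (source (postcomp2 C Y (\<beta> \<bullet> \<alpha>))))"
  then show "label (postcomp2 C Y (\<beta> \<bullet> \<alpha>)) x = label (postcomp2 C Y \<beta> \<bullet>\<^bsub>Cat\<^esub> postcomp2 C Y \<alpha>) x"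
    using a by (simp add: hom1_def whisker_right)
qed (simp_all)

lemma postcomp2_hcomp:
  assumes a: "\<alpha> \<in> Cell C" "\<beta> \<in> Cell C" "tgt C (dom2 C \<alpha>) = src C (dom2 C \<beta>)"
  shows "postcomp2 C Y (\<beta> \<star> \<alpha>) = postcomp2 C Y \<beta> \<star>\<^bsub>Cat\<^esub> postcomp2 C Y \<alpha>"
proof (rule Cell_Cat_eqI)
  fix x assume "x \<in> cOb (source (source (postcomp2 C Y (\<beta> \<star> \<alpha>))))"
  then have x: "x \<in> Mor C" "src C x = Y" "tgt C x = src C (dom2 C \<alpha>)" using a by (simp_all add: hom1_def)
  then show "label (postcomp2 C Y (\<beta> \<star> \<alpha>)) x = label (postcomp2 C Y \<beta> \<star>\<^bsub>Cat\<^esub> postcomp2 C Y \<alpha>) x"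
    using a hcomp_whiskers(2)[of "\<alpha> \<star> id2 C x" \<beta>] by (simp add: hom1_def)
qed (use a in \<open>simp_all add: postcomp_comp\<close>)

lemma postcomp2_invertible:
  assumes g: "invertible2 C \<gamma>"
  shows "invertible2 Cat (postcomp2 C Y \<gamma>)"
proof (rule Cat.invertible2I[of _ "postcomp2 C Y (inv2 C \<gamma>)"])
  have c: "\<gamma> \<in> Cell C" using g by simp
  show "postcomp2 C Y (inv2 C \<gamma>) \<bullet>\<^bsub>Cat\<^esub> postcomp2 C Y \<gamma> = id2 Cat (dom2 Cat (postcomp2 C Y \<gamma>))"
    "postcomp2 C Y \<gamma> \<bullet>\<^bsub>Cat\<^esub> postcomp2 C Y (inv2 C \<gamma>) = id2 Cat (cod2 Cat (postcomp2 C Y \<gamma>))"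
    using g c postcomp2_vcomp[of \<gamma> "inv2 C \<gamma>" Y] postcomp2_vcomp[of "inv2 C \<gamma>" \<gamma> Y]
    by (simp_all add: postcomp2_id2)
qed (use g in simp_all)

end

lemma hom_psfun_sel [simp]:
  "i \<in> Obj I \<Longrightarrow> on0 (hom_psfun I C Y F) i = hom_cat C Y (on0 F i)"
  "a \<in> Mor I \<Longrightarrow> on1 (hom_psfun I C Y F) a = postcomp C Y (on1 F a)"
  "\<alpha> \<in> Cell I \<Longrightarrow> on2 (hom_psfun I C Y F) \<alpha> = postcomp2 C Y (on2 F \<alpha>)"
  "a \<in> Mor I \<Longrightarrow> a' \<in> Mor I \<Longrightarrow> tgt I a = src I a' \<Longrightarrow>
    cpt (hom_psfun I C Y F) (a', a) = postcomp2 C Y (cpt F (a', a))"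
  by (simp_all add: hom_psfun_def)

text \<open>
  The representable \<open>B(Y, -)\<close>, that is postcomposition, is a strict 2-functor. It therefore carries every axiom of \<open>F\<close> to
  the corresponding axiom of \<open>B(Y, F -)\<close>.
\<close>

lemma (in psfunctor) normal_hom_psfun:
  "normal_psfunctor A Cat (hom_psfun A B Y F)"
proof -
  note [simp] = B.postcomp_id1 B.postcomp_comp B.postcomp2_id2 B.postcomp2_vcomp B.postcomp2_hcomp B.postcomp2_invertible
  have "postcomp2 B Y (cpt F (cod2 A \<alpha>', cod2 A \<alpha>)) \<bullet>\<^bsub>Cat\<^esub> (postcomp2 B Y (on2 F \<alpha>') \<star>\<^bsub>Cat\<^esub> postcomp2 B Y (on2 F \<alpha>)) =
    postcomp2 B Y (on2 F (\<alpha>' \<star>\<^bsub>A\<^esub> \<alpha>)) \<bullet>\<^bsub>Cat\<^esub> postcomp2 B Y (cpt F (dom2 A \<alpha>', dom2 A \<alpha>))"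
    if "\<alpha> \<in> Cell A" "\<alpha>' \<in> Cell A" "tgt A (dom2 A \<alpha>) = src A (dom2 A \<alpha>')" for \<alpha> \<alpha>'
    using that arg_cong[OF cpt_natural[OF that], of "postcomp2 B Y"] by simp
  moreover have "postcomp2 B Y (cpt F (a'', a' \<cdot>\<^bsub>A\<^esub> a)) \<bullet>\<^bsub>Cat\<^esub> (id2 Cat (postcomp B Y (on1 F a'')) \<star>\<^bsub>Cat\<^esub> postcomp2 B Y (cpt F (a', a))) =
        postcomp2 B Y (cpt F (a'' \<cdot>\<^bsub>A\<^esub> a', a)) \<bullet>\<^bsub>Cat\<^esub> (postcomp2 B Y (cpt F (a'', a')) \<star>\<^bsub>Cat\<^esub> id2 Cat (postcomp B Y (on1 F a)))"
    if "a \<in> Mor A" "a' \<in> Mor A" "a'' \<in> Mor A" "tgt A a = src A a'" "tgt A a' = src A a''" for a a' a''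
    using that arg_cong[OF cpt_assoc[OF that], of "postcomp2 B Y"] by simp
  moreover have "on0 (hom_psfun A B Y F) \<in> extensional (Obj A)" "on1 (hom_psfun A B Y F) \<in> extensional (Mor A)"
    "on2 (hom_psfun A B Y F) \<in> extensional (Cell A)" "cpt (hom_psfun A B Y F) \<in> extensional (composable A)"
    by (simp_all add: hom_psfun_def)
  ultimately show ?thesis
    unfolding normal_psfunctor_def PiE_def
    by (auto simp: hom1_def hom2_def on2_vcomp)
qed

lemma category_terminal_cat [simp]: "category terminal_cat"
  by unfold_locales (auto simp: terminal_cat_def chom_def)

lemma terminal_cat_sel [simp]: "cOb terminal_cat = {undefined}" "cAr terminal_cat = {undefined}"
  "cdom terminal_cat u = undefined" "ccod terminal_cat u = undefined" "cid terminal_cat x = undefined"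
  "v \<odot>\<^bsub>terminal_cat\<^esub> u = undefined"
  by (simp_all add: terminal_cat_def)

text \<open>
  Objects and arrows of \<open>A\<close> as functors from the terminal category and natural transformations between them.
\<close>

definition point :: "('a, 'b) cat \<Rightarrow> 'a \<Rightarrow> ('a, 'b) cat_mor" where
  "point A x = Arrow terminal_cat A \<lparr>fob = (\<lambda>_\<in>{undefined}. x), far = (\<lambda>_\<in>{undefined}. cid A x)\<rparr>"

definition point2 :: "('a, 'b) cat \<Rightarrow> 'b \<Rightarrow> ('a, 'b) cat_cell" where
  "point2 A u = Arrow (point A (cdom A u)) (point A (ccod A u)) (\<lambda>_\<in>{undefined}. u)"

lemma point_sel [simp]:
  "source (point A x) = terminal_cat" "target (point A x) = A"
  "fob (label (point A x)) undefined = x" "far (label (point A x)) undefined = cid A x"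
  by (simp_all add: point_def)

lemma point2_sel [simp]:
  "source (point2 A u) = point A (cdom A u)" "target (point2 A u) = point A (ccod A u)"
  "label (point2 A u) undefined = u"
  by (simp_all add: point2_def)

lemma point2_inject [simp]: "point2 A u = point2 A v \<longleftrightarrow> u = v"
  by (metis point2_sel(3))

context category
begin

interpretation Cat: two_category Cat by (rule two_category_Cat)

lemma point_Mor [simp]:
  assumes "x \<in> cOb A"
  shows "point A x \<in> Mor Cat"
proof -
  have "is_functor terminal_cat A (label (point A x))"
    by (rule is_functorI) (use assms in \<open>simp_all\<close>, simp_all add: point_def)
  then show ?thesis by (simp add: Mor_Cat category_axioms)
qed

lemma point2_Cell [simp]:
  assumes "u \<in> cAr A"
  shows "point2 A u \<in> Cell Cat"
proof -
  have "label (point2 A u) \<in> extensional {undefined}" by (simp add: point2_def)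
  then show ?thesis unfolding Cell_Cat is_nat_trans_def chom_iff using assms by simp
qed

text \<open>
  The value on the arrow of the terminal category is forced, because that arrow is an identity.
\<close>

lemma point_cases:
  assumes "p \<in> hom1 Cat terminal_cat A"
  shows "fob (label p) undefined \<in> cOb A" "p = point A (fob (label p) undefined)"
proof -
  have p: "p \<in> Mor Cat" "source p = terminal_cat" "target p = A" using assms by (simp_all add: hom1_def)
  note F = is_functorD[OF Mor_CatD(3)[OF p(1)], unfolded p]
  show x: "fob (label p) undefined \<in> cOb A" using F(1) by simp
  show "p = point A (fob (label p) undefined)"
    by (rule Mor_Cat_eqI) (use p x F(5)[of undefined] in simp_all)
qed

lemma point2_cases:
  assumes "\<alpha> \<in> hom2 Cat (point A x) (point A y)"
  shows "label \<alpha> undefined \<in> chom A x y" "\<alpha> = point2 A (label \<alpha> undefined)"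
proof -
  have a: "\<alpha> \<in> Cell Cat" "source \<alpha> = point A x" "target \<alpha> = point A y" using assms by (simp_all add: hom2_def)
  note n = is_nat_transD[OF Cell_CatD(5)[OF a(1)], unfolded a point_sel]
  show u: "label \<alpha> undefined \<in> chom A x y" using n(2-4) by (simp add: chom_iff)
  show "\<alpha> = point2 A (label \<alpha> undefined)"
    by (rule Cell_Cat_eqI) (use a u in \<open>simp_all add: chom_iff\<close>)
qed

lemma point2_vcomp [simp]:
  assumes "u \<in> cAr A" "v \<in> cAr A" "ccod A u = cdom A v"
  shows "point2 A v \<bullet>\<^bsub>Cat\<^esub> point2 A u = point2 A (v \<odot> u)"
  by (rule Cell_Cat_eqI) (use assms in simp_all)

lemma id2_point [simp]: "x \<in> cOb A \<Longrightarrow> id2 Cat (point A x) = point2 A (cid A x)"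
  by (rule Cell_Cat_eqI) simp_all

lemma point_comp_id1 [simp]: "x \<in> cOb A \<Longrightarrow> Cat_comp (point A x) (id1 Cat terminal_cat) = point A x"
  using Cat.comp_id1_right[of "point A x"] by simp

lemma invertible2_point2:
  assumes u: "u \<in> cAr A"
  shows "invertible2 Cat (point2 A u) \<longleftrightarrow> is_ciso A u"
proof
  assume "is_ciso A u"
  then show "invertible2 Cat (point2 A u)"
    by (intro Cat.invertible2I[of _ "point2 A (cinv A u)"]) simp_all
next
  assume i: "invertible2 Cat (point2 A u)"
  let ?\<beta> = "inv2 Cat (point2 A u)"
  note b = Cat.inv2_simps[OF i, unfolded Cat_sel point2_sel]
  have h: "?\<beta> \<in> hom2 Cat (point A (ccod A u)) (point A (cdom A u))" using b by (simp add: hom2_def)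
  define v where "v = label ?\<beta> undefined"
  have v: "v \<in> chom A (ccod A u) (cdom A u)" "?\<beta> = point2 A v"
    using point2_cases[OF h] by (simp_all add: v_def)
  have v': "v \<in> cAr A" "cdom A v = ccod A u" "ccod A v = cdom A u" using v(1) by (simp_all add: chom_iff)
  show "is_ciso A u"
  proof (rule is_cisoI)
    show "u \<in> chom A (cdom A u) (ccod A u)" using u by (simp add: chom_iff)
    show "v \<in> chom A (ccod A u) (cdom A u)" by (rule v)
    have "point2 A v \<bullet>\<^bsub>Cat\<^esub> point2 A u = id2 Cat (point A (cdom A u))"
      "point2 A u \<bullet>\<^bsub>Cat\<^esub> point2 A v = id2 Cat (point A (ccod A u))" using b(4,5) unfolding v(2) by simp_all
    then show "v \<odot> u = cid A (cdom A u)" "u \<odot> v = cid A (ccod A u)" using u v' by simp_all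
  qed
qed

end

context two_category
begin

lemma postcomp_point [simp]:
  assumes "f \<in> Mor C" "src C f = Z" "x \<in> hom1 C Y Z"
  shows "Cat_comp (postcomp C Y f) (point (hom_cat C Y Z) x) = point (hom_cat C Y (tgt C f)) (f \<cdot> x)"
proof -
  interpret A: category "hom_cat C Y Z" by simp
  interpret B: category "hom_cat C Y (tgt C f)" by simp
  show ?thesis
    by (rule Mor_Cat_eqI) (use assms in \<open>simp_all add: hom1_def\<close>)
qed

lemma precomp_point [simp]:
  assumes "f \<in> Mor C" "tgt C f = Y" "x \<in> hom1 C Y Z"
  shows "Cat_comp (precomp C f Z) (point (hom_cat C Y Z) x) = point (hom_cat C (src C f) Z) (x \<cdot> f)"
proof -
  interpret A: category "hom_cat C Y Z" by simp
  interpret B: category "hom_cat C (src C f) Z" by simp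
  show ?thesis
    by (rule Mor_Cat_eqI) (use assms in \<open>simp_all add: hom1_def\<close>)
qed

lemma postcomp2_point2 [simp]:
  assumes "\<gamma> \<in> Cell C" "src C (dom2 C \<gamma>) = Z" "u \<in> Cell C" "src C (dom2 C u) = Y" "tgt C (dom2 C u) = Z"
  shows "postcomp2 C Y \<gamma> \<star>\<^bsub>Cat\<^esub> point2 (hom_cat C Y Z) u = point2 (hom_cat C Y (tgt C (dom2 C \<gamma>))) (\<gamma> \<star> u)"
proof -
  interpret A: category "hom_cat C Y Z" by simp
  interpret B: category "hom_cat C Y (tgt C (dom2 C \<gamma>))" by simp
  show ?thesis
    by (rule Cell_Cat_eqI) (use assms hcomp_whiskers(2)[of u \<gamma>] in \<open>simp_all add: hom1_def\<close>)
qed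

lemma precomp2_point2 [simp]:
  assumes "\<gamma> \<in> Cell C" "tgt C (dom2 C \<gamma>) = Y" "u \<in> Cell C" "src C (dom2 C u) = Y" "tgt C (dom2 C u) = Z"
  shows "precomp2 C \<gamma> Z \<star>\<^bsub>Cat\<^esub> point2 (hom_cat C Y Z) u = point2 (hom_cat C (src C (dom2 C \<gamma>)) Z) (u \<star> \<gamma>)"
proof -
  interpret A: category "hom_cat C Y Z" by simp
  interpret B: category "hom_cat C (src C (dom2 C \<gamma>)) Z" by simp
  show ?thesis
    by (rule Cell_Cat_eqI) (use assms hcomp_whiskers(1)[of \<gamma> u] in \<open>simp_all add: hom1_def\<close>)
qed

end

section \<open>Bi-limits as biuniversal arrows\<close>

text \<open>
  What a pseudo-natural transformation from \<open>\<Delta>Y\<close> to \<open>F\<close> and one from \<open>\<Delta>1\<close> to \<open>C(Y, F -)\<close> have in common: the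
  components and axioms that remain after the identities of the constant diagram are cancelled.
\<close>

definition is_pseudocone ::
  "('i, 'j, 'k) two_cat \<Rightarrow> ('o, 'm, 't) two_cat \<Rightarrow> ('i, 'j, 'k, 'o, 'm, 't) psfun \<Rightarrow> 'o \<Rightarrow>
   ('i \<Rightarrow> 'm) \<Rightarrow> ('j \<Rightarrow> 't) \<Rightarrow> bool" where
  "is_pseudocone I C F Y x u \<longleftrightarrow>
     (\<forall>i\<in>Obj I. x i \<in> hom1 C Y (on0 F i)) \<and>
     (\<forall>a\<in>Mor I. u a \<in> hom2 C (on1 F a \<cdot>\<^bsub>C\<^esub> x (src I a)) (x (tgt I a))) \<and>
     (\<forall>a\<in>Mor I. invertible2 C (u a)) \<and>
     (\<forall>\<alpha>\<in>Cell I. u (cod2 I \<alpha>) \<bullet>\<^bsub>C\<^esub> (on2 F \<alpha> \<star>\<^bsub>C\<^esub> id2 C (x (src I (dom2 I \<alpha>)))) = u (dom2 I \<alpha>)) \<and>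
     (\<forall>i\<in>Obj I. u (id1 I i) = id2 C (x i)) \<and>
     (\<forall>a\<in>Mor I. \<forall>a'\<in>Mor I. tgt I a = src I a' \<longrightarrow>
        u (a' \<cdot>\<^bsub>I\<^esub> a) \<bullet>\<^bsub>C\<^esub> (cpt F (a', a) \<star>\<^bsub>C\<^esub> id2 C (x (src I a))) =
        u a' \<bullet>\<^bsub>C\<^esub> (id2 C (on1 F a') \<star>\<^bsub>C\<^esub> u a))"

locale diagram = I: two_category I + C: two_category C + F: psfunctor I C F
  for I :: "('i, 'j, 'k) two_cat" and C :: "('o, 'm, 't) two_cat" (structure)
    and F :: "('i, 'j, 'k, 'o, 'm, 't) psfun"
begin

sublocale Cat: two_category "Cat :: (('m, 't) cat, ('m, 't) cat_mor, ('m, 't) cat_cell) two_cat"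
  by (rule two_category_Cat)

sublocale PsC: two_category "Ps I C"
  by (rule two_category_Ps) (rule I.two_category_axioms C.two_category_axioms)+

sublocale PsCat: two_category
  "Ps I (Cat :: (('m, 't) cat, ('m, 't) cat_mor, ('m, 't) cat_cell) two_cat)"
  by (rule two_category_Ps) (rule I.two_category_axioms two_category_Cat)+

lemmas constC [simp] =
  const_psfun_sel[OF I.two_category_axioms C.two_category_axioms]
  normal_const_psfun[OF I.two_category_axioms C.two_category_axioms]
  const_pstrans_sel[OF I.two_category_axioms C.two_category_axioms]
  const_pstrans_Mor[OF I.two_category_axioms C.two_category_axioms]
  const_modification_sel[OF I.two_category_axioms C.two_category_axioms]
  const_modification_Cell[OF I.two_category_axioms C.two_category_axioms]

lemmas constCat [simp] =
  const_psfun_sel[OF I.two_category_axioms two_category_Cat]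
  normal_const_psfun[OF I.two_category_axioms two_category_Cat]

abbreviation One where "One \<equiv> const_psfun I Cat (terminal_cat :: ('m, 't) cat)"
abbreviation H where "H Y \<equiv> hom_psfun I C Y F"
abbreviation hc where "hc Y i \<equiv> hom_cat C Y (on0 F i)"

lemma typed_simps:
  assumes x: "\<And>i. i \<in> Obj I \<Longrightarrow> x i \<in> hom1 C Y (on0 F i)"
    and u: "\<And>a. a \<in> Mor I \<Longrightarrow> u a \<in> hom2 C (on1 F a \<cdot> x (src I a)) (x (tgt I a))"
  shows "i \<in> Obj I \<Longrightarrow> x i \<in> Mor C" "i \<in> Obj I \<Longrightarrow> src C (x i) = Y" "i \<in> Obj I \<Longrightarrow> tgt C (x i) = on0 F i"
    "a \<in> Mor I \<Longrightarrow> u a \<in> Cell C" "a \<in> Mor I \<Longrightarrow> dom2 C (u a) = on1 F a \<cdot> x (src I a)"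
    "a \<in> Mor I \<Longrightarrow> cod2 C (u a) = x (tgt I a)"
  using x u by (simp_all add: hom1_def hom2_def)

lemma is_pstrans_const_iff:
  assumes Y: "Y \<in> Obj C"
  shows "is_pstrans I C (const_psfun I C Y) F \<sigma> \<longleftrightarrow> pt0 \<sigma> \<in> extensional (Obj I) \<and>
    pt1 \<sigma> \<in> extensional (Mor I) \<and> is_pseudocone I C F Y (pt0 \<sigma>) (pt1 \<sigma>)"
proof (cases "(\<forall>i\<in>Obj I. pt0 \<sigma> i \<in> hom1 C Y (on0 F i)) \<and>
    (\<forall>a\<in>Mor I. pt1 \<sigma> a \<in> hom2 C (on1 F a \<cdot> pt0 \<sigma> (src I a)) (pt0 \<sigma> (tgt I a)))")
  case True
  then have x: "\<And>i. i \<in> Obj I \<Longrightarrow> pt0 \<sigma> i \<in> hom1 C Y (on0 F i)"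
    and u: "\<And>a. a \<in> Mor I \<Longrightarrow> pt1 \<sigma> a \<in> hom2 C (on1 F a \<cdot> pt0 \<sigma> (src I a)) (pt0 \<sigma> (tgt I a))"
    by blast+
  note [simp] = typed_simps[of "pt0 \<sigma>", OF x u] Y
  have typd: "(\<forall>a\<in>Mor I. invertible2 C (pt1 \<sigma> a) \<and>
      pt1 \<sigma> a \<in> hom2 C (on1 F a \<cdot> pt0 \<sigma> (src I a)) (pt0 \<sigma> (tgt I a) \<cdot> on1 (const_psfun I C Y) a)) \<longleftrightarrow>
    (\<forall>a\<in>Mor I. invertible2 C (pt1 \<sigma> a))"
    by (intro ball_cong refl) (simp add: hom2_def)
  have nat: "(\<forall>\<alpha>\<in>Cell I. pt1 \<sigma> (cod2 I \<alpha>) \<bullet> (on2 F \<alpha> \<star> id2 C (pt0 \<sigma> (src I (dom2 I \<alpha>)))) =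
      (id2 C (pt0 \<sigma> (tgt I (dom2 I \<alpha>))) \<star> on2 (const_psfun I C Y) \<alpha>) \<bullet> pt1 \<sigma> (dom2 I \<alpha>)) \<longleftrightarrow>
    (\<forall>\<alpha>\<in>Cell I. pt1 \<sigma> (cod2 I \<alpha>) \<bullet> (on2 F \<alpha> \<star> id2 C (pt0 \<sigma> (src I (dom2 I \<alpha>)))) = pt1 \<sigma> (dom2 I \<alpha>))"
    by (intro ball_cong refl) simp
  have mul: "(\<forall>(a', a)\<in>composable I. pt1 \<sigma> (a' \<cdot>\<^bsub>I\<^esub> a) \<bullet> (cpt F (a', a) \<star> id2 C (pt0 \<sigma> (src I a))) =
      (id2 C (pt0 \<sigma> (tgt I a')) \<star> cpt (const_psfun I C Y) (a', a)) \<bullet>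
        (pt1 \<sigma> a' \<star> id2 C (on1 (const_psfun I C Y) a)) \<bullet> (id2 C (on1 F a') \<star> pt1 \<sigma> a)) \<longleftrightarrow>
    (\<forall>(a', a)\<in>composable I. pt1 \<sigma> (a' \<cdot>\<^bsub>I\<^esub> a) \<bullet> (cpt F (a', a) \<star> id2 C (pt0 \<sigma> (src I a))) =
      pt1 \<sigma> a' \<bullet> (id2 C (on1 F a') \<star> pt1 \<sigma> a))"
    by (intro ball_cong refl) auto
  have x': "\<forall>i\<in>Obj I. pt0 \<sigma> i \<in> hom1 C (on0 (const_psfun I C Y) i) (on0 F i)" using x by simp
  show ?thesis
    unfolding is_pstrans_def is_pseudocone_def Let_def typd nat mul
    using x' x u by (auto simp: Ball_def)
next
  case False
  moreover have "pt1 \<sigma> a \<in> hom2 C (on1 F a \<cdot> pt0 \<sigma> (src I a)) (pt0 \<sigma> (tgt I a))"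
    if "is_pstrans I C (const_psfun I C Y) F \<sigma>" "a \<in> Mor I" for a
  proof -
    have "pt0 \<sigma> (tgt I a) \<in> hom1 C Y (on0 F (tgt I a))"
      using that unfolding is_pstrans_def by (metis I.Mor_tgt constC(1))
    with that show ?thesis unfolding is_pstrans_def by (auto simp: hom1_def)
  qed
  moreover have "pt0 \<sigma> i \<in> hom1 C Y (on0 F i)" if "is_pstrans I C (const_psfun I C Y) F \<sigma>" "i \<in> Obj I" for i
    using that unfolding is_pstrans_def by (metis constC(1))
  ultimately show ?thesis unfolding is_pseudocone_def by blast
qed

definition points_trans :: "'o \<Rightarrow> ('i \<Rightarrow> 'm) \<Rightarrow> ('j \<Rightarrow> 't) \<Rightarrow> ('i, 'j, ('m, 't) cat_mor, ('m, 't) cat_cell) pstrans" where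
  "points_trans Y x u = \<lparr>pt0 = (\<lambda>i\<in>Obj I. point (hc Y i) (x i)),
     pt1 = (\<lambda>a\<in>Mor I. point2 (hc Y (tgt I a)) (u a))\<rparr>"

lemma points_trans_sel [simp]:
  "i \<in> Obj I \<Longrightarrow> pt0 (points_trans Y x u) i = point (hc Y i) (x i)"
  "a \<in> Mor I \<Longrightarrow> pt1 (points_trans Y x u) a = point2 (hc Y (tgt I a)) (u a)"
  by (simp_all add: points_trans_def)

text \<open>
  Composing points with postcomposition functors yields points again, so both sides of each axiom are
  points of \<open>C(Y, F i)\<close>, and the axiom is an equation in \<open>C\<close>.
\<close>

lemma is_pstrans_points_iff:
  assumes x: "\<And>i. i \<in> Obj I \<Longrightarrow> x i \<in> hom1 C Y (on0 F i)"
    and u: "\<And>a. a \<in> Mor I \<Longrightarrow> u a \<in> hom2 C (on1 F a \<cdot> x (src I a)) (x (tgt I a))"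
  shows "is_pstrans I Cat One (H Y) (points_trans Y x u) \<longleftrightarrow> is_pseudocone I C F Y x u"
proof -
  note ty [simp] = typed_simps[of x, OF x u]
  let ?t = "points_trans Y x u"
  have cat [simp]: "category (hom_cat C Y Z)" for Z by (rule C.category_hom_cat)
  note pt [simp] = category.point_Mor[OF cat] category.point2_Cell[OF cat] category.point2_vcomp[OF cat]
    category.id2_point[OF cat] category.point_comp_id1[OF cat]
  have x' [simp]: "x i \<in> hom1 C Y (on0 F i)" "x i \<in> hom1 C Y Z \<longleftrightarrow> on0 F i = Z" if "i \<in> Obj I" for i Z
    using x[OF that] that by (auto simp: hom1_def)
  have inv: "invertible2 Cat (point2 (hc Y (tgt I a)) (u a)) \<longleftrightarrow> invertible2 C (u a)" if a: "a \<in> Mor I" for a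
  proof -
    have "invertible2 Cat (point2 (hc Y (tgt I a)) (u a)) \<longleftrightarrow> is_ciso (hc Y (tgt I a)) (u a)"
      by (rule category.invertible2_point2[OF cat]) (use a in simp)
    also have "\<dots> \<longleftrightarrow> invertible2 C (u a)"
      by (rule C.is_ciso_hom_cat[OF u[OF a]]) (use a in \<open>simp add: hom1_def\<close>)
    finally show ?thesis .
  qed
  have ext: "pt0 ?t \<in> extensional (Obj I)" "pt1 ?t \<in> extensional (Mor I)" by (simp_all add: points_trans_def)
  have t0: "pt0 ?t i \<in> hom1 Cat (on0 One i) (on0 (H Y) i)" if "i \<in> Obj I" for i
    using that by (simp add: hom1_def)
  have t1: "pt1 ?t a \<in> hom2 Cat (on1 (H Y) a \<cdot>\<^bsub>Cat\<^esub> pt0 ?t (src I a)) (pt0 ?t (tgt I a) \<cdot>\<^bsub>Cat\<^esub> on1 One a)"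
    if "a \<in> Mor I" for a
    using that by (simp add: hom2_def)
  have nat: "(pt1 ?t (cod2 I \<alpha>) \<bullet>\<^bsub>Cat\<^esub> (on2 (H Y) \<alpha> \<star>\<^bsub>Cat\<^esub> id2 Cat (pt0 ?t (src I (dom2 I \<alpha>)))) =
      (id2 Cat (pt0 ?t (tgt I (dom2 I \<alpha>))) \<star>\<^bsub>Cat\<^esub> on2 One \<alpha>) \<bullet>\<^bsub>Cat\<^esub> pt1 ?t (dom2 I \<alpha>)) \<longleftrightarrow>
    u (cod2 I \<alpha>) \<bullet> (on2 F \<alpha> \<star> id2 C (x (src I (dom2 I \<alpha>)))) = u (dom2 I \<alpha>)"
    if "\<alpha> \<in> Cell I" for \<alpha>
    using that by simp
  have un: "pt1 ?t (id1 I i) = id2 Cat (pt0 ?t i) \<longleftrightarrow> u (id1 I i) = id2 C (x i)" if "i \<in> Obj I" for i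
    using that by simp
  have mul: "(pt1 ?t (a' \<cdot>\<^bsub>I\<^esub> a) \<bullet>\<^bsub>Cat\<^esub> (cpt (H Y) (a', a) \<star>\<^bsub>Cat\<^esub> id2 Cat (pt0 ?t (src I a))) =
      (id2 Cat (pt0 ?t (tgt I a')) \<star>\<^bsub>Cat\<^esub> cpt One (a', a)) \<bullet>\<^bsub>Cat\<^esub>
        (pt1 ?t a' \<star>\<^bsub>Cat\<^esub> id2 Cat (on1 One a)) \<bullet>\<^bsub>Cat\<^esub> (id2 Cat (on1 (H Y) a') \<star>\<^bsub>Cat\<^esub> pt1 ?t a)) \<longleftrightarrow>
    u (a' \<cdot>\<^bsub>I\<^esub> a) \<bullet> (cpt F (a', a) \<star> id2 C (x (src I a))) = u a' \<bullet> (id2 C (on1 F a') \<star> u a)"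
    if "a \<in> Mor I" "a' \<in> Mor I" "tgt I a = src I a'" for a a'
    using that by (simp flip: C.postcomp2_id2)
  have nat': "(\<forall>\<alpha>\<in>Cell I. pt1 ?t (cod2 I \<alpha>) \<bullet>\<^bsub>Cat\<^esub> (on2 (H Y) \<alpha> \<star>\<^bsub>Cat\<^esub> id2 Cat (pt0 ?t (src I (dom2 I \<alpha>)))) =
      (id2 Cat (pt0 ?t (tgt I (dom2 I \<alpha>))) \<star>\<^bsub>Cat\<^esub> on2 One \<alpha>) \<bullet>\<^bsub>Cat\<^esub> pt1 ?t (dom2 I \<alpha>)) \<longleftrightarrow>
    (\<forall>\<alpha>\<in>Cell I. u (cod2 I \<alpha>) \<bullet> (on2 F \<alpha> \<star> id2 C (x (src I (dom2 I \<alpha>)))) = u (dom2 I \<alpha>))"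
    by (intro ball_cong refl nat)
  have un': "(\<forall>i\<in>Obj I. pt1 ?t (id1 I i) = id2 Cat (pt0 ?t i)) \<longleftrightarrow> (\<forall>i\<in>Obj I. u (id1 I i) = id2 C (x i))"
    by (intro ball_cong refl un)
  have mul': "(\<forall>(a', a)\<in>composable I. pt1 ?t (a' \<cdot>\<^bsub>I\<^esub> a) \<bullet>\<^bsub>Cat\<^esub> (cpt (H Y) (a', a) \<star>\<^bsub>Cat\<^esub> id2 Cat (pt0 ?t (src I a))) =
      (id2 Cat (pt0 ?t (tgt I a')) \<star>\<^bsub>Cat\<^esub> cpt One (a', a)) \<bullet>\<^bsub>Cat\<^esub>
        (pt1 ?t a' \<star>\<^bsub>Cat\<^esub> id2 Cat (on1 One a)) \<bullet>\<^bsub>Cat\<^esub> (id2 Cat (on1 (H Y) a') \<star>\<^bsub>Cat\<^esub> pt1 ?t a)) \<longleftrightarrow>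
    (\<forall>a\<in>Mor I. \<forall>a'\<in>Mor I. tgt I a = src I a' \<longrightarrow>
      u (a' \<cdot>\<^bsub>I\<^esub> a) \<bullet> (cpt F (a', a) \<star> id2 C (x (src I a))) = u a' \<bullet> (id2 C (on1 F a') \<star> u a))"
    using mul by (auto simp: Ball_def simp del: points_trans_sel)
  have inv': "(\<forall>a\<in>Mor I. invertible2 Cat (pt1 ?t a) \<and>
      pt1 ?t a \<in> hom2 Cat (on1 (H Y) a \<cdot>\<^bsub>Cat\<^esub> pt0 ?t (src I a)) (pt0 ?t (tgt I a) \<cdot>\<^bsub>Cat\<^esub> on1 One a)) \<longleftrightarrow>
    (\<forall>a\<in>Mor I. invertible2 C (u a))"
    by (intro ball_cong refl) (use t1 inv in simp)
  show ?thesis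
    unfolding is_pstrans_def is_pseudocone_def Let_def nat' un' mul' inv'
    using ext t0 x u by blast
qed

text \<open>
  The isomorphism from \<open>Ps(I, C)(\<Delta>Y, F)\<close> to \<open>Ps(I, Cat)(\<Delta>1, C(Y, F -))\<close>, on objects and on arrows.
\<close>

definition points :: "'o \<Rightarrow> ('i, 'j, 'k, 'o, 'm, 't) ps_mor \<Rightarrow>
    ('i, 'j, 'k, ('m, 't) cat, ('m, 't) cat_mor, ('m, 't) cat_cell) ps_mor" where
  "points Y \<kappa> = Arrow One (H Y) (points_trans Y (pt0 (label \<kappa>)) (pt1 (label \<kappa>)))"

definition points2 :: "'o \<Rightarrow> ('i, 'j, 'k, 'o, 'm, 't) ps_cell \<Rightarrow>
    ('i, 'j, 'k, ('m, 't) cat, ('m, 't) cat_mor, ('m, 't) cat_cell) ps_cell" where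
  "points2 Y \<Gamma> = Arrow (points Y (source \<Gamma>)) (points Y (target \<Gamma>))
     (\<lambda>i\<in>Obj I. point2 (hc Y i) (label \<Gamma> i))"

lemma points_sel [simp]:
  "source (points Y \<kappa>) = One" "target (points Y \<kappa>) = H Y"
  "label (points Y \<kappa>) = points_trans Y (pt0 (label \<kappa>)) (pt1 (label \<kappa>))"
  "source (points2 Y \<Gamma>) = points Y (source \<Gamma>)" "target (points2 Y \<Gamma>) = points Y (target \<Gamma>)"
  "i \<in> Obj I \<Longrightarrow> label (points2 Y \<Gamma>) i = point2 (hc Y i) (label \<Gamma> i)"
  by (simp_all add: points_def points2_def)

abbreviation cones where "cones Y \<equiv> hom1 (Ps I C) (const_psfun I C Y) F"

lemma conesD:
  assumes k: "\<kappa> \<in> cones Y"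
  shows "\<kappa> \<in> Mor (Ps I C)" "source \<kappa> = const_psfun I C Y" "target \<kappa> = F"
  using k by (simp_all add: hom1_def)

lemma cones_pseudocone:
  assumes k: "\<kappa> \<in> cones Y" and Y: "Y \<in> Obj C"
  shows "is_pseudocone I C F Y (pt0 (label \<kappa>)) (pt1 (label \<kappa>))"
  using conesD[OF k] is_pstrans_const_iff[OF Y] by (simp add: Mor_Ps)

lemma pseudocone_typed:
  assumes "is_pseudocone I C F Y x u"
  shows "i \<in> Obj I \<Longrightarrow> x i \<in> hom1 C Y (on0 F i)"
    "a \<in> Mor I \<Longrightarrow> u a \<in> hom2 C (on1 F a \<cdot> x (src I a)) (x (tgt I a))"
  using assms unfolding is_pseudocone_def by blast+

lemma cones_simps:
  assumes k: "\<kappa> \<in> cones Y" and Y: "Y \<in> Obj C"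
  shows "i \<in> Obj I \<Longrightarrow> pt0 (label \<kappa>) i \<in> hom1 C Y (on0 F i)"
    "i \<in> Obj I \<Longrightarrow> pt0 (label \<kappa>) i \<in> Mor C" "i \<in> Obj I \<Longrightarrow> src C (pt0 (label \<kappa>) i) = Y"
    "i \<in> Obj I \<Longrightarrow> tgt C (pt0 (label \<kappa>) i) = on0 F i"
    "a \<in> Mor I \<Longrightarrow> pt1 (label \<kappa>) a \<in> Cell C"
    "a \<in> Mor I \<Longrightarrow> dom2 C (pt1 (label \<kappa>) a) = on1 F a \<cdot> pt0 (label \<kappa>) (src I a)"
    "a \<in> Mor I \<Longrightarrow> cod2 C (pt1 (label \<kappa>) a) = pt0 (label \<kappa>) (tgt I a)"
  using pseudocone_typed[OF cones_pseudocone[OF k Y]] typed_simps[of "pt0 (label \<kappa>)" Y "pt1 (label \<kappa>)"]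
  by blast+

lemma points_hom1:
  assumes k: "\<kappa> \<in> cones Y" and Y: "Y \<in> Obj C"
  shows "points Y \<kappa> \<in> hom1 (Ps I Cat) One (H Y)"
proof -
  note c = cones_pseudocone[OF k Y]
  have "is_pstrans I Cat One (H Y) (points_trans Y (pt0 (label \<kappa>)) (pt1 (label \<kappa>)))"
    using is_pstrans_points_iff[of "pt0 (label \<kappa>)" Y "pt1 (label \<kappa>)"] pseudocone_typed[OF c] c by blast
  then show ?thesis using F.normal_hom_psfun by (simp add: hom1_def Mor_Ps)
qed

text \<open>
  Every functor from the terminal category is a point and every transformation between points comes from
  an arrow; the components of \<open>p\<close> thus determine a pseudo-cone in \<open>C\<close>.
\<close>

lemma points_surj:
  assumes p: "p \<in> hom1 (Ps I Cat) One (H Y)" and Y: "Y \<in> Obj C"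
  shows "\<exists>\<kappa>\<in>cones Y. p = points Y \<kappa>"
proof -
  have cat [simp]: "category (hom_cat C Y Z)" for Z by (rule C.category_hom_cat)
  have pm: "p \<in> Mor (Ps I Cat)" and st: "source p = One" "target p = H Y" using p by (simp_all add: hom1_def)
  have t: "is_pstrans I Cat One (H Y) (label p)" using pm st by (simp add: Mor_Ps)
  define x where "x = (\<lambda>i\<in>Obj I. fob (label (pt0 (label p) i)) undefined)"
  define u where "u = (\<lambda>a\<in>Mor I. label (pt1 (label p) a) undefined)"
  have x: "x i \<in> hom1 C Y (on0 F i)" "pt0 (label p) i = point (hc Y i) (x i)" if i: "i \<in> Obj I" for i
  proof -
    have "pt0 (label p) i \<in> hom1 Cat terminal_cat (hc Y i)" using t i unfolding is_pstrans_def by auto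
    from category.point_cases[OF cat this]
    show "x i \<in> hom1 C Y (on0 F i)" "pt0 (label p) i = point (hc Y i) (x i)" using i by (simp_all add: x_def)
  qed
  have x' [simp]: "x i \<in> Mor C" "src C (x i) = Y" "tgt C (x i) = on0 F i" if "i \<in> Obj I" for i
    using x(1)[OF that] by (simp_all add: hom1_def)
  have u: "u a \<in> hom2 C (on1 F a \<cdot> x (src I a)) (x (tgt I a))" "pt1 (label p) a = point2 (hc Y (tgt I a)) (u a)"
    if a: "a \<in> Mor I" for a
  proof -
    have "pt1 (label p) a \<in> hom2 Cat (on1 (H Y) a \<cdot>\<^bsub>Cat\<^esub> pt0 (label p) (src I a)) (pt0 (label p) (tgt I a) \<cdot>\<^bsub>Cat\<^esub> on1 One a)"
      using t a unfolding is_pstrans_def by auto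
    then have h: "pt1 (label p) a \<in> hom2 Cat (point (hc Y (tgt I a)) (on1 F a \<cdot> x (src I a))) (point (hc Y (tgt I a)) (x (tgt I a)))"
      using a by (simp add: x category.point_comp_id1[OF cat])
    note c = category.point2_cases[OF cat h]
    have "on1 F a \<cdot> x (src I a) \<in> hom1 C Y (on0 F (tgt I a))" using a by (simp add: hom1_def)
    from C.chom_hom_cat[OF this] c
    show "u a \<in> hom2 C (on1 F a \<cdot> x (src I a)) (x (tgt I a))" "pt1 (label p) a = point2 (hc Y (tgt I a)) (u a)"
      using a by (simp_all add: u_def)
  qed
  have lab: "label p = points_trans Y x u"
  proof (rule pstrans.equality)
    have e: "pt0 (label p) \<in> extensional (Obj I)" "pt1 (label p) \<in> extensional (Mor I)"
      using t unfolding is_pstrans_def by blast+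
    show "pt0 (label p) = pt0 (points_trans Y x u)"
      by (rule extensionalityI[OF e(1)]) (simp add: points_trans_def, simp add: x)
    show "pt1 (label p) = pt1 (points_trans Y x u)"
      by (rule extensionalityI[OF e(2)]) (simp add: points_trans_def, simp add: u)
  qed simp
  have "is_pseudocone I C F Y x u"
    using is_pstrans_points_iff[of x Y u] x(1) u(1) t unfolding lab by blast
  then have "is_pstrans I C (const_psfun I C Y) F \<lparr>pt0 = x, pt1 = u\<rparr>"
    unfolding is_pstrans_const_iff[OF Y] by (simp add: x_def u_def)
  then have k: "Arrow (const_psfun I C Y) F \<lparr>pt0 = x, pt1 = u\<rparr> \<in> cones Y"
    using Y F.psfunctor by (simp add: hom1_def Mor_Ps)
  have "p = points Y (Arrow (const_psfun I C Y) F \<lparr>pt0 = x, pt1 = u\<rparr>)"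
    by (rule arrow_eqI) (simp_all add: st lab)
  with k show ?thesis by blast
qed

lemma cone_cellD:
  assumes G: "\<Gamma> \<in> hom2 (Ps I C) \<kappa> \<mu>"
  shows "\<Gamma> \<in> Cell (Ps I C)" "source \<Gamma> = \<kappa>" "target \<Gamma> = \<mu>"
    "i \<in> Obj I \<Longrightarrow> label \<Gamma> i \<in> Cell C" "i \<in> Obj I \<Longrightarrow> dom2 C (label \<Gamma> i) = pt0 (label \<kappa>) i"
    "i \<in> Obj I \<Longrightarrow> cod2 C (label \<Gamma> i) = pt0 (label \<mu>) i"
proof -
  show g: "\<Gamma> \<in> Cell (Ps I C)" "source \<Gamma> = \<kappa>" "target \<Gamma> = \<mu>" using G by (simp_all add: hom2_def)
  show "i \<in> Obj I \<Longrightarrow> label \<Gamma> i \<in> Cell C" "i \<in> Obj I \<Longrightarrow> dom2 C (label \<Gamma> i) = pt0 (label \<kappa>) i"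
    "i \<in> Obj I \<Longrightarrow> cod2 C (label \<Gamma> i) = pt0 (label \<mu>) i"
    using Cell_PsD(5-7)[OF g(1)] g by simp_all
qed

lemma points2_hom2:
  assumes G: "\<Gamma> \<in> hom2 (Ps I C) \<kappa> \<mu>" and k: "\<kappa> \<in> cones Y" and m: "\<mu> \<in> cones Y" and Y: "Y \<in> Obj C"
  shows "points2 Y \<Gamma> \<in> hom2 (Ps I Cat) (points Y \<kappa>) (points Y \<mu>)"
proof -
  note [simp] = cone_cellD[OF G] cones_simps[OF k Y] cones_simps[OF m Y] conesD[OF k] conesD[OF m]
  have cat [simp]: "category (hom_cat C Y Z)" for Z by (rule C.category_hom_cat)
  note pt [simp] = category.point2_Cell[OF cat] category.point2_vcomp[OF cat]
  have "points2 Y \<Gamma> \<in> Cell (Ps I Cat)"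
  proof (rule Cell_PsI)
    show "source (points2 Y \<Gamma>) \<in> Mor (Ps I Cat)" "target (points2 Y \<Gamma>) \<in> Mor (Ps I Cat)"
      using points_hom1[OF k Y] points_hom1[OF m Y] by (simp_all add: hom1_def)
    show "label (points2 Y \<Gamma>) \<in> extensional (Obj I)" by (simp add: points2_def)
    fix a assume a: "a \<in> Mor I"
    have "pt1 (label \<mu>) a \<bullet> (id2 C (on1 F a) \<star> label \<Gamma> (src I a)) = label \<Gamma> (tgt I a) \<bullet> pt1 (label \<kappa>) a"
      using modification_natural[OF cone_cellD(1)[OF G] a] a Y by simp
    then show "pt1 (label (target (points2 Y \<Gamma>))) a \<bullet>\<^bsub>Cat\<^esub>
        (id2 Cat (on1 (target (source (points2 Y \<Gamma>))) a) \<star>\<^bsub>Cat\<^esub> label (points2 Y \<Gamma>) (src I a)) =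
      (label (points2 Y \<Gamma>) (tgt I a) \<star>\<^bsub>Cat\<^esub> id2 Cat (on1 (source (source (points2 Y \<Gamma>))) a)) \<bullet>\<^bsub>Cat\<^esub>
        pt1 (label (source (points2 Y \<Gamma>))) a"
      using a Y by (simp flip: C.postcomp2_id2)
  qed simp_all
  then show ?thesis by (simp add: hom2_def)
qed

lemma points2_inject:
  assumes G: "\<Gamma> \<in> hom2 (Ps I C) \<kappa> \<mu>" and D: "\<Delta> \<in> hom2 (Ps I C) \<kappa> \<mu>" and e: "points2 Y \<Gamma> = points2 Y \<Delta>"
  shows "\<Gamma> = \<Delta>"
proof (rule Cell_Ps_eqI)
  show "label \<Gamma> i = label \<Delta> i" if "i \<in> Obj I" for i
    using arg_cong[OF e, of "\<lambda>t. label t i"] that by simp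
qed (use cone_cellD[OF G] cone_cellD[OF D] in simp_all)

lemma points2_surj:
  assumes s: "s \<in> hom2 (Ps I Cat) (points Y \<kappa>) (points Y \<mu>)"
    and k: "\<kappa> \<in> cones Y" and m: "\<mu> \<in> cones Y" and Y: "Y \<in> Obj C"
  shows "\<exists>\<Gamma>\<in>hom2 (Ps I C) \<kappa> \<mu>. s = points2 Y \<Gamma>"
proof -
  note [simp] = cones_simps[OF k Y] cones_simps[OF m Y] conesD[OF k] conesD[OF m]
  have cat [simp]: "category (hom_cat C Y Z)" for Z by (rule C.category_hom_cat)
  note pt [simp] = category.point2_Cell[OF cat] category.point2_vcomp[OF cat]
  have sc: "s \<in> Cell (Ps I Cat)" "source s = points Y \<kappa>" "target s = points Y \<mu>" using s by (simp_all add: hom2_def)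
  define g where "g = (\<lambda>i\<in>Obj I. label (label s i) undefined)"
  have g: "label s i = point2 (hc Y i) (g i)" "g i \<in> Cell C" "dom2 C (g i) = pt0 (label \<kappa>) i" "cod2 C (g i) = pt0 (label \<mu>) i"
    if i: "i \<in> Obj I" for i
  proof -
    have "label s i \<in> hom2 Cat (point (hc Y i) (pt0 (label \<kappa>) i)) (point (hc Y i) (pt0 (label \<mu>) i))"
      using Cell_PsD(5-7)[OF sc(1) i] sc i by (simp add: hom2_def)
    from category.point2_cases[OF cat this] C.chom_hom_cat[OF cones_simps(1)[OF k Y i]] i
    show "label s i = point2 (hc Y i) (g i)" "g i \<in> Cell C" "dom2 C (g i) = pt0 (label \<kappa>) i" "cod2 C (g i) = pt0 (label \<mu>) i"
      by (simp_all add: g_def hom2_def)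
  qed
  note [simp] = g(2-4)
  let ?G = "Arrow \<kappa> \<mu> g"
  have "?G \<in> Cell (Ps I C)"
  proof (rule Cell_PsI)
    show "label ?G \<in> extensional (Obj I)" by (simp add: g_def)
    fix a assume a: "a \<in> Mor I"
    have "point2 (hc Y (tgt I a)) (pt1 (label \<mu>) a \<bullet> (id2 C (on1 F a) \<star> g (src I a))) =
        point2 (hc Y (tgt I a)) (g (tgt I a) \<bullet> pt1 (label \<kappa>) a)"
      using modification_natural[OF sc(1) a] a Y by (simp add: sc g(1) flip: C.postcomp2_id2)
    then show "pt1 (label (target ?G)) a \<bullet> (id2 C (on1 (target (source ?G)) a) \<star> label ?G (src I a)) =
      (label ?G (tgt I a) \<star> id2 C (on1 (source (source ?G)) a)) \<bullet> pt1 (label (source ?G)) a"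
      using a Y by simp
  qed simp_all
  then have G: "?G \<in> hom2 (Ps I C) \<kappa> \<mu>" by (simp add: hom2_def)
  have "s = points2 Y ?G"
    by (rule Cell_Ps_eqI[OF sc(1)]) (use points2_hom2[OF G k m Y] g(1) in \<open>simp_all add: hom2_def sc\<close>)
  with G show ?thesis by blast
qed

lemma points2_id2:
  assumes k: "\<kappa> \<in> cones Y" and Y: "Y \<in> Obj C"
  shows "points2 Y (id2 (Ps I C) \<kappa>) = id2 (Ps I Cat) (points Y \<kappa>)"
proof (rule Cell_Ps_eqI)
  have h: "id2 (Ps I C) \<kappa> \<in> hom2 (Ps I C) \<kappa> \<kappa>" using PsC.id2_hom conesD[OF k] by blast
  show "points2 Y (id2 (Ps I C) \<kappa>) \<in> Cell (Ps I Cat)" using points2_hom2[OF h k k Y] by (simp add: hom2_def)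
  show "id2 (Ps I Cat) (points Y \<kappa>) \<in> Cell (Ps I Cat)"
    using PsCat.id2_simps(1) points_hom1[OF k Y] by (simp add: hom1_def)
  fix i assume i: "i \<in> Obj I"
  have "id2 Cat (point (hc Y i) (pt0 (label \<kappa>) i)) = point2 (hc Y i) (id2 C (pt0 (label \<kappa>) i))"
    using category.id2_point[OF C.category_hom_cat] cones_simps(1)[OF k Y i] by simp
  then show "label (points2 Y (id2 (Ps I C) \<kappa>)) i = label (id2 (Ps I Cat) (points Y \<kappa>)) i" using i by simp
qed simp_all

lemma points2_vcomp:
  assumes G: "\<Gamma> \<in> hom2 (Ps I C) \<kappa> \<mu>" and D: "\<Delta> \<in> hom2 (Ps I C) \<mu> \<nu>"
    and k: "\<kappa> \<in> cones Y" and m: "\<mu> \<in> cones Y" and n: "\<nu> \<in> cones Y" and Y: "Y \<in> Obj C"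
  shows "points2 Y (\<Delta> \<bullet>\<^bsub>Ps I C\<^esub> \<Gamma>) = points2 Y \<Delta> \<bullet>\<^bsub>Ps I Cat\<^esub> points2 Y \<Gamma>"
proof (rule Cell_Ps_eqI)
  note [simp] = cone_cellD[OF G] cone_cellD[OF D] cones_simps[OF k Y] cones_simps[OF m Y]
  show "points2 Y (\<Delta> \<bullet>\<^bsub>Ps I C\<^esub> \<Gamma>) \<in> Cell (Ps I Cat)"
    using points2_hom2[OF PsC.vcomp_hom[OF G D] k n Y] by (simp add: hom2_def)
  show "points2 Y \<Delta> \<bullet>\<^bsub>Ps I Cat\<^esub> points2 Y \<Gamma> \<in> Cell (Ps I Cat)"
    using PsCat.vcomp_hom[OF points2_hom2[OF G k m Y] points2_hom2[OF D m n Y]] by (simp add: hom2_def)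
  fix i assume i: "i \<in> Obj I"
  show "label (points2 Y (\<Delta> \<bullet>\<^bsub>Ps I C\<^esub> \<Gamma>)) i = label (points2 Y \<Delta> \<bullet>\<^bsub>Ps I Cat\<^esub> points2 Y \<Gamma>) i"
    using i by (simp add: category.point2_vcomp[OF C.category_hom_cat])
qed simp_all

lemma invertible2_points2:
  assumes G: "\<Gamma> \<in> hom2 (Ps I C) \<kappa> \<mu>" and k: "\<kappa> \<in> cones Y" and m: "\<mu> \<in> cones Y" and Y: "Y \<in> Obj C"
  shows "invertible2 (Ps I Cat) (points2 Y \<Gamma>) \<longleftrightarrow> invertible2 (Ps I C) \<Gamma>"
proof
  have km: "\<kappa> \<in> Mor (Ps I C)" "\<mu> \<in> Mor (Ps I C)" using conesD(1)[OF k] conesD(1)[OF m] by blast+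
  note h = points2_hom2[OF G k m Y]
  note gd = cone_cellD(1-3)[OF G]
  {
    assume i: "invertible2 (Ps I C) \<Gamma>"
    let ?D = "inv2 (Ps I C) \<Gamma>"
    note inv = PsC.inv2_simps[OF i, unfolded Ps_sel gd]
    have D: "?D \<in> hom2 (Ps I C) \<mu> \<kappa>" using inv by (simp add: hom2_def)
    show "invertible2 (Ps I Cat) (points2 Y \<Gamma>)"
      by (rule invertible2_hom2I[OF h points2_hom2[OF D m k Y]])
        (simp_all add: inv points2_id2[OF k Y] points2_id2[OF m Y]
          points2_vcomp[OF G D k m k Y, symmetric] points2_vcomp[OF D G m k m Y, symmetric])
  next
    assume i: "invertible2 (Ps I Cat) (points2 Y \<Gamma>)"
    note inv = PsCat.inv2_simps[OF i, unfolded Ps_sel points_sel gd]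
    have "inv2 (Ps I Cat) (points2 Y \<Gamma>) \<in> hom2 (Ps I Cat) (points Y \<mu>) (points Y \<kappa>)"
      using inv by (simp add: hom2_def)
    from points2_surj[OF this m k Y] obtain \<Delta>
      where D: "\<Delta> \<in> hom2 (Ps I C) \<mu> \<kappa>" and e: "inv2 (Ps I Cat) (points2 Y \<Gamma>) = points2 Y \<Delta>" by blast
    show "invertible2 (Ps I C) \<Gamma>"
    proof (rule invertible2_hom2I[OF G D])
      show "\<Delta> \<bullet>\<^bsub>Ps I C\<^esub> \<Gamma> = id2 (Ps I C) \<kappa>"
        by (rule points2_inject[OF PsC.vcomp_hom[OF G D] PsC.id2_hom[OF km(1)], of Y])
          (use inv(4) in \<open>simp add: e points2_id2[OF k Y] points2_vcomp[OF G D k m k Y]\<close>)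
      show "\<Gamma> \<bullet>\<^bsub>Ps I C\<^esub> \<Delta> = id2 (Ps I C) \<mu>"
        by (rule points2_inject[OF PsC.vcomp_hom[OF D G] PsC.id2_hom[OF km(2)], of Y])
          (use inv(5) in \<open>simp add: e points2_id2[OF m Y] points2_vcomp[OF D G m k m Y]\<close>)
    qed
  }
qed

end

context diagram
begin

lemma hom_pstrans_sel:
  "source (hom_pstrans I C f F) = H (tgt C f)" "target (hom_pstrans I C f F) = H (src C f)"
  "i \<in> Obj I \<Longrightarrow> pt0 (label (hom_pstrans I C f F)) i = precomp C f (on0 F i)"
  "a \<in> Mor I \<Longrightarrow> pt1 (label (hom_pstrans I C f F)) a =
    id2 Cat (Cat_comp (postcomp C (src C f) (on1 F a)) (precomp C f (on0 F (src I a))))"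
  by (simp_all add: hom_pstrans_def)

lemma cone_comp_hom:
  assumes "l \<in> cones X" and "f \<in> hom1 C Y X"
  shows "l \<cdot>\<^bsub>Ps I C\<^esub> const_pstrans I C f \<in> cones Y"
  using assms PsC.comp_hom[of "const_pstrans I C f" "const_psfun I C Y" "const_psfun I C X" l F]
  by (simp add: hom1_def)

lemma cone_whisker_hom:
  assumes l: "l \<in> cones X" and f: "f \<in> hom1 C Y X" and g: "\<gamma> \<in> hom2 C f g"
  shows "id2 (Ps I C) l \<star>\<^bsub>Ps I C\<^esub> const_modification I C \<gamma> \<in>
    hom2 (Ps I C) (l \<cdot>\<^bsub>Ps I C\<^esub> const_pstrans I C f) (l \<cdot>\<^bsub>Ps I C\<^esub> const_pstrans I C g)"
  by (rule PsC.hcomp_hom) (use assms conesD[OF l] PsC.id2_hom in \<open>simp_all add: hom1_def hom2_def\<close>)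

text \<open>
  The functors \<open>C(f, F i)\<close> precompose with \<open>f\<close>, and the 2-morphisms of \<open>C(f, F -)\<close> are identities; so composing
  the points of \<open>l\<close> with \<open>C(f, F -)\<close> gives the points of \<open>l (\<Delta>f)\<close>.
\<close>

lemma hom_pstrans_points:
  assumes l: "l \<in> cones X" and f: "f \<in> hom1 C Y X" and X: "X \<in> Obj C"
  shows "hom_pstrans I C f F \<cdot>\<^bsub>Ps I Cat\<^esub> points X l = points Y (l \<cdot>\<^bsub>Ps I C\<^esub> const_pstrans I C f)"
proof (rule arrow_eqI)
  have f' [simp]: "f \<in> Mor C" "src C f = Y" "tgt C f = X" using f by (simp_all add: hom1_def)
  note [simp] = cones_simps[OF l X] conesD[OF l] hom_pstrans_sel
  have cat [simp]: "category (hom_cat C Z W)" for Z W by (rule C.category_hom_cat)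
  note pt [simp] = category.point_Mor[OF cat] category.point2_Cell[OF cat] category.point2_vcomp[OF cat]
    category.id2_point[OF cat]
  let ?p = "label (hom_pstrans I C f F \<cdot>\<^bsub>Ps I Cat\<^esub> points X l)"
    and ?q = "label (points Y (l \<cdot>\<^bsub>Ps I C\<^esub> const_pstrans I C f))"
  show "source (hom_pstrans I C f F \<cdot>\<^bsub>Ps I Cat\<^esub> points X l) = source (points Y (l \<cdot>\<^bsub>Ps I C\<^esub> const_pstrans I C f))"
    "target (hom_pstrans I C f F \<cdot>\<^bsub>Ps I Cat\<^esub> points X l) = target (points Y (l \<cdot>\<^bsub>Ps I C\<^esub> const_pstrans I C f))"
    by simp_all
  show "?p = ?q"
  proof (rule pstrans.equality)
    show "pt0 ?p = pt0 ?q"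
    proof (rule extensionalityI[of _ "Obj I"])
      show "pt0 ?p \<in> extensional (Obj I)" "pt0 ?q \<in> extensional (Obj I)"
        by (simp_all add: Ps_comp_def points_trans_def)
      show "pt0 ?p i = pt0 ?q i" if "i \<in> Obj I" for i using that by simp
    qed
    show "pt1 ?p = pt1 ?q"
    proof (rule extensionalityI[of _ "Mor I"])
      show "pt1 ?p \<in> extensional (Mor I)" "pt1 ?q \<in> extensional (Mor I)"
        by (simp_all add: Ps_comp_def points_trans_def)
      fix a assume a [simp]: "a \<in> Mor I"
      let ?x = "pt0 (label l) (src I a)"
      have xf: "?x \<cdot> f \<in> hom1 C Y (on0 F (src I a))" "on1 F a \<cdot> ?x \<cdot> f \<in> hom1 C Y (on0 F (tgt I a))"
        by (simp_all add: hom1_def)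
      have 1: "id2 Cat (Cat_comp (postcomp C Y (on1 F a)) (precomp C f (on0 F (src I a)))) \<star>\<^bsub>Cat\<^esub>
          id2 Cat (point (hc X (src I a)) ?x) = point2 (hc Y (tgt I a)) (id2 C (on1 F a \<cdot> ?x \<cdot> f))"
      proof -
        have "id2 Cat (Cat_comp (postcomp C Y (on1 F a)) (precomp C f (on0 F (src I a)))) \<star>\<^bsub>Cat\<^esub>
          id2 Cat (point (hc X (src I a)) ?x) =
          id2 Cat (Cat_comp (Cat_comp (postcomp C Y (on1 F a)) (precomp C f (on0 F (src I a)))) (point (hc X (src I a)) ?x))"
          using Cat.hcomp_id2'[of "point (hc X (src I a)) ?x" "Cat_comp (postcomp C Y (on1 F a)) (precomp C f (on0 F (src I a)))"]
          by (simp del: pt(4))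
        also have "\<dots> = id2 Cat (Cat_comp (postcomp C Y (on1 F a)) (Cat_comp (precomp C f (on0 F (src I a))) (point (hc X (src I a)) ?x)))"
          using Cat.comp_assoc'[of "point (hc X (src I a)) ?x" "precomp C f (on0 F (src I a))" "postcomp C Y (on1 F a)"] by simp
        also have "\<dots> = point2 (hc Y (tgt I a)) (id2 C (on1 F a \<cdot> ?x \<cdot> f))" using xf by simp
        finally show ?thesis .
      qed
      have 2: "id2 Cat (precomp C f (on0 F (tgt I a))) \<star>\<^bsub>Cat\<^esub> point2 (hc X (tgt I a)) (pt1 (label l) a) =
        point2 (hc Y (tgt I a)) (pt1 (label l) a \<star> id2 C f)"
        by (simp flip: C.precomp2_id2)
      show "pt1 ?p a = pt1 ?q a" using 1 2 by (simp del: pt(4))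
    qed
  qed simp
qed

lemma hom_modification_points:
  assumes l: "l \<in> cones X" and f: "f \<in> hom1 C Y X" and g: "\<gamma> \<in> hom2 C f g" and X: "X \<in> Obj C"
  shows "hom_modification I C \<gamma> F \<star>\<^bsub>Ps I Cat\<^esub> id2 (Ps I Cat) (points X l) =
    points2 Y (id2 (Ps I C) l \<star>\<^bsub>Ps I C\<^esub> const_modification I C \<gamma>)"
proof (rule arrow_eqI)
  have f' [simp]: "f \<in> Mor C" "src C f = Y" "tgt C f = X" "\<gamma> \<in> Cell C" "dom2 C \<gamma> = f" "cod2 C \<gamma> = g"
    using f g by (simp_all add: hom1_def hom2_def)
  have g1: "g \<in> hom1 C Y X"
    using C.Cell_cod2[OF f'(4)] C.src_cod2[OF f'(4)] C.tgt_cod2[OF f'(4)] by (simp add: hom1_def)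
  note [simp] = cones_simps[OF l X] conesD[OF l]
  have cat: "category (hom_cat C Z W)" for Z W by (rule C.category_hom_cat)
  let ?s = "hom_modification I C \<gamma> F \<star>\<^bsub>Ps I Cat\<^esub> id2 (Ps I Cat) (points X l)"
    and ?t = "points2 Y (id2 (Ps I C) l \<star>\<^bsub>Ps I C\<^esub> const_modification I C \<gamma>)"
  have "source (hom_modification I C \<gamma> F) = hom_pstrans I C f F" "target (hom_modification I C \<gamma> F) = hom_pstrans I C g F"
    by (simp_all add: hom_modification_def)
  then show "source ?s = source ?t" "target ?s = target ?t"
    using hom_pstrans_points[OF l f X] hom_pstrans_points[OF l g1 X] by simp_all
  show "label ?s = label ?t"
  proof (rule extensionalityI[of _ "Obj I"])
    show "label ?s \<in> extensional (Obj I)" "label ?t \<in> extensional (Obj I)"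
      by (simp_all add: hcomp_Ps points2_def)
    fix i assume i: "i \<in> Obj I"
    have "label (hom_modification I C \<gamma> F) i = precomp2 C \<gamma> (on0 F i)"
      using i by (simp add: hom_modification_def)
    moreover have "id2 Cat (point (hc X i) (pt0 (label l) i)) = point2 (hc X i) (id2 C (pt0 (label l) i))"
      using category.id2_point[OF cat] i by simp
    ultimately show "label ?s i = label ?t i" using i by simp
  qed
qed

lemma bilimit_comparison_sel:
  assumes l: "l \<in> cones X" and X: "X \<in> Obj C"
  shows "f \<in> hom1 C Y X \<Longrightarrow> fob (bilimit_comparison I C F (points X l) X Y) f =
      points Y (l \<cdot>\<^bsub>Ps I C\<^esub> const_pstrans I C f)"
    and "f \<in> hom1 C Y X \<Longrightarrow> \<gamma> \<in> hom2 C f g \<Longrightarrow> far (bilimit_comparison I C F (points X l) X Y) \<gamma> =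
      points2 Y (id2 (Ps I C) l \<star>\<^bsub>Ps I C\<^esub> const_modification I C \<gamma>)"
proof -
  show "f \<in> hom1 C Y X \<Longrightarrow> fob (bilimit_comparison I C F (points X l) X Y) f =
      points Y (l \<cdot>\<^bsub>Ps I C\<^esub> const_pstrans I C f)"
    using hom_pstrans_points[OF l _ X] by (simp add: bilimit_comparison_def)
  show "far (bilimit_comparison I C F (points X l) X Y) \<gamma> =
      points2 Y (id2 (Ps I C) l \<star>\<^bsub>Ps I C\<^esub> const_modification I C \<gamma>)" if "f \<in> hom1 C Y X" "\<gamma> \<in> hom2 C f g"
  proof -
    have "\<gamma> \<in> cAr (hom_cat C Y X)" using that by (simp add: hom1_def hom2_def)
    then show ?thesis
      using hom_modification_points[OF l that X] by (simp add: bilimit_comparison_def del: C.cAr_hom_cat)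
  qed
qed

lemma is_functor_bilimit_comparison:
  assumes l: "l \<in> cones X" and X: "X \<in> Obj C" and Y: "Y \<in> Obj C"
  shows "is_functor (hom_cat C Y X) (hom_cat (Ps I Cat) One (H Y)) (bilimit_comparison I C F (points X l) X Y)"
    (is "is_functor ?A ?B ?K")
proof (rule is_functorI)
  have sel: "fob ?K f = points Y (l \<cdot>\<^bsub>Ps I C\<^esub> const_pstrans I C f)" if "f \<in> hom1 C Y X" for f
    by (rule bilimit_comparison_sel(1)[OF l X that])
  have ar: "\<gamma> \<in> hom2 C (dom2 C \<gamma>) (cod2 C \<gamma>)" "dom2 C \<gamma> \<in> hom1 C Y X" "cod2 C \<gamma> \<in> hom1 C Y X" if "\<gamma> \<in> cAr ?A" for \<gamma>
    using that by (simp_all add: hom1_def hom2_def)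
  have sel2: "far ?K \<gamma> = points2 Y (id2 (Ps I C) l \<star>\<^bsub>Ps I C\<^esub> const_modification I C \<gamma>)" if "\<gamma> \<in> cAr ?A" for \<gamma>
    by (rule bilimit_comparison_sel(2)[OF l X ar(2)[OF that] ar(1)[OF that]])
  have cell: "far ?K \<gamma> \<in> hom2 (Ps I Cat) (fob ?K (dom2 C \<gamma>)) (fob ?K (cod2 C \<gamma>))" if g: "\<gamma> \<in> cAr ?A" for \<gamma>
    unfolding sel2[OF g] sel[OF ar(2)[OF g]] sel[OF ar(3)[OF g]]
    by (rule points2_hom2[OF cone_whisker_hom[OF l ar(2)[OF g] ar(1)[OF g]] cone_comp_hom[OF l ar(2)[OF g]]
      cone_comp_hom[OF l ar(3)[OF g]] Y])
  have ob: "fob ?K f \<in> hom1 (Ps I Cat) One (H Y)" if "f \<in> hom1 C Y X" for f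
    unfolding sel[OF that] by (rule points_hom1[OF cone_comp_hom[OF l that] Y])
  show "fob ?K \<in> extensional (cOb ?A)" "far ?K \<in> extensional (cAr ?A)"
    by (simp_all add: bilimit_comparison_def del: C.cAr_hom_cat)
  show "f \<in> cOb ?A \<Longrightarrow> fob ?K f \<in> cOb ?B" for f using ob by simp
  show "far ?K \<gamma> \<in> cAr ?B" "cdom ?B (far ?K \<gamma>) = fob ?K (cdom ?A \<gamma>)" "ccod ?B (far ?K \<gamma>) = fob ?K (ccod ?A \<gamma>)"
    if g: "\<gamma> \<in> cAr ?A" for \<gamma>
    using cell[OF g] ob[OF ar(2)[OF g]] by (simp_all add: hom2_def hom1_def)
  show "far ?K (cid ?A f) = cid ?B (fob ?K f)" if f: "f \<in> cOb ?A" for f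
  proof -
    have f1: "f \<in> hom1 C Y X" using f by simp
    have f2: "f \<in> Mor C" "src C f = Y" "tgt C f = X" using f1 by (simp_all add: hom1_def)
    have i: "const_modification I C (id2 C f) = id2 (Ps I C) (const_pstrans I C f)"
      by (rule Cell_Ps_eqI[of _ I C]) (use f2 PsC.id2_simps(1) in simp_all)
    have "id2 (Ps I C) l \<star>\<^bsub>Ps I C\<^esub> const_modification I C (id2 C f) = id2 (Ps I C) (l \<cdot>\<^bsub>Ps I C\<^esub> const_pstrans I C f)"
      unfolding i using PsC.hcomp_id2'[of "const_pstrans I C f" l] conesD[OF l] f2 by simp
    then show ?thesis
      using sel2[of "id2 C f"] f2 sel[OF f1] points2_id2[OF cone_comp_hom[OF l f1] Y] by simp
  qed
  show "far ?K (\<delta> \<odot>\<^bsub>?A\<^esub> \<gamma>) = far ?K \<delta> \<odot>\<^bsub>?B\<^esub> far ?K \<gamma>"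
    if g: "\<gamma> \<in> cAr ?A" and d: "\<delta> \<in> cAr ?A" and t: "ccod ?A \<gamma> = cdom ?A \<delta>" for \<gamma> \<delta>
  proof -
    have g2: "\<gamma> \<in> Cell C" "\<delta> \<in> Cell C" "cod2 C \<gamma> = dom2 C \<delta>" "src C (dom2 C \<gamma>) = Y" "tgt C (dom2 C \<gamma>) = X"
      using g d t by simp_all
    have v: "\<delta> \<bullet> \<gamma> \<in> cAr ?A" using g2 by simp
    have m: "const_modification I C (\<delta> \<bullet> \<gamma>) = const_modification I C \<delta> \<bullet>\<^bsub>Ps I C\<^esub> const_modification I C \<gamma>"
      by (rule Cell_Ps_eqI[of _ I C]) (use g2 PsC.vcomp_simps(1) in simp_all)
    have e: "id2 (Ps I C) l \<star>\<^bsub>Ps I C\<^esub> const_modification I C (\<delta> \<bullet> \<gamma>) =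
      (id2 (Ps I C) l \<star>\<^bsub>Ps I C\<^esub> const_modification I C \<delta>) \<bullet>\<^bsub>Ps I C\<^esub> (id2 (Ps I C) l \<star>\<^bsub>Ps I C\<^esub> const_modification I C \<gamma>)"
      unfolding m by (rule PsC.whisker_left) (use g2 conesD[OF l] in simp_all)
    have D: "\<delta> \<in> hom2 C (cod2 C \<gamma>) (cod2 C \<delta>)" using ar(1)[OF d] g2(3) by simp
    have "far ?K (\<delta> \<bullet> \<gamma>) = far ?K \<delta> \<bullet>\<^bsub>Ps I Cat\<^esub> far ?K \<gamma>"
      unfolding sel2[OF v] sel2[OF g] sel2[OF d] e
      by (rule points2_vcomp[OF cone_whisker_hom[OF l ar(2)[OF g] ar(1)[OF g]] cone_whisker_hom[OF l ar(3)[OF g] D]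
        cone_comp_hom[OF l ar(2)[OF g]] cone_comp_hom[OF l ar(3)[OF g]] cone_comp_hom[OF l ar(3)[OF d]] Y])
    then show ?thesis by simp
  qed
qed

lemma Diag_sel:
  "X \<in> Obj C \<Longrightarrow> on0 (Diag I C) X = const_psfun I C X"
  "f \<in> Mor C \<Longrightarrow> on1 (Diag I C) f = const_pstrans I C f"
  "\<gamma> \<in> Cell C \<Longrightarrow> on2 (Diag I C) \<gamma> = const_modification I C \<gamma>"
  by (simp_all add: Diag_def)

abbreviation T1 where "T1 l c \<equiv> l \<cdot>\<^bsub>Ps I C\<^esub> const_pstrans I C c"
abbreviation T2 where "T2 l \<gamma> \<equiv> id2 (Ps I C) l \<star>\<^bsub>Ps I C\<^esub> const_modification I C \<gamma>"

lemma biuniversal_Diag_iff: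
  "biuniversal_arrow C (Ps I C) (Diag I C) F X l \<longleftrightarrow> X \<in> Obj C \<and> l \<in> cones X \<and> (\<forall>Y\<in>Obj C.
     (\<forall>\<kappa>\<in>cones Y. \<exists>c\<in>hom1 C Y X. \<exists>\<psi>\<in>hom2 (Ps I C) (T1 l c) \<kappa>. invertible2 (Ps I C) \<psi>) \<and>
     (\<forall>c\<in>hom1 C Y X. \<forall>d\<in>hom1 C Y X. \<forall>\<Theta>\<in>hom2 (Ps I C) (T1 l c) (T1 l d).
        \<exists>!\<gamma>. \<gamma> \<in> hom2 C c d \<and> T2 l \<gamma> = \<Theta>))"
proof -
  have m: "on1 (Diag I C) c = const_pstrans I C c" if "c \<in> hom1 C Y X" for c Y
    using that by (simp add: hom1_def Diag_sel)
  have t: "(\<gamma> \<in> hom2 C c d \<and> id2 (Ps I C) l \<star>\<^bsub>Ps I C\<^esub> on2 (Diag I C) \<gamma> = \<Theta>) \<longleftrightarrow> (\<gamma> \<in> hom2 C c d \<and> T2 l \<gamma> = \<Theta>)" for \<gamma> c d \<Theta>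
    by (auto simp: hom2_def Diag_sel)
  show ?thesis
    unfolding biuniversal_arrow_def t
    by (simp add: pslice_obj_def Diag_sel m cong: conj_cong ball_cong)
qed

text \<open>
  The bijections \<open>points\<close> and \<open>points2\<close> carry \<open>c \<mapsto> l (\<Delta>c)\<close> to the comparison functor and preserve and
  reflect isomorphisms. So one is essentially surjective and fully faithful iff the other is.
\<close>

theorem weighted_bilimit_iff_biuniversal:
  assumes X: "X \<in> Obj C" and l: "l \<in> cones X"
  shows "weighted_bilimit I C One F X (points X l) \<longleftrightarrow> biuniversal_arrow C (Ps I C) (Diag I C) F X l"
proof -
  have "adjoint_equivalence (hom_cat C Y X) (hom_cat (Ps I Cat) One (H Y)) (bilimit_comparison I C F (points X l) X Y) \<longleftrightarrow>
    (\<forall>\<kappa>\<in>cones Y. \<exists>c\<in>hom1 C Y X. \<exists>\<psi>\<in>hom2 (Ps I C) (T1 l c) \<kappa>. invertible2 (Ps I C) \<psi>) \<and>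
    (\<forall>c\<in>hom1 C Y X. \<forall>d\<in>hom1 C Y X. \<forall>\<Theta>\<in>hom2 (Ps I C) (T1 l c) (T1 l d).
       \<exists>!\<gamma>. \<gamma> \<in> hom2 C c d \<and> T2 l \<gamma> = \<Theta>)" (is "?ae \<longleftrightarrow> ?es \<and> ?ff") if Y: "Y \<in> Obj C" for Y
  proof -
    let ?A = "hom_cat C Y X" and ?B = "hom_cat (Ps I Cat) One (H Y)" and ?K = "bilimit_comparison I C F (points X l) X Y"
    note cA = C.category_hom_cat[of Y X] and cB = PsCat.category_hom_cat[of One "H Y"]
    note ob = bilimit_comparison_sel(1)[OF l X] and arr = bilimit_comparison_sel(2)[OF l X]
    note T1 = cone_comp_hom[OF l] and T2 = cone_whisker_hom[OF l]
    have homB: "chom ?B (points Y \<kappa>) s = hom2 (Ps I Cat) (points Y \<kappa>) s" if "\<kappa> \<in> cones Y" for \<kappa> s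
      by (rule PsCat.chom_hom_cat[OF points_hom1[OF that Y]])
    have iso: "is_ciso ?B (points2 Y \<Gamma>) \<longleftrightarrow> invertible2 (Ps I C) \<Gamma>"
      if "\<Gamma> \<in> hom2 (Ps I C) \<kappa> \<mu>" "\<kappa> \<in> cones Y" "\<mu> \<in> cones Y" for \<Gamma> \<kappa> \<mu>
      unfolding PsCat.is_ciso_hom_cat[OF points2_hom2[OF that Y] points_hom1[OF that(2) Y]]
      by (rule invertible2_points2[OF that Y])
    show ?thesis
    proof
      assume ae: ?ae
      note es = adjoint_equivalence_imp(1)[OF cA cB ae] and ff = adjoint_equivalence_imp(2)[OF cA cB ae]
      have ?es
      proof
        fix \<kappa> assume k: "\<kappa> \<in> cones Y"
        have "points Y \<kappa> \<in> cOb ?B" using points_hom1[OF k Y] by simp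
        from es[OF this] obtain c s where c: "c \<in> hom1 C Y X" and s: "s \<in> chom ?B (fob ?K c) (points Y \<kappa>)" "is_ciso ?B s"
          by auto
        from s(1) have "s \<in> hom2 (Ps I Cat) (points Y (T1 l c)) (points Y \<kappa>)" unfolding ob[OF c] homB[OF T1[OF c]] .
        from points2_surj[OF this T1[OF c] k Y] obtain \<psi> where p: "\<psi> \<in> hom2 (Ps I C) (T1 l c) \<kappa>" "s = points2 Y \<psi>" by blast
        with s(2) iso[OF p(1) T1[OF c] k] have "invertible2 (Ps I C) \<psi>" by simp
        with c p(1) show "\<exists>c\<in>hom1 C Y X. \<exists>\<psi>\<in>hom2 (Ps I C) (T1 l c) \<kappa>. invertible2 (Ps I C) \<psi>" by blast
      qed
      moreover have ?ff
      proof (intro ballI)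
        fix c d \<Theta> assume c: "c \<in> hom1 C Y X" and d: "d \<in> hom1 C Y X" and t: "\<Theta> \<in> hom2 (Ps I C) (T1 l c) (T1 l d)"
        have "points2 Y \<Theta> \<in> chom ?B (fob ?K c) (fob ?K d)"
          unfolding ob[OF c] ob[OF d] homB[OF T1[OF c]] by (rule points2_hom2[OF t T1[OF c] T1[OF d] Y])
        from ff[OF _ _ this] have "\<exists>!\<gamma>. \<gamma> \<in> chom ?A c d \<and> far ?K \<gamma> = points2 Y \<Theta>" using c d by simp
        moreover have "\<gamma> \<in> chom ?A c d \<and> far ?K \<gamma> = points2 Y \<Theta> \<longleftrightarrow> \<gamma> \<in> hom2 C c d \<and> T2 l \<gamma> = \<Theta>" for \<gamma>
          unfolding C.chom_hom_cat[OF c] using arr[OF c] points2_inject[OF T2[OF c] t] by auto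
        ultimately show "\<exists>!\<gamma>. \<gamma> \<in> hom2 C c d \<and> T2 l \<gamma> = \<Theta>" by simp
      qed
      ultimately show "?es \<and> ?ff" by blast
    next
      assume "?es \<and> ?ff"
      then have es: ?es and ff: ?ff by blast+
      show ?ae
      proof (rule adjoint_equivalenceI[OF cA cB is_functor_bilimit_comparison[OF l X Y]])
        fix p assume "p \<in> cOb ?B"
        then have "p \<in> hom1 (Ps I Cat) One (H Y)" by simp
        from points_surj[OF this Y] obtain \<kappa> where k: "\<kappa> \<in> cones Y" "p = points Y \<kappa>" by blast
        from es k(1) obtain c \<psi> where c: "c \<in> hom1 C Y X" and p: "\<psi> \<in> hom2 (Ps I C) (T1 l c) \<kappa>" "invertible2 (Ps I C) \<psi>" by blast
        have "points2 Y \<psi> \<in> chom ?B (fob ?K c) p"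
          unfolding ob[OF c] homB[OF T1[OF c]] k(2) by (rule points2_hom2[OF p(1) T1[OF c] k(1) Y])
        moreover have "is_ciso ?B (points2 Y \<psi>)" using iso[OF p(1) T1[OF c] k(1)] p(2) by blast
        ultimately show "\<exists>c\<in>cOb ?A. \<exists>u\<in>chom ?B (fob ?K c) p. is_ciso ?B u" using c by auto
      next
        fix c d v assume cd: "c \<in> cOb ?A" "d \<in> cOb ?A" and v: "v \<in> chom ?B (fob ?K c) (fob ?K d)"
        have c: "c \<in> hom1 C Y X" and d: "d \<in> hom1 C Y X" using cd by simp_all
        from v have "v \<in> hom2 (Ps I Cat) (points Y (T1 l c)) (points Y (T1 l d))"
          unfolding ob[OF c] ob[OF d] homB[OF T1[OF c]] .
        from points2_surj[OF this T1[OF c] T1[OF d] Y] obtain \<Theta>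
          where t: "\<Theta> \<in> hom2 (Ps I C) (T1 l c) (T1 l d)" "v = points2 Y \<Theta>" by blast
        have "\<exists>!\<gamma>. \<gamma> \<in> hom2 C c d \<and> T2 l \<gamma> = \<Theta>" using ff c d t(1) by blast
        moreover have "\<gamma> \<in> chom ?A c d \<and> far ?K \<gamma> = v \<longleftrightarrow> \<gamma> \<in> hom2 C c d \<and> T2 l \<gamma> = \<Theta>" for \<gamma>
          unfolding C.chom_hom_cat[OF c] t(2) using arr[OF c] points2_inject[OF T2[OF c] t(1)] by auto
        ultimately show "\<exists>!u. u \<in> chom ?A c d \<and> far ?K u = v" by simp
      qed
    qed
  qed
  then show ?thesis
    unfolding weighted_bilimit_def biuniversal_Diag_iff using X l points_hom1[OF l X] by simp
qed

lemma bilimit_iff_biuniversal: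
  "(\<exists>X l. bilimit I C F X l) \<longleftrightarrow>
    (\<exists>X\<in>Obj C. \<exists>l\<in>cones X. biuniversal_arrow C (Ps I C) (Diag I C) F X l)"
proof
  assume "\<exists>X l. bilimit I C F X l"
  then obtain X p where b: "weighted_bilimit I C One F X p" unfolding bilimit_def by blast
  then have X: "X \<in> Obj C" and p: "p \<in> hom1 (Ps I Cat) One (H X)" by (simp_all add: weighted_bilimit_def)
  from points_surj[OF p X] obtain l where l: "l \<in> cones X" "p = points X l" by blast
  with b X weighted_bilimit_iff_biuniversal[OF X l(1)]
  show "\<exists>X\<in>Obj C. \<exists>l\<in>cones X. biuniversal_arrow C (Ps I C) (Diag I C) F X l" by blast
next
  assume "\<exists>X\<in>Obj C. \<exists>l\<in>cones X. biuniversal_arrow C (Ps I C) (Diag I C) F X l"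
  then show "\<exists>X l. bilimit I C F X l" unfolding bilimit_def using weighted_bilimit_iff_biuniversal by blast
qed

end

section \<open>Characterisations of bi-limits\<close>

theorem corollary7p23:
  fixes I :: "('i, 'j, 'k) two_cat"
    and C :: "('o, 'm, 't) two_cat"
    and F :: "('i, 'j, 'k, 'o, 'm, 't) psfun"
  assumes "two_category I" and "two_category C" and "normal_psfunctor I C F"
  shows
    "((\<exists>X l. bilimit I C F X l) \<longleftrightarrow>
      (\<exists>X\<in>Obj C. \<exists>l\<in>hom1 (Ps I C) (const_psfun I C X) F.
         double_bi_terminal (pslice_dbl C (Ps I C) (Diag I C) F) (X, l))) \<and>
     ((\<exists>X l. bilimit I C F X l) \<longleftrightarrow>
      (\<exists>X\<in>Obj C. \<exists>l\<in>hom1 (Ps I C) (const_psfun I C X) F.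
         bi_terminal (pslice C (Ps I C) (Diag I C) F) (X, l) \<and>
         bi_terminal (pslice (Ar C) (Ar (Ps I C)) (Ar_psfun C (Ps I C) (Diag I C)) F)
           (X, id2 (Ps I C) l))) \<and>
     ((\<exists>X l. bilimit I C F X l) \<longleftrightarrow>
      (\<exists>X\<in>Obj C. \<exists>l\<in>hom1 (Ps I C) (const_psfun I C X) F.
         bi_terminal (pslice (Ar C) (Ar (Ps I C)) (Ar_psfun C (Ps I C) (Diag I C)) F)
           (X, id2 (Ps I C) l)))"
proof -
  interpret diagram I C F
    using assms by (simp add: diagram_def psfunctor_def psfunctor_axioms_def)
  interpret pseudo_slice C "Ps I C" "Diag I C" F
    using assms(2) two_category_Ps[OF assms(1,2)] normal_psfunctor_Diag[OF assms(1,2)]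
    by (simp add: pseudo_slice_def psfunctor_def psfunctor_axioms_def)
  have "(X, l) \<in> pslice_obj C (Ps I C) (Diag I C) F" if "X \<in> Obj C" "l \<in> cones X" for X l
    using that by (simp add: pslice_obj_def Diag_sel)
  note iff = double_bi_terminal_iff_biuniversal[OF this] Ar_bi_terminal_iff_biuniversal[OF this]
  show ?thesis
    unfolding bilimit_iff_biuniversal
    using biuniversal_imp_bi_terminal by (simp add: iff cong: bex_cong conj_cong) blast
qed

end
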